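(* Let $(W,S)$ be a Coxeter system and assume there exists $s\in S$ such that $W$ satisfies the nested condition relative to $s$. Let $m_W^s:W\to\mathbb{C}$ be the function with $m_W^s(g)=1$ if $gK\in H_s^+$ and $m_W^s(g)=-1$ if $gK\in H_s^-$, and set $\mathrm{Stab}_{H_s^+}=\{g\in W: g\cdot H_s^+=H_s^+\}$. Then: (i) $(m_W^s(g)-m_W^s(h))\,(m_W^s(g^{-1}h)-m_W^s(g^{-1}))=0$ for all $g\in W\setminus \mathrm{Stab}_{H_s^+}$ and all $h\in W$. (ii) $m_W^s$ is left $\mathrm{Stab}_{H_s^+}$-invariant, i.e. $m_W^s(h'h)=m_W^s(h)$ for all $h'\in \mathrm{Stab}_{H_s^+}$ and $h\in W$. Consequently, the Fourier multiplier $T_{m_W^s}$ is bounded on $L_p(\mathcal{L}W)$ for every $1<p<\infty$.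
   Context: Coxeter systems. $S$ is a finite set, $(\mathrm{m}_{st})_{s,t\in S}$ is a symmetric matrix with $\mathrm{m}_{ss}=1$ and $\mathrm{m}_{st}\in\{2,3,\dots,\infty\}$ for $s\neq t$, and $W=\langle S: (st)^{\mathrm{m}_{st}}=1\rangle$ (no relation when $\mathrm{m}_{st}=\infty$). $l$ is the word length on $W$ with respect to $S$. Coxeter complex. For $T\subsetneq S$ let $W_T$ be the subgroup generated by $T$. The Coxeter complex $\Sigma(W,S)$ is the geometric realization of the poset $\{wW_T: w\in W, T\subsetneq S\}$ ordered by inclusion; equivalently it is obtained by gluing copies $wK$ ($w\in W$) of a $(|S|-1)$-simplex $K$ with codimension-one faces $K_s$ ($s\in S$), where $wK$ and $wsK$ are glued along the face of type $s$. The $wK$ are the chambers, $K$ is the fundamental chamber, and $W$ acts by $g\cdot wK=gwK$. The wall $H_s$ is the set of simplices fixed by $s$; it partitions the chambers into two roots (half-spaces) interchanged by $s$: $H_s^+$, the one containing $K$, and $H_s^-$, the other one. Explicitly, $gK\in H_s^+$ iff $l(g)<l(sg)$, and $gK\in H_s^-$ iff $l(g)>l(sg)$. Roots may be identified with their sets of chambers. Nested condition. A subset $L\subseteq W$ satisfies the nested condition relative to $s$ if for every $g\in L$ one of the following holds: $g\cdot H_s^+=H_s^+$, $g\cdot H_s^+=H_s^-$, $g\cdot H_s^+\subsetneq H_s^+$, $g\cdot H_s^+\subsetneq H_s^-$, $g\cdot H_s^-\subsetneq H_s^+$, or $g\cdot H_s^-\subsetneq H_s^-$. Fourier multipliers.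 $\mathcal{L}W\subseteq B(\ell_2(W))$ is the group von Neumann algebra generated by the left regular representation $\lambda$, with its canonical trace $\tau(\lambda(f))=f(1)$; $L_p(\mathcal{L}W)$ is the associated non-commutative $L_p$-space, with norm $\|x\|_p=\tau(|x|^p)^{1/p}$. For bounded $m:W\to\mathbb{C}$, $T_m$ is the linear extension of $\lambda(g)\mapsto m(g)\lambda(g)$; it is bounded on $L_p$ if it extends to a bounded operator on $L_p(\mathcal{L}W)$. *)

theory Defs
  imports
    "HOL-Analysis.Analysis"
    "HOL-Algebra.Generated_Groups"
    "HOL-Computational_Algebra.Polynomial"
    "HOL-Library.Extended_Nat"
    "HOL-Library.Function_Algebras"
begin

section \<open>Coxeter systems\<close>

definition coxeter_matrix :: "'a set \<Rightarrow> ('a \<Rightarrow> 'a \<Rightarrow> enat) \<Rightarrow> bool" where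
  "coxeter_matrix S M \<longleftrightarrow>
     (\<forall>s\<in>S. M s s = 1) \<and>
     (\<forall>s\<in>S. \<forall>t\<in>S. M s t = M t s) \<and>
     (\<forall>s\<in>S. \<forall>t\<in>S. s \<noteq> t \<longrightarrow> 2 \<le> M s t)"

definition word_value :: "('a, 'b) monoid_scheme \<Rightarrow> 'a list \<Rightarrow> 'a" where
  "word_value W ws = foldr (\<lambda>x y. x \<otimes>\<^bsub>W\<^esub> y) ws \<one>\<^bsub>W\<^esub>"

text \<open>
  Deletion of a relator \<open>(st)\<^sup>k\<close>, \<open>k = M s t < \<infinity>\<close>, from a word over \<open>S\<close>. Since \<open>M s s = 1\<close>, the
  words \<open>ss\<close> are relators, so every generator is its own inverse in the presented group; hence no
  formal inverses of letters are needed, and the equivalence generated by these steps is equality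
  in the group with generators \<open>S\<close> and relations \<open>(st)\<^bsup>M s t\<^esup> = 1\<close>.
\<close>

inductive coxeter_step :: "'a set \<Rightarrow> ('a \<Rightarrow> 'a \<Rightarrow> enat) \<Rightarrow> 'a list \<Rightarrow> 'a list \<Rightarrow> bool"
  for S M where
  "\<lbrakk>u \<in> lists S; v \<in> lists S; s \<in> S; t \<in> S; M s t = enat k\<rbrakk>
     \<Longrightarrow> coxeter_step S M (u @ concat (replicate k [s, t]) @ v) (u @ v)"

definition coxeter_system ::
    "('a, 'b) monoid_scheme \<Rightarrow> 'a set \<Rightarrow> ('a \<Rightarrow> 'a \<Rightarrow> enat) \<Rightarrow> bool" where
  "coxeter_system W S M \<longleftrightarrow>
     group W \<and> finite S \<and> S \<subseteq> carrier W \<and> coxeter_matrix S M \<and>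
     generate W S = carrier W \<and>
     (\<forall>u\<in>lists S. \<forall>v\<in>lists S.
        word_value W u = word_value W v \<longleftrightarrow> equivclp (coxeter_step S M) u v)"

definition word_length :: "('a, 'b) monoid_scheme \<Rightarrow> 'a set \<Rightarrow> 'a \<Rightarrow> nat" where
  "word_length W S g = (LEAST n. \<exists>ws\<in>lists S. length ws = n \<and> word_value W ws = g)"

section \<open>Chambers, roots and the nested condition\<close>

text \<open>
  The chamber \<open>gK\<close> is the coset \<open>g W\<^sub>T\<close> with \<open>T = {}\<close>. Roots are identified with their sets of
  chambers: \<open>pos_root W S s\<close> is the half-space of the wall of \<open>s\<close> that contains \<open>K\<close>, and
  \<open>neg_root W S s\<close> is the opposite one.
\<close>

definition chamber :: "('a, 'b) monoid_scheme \<Rightarrow> 'a \<Rightarrow> 'a set" where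
  "chamber W g = g <#\<^bsub>W\<^esub> generate W {}"

definition pos_root :: "('a, 'b) monoid_scheme \<Rightarrow> 'a set \<Rightarrow> 'a \<Rightarrow> 'a set set" where
  "pos_root W S s =
     {chamber W g |g. g \<in> carrier W \<and> word_length W S g < word_length W S (s \<otimes>\<^bsub>W\<^esub> g)}"

definition neg_root :: "('a, 'b) monoid_scheme \<Rightarrow> 'a set \<Rightarrow> 'a \<Rightarrow> 'a set set" where
  "neg_root W S s =
     {chamber W g |g. g \<in> carrier W \<and> word_length W S g > word_length W S (s \<otimes>\<^bsub>W\<^esub> g)}"

definition translate :: "('a, 'b) monoid_scheme \<Rightarrow> 'a \<Rightarrow> 'a set set \<Rightarrow> 'a set set" where
  "translate W g H = (\<lambda>C. g <#\<^bsub>W\<^esub> C) ` H"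

definition nested_condition ::
    "('a, 'b) monoid_scheme \<Rightarrow> 'a set \<Rightarrow> 'a \<Rightarrow> 'a set \<Rightarrow> bool" where
  "nested_condition W S s L \<longleftrightarrow>
     (\<forall>g\<in>L.
        translate W g (pos_root W S s) = pos_root W S s \<or>
        translate W g (pos_root W S s) = neg_root W S s \<or>
        translate W g (pos_root W S s) \<subset> pos_root W S s \<or>
        translate W g (pos_root W S s) \<subset> neg_root W S s \<or>
        translate W g (neg_root W S s) \<subset> pos_root W S s \<or>
        translate W g (neg_root W S s) \<subset> neg_root W S s)"

definition root_stabilizer :: "('a, 'b) monoid_scheme \<Rightarrow> 'a set \<Rightarrow> 'a \<Rightarrow> 'a set" where
  "root_stabilizer W S s =
     {g \<in> carrier W. translate W g (pos_root W S s) = pos_root W S s}"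

text \<open>
  The roots partition the chambers, so on \<open>carrier W\<close> the value \<open>0\<close> does not occur.
\<close>

definition root_symbol :: "('a, 'b) monoid_scheme \<Rightarrow> 'a set \<Rightarrow> 'a \<Rightarrow> 'a \<Rightarrow> complex" where
  "root_symbol W S s g =
     (if chamber W g \<in> pos_root W S s then 1
      else if chamber W g \<in> neg_root W S s then -1 else 0)"

section \<open>Bounded operators on \<open>\<ell>\<^sub>2\<close>\<close>

definition l2 :: "'a set \<Rightarrow> ('a \<Rightarrow> complex) set" where
  "l2 A = {f. (\<forall>x. x \<notin> A \<longrightarrow> f x = 0) \<and> (\<lambda>x. (cmod (f x))\<^sup>2) summable_on A}"

definition l2_inner :: "'a set \<Rightarrow> ('a \<Rightarrow> complex) \<Rightarrow> ('a \<Rightarrow> complex) \<Rightarrow> complex" where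
  "l2_inner A f g = (\<Sum>\<^sub>\<infinity>x\<in>A. cnj (f x) * g x)"

definition l2_norm :: "'a set \<Rightarrow> ('a \<Rightarrow> complex) \<Rightarrow> real" where
  "l2_norm A f = sqrt (\<Sum>\<^sub>\<infinity>x\<in>A. (cmod (f x))\<^sup>2)"

text \<open>
  Operators are total functions; to make them extensional, a bounded operator on \<open>l2 A\<close> is required
  to be \<open>0\<close> outside \<open>l2 A\<close>. Sums and differences of vectors, operators and sequences of operators
  are the pointwise ones of the function type.
\<close>

type_synonym 'a l2_op = "('a \<Rightarrow> complex) \<Rightarrow> ('a \<Rightarrow> complex)"

definition bounded_ops :: "'a set \<Rightarrow> 'a l2_op set" where
  "bounded_ops A = {T.
     (\<forall>f\<in>l2 A. T f \<in> l2 A) \<and>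
     (\<forall>f\<in>l2 A. \<forall>g\<in>l2 A. T (f + g) = T f + T g) \<and>
     (\<forall>c. \<forall>f\<in>l2 A. T (\<lambda>x. c * f x) = (\<lambda>x. c * T f x)) \<and>
     (\<exists>C. \<forall>f\<in>l2 A. l2_norm A (T f) \<le> C * l2_norm A f) \<and>
     (\<forall>f. f \<notin> l2 A \<longrightarrow> T f = (\<lambda>_. 0))}"

definition op_scale :: "complex \<Rightarrow> 'a l2_op \<Rightarrow> 'a l2_op" where
  "op_scale c T = (\<lambda>f x. c * T f x)"

definition op_norm :: "'a set \<Rightarrow> 'a l2_op \<Rightarrow> real" where
  "op_norm A T = (SUP f\<in>l2 A. l2_norm A (T f) / l2_norm A f)"

definition op_adjoint :: "'a set \<Rightarrow> 'a l2_op \<Rightarrow> 'a l2_op" where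
  "op_adjoint A T = (THE R. R \<in> bounded_ops A \<and>
     (\<forall>f\<in>l2 A. \<forall>g\<in>l2 A. l2_inner A f (T g) = l2_inner A (R f) g))"

definition commutant :: "'a set \<Rightarrow> 'a l2_op set \<Rightarrow> 'a l2_op set" where
  "commutant A X = {T \<in> bounded_ops A. \<forall>R\<in>X. T \<circ> R = R \<circ> T}"

definition op_poly :: "real poly \<Rightarrow> 'a l2_op \<Rightarrow> 'a l2_op" where
  "op_poly q a = (\<Sum>i\<le>Polynomial.degree q. op_scale (complex_of_real (Polynomial.coeff q i)) (a ^^ i))"

text \<open>
  Continuous functional calculus \<open>h(a)\<close> for a positive operator \<open>a\<close> (whose spectrum is contained in
  \<open>[0, \<parallel>a\<parallel>]\<close>) and \<open>h\<close> continuous on \<open>[0, \<parallel>a\<parallel>]\<close>: the operator-norm limit of \<open>q\<^sub>n(a)\<close> for polynomials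
  \<open>q\<^sub>n\<close> converging to \<open>h\<close> uniformly on this interval.
\<close>

definition op_calculus :: "'a set \<Rightarrow> (real \<Rightarrow> real) \<Rightarrow> 'a l2_op \<Rightarrow> 'a l2_op" where
  "op_calculus A h a = (THE b. b \<in> bounded_ops A \<and>
     (\<forall>q :: nat \<Rightarrow> real poly.
        uniform_limit {0..op_norm A a} (\<lambda>n. poly (q n)) h sequentially \<longrightarrow>
        (\<lambda>n. op_norm A (op_poly (q n) a - b)) \<longlonglongrightarrow> 0))"

text \<open>\<open>|x|\<^sup>p = (x\<^sup>* x)\<^bsup>p/2\<^esup>\<close>\<close>

definition abs_powr :: "'a set \<Rightarrow> real \<Rightarrow> 'a l2_op \<Rightarrow> 'a l2_op" where
  "abs_powr A p x = op_calculus A (\<lambda>t. t powr (p / 2)) (op_adjoint A x \<circ> x)"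

section \<open>The group von Neumann algebra and its \<open>L\<^sub>p\<close>-spaces\<close>

definition left_regular :: "('a, 'b) monoid_scheme \<Rightarrow> 'a \<Rightarrow> 'a l2_op" where
  "left_regular W g = (\<lambda>f. if f \<in> l2 (carrier W)
     then (\<lambda>x. if x \<in> carrier W then f (inv\<^bsub>W\<^esub> g \<otimes>\<^bsub>W\<^esub> x) else 0) else (\<lambda>_. 0))"

definition group_vN :: "('a, 'b) monoid_scheme \<Rightarrow> 'a l2_op set" where
  "group_vN W =
     commutant (carrier W) (commutant (carrier W) (left_regular W ` carrier W))"

definition vN_trace :: "('a, 'b) monoid_scheme \<Rightarrow> 'a l2_op \<Rightarrow> complex" where
  "vN_trace W x =
     l2_inner (carrier W) (indicator {\<one>\<^bsub>W\<^esub>}) (x (indicator {\<one>\<^bsub>W\<^esub>}))"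

definition Lp_norm :: "('a, 'b) monoid_scheme \<Rightarrow> real \<Rightarrow> 'a l2_op \<Rightarrow> real" where
  "Lp_norm W p x = Re (vN_trace W (abs_powr (carrier W) p x)) powr (1 / p)"

text \<open>
  \<open>L\<^sub>p\<close> is the completion of \<open>group_vN W\<close> for \<open>Lp_norm W p\<close>: classes of Cauchy sequences modulo
  null sequences.
\<close>

definition Lp_Cauchy :: "('a, 'b) monoid_scheme \<Rightarrow> real \<Rightarrow> (nat \<Rightarrow> 'a l2_op) set" where
  "Lp_Cauchy W p = {X. (\<forall>n. X n \<in> group_vN W) \<and>
     (\<forall>e>0. \<exists>N. \<forall>i\<ge>N. \<forall>j\<ge>N. Lp_norm W p (X i - X j) < e)}"

definition Lp_rel ::
    "('a, 'b) monoid_scheme \<Rightarrow> real \<Rightarrow> ((nat \<Rightarrow> 'a l2_op) \<times> (nat \<Rightarrow> 'a l2_op)) set" where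
  "Lp_rel W p = {(X, Y). X \<in> Lp_Cauchy W p \<and> Y \<in> Lp_Cauchy W p \<and>
     (\<lambda>n. Lp_norm W p (X n - Y n)) \<longlonglongrightarrow> 0}"

definition Lp_space :: "('a, 'b) monoid_scheme \<Rightarrow> real \<Rightarrow> (nat \<Rightarrow> 'a l2_op) set set" where
  "Lp_space W p = Lp_Cauchy W p // Lp_rel W p"

definition Lp_embed ::
    "('a, 'b) monoid_scheme \<Rightarrow> real \<Rightarrow> 'a l2_op \<Rightarrow> (nat \<Rightarrow> 'a l2_op) set" where
  "Lp_embed W p x = Lp_rel W p `` {\<lambda>_. x}"

definition Lp_add :: "('a, 'b) monoid_scheme \<Rightarrow> real \<Rightarrow>
    (nat \<Rightarrow> 'a l2_op) set \<Rightarrow> (nat \<Rightarrow> 'a l2_op) set \<Rightarrow> (nat \<Rightarrow> 'a l2_op) set" where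
  "Lp_add W p U V = Lp_rel W p `` {X + Y |X Y. X \<in> U \<and> Y \<in> V}"

definition Lp_scale :: "('a, 'b) monoid_scheme \<Rightarrow> real \<Rightarrow>
    complex \<Rightarrow> (nat \<Rightarrow> 'a l2_op) set \<Rightarrow> (nat \<Rightarrow> 'a l2_op) set" where
  "Lp_scale W p c U = Lp_rel W p `` {\<lambda>n. op_scale c (X n) |X. X \<in> U}"

definition Lp_space_norm ::
    "('a, 'b) monoid_scheme \<Rightarrow> real \<Rightarrow> (nat \<Rightarrow> 'a l2_op) set \<Rightarrow> real" where
  "Lp_space_norm W p U = (THE r. \<forall>X\<in>U. (\<lambda>n. Lp_norm W p (X n)) \<longlonglongrightarrow> r)"

definition bounded_linear_Lp :: "('a, 'b) monoid_scheme \<Rightarrow> real \<Rightarrow>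
    ((nat \<Rightarrow> 'a l2_op) set \<Rightarrow> (nat \<Rightarrow> 'a l2_op) set) \<Rightarrow> bool" where
  "bounded_linear_Lp W p \<Phi> \<longleftrightarrow>
     (\<forall>U\<in>Lp_space W p. \<Phi> U \<in> Lp_space W p) \<and>
     (\<forall>U\<in>Lp_space W p. \<forall>V\<in>Lp_space W p. \<Phi> (Lp_add W p U V) = Lp_add W p (\<Phi> U) (\<Phi> V)) \<and>
     (\<forall>c. \<forall>U\<in>Lp_space W p. \<Phi> (Lp_scale W p c U) = Lp_scale W p c (\<Phi> U)) \<and>
     (\<exists>C. \<forall>U\<in>Lp_space W p. Lp_space_norm W p (\<Phi> U) \<le> C * Lp_space_norm W p U)"

text \<open>
  The multiplier with symbol \<open>m\<close>, that is, the map
  \<open>\<Sum>\<^sub>g c\<^sub>g \<lambda>(g) \<mapsto> \<Sum>\<^sub>g m(g) c\<^sub>g \<lambda>(g)\<close> on finite sums, extends to a bounded operator on \<open>L\<^sub>p\<close>.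
\<close>

definition multiplier_bounded ::
    "('a, 'b) monoid_scheme \<Rightarrow> real \<Rightarrow> ('a \<Rightarrow> complex) \<Rightarrow> bool" where
  "multiplier_bounded W p m \<longleftrightarrow>
     (\<exists>\<Phi>. bounded_linear_Lp W p \<Phi> \<and>
        (\<forall>F c. finite F \<and> F \<subseteq> carrier W \<longrightarrow>
           \<Phi> (Lp_embed W p (\<Sum>g\<in>F. op_scale (c g) (left_regular W g))) =
           Lp_embed W p (\<Sum>g\<in>F. op_scale (m g * c g) (left_regular W g))))"

end

theory Submission
  imports Defs "HOL-Complex_Analysis.Complex_Analysis"
begin

text \<open>
  Let \<open>P\<close> be the set of group elements \<open>w\<close> with \<open>l w < l (s w)\<close>. If exactly one of \<open>w\<close> and \<open>w s\<close> lies in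
  \<open>P\<close> then \<open>w s = s w\<close>. An element that commutes with \<open>s\<close> maps opposite roots to opposite roots and so
  excludes every strict inclusion between a root and a translated root; hence in the strict cases of
  the nested condition no such crossing occurs, which gives (i). Part (ii) is immediate.

  Let \<open>T\<close> be the multiplier with symbol \<open>m\<close>, \<open>T'\<close> the one with symbol \<open>g \<mapsto> m (g\<^sup>-\<^sup>1)\<close> and \<open>E\<close> the
  conditional expectation onto the algebra of the stabilizer. Comparing coefficients, (i), (ii) and
  \<open>m\<^sup>2 = 1\<close> yield for finite sums \<open>x\<close> that
  \<open>T x (T x)\<^sup>* = B - E B + E (x x\<^sup>*)\<close> with \<open>B = T (x (T x)\<^sup>*) + T' (T x x\<^sup>*) - T T' (x x\<^sup>*)\<close>.
  So a bound on \<open>L\<^sub>p\<close> gives one on \<open>L\<^sub>2\<^sub>p\<close>. Starting from \<open>p = 2\<close> this covers the powers of two, and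
  interpolation with the dual exponents covers all \<open>1 < p < \<infinity>\<close>.
\<close>

section \<open>Real algebras of bounded operators\<close>

text \<open>The projection \<open>E\<close> enters because the product in (i) does not vanish for
  \<open>g\<close> in the stabilizer (take \<open>h = s\<close>); there (ii) makes the coefficients
  of \<open>T x\<close> times its adjoint equal to those of \<open>x\<close> times its adjoint.
  Since \<open>x * star x\<close> has the squared norm of \<open>x\<close> at twice the exponent,
  the identity becomes a quadratic inequality for the norm of \<open>T x\<close>. Contractivity of
  \<open>E\<close> is proved at even integers, where the norming element is a polynomial and so
  stays among finite sums.

  The algebra offers a continuous functional calculus but neither spectral projections nor polar
  parts. Both are replaced by powers of \<open>star x * x + e\<close> with \<open>e > 0\<close>, and
  \<open>e\<close> tends to 0 at the end. Such powers are exponentials, hence entire in the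
  exponent, and the three lines theorem applies to them: first for Hoelder's inequality, then for
  interpolation. Exponents below 2 come from transposing the multiplier under the trace, so what is
  interpolated is a bilinear form and not an operator.\<close>

text \<open>
  Scalars are real; the complex structure is the central element \<open>imunit\<close>, and below a trace is
  represented by its real part.
\<close>

class op_algebra = real_normed_algebra_1 + banach +
  fixes star :: "'a \<Rightarrow> 'a" and imunit :: 'a and psd :: "'a \<Rightarrow> bool"
  assumes star_add: "star (x + y) = star x + star y"
    and star_scaleR: "star (r *\<^sub>R x) = r *\<^sub>R star x"
    and star_mult: "star (x * y) = star y * star x"
    and star_star: "star (star x) = x"
    and norm_star_mult: "norm (star x * x) = norm x * norm x"
    and imunit_square: "imunit * imunit = - 1"
    and imunit_comm: "imunit * x = x * imunit"
    and star_imunit: "star imunit = - imunit"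
    and psd_imp_star: "psd a \<Longrightarrow> star a = a"
    and psd_add: "psd a \<Longrightarrow> psd b \<Longrightarrow> psd (a + b)"
    and psd_scaleR: "0 \<le> r \<Longrightarrow> psd a \<Longrightarrow> psd (r *\<^sub>R a)"
    and psd_one: "psd 1"
    and psd_conj: "psd a \<Longrightarrow> psd (star x * a * x)"
    and psd_limit: "(\<And>n. psd (X n)) \<Longrightarrow> X \<longlonglongrightarrow> a \<Longrightarrow> psd a"
    and norm_le_psd: "star a = a \<Longrightarrow> psd (c *\<^sub>R 1 - a) \<Longrightarrow> psd (c *\<^sub>R 1 + a) \<Longrightarrow> norm a \<le> c"
    and psd_norm_diff: "star a = a \<Longrightarrow> psd (norm a *\<^sub>R 1 - a)"

lemma star_zero [simp]: "star (0 :: 'a::op_algebra) = 0"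
  using star_scaleR[of 0 "0::'a"] by simp

lemma star_one [simp]: "star (1 :: 'a::op_algebra) = 1"
  using psd_one psd_imp_star by blast

lemma star_uminus: "star (- x) = - star x"
  using star_scaleR[of "-1" x] by simp

lemma star_diff: "star (x - y) = star x - star y"
  using star_add[of x "- y"] star_uminus by simp

lemma star_power: "star (x ^ n) = star x ^ n"
  by (induction n) (simp_all add: star_mult power_commutes)

lemma star_sum: "star (sum f A) = (\<Sum>i\<in>A. star (f i))"
  by (induction A rule: infinite_finite_induct) (simp_all add: star_add)

lemma norm_star [simp]: "norm (star x) = norm x"
proof -
  have le: "norm y \<le> norm (star y)" for y
  proof (cases "y = 0")
    case False
    have "norm y * norm y \<le> norm (star y) * norm y"
      by (metis norm_star_mult norm_mult_ineq)
    then show ?thesis using False by simp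
  qed simp
  show ?thesis using le[of x] le[of "star x"] by (simp add: star_star)
qed

lemma psd_square: "psd (star x * x)"
  using psd_conj[OF psd_one, of x] by simp

lemma psd_zero [simp]: "psd (0 :: 'a::op_algebra)"
  using psd_scaleR[OF order_refl psd_one] by simp

lemma psd_sum: "(\<And>i. i \<in> A \<Longrightarrow> psd (f i)) \<Longrightarrow> psd (sum f A)"
  by (induction A rule: infinite_finite_induct) (simp_all add: psd_add)

lemma bounded_linear_star: "bounded_linear (star :: 'a::op_algebra \<Rightarrow> 'a)"
  by (rule bounded_linear_intro[where K = 1]) (simp_all add: star_add star_scaleR)

lemmas tendsto_star = bounded_linear.tendsto[OF bounded_linear_star]

definition ofc :: "complex \<Rightarrow> 'a::op_algebra" where
  "ofc z = Re z *\<^sub>R 1 + Im z *\<^sub>R imunit"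

lemma ofc_add: "ofc (z + w) = ofc z + ofc w"
  by (simp add: ofc_def algebra_simps)

lemma ofc_mult: "ofc (z * w) = ofc z * ofc w"
proof -
  have "(x *\<^sub>R imunit) * (y *\<^sub>R imunit) = - ((x * y) *\<^sub>R (1::'a))" for x y
    by (simp add: imunit_square)
  then show ?thesis
    unfolding ofc_def by (simp add: algebra_simps imunit_square)
qed

lemma ofc_comm: "ofc z * x = x * ofc z"
  by (simp add: ofc_def algebra_simps imunit_comm)

lemma ofc_left_commute: "x * (ofc z * y) = ofc z * (x * y)"
  unfolding mult.assoc[symmetric] ofc_comm[of z x] ..

lemma ofc_of_real [simp]: "ofc (of_real r) = r *\<^sub>R 1"
  by (simp add: ofc_def)

lemma ofc_0 [simp]: "ofc 0 = 0" and ofc_1 [simp]: "ofc 1 = 1"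
  by (simp_all add: ofc_def)

lemma ofc_ii: "ofc \<i> = imunit"
  by (simp add: ofc_def)

lemma star_ofc: "star (ofc z) = ofc (cnj z)"
  by (simp add: ofc_def star_add star_scaleR star_imunit)

lemma norm_ofc: "norm (ofc z :: 'a::op_algebra) = cmod z"
proof -
  have "star (ofc z) * ofc z = ((cmod z)\<^sup>2 *\<^sub>R 1 :: 'a)"
    by (metis complex_norm_square mult.commute ofc_mult ofc_of_real star_ofc)
  then have "(norm (ofc z :: 'a))\<^sup>2 = (cmod z)\<^sup>2"
    using norm_star_mult[of "ofc z :: 'a"] by (simp add: power2_eq_square)
  then show ?thesis by simp
qed

section \<open>Polynomials of positive elements\<close>

definition ev :: "real poly \<Rightarrow> 'a::real_algebra_1 \<Rightarrow> 'a" where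
  "ev q a = (\<Sum>i\<le>degree q. coeff q i *\<^sub>R a ^ i)"

lemma ev_altdef:
  assumes "degree q \<le> n"
  shows "ev q a = (\<Sum>i\<le>n. coeff q i *\<^sub>R a ^ i)"
  unfolding ev_def
  by (rule sum.mono_neutral_left) (use assms in \<open>auto simp: coeff_eq_0\<close>)

lemma ev_0 [simp]: "ev 0 a = 0" and ev_const [simp]: "ev [:c:] a = c *\<^sub>R 1"
  by (simp_all add: ev_def)

lemma ev_1 [simp]: "ev 1 a = 1"
  by (simp add: ev_def)

lemma ev_add: "ev (p + q) a = ev p a + ev q a"
proof -
  let ?n = "max (degree p) (degree q)"
  have "degree (p + q) \<le> ?n" by (rule degree_add_le_max)
  then show ?thesis
    by (simp add: ev_altdef[where n = ?n] scaleR_left_distrib sum.distrib)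
qed

lemma ev_smult: "ev (smult c p) a = c *\<^sub>R ev p a"
  by (simp add: ev_altdef[where n = "degree p"] degree_smult_le scaleR_right.sum)

lemma ev_uminus: "ev (- p) a = - ev p a"
  using ev_smult[of "-1" p a] by simp

lemma ev_diff: "ev (p - q) a = ev p a - ev q a"
  using ev_add[of p "- q" a] by (simp add: ev_uminus)

lemma ev_sum: "ev (sum f A) a = (\<Sum>i\<in>A. ev (f i) a)"
  by (induction A rule: infinite_finite_induct) (simp_all add: ev_add)

lemma ev_pCons: "ev (pCons c q) a = c *\<^sub>R 1 + a * ev q a"
proof -
  have "ev (pCons c q) a = (\<Sum>i\<le>Suc (degree q). coeff (pCons c q) i *\<^sub>R a ^ i)"
    by (rule ev_altdef) (rule degree_pCons_le)
  also have "\<dots> = c *\<^sub>R 1 + (\<Sum>i\<le>degree q. coeff q i *\<^sub>R a ^ Suc i)"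
    by (subst sum.atMost_Suc_shift) simp
  also have "\<dots> = c *\<^sub>R 1 + a * ev q a"
    by (simp add: ev_def sum_distrib_left)
  finally show ?thesis .
qed

lemma ev_mult: "ev (p * q) a = ev p a * ev q a"
  by (induction p) (simp_all add: ev_pCons ev_add ev_smult algebra_simps)

lemma ev_power: "ev (p ^ n) a = ev p a ^ n"
  by (induction n) (simp_all add: ev_mult)

lemma ev_X [simp]: "ev [:0, 1:] a = a"
  by (simp add: ev_pCons)

lemma ev_prod_commute: "a * x = x * b \<Longrightarrow> ev q a * x = x * ev q b"
proof (induction q)
  case (pCons c q)
  have "a * (ev q a * x) = x * (b * ev q b)"
    by (simp add: pCons.IH[OF pCons.prems] flip: mult.assoc) (simp add: pCons.prems)
  then show ?case by (simp add: ev_pCons algebra_simps)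
qed simp

lemma ev_pcompose: "ev (pcompose p q) a = ev p (ev q a)"
  by (induction p) (simp_all add: pcompose_pCons ev_pCons ev_add ev_mult)

lemma star_ev: "star a = a \<Longrightarrow> star (ev q a) = ev q (a :: 'a::op_algebra)"
  by (simp add: ev_def star_sum star_scaleR star_power)

text \<open>All factors commute. Taking out \<open>y = a ^ (k div 2) * (1 - a) ^ (l div 2)\<close>
  on both sides leaves exponents below 2, so only the product of \<open>a\<close> and
  \<open>1 - a\<close> needs an argument.\<close>

lemma psd_power_mult:
  fixes a :: "'a::op_algebra"
  assumes a: "psd a" "psd (1 - a)"
  shows "psd (a ^ k * (1 - a) ^ l)"
proof -
  let ?b = "1 - a"
  have sa: "star a = a" "star ?b = ?b" using a psd_imp_star by blast+
  have comm: "a * ?b = ?b * a" by (simp add: algebra_simps)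
  have base: "psd (a ^ e * ?b ^ f)" if "e < 2" "f < 2" for e f
  proof -
    \<comment> \<open>Multiplication by \<open>a + ?b = 1\<close>; both summands are conjugates of
      positive elements.\<close>
    have "a * ?b = a * ?b * a + ?b * a * ?b" by (simp add: algebra_simps)
    moreover have "psd (a * ?b * a)" "psd (?b * a * ?b)"
      using psd_conj[OF a(2), of a] psd_conj[OF a(1), of ?b] sa by simp_all
    ultimately have "psd (a * ?b)" using psd_add by metis
    moreover have "e = 0 \<or> e = 1" "f = 0 \<or> f = 1" using that by auto
    ultimately show ?thesis using a psd_one by auto
  qed
  have cp: "a ^ i * ?b ^ j = ?b ^ j * a ^ i" for i j
    by (metis comm power_commuting_commutes)
  define y where "y = a ^ (k div 2) * ?b ^ (l div 2)"
  have sy: "star y = y" unfolding y_def by (simp add: star_mult star_power sa cp)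
  have k: "k div 2 + k mod 2 + k div 2 = k" and l: "l div 2 + l mod 2 + l div 2 = l" by presburger+
  have "a ^ k * ?b ^ l = a ^ (k div 2 + k mod 2 + k div 2) * ?b ^ (l div 2 + l mod 2 + l div 2)"
    by (simp only: k l)
  also have "\<dots> = a ^ (k div 2) * ?b ^ (l div 2) * (a ^ (k mod 2) * ?b ^ (l mod 2)) * (a ^ (k div 2) * ?b ^ (l div 2))"
  proof -
    have "a ^ i * (?b ^ j * z) = ?b ^ j * (a ^ i * z)" for i j z
      using cp[of i j] by (simp flip: mult.assoc)
    then show ?thesis by (simp only: power_add mult.assoc cp)
  qed
  also have "\<dots> = y * (a ^ (k mod 2) * ?b ^ (l mod 2)) * y" by (simp only: y_def)
  finally show ?thesis
    using psd_conj[OF base[of "k mod 2" "l mod 2"], of y] sy by simp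
qed

section \<open>Bernstein polynomials and positivity of the polynomial calculus\<close>

lemma smult_sum_right: "smult c (sum f A) = (\<Sum>i\<in>A. smult c (f i))"
  by (induction A rule: infinite_finite_induct) (simp_all add: smult_add_right)

lemma Suc_choose_Suc: "Suc i * (n choose Suc i) = (n - i) * (n choose i)"
  by (simp only: binomial_absorption binomial_absorb_comp)

text \<open>The Bernstein polynomial with sample values \<open>f k\<close> at the nodes
  \<open>k / n\<close>. Samples are indexed by \<open>k\<close>, which makes it computable on
  binomial coefficients in \<open>k\<close>.\<close>

definition bpoly :: "nat \<Rightarrow> (nat \<Rightarrow> real) \<Rightarrow> real poly" where
  "bpoly n f = (\<Sum>k\<le>n. smult (f k * real (n choose k)) ([:0, 1:] ^ k * [:1, - 1:] ^ (n - k)))"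

text \<open>The factorial moments of the binomial distribution: after \<open>choose_mult\<close> the
  remaining sum is the binomial theorem for \<open>X + (1 - X) = 1\<close>.\<close>

lemma bpoly_choose: "bpoly n (\<lambda>k. real (k choose i)) = smult (real (n choose i)) ([:0, 1:] ^ i)"
proof (cases "i \<le> n")
  case False
  then have "bpoly n (\<lambda>k. real (k choose i)) = 0"
    unfolding bpoly_def by (intro sum.neutral) auto
  then show ?thesis using False by simp
next
  case True
  let ?X = "[:0, 1:] :: real poly" and ?Y = "[:1, - 1:] :: real poly"
  have "bpoly n (\<lambda>k. real (k choose i)) =
      (\<Sum>k\<in>{i..n}. smult (real (k choose i) * real (n choose k)) (?X ^ k * ?Y ^ (n - k)))"
    unfolding bpoly_def by (rule sum.mono_neutral_right) auto
  also have "\<dots> = (\<Sum>k\<in>{i..n}. smult (real (n choose i) * real ((n - i) choose (k - i)))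
      (?X ^ i * (?X ^ (k - i) * ?Y ^ (n - i - (k - i)))))"
  proof (rule sum.cong[OF refl])
    fix k assume k: "k \<in> {i..n}"
    have "real (k choose i) * real (n choose k) = real (n choose i) * real ((n - i) choose (k - i))"
      using choose_mult[of i k n] k by (metis atLeastAtMost_iff mult.commute of_nat_mult)
    moreover have "?X ^ k = ?X ^ i * ?X ^ (k - i)" using k by (simp flip: power_add)
    ultimately show "smult (real (k choose i) * real (n choose k)) (?X ^ k * ?Y ^ (n - k)) =
      smult (real (n choose i) * real ((n - i) choose (k - i)))
        (?X ^ i * (?X ^ (k - i) * ?Y ^ (n - i - (k - i))))"
      using k by (simp add: mult.assoc)
  qed
  also have "\<dots> = (\<Sum>l\<le>n - i. smult (real (n choose i) * real ((n - i) choose l))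
      (?X ^ i * (?X ^ l * ?Y ^ (n - i - l))))"
    by (rule sum.reindex_bij_witness[where i = "\<lambda>l. l + i" and j = "\<lambda>k. k - i"]) (use True in auto)
  also have "\<dots> = smult (real (n choose i)) (?X ^ i * (\<Sum>l\<le>n - i. of_nat ((n - i) choose l) * ?X ^ l * ?Y ^ (n - i - l)))"
    by (simp add: sum_distrib_left smult_sum_right of_nat_poly mult_ac)
  also have "(\<Sum>l\<le>n - i. of_nat ((n - i) choose l) * ?X ^ l * ?Y ^ (n - i - l)) = (?X + ?Y) ^ (n - i)"
    by (rule binomial_ring[symmetric])
  also have "?X + ?Y = 1" by simp
  finally show ?thesis by simp
qed

lemma bpoly_add: "bpoly n (\<lambda>k. f k + g k) = bpoly n f + bpoly n g"
  by (simp add: bpoly_def algebra_simps smult_add_left sum.distrib)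

lemma bpoly_smult: "bpoly n (\<lambda>k. c * f k) = smult c (bpoly n f)"
  by (simp add: bpoly_def smult_sum_right mult.assoc)

lemma bpoly_sum: "finite I \<Longrightarrow> bpoly n (\<lambda>k. \<Sum>i\<in>I. f i k) = (\<Sum>i\<in>I. bpoly n (f i))"
proof (induction I rule: finite_induct)
  case empty
  then show ?case by (simp add: bpoly_def)
qed (simp add: bpoly_add)

lemma choose_over_power_tendsto: "(\<lambda>n. real (n choose i) / real n ^ i) \<longlonglongrightarrow> 1 / fact i"
proof (induction i)
  case (Suc i)
  have ev: "\<forall>\<^sub>F n in sequentially. real (n choose Suc i) / real n ^ Suc i =
      (real (n choose i) / real n ^ i) * (1 - real i / real n) / real (Suc i)"
  proof (rule eventually_mono[OF eventually_gt_at_top[of i]])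
    fix n :: nat assume n: "n > i"
    have "real (Suc i) * real (n choose Suc i) = (real n - real i) * real (n choose i)"
      using n Suc_choose_Suc[of i n] by (metis of_nat_diff of_nat_mult less_imp_le_nat)
    then show "real (n choose Suc i) / real n ^ Suc i =
      (real (n choose i) / real n ^ i) * (1 - real i / real n) / real (Suc i)"
      using n by (simp add: field_simps del: of_nat_Suc)
  qed
  have "(\<lambda>n. (real (n choose i) / real n ^ i) * (1 - real i / real n) / real (Suc i))
      \<longlonglongrightarrow> (1 / fact i) * (1 - 0) / real (Suc i)"
    by (intro tendsto_intros Suc lim_const_over_n) simp
  then show ?case
    using tendsto_cong[OF ev] by (simp add: field_simps)
qed simp

text \<open>A factor \<open>k\<close> is traded for a higher binomial coefficient,
  \<open>k (k choose i) = (i + 1) (k choose (i + 1)) + i (k choose i)\<close>; the last term is one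
  power of \<open>n\<close> short and vanishes. The case \<open>i = 0\<close> is the convergence of
  Bernstein polynomials of monomials, obtained in the algebra itself without any estimate on an
  interval.\<close>

lemma bpoly_monomial_tendsto:
  fixes a :: "'a::real_normed_algebra_1"
  shows "(\<lambda>n. (1 / real n ^ (i + j)) *\<^sub>R ev (bpoly n (\<lambda>k. real k ^ j * real (k choose i))) a)
    \<longlonglongrightarrow> (1 / fact i) *\<^sub>R a ^ (i + j)"
proof (induction j arbitrary: i)
  case 0
  have "(\<lambda>n. (real (n choose i) / real n ^ i) *\<^sub>R a ^ i) \<longlonglongrightarrow> (1 / fact i) *\<^sub>R a ^ i"
    by (intro tendsto_intros choose_over_power_tendsto)
  then show ?case by (simp add: bpoly_choose ev_smult ev_power)
next
  case (Suc j)
  have absorb: "real k * real (k choose i) = real (Suc i) * real (k choose Suc i) + real i * real (k choose i)" for k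
  proof (cases "i \<le> k")
    case True
    have "real (Suc i) * real (k choose Suc i) = (real k - real i) * real (k choose i)"
      using True Suc_choose_Suc[of i k] by (metis of_nat_diff of_nat_mult)
    then show ?thesis by (simp add: algebra_simps)
  qed (simp add: binomial_eq_0)
  have eq: "bpoly n (\<lambda>k. real k ^ Suc j * real (k choose i)) =
      smult (real (Suc i)) (bpoly n (\<lambda>k. real k ^ j * real (k choose Suc i)))
      + smult (real i) (bpoly n (\<lambda>k. real k ^ j * real (k choose i)))" for n
  proof -
    have "real k ^ Suc j * real (k choose i) = real (Suc i) * (real k ^ j * real (k choose Suc i))
        + real i * (real k ^ j * real (k choose i))" for k
      using arg_cong[OF absorb[of k], of "\<lambda>x. real k ^ j * x"] by (simp add: algebra_simps del: of_nat_Suc)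
    then show ?thesis by (simp only: bpoly_add bpoly_smult)
  qed
  have "(\<lambda>n. real (Suc i) *\<^sub>R ((1 / real n ^ (Suc i + j)) *\<^sub>R ev (bpoly n (\<lambda>k. real k ^ j * real (k choose Suc i))) a)
      + (real i / real n) *\<^sub>R ((1 / real n ^ (i + j)) *\<^sub>R ev (bpoly n (\<lambda>k. real k ^ j * real (k choose i))) a))
    \<longlonglongrightarrow> real (Suc i) *\<^sub>R ((1 / fact (Suc i)) *\<^sub>R a ^ (Suc i + j)) + 0 *\<^sub>R ((1 / fact i) *\<^sub>R a ^ (i + j))"
    by (intro tendsto_intros Suc lim_const_over_n)
  moreover have "real (Suc i) *\<^sub>R ((1 / fact (Suc i)) *\<^sub>R a ^ (Suc i + j)) = (1 / fact i) *\<^sub>R a ^ (i + Suc j)"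
    by (simp add: field_simps del: of_nat_Suc)
  ultimately show ?case
    by (simp add: eq ev_add ev_smult scaleR_add_right del: of_nat_Suc power_Suc) (simp add: mult_ac)
qed

text \<open>
  The Bernstein polynomials of \<open>q\<close> have nonnegative coefficients in front of the positive elements
  \<open>a\<^sup>k (1 - a)\<^sup>l\<close>, so positivity of \<open>q(a)\<close> needs no spectral theory.
\<close>

lemma psd_ev_unit:
  fixes a :: "'a::op_algebra"
  assumes a: "psd a" "psd (1 - a)" and q: "\<And>t. 0 \<le> t \<Longrightarrow> t \<le> 1 \<Longrightarrow> 0 \<le> poly q t"
  shows "psd (ev q a)"
proof -
  \<comment> \<open>Degree \<open>Suc n\<close> keeps the denominators of the nodes
    positive.\<close>
  define b where "b n = ev (bpoly (Suc n) (\<lambda>k. poly q (real k / real (Suc n)))) a" for n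
  have "psd (b n)" for n
    unfolding b_def bpoly_def ev_sum ev_smult ev_mult ev_power
  proof (intro psd_sum psd_scaleR)
    fix k assume "k \<in> {..Suc n}"
    then show "0 \<le> poly q (real k / real (Suc n)) * real (Suc n choose k)"
      by (intro mult_nonneg_nonneg q) (simp_all add: divide_simps)
    have "ev [:1, -1:] a = 1 - a" by (simp add: ev_pCons)
    then show "psd (ev [:0, 1:] a ^ k * ev [:1, -1:] a ^ (Suc n - k))"
      using psd_power_mult[OF a] by simp
  qed
  moreover have "b \<longlonglongrightarrow> ev q a"
  proof -
    have "b n = (\<Sum>j\<le>degree q. coeff q j *\<^sub>R ((1 / real (Suc n) ^ (0 + j)) *\<^sub>R
        ev (bpoly (Suc n) (\<lambda>k. real k ^ j * real (k choose 0))) a))" (is "_ = ?c n") for n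
    proof -
      have "(\<lambda>k. poly q (real k / real (Suc n))) =
          (\<lambda>k. \<Sum>j\<le>degree q. (coeff q j * (1 / real (Suc n) ^ j)) * (real k ^ j))"
        by (simp add: poly_altdef power_divide)
      then have "b n = ev (\<Sum>j\<le>degree q. smult (coeff q j * (1 / real (Suc n) ^ j)) (bpoly (Suc n) (\<lambda>k. real k ^ j))) a"
        unfolding b_def by (simp only: bpoly_sum bpoly_smult finite_atMost)
      then show ?thesis by (simp add: ev_sum ev_smult del: of_nat_Suc One_nat_def)
    qed
    then have "b = ?c" by blast
    moreover have "?c
      \<longlonglongrightarrow> (\<Sum>j\<le>degree q. coeff q j *\<^sub>R ((1 / fact 0) *\<^sub>R a ^ (0 + j)))"
      by (intro tendsto_intros LIMSEQ_Suc[OF bpoly_monomial_tendsto])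
    ultimately have "b \<longlonglongrightarrow> (\<Sum>j\<le>degree q. coeff q j *\<^sub>R ((1 / fact 0) *\<^sub>R a ^ (0 + j)))"
      by (simp only:)
    then show ?thesis by (simp add: ev_def)
  qed
  ultimately show ?thesis by (rule psd_limit)
qed

text \<open>Rescaling by \<open>norm a\<close> moves the spectrum into the unit interval. For
  \<open>a = 0\<close> only the constant coefficient remains, which is the value of \<open>q\<close>
  at 0.\<close>

lemma psd_ev:
  fixes a :: "'a::op_algebra"
  assumes a: "psd a" and q: "\<And>t. 0 \<le> t \<Longrightarrow> t \<le> norm a \<Longrightarrow> 0 \<le> poly q t"
  shows "psd (ev q a)"
proof (cases "a = 0")
  case True
  have "ev q 0 = coeff q 0 *\<^sub>R (1::'a)"
  proof (cases q)
    case (pCons c p)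
    then show ?thesis by (simp only: ev_pCons coeff_pCons_0 mult_zero_left add_0_right)
  qed
  moreover have "0 \<le> coeff q 0" using q[OF order_refl norm_ge_zero] unfolding poly_0_coeff_0 .
  ultimately show ?thesis unfolding True by (simp only: psd_scaleR psd_one)
next
  case False
  define M where "M = norm a"
  have M: "M > 0" using False M_def by simp
  define b where "b = (1 / M) *\<^sub>R a"
  have "1 - b = (1 / M) *\<^sub>R (norm a *\<^sub>R 1 - a)"
    using M by (simp add: b_def M_def algebra_simps)
  then have "psd (1 - b)"
    using psd_scaleR[OF _ psd_norm_diff[OF psd_imp_star[OF a]], of "1 / M"] M by simp
  moreover have "psd b" unfolding b_def using M a by (intro psd_scaleR) auto
  moreover have "0 \<le> poly (pcompose q [:0, M:]) t" if "0 \<le> t" "t \<le> 1" for t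
    using q[of "t * M"] that M by (simp add: poly_pcompose M_def mult_left_le_one_le)
  ultimately have psd: "psd (ev (pcompose q [:0, M:]) b)" using psd_ev_unit by blast
  have "ev [:0, M:] b = a"
    unfolding ev_pCons b_def using M by simp
  then have "ev (pcompose q [:0, M:]) b = ev q a"
    using ev_pcompose[of q "[:0, M:]" b] by argo
  then show ?thesis using psd by metis
qed

text \<open>Apply \<open>psd_ev\<close> to \<open>c - q\<close> and \<open>c + q\<close>. This
  sup-norm bound is what lets the calculus pass from polynomials to continuous functions.\<close>

lemma norm_ev_le:
  fixes a :: "'a::op_algebra"
  assumes a: "psd a" and q: "\<And>t. 0 \<le> t \<Longrightarrow> t \<le> norm a \<Longrightarrow> \<bar>poly q t\<bar> \<le> c"
  shows "norm (ev q a) \<le> c"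
proof (rule norm_le_psd)
  show "star (ev q a) = ev q a" using a psd_imp_star star_ev by blast
  have "0 \<le> poly ([:c:] - q) t \<and> 0 \<le> poly ([:c:] + q) t" if "0 \<le> t" "t \<le> norm a" for t
    using q[OF that] by (simp add: abs_le_iff)
  then have "psd (ev ([:c:] - q) a)" "psd (ev ([:c:] + q) a)"
    using psd_ev[OF a] by blast+
  then show "psd (c *\<^sub>R 1 - ev q a)" "psd (c *\<^sub>R 1 + ev q a)"
    by (simp_all add: ev_diff ev_add)
qed

section \<open>Continuous functional calculus\<close>

lemma polynomials_uniform_limit:
  fixes f :: "real \<Rightarrow> real"
  assumes "continuous_on {0..M} f"
  obtains q where "uniform_limit {0..M} (\<lambda>n. poly (q n)) f sequentially"
proof -
  have "\<exists>q. \<forall>x\<in>{0..M}. \<bar>f x - poly q x\<bar> < 1 / real (Suc n)" for n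
  proof -
    obtain g where g: "real_polynomial_function g" "\<And>x. x \<in> {0..M} \<Longrightarrow> \<bar>f x - g x\<bar> < 1 / real (Suc n)"
      using Stone_Weierstrass_real_polynomial_function[OF compact_Icc assms, of "1 / real (Suc n)"] by auto
    obtain c m where "g = (\<lambda>x. \<Sum>i\<le>m. c i * x ^ i)"
      using g(1) real_polynomial_function_iff_sum by auto
    then have "g = poly (\<Sum>i\<le>m. monom (c i) i)"
      by (simp add: poly_sum poly_monom fun_eq_iff)
    then show ?thesis using g(2) by blast
  qed
  then obtain q where q: "\<And>n x. x \<in> {0..M} \<Longrightarrow> \<bar>f x - poly (q n) x\<bar> < 1 / real (Suc n)" by metis
  have "uniform_limit {0..M} (\<lambda>n. poly (q n)) f sequentially"
  proof (rule uniform_limitI)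
    fix e :: real assume "e > 0"
    then obtain N where N: "inverse (real (Suc N)) < e" using reals_Archimedean by blast
    show "\<forall>\<^sub>F n in sequentially. \<forall>x\<in>{0..M}. dist (poly (q n) x) (f x) < e"
      unfolding eventually_sequentially
    proof (intro exI allI impI ballI)
      fix n x assume "N \<le> n" "x \<in> {0..M}"
      then have "\<bar>f x - poly (q n) x\<bar> < 1 / real (Suc n)" "1 / real (Suc n) \<le> inverse (real (Suc N))"
        using q by (auto simp: field_simps)
      then show "dist (poly (q n) x) (f x) < e" using N by (simp add: dist_real_def)
    qed
  qed
  then show thesis using that by blast
qed

text \<open>Quantifying over all approximating sequences frees the value from a choice of sequence,
  and the interval is the one in \<open>op_calculus\<close>, with which \<open>fc\<close> is
  identified later.\<close>

definition fc :: "(real \<Rightarrow> real) \<Rightarrow> 'a::op_algebra \<Rightarrow> 'a" where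
  "fc f a = (SOME b. \<forall>q. uniform_limit {0..norm a} (\<lambda>n. poly (q n)) f sequentially \<longrightarrow>
     (\<lambda>n. ev (q n) a) \<longlonglongrightarrow> b)"

lemma uniform_limit_imp_eventually_bound:
  fixes f :: "real \<Rightarrow> real"
  assumes "uniform_limit S (\<lambda>n. poly (q n)) f sequentially" "e > 0"
  obtains N where "\<And>n x. n \<ge> N \<Longrightarrow> x \<in> S \<Longrightarrow> \<bar>poly (q n) x - f x\<bar> < e"
  using uniform_limitD[OF assms] unfolding eventually_sequentially dist_real_def by blast

text \<open>By \<open>norm_ev_le\<close> a uniform Cauchy sequence of polynomials gives a norm
  Cauchy sequence, and two sequences with the same limit function have differences tending to
  0.\<close>

lemma fc_limit_norm:
  fixes a :: "'a::op_algebra"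
  assumes a: "psd a" and f: "continuous_on {0..norm a} f"
    and q: "uniform_limit {0..norm a} (\<lambda>n. poly (q n)) f sequentially"
  shows "(\<lambda>n. ev (q n) a) \<longlonglongrightarrow> fc f a"
proof -
  obtain q0 where q0: "uniform_limit {0..norm a} (\<lambda>n. poly (q0 n)) f sequentially"
    using polynomials_uniform_limit[OF f] by blast
  have "Cauchy (\<lambda>n. ev (q0 n) a)"
  proof (rule metric_CauchyI)
    fix e :: real assume e: "e > 0"
    obtain N where N: "\<And>n x. n \<ge> N \<Longrightarrow> x \<in> {0..norm a} \<Longrightarrow> \<bar>poly (q0 n) x - f x\<bar> < e / 4"
      using uniform_limit_imp_eventually_bound[OF q0, of "e / 4"] e by auto
    have "dist (ev (q0 m) a) (ev (q0 n) a) < e" if mn: "m \<ge> N" "n \<ge> N" for m n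
    proof -
      have "norm (ev (q0 m - q0 n) a) \<le> e / 2"
      proof (rule norm_ev_le[OF a])
        fix t assume "0 \<le> t" "t \<le> norm a"
        then show "\<bar>poly (q0 m - q0 n) t\<bar> \<le> e / 2"
          using N[OF mn(1), of t] N[OF mn(2), of t] unfolding poly_diff abs_le_iff abs_less_iff
            atLeastAtMost_iff by linarith
      qed
      then show ?thesis using e by (simp add: dist_norm ev_diff)
    qed
    then show "\<exists>N. \<forall>m\<ge>N. \<forall>n\<ge>N. dist (ev (q0 m) a) (ev (q0 n) a) < e" by blast
  qed
  then obtain b where b: "(\<lambda>n. ev (q0 n) a) \<longlonglongrightarrow> b"
    using Cauchy_convergent convergent_def by blast
  have "(\<lambda>n. ev (r n) a) \<longlonglongrightarrow> b"
    if r: "uniform_limit {0..norm a} (\<lambda>n. poly (r n)) f sequentially" for r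
  proof -
    have "(\<lambda>n. ev (r n) a - ev (q0 n) a) \<longlonglongrightarrow> 0"
    proof (rule metric_LIMSEQ_I)
      fix e :: real assume e: "e > 0"
      obtain N where N: "\<And>n x. n \<ge> N \<Longrightarrow> x \<in> {0..norm a} \<Longrightarrow> \<bar>poly (q0 n) x - f x\<bar> < e / 4"
        using uniform_limit_imp_eventually_bound[OF q0, of "e / 4"] e by auto
      obtain N' where N': "\<And>n x. n \<ge> N' \<Longrightarrow> x \<in> {0..norm a} \<Longrightarrow> \<bar>poly (r n) x - f x\<bar> < e / 4"
        using uniform_limit_imp_eventually_bound[OF r, of "e / 4"] e by auto
      have "dist (ev (r n) a - ev (q0 n) a) 0 < e" if n: "n \<ge> max N N'" for n
      proof -
        have "norm (ev (r n - q0 n) a) \<le> e / 2"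
        proof (rule norm_ev_le[OF a])
          fix t assume "0 \<le> t" "t \<le> norm a"
          then show "\<bar>poly (r n - q0 n) t\<bar> \<le> e / 2"
            using N[of n t] N'[of n t] n unfolding poly_diff abs_le_iff abs_less_iff
              atLeastAtMost_iff by linarith
        qed
        then show ?thesis using e by (simp add: ev_diff)
      qed
      then show "\<exists>no. \<forall>n\<ge>no. dist (ev (r n) a - ev (q0 n) a) 0 < e" by blast
    qed
    from tendsto_add[OF this b] show ?thesis by simp
  qed
  then have "\<forall>q. uniform_limit {0..norm a} (\<lambda>n. poly (q n)) f sequentially \<longrightarrow>
     (\<lambda>n. ev (q n) a) \<longlonglongrightarrow> b" by blast
  then have "\<forall>q. uniform_limit {0..norm a} (\<lambda>n. poly (q n)) f sequentially \<longrightarrow>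
     (\<lambda>n. ev (q n) a) \<longlonglongrightarrow> fc f a"
    unfolding fc_def by (rule someI)
  then show ?thesis using q by blast
qed

text \<open>One sequence of polynomials serves all positive elements of norm at most
  \<open>M\<close>. Comparisons of functions of two different elements, such as
  \<open>x * star x\<close> and \<open>star x * x\<close>, rest on this.\<close>

lemma fc_approx:
  assumes "continuous_on {0..} f"
  obtains q where "\<forall>a :: 'a::op_algebra. psd a \<longrightarrow> norm a \<le> M \<longrightarrow> (\<lambda>n. ev (q n) a) \<longlonglongrightarrow> fc f a"
    "uniform_limit {0..M} (\<lambda>n. poly (q n)) f sequentially"
proof -
  obtain q where q: "uniform_limit {0..M} (\<lambda>n. poly (q n)) f sequentially"
    by (rule polynomials_uniform_limit[of M f]) (auto intro: continuous_on_subset[OF assms])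
  show thesis
  proof (rule that[OF _ q], intro allI impI)
    fix a :: 'a assume "psd a" "norm a \<le> M"
    then show "(\<lambda>n. ev (q n) a) \<longlonglongrightarrow> fc f a"
      by (intro fc_limit_norm uniform_limit_on_subset[OF q] continuous_on_subset[OF assms]) auto
  qed
qed

lemma fc_approx_single:
  assumes "psd a" "continuous_on {0..} f"
  obtains q where "(\<lambda>n. ev (q n) a) \<longlonglongrightarrow> fc f a"
    "uniform_limit {0..norm a} (\<lambda>n. poly (q n)) f sequentially"
proof (rule fc_approx[OF assms(2), where M = "norm a"])
  fix q assume "\<forall>b :: 'a. psd b \<longrightarrow> norm b \<le> norm a \<longrightarrow> (\<lambda>n. ev (q n) b) \<longlonglongrightarrow> fc f b"
    "uniform_limit {0..norm a} (\<lambda>n. poly (q n)) f sequentially"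
  then show thesis using that assms(1) by blast
qed

lemma fc_approx_ex:
  fixes a :: "'a::op_algebra"
  assumes "psd a" "continuous_on {0..} f"
  shows "\<exists>q. (\<lambda>n. ev (q n) a) \<longlonglongrightarrow> fc f a"
  by (rule fc_approx_single[OF assms]) (rule exI)

lemma fc_poly: "psd a \<Longrightarrow> fc (poly q) a = ev q (a :: 'a::op_algebra)"
  by (rule LIMSEQ_unique[OF fc_limit_norm tendsto_const])
    (auto intro!: uniform_limit_const continuous_intros)

lemma fc_const: "psd a \<Longrightarrow> fc (\<lambda>_. c) a = c *\<^sub>R (1 :: 'a::op_algebra)"
proof -
  have "poly [:c:] = (\<lambda>_. c)" by (simp add: fun_eq_iff)
  then show "psd a \<Longrightarrow> fc (\<lambda>_. c) a = c *\<^sub>R 1" using fc_poly[of a "[:c:]"] by simp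
qed

lemma fc_id: "psd a \<Longrightarrow> fc (\<lambda>t. t) a = (a :: 'a::op_algebra)"
proof -
  have "poly [:0, 1:] = (\<lambda>t. t :: real)" by (simp add: fun_eq_iff)
  then show "psd a \<Longrightarrow> fc (\<lambda>t. t) a = a" using fc_poly[of a "[:0, 1:]"] by simp
qed

lemma fc_cong:
  assumes "\<And>t. 0 \<le> t \<Longrightarrow> t \<le> norm a \<Longrightarrow> f t = g t"
  shows "fc f a = fc g a"
proof -
  have "uniform_limit {0..norm a} (\<lambda>n. poly (q n)) f sequentially =
      uniform_limit {0..norm a} (\<lambda>n. poly (q n)) g sequentially" for q
    by (rule uniform_limit_cong') (use assms in auto)
  then show ?thesis by (simp add: fc_def)
qed

lemma fc_add:
  fixes a :: "'a::op_algebra"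
  assumes a: "psd a" and f: "continuous_on {0..} f" and g: "continuous_on {0..} g"
  shows "fc (\<lambda>t. f t + g t) a = fc f a + fc g a"
proof -
  obtain p where p: "(\<lambda>n. ev (p n) a) \<longlonglongrightarrow> fc f a" "uniform_limit {0..norm a} (\<lambda>n. poly (p n)) f sequentially"
    by (rule fc_approx_single[OF a f])
  obtain q where q: "(\<lambda>n. ev (q n) a) \<longlonglongrightarrow> fc g a" "uniform_limit {0..norm a} (\<lambda>n. poly (q n)) g sequentially"
    by (rule fc_approx_single[OF a g])
  have "(\<lambda>n. poly (p n + q n)) = (\<lambda>n t. poly (p n) t + poly (q n) t)" by (simp add: fun_eq_iff)
  then have "(\<lambda>n. ev (p n + q n) a) \<longlonglongrightarrow> fc (\<lambda>t. f t + g t) a"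
    by (intro fc_limit_norm[OF a])
      (auto intro!: continuous_intros continuous_on_subset[OF f] continuous_on_subset[OF g]
        uniform_limit_add p(2) q(2))
  then show ?thesis using tendsto_add[OF p(1) q(1)] by (simp add: ev_add LIMSEQ_unique)
qed

lemma fc_mult:
  fixes a :: "'a::op_algebra"
  assumes a: "psd a" and f: "continuous_on {0..} f" and g: "continuous_on {0..} g"
  shows "fc (\<lambda>t. f t * g t) a = fc f a * fc g a"
proof -
  obtain p where p: "(\<lambda>n. ev (p n) a) \<longlonglongrightarrow> fc f a" "uniform_limit {0..norm a} (\<lambda>n. poly (p n)) f sequentially"
    by (rule fc_approx_single[OF a f])
  obtain q where q: "(\<lambda>n. ev (q n) a) \<longlonglongrightarrow> fc g a" "uniform_limit {0..norm a} (\<lambda>n. poly (q n)) g sequentially"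
    by (rule fc_approx_single[OF a g])
  have fg: "continuous_on {0..norm a} f" "continuous_on {0..norm a} g"
    by (rule continuous_on_subset[OF f], simp) (rule continuous_on_subset[OF g], simp)
  have eq: "(\<lambda>n. poly (p n * q n)) = (\<lambda>n t. poly (p n) t * poly (q n) t)" by (simp add: fun_eq_iff)
  have "bounded (f ` {0..norm a})" "bounded (g ` {0..norm a})"
    by (intro compact_imp_bounded compact_continuous_image fg compact_Icc)+
  from uniform_lim_mult[OF p(2) q(2) this]
  have "uniform_limit {0..norm a} (\<lambda>n. poly (p n * q n)) (\<lambda>t. f t * g t) sequentially"
    unfolding eq .
  then have "(\<lambda>n. ev (p n * q n) a) \<longlonglongrightarrow> fc (\<lambda>t. f t * g t) a"
    by (intro fc_limit_norm[OF a] continuous_on_mult fg)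
  then show ?thesis using tendsto_mult[OF p(1) q(1)] by (simp add: ev_mult LIMSEQ_unique)
qed

lemma fc_scale:
  fixes a :: "'a::op_algebra"
  assumes "psd a" "continuous_on {0..} f"
  shows "fc (\<lambda>t. c * f t) a = c *\<^sub>R fc f a"
  using fc_mult[OF assms(1) continuous_on_const assms(2), of c] by (simp add: fc_const[OF assms(1)])

lemma fc_diff:
  fixes a :: "'a::op_algebra"
  assumes "psd a" "continuous_on {0..} f" "continuous_on {0..} g"
  shows "fc (\<lambda>t. f t - g t) a = fc f a - fc g a"
proof -
  have "continuous_on {0..} (\<lambda>t. (-1) * g t)" by (intro continuous_intros assms)
  from fc_add[OF assms(1,2) this] fc_scale[OF assms(1,3), of "-1"] show ?thesis by simp
qed

lemma star_fc:
  fixes a :: "'a::op_algebra"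
  assumes a: "psd a" and f: "continuous_on {0..} f"
  shows "star (fc f a) = fc f a"
proof -
  obtain p where p: "(\<lambda>n. ev (p n) a) \<longlonglongrightarrow> fc f a"
    by (rule fc_approx_single[OF a f]) blast
  have "(\<lambda>n. star (ev (p n) a)) \<longlonglongrightarrow> star (fc f a)" using p by (rule tendsto_star)
  then show ?thesis using p LIMSEQ_unique by (simp add: star_ev[OF psd_imp_star[OF a]])
qed

text \<open>\<open>fc f a\<close> is the square of a self-adjoint element. The absolute value under
  the root keeps the function continuous on the whole half-line although \<open>f\<close> is
  nonnegative only up to \<open>norm a\<close>.\<close>

lemma psd_fc:
  fixes a :: "'a::op_algebra"
  assumes a: "psd a" and f: "continuous_on {0..} f" and nn: "\<And>t. 0 \<le> t \<Longrightarrow> t \<le> norm a \<Longrightarrow> 0 \<le> f t"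
  shows "psd (fc f a)"
proof -
  have c: "continuous_on {0..} (\<lambda>t. sqrt \<bar>f t\<bar>)" by (intro continuous_intros f)
  have "fc f a = fc (\<lambda>t. sqrt \<bar>f t\<bar> * sqrt \<bar>f t\<bar>) a" by (rule fc_cong) (simp add: nn)
  also have "\<dots> = star (fc (\<lambda>t. sqrt \<bar>f t\<bar>) a) * fc (\<lambda>t. sqrt \<bar>f t\<bar>) a"
    by (simp only: fc_mult[OF a c c] star_fc[OF a c])
  finally show ?thesis by (simp only: psd_square)
qed

lemma norm_fc_le:
  fixes a :: "'a::op_algebra"
  assumes a: "psd a" and f: "continuous_on {0..} f" and c: "\<And>t. 0 \<le> t \<Longrightarrow> t \<le> norm a \<Longrightarrow> \<bar>f t\<bar> \<le> c"
  shows "norm (fc f a) \<le> c"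
proof (rule norm_le_psd)
  show "star (fc f a) = fc f a" by (rule star_fc[OF a f])
  have "0 \<le> c - f t \<and> 0 \<le> c + f t" if "0 \<le> t" "t \<le> norm a" for t
    using c[OF that] by (simp add: abs_le_iff)
  then have "psd (fc (\<lambda>t. c - f t) a)" "psd (fc (\<lambda>t. c + f t) a)"
    by (auto intro!: psd_fc a continuous_intros f)
  then show "psd (c *\<^sub>R 1 - fc f a)" "psd (c *\<^sub>R 1 + fc f a)"
    using fc_diff[OF a continuous_on_const f] fc_add[OF a continuous_on_const f] by (simp_all add: fc_const[OF a])
qed

text \<open>True for polynomials, and a common approximating sequence carries it to the limit. With
  \<open>a = x * star x\<close> and \<open>b = star x * x\<close> it moves functions across
  \<open>x\<close>.\<close>

lemma fc_intertwine:
  fixes a b x :: "'a::op_algebra"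
  assumes a: "psd a" "psd b" and f: "continuous_on {0..} f" and x: "a * x = x * b"
  shows "fc f a * x = x * fc f b"
proof -
  define M where "M = max (norm a) (norm b)"
  obtain q where q: "\<forall>c :: 'a. psd c \<longrightarrow> norm c \<le> M \<longrightarrow> (\<lambda>n. ev (q n) c) \<longlonglongrightarrow> fc f c"
    by (rule fc_approx[OF f, where M = M]) blast
  have "(\<lambda>n. ev (q n) a * x) \<longlonglongrightarrow> fc f a * x" "(\<lambda>n. x * ev (q n) b) \<longlonglongrightarrow> x * fc f b"
    using q a by (auto intro!: tendsto_intros simp: M_def)
  then show ?thesis using LIMSEQ_unique by (simp add: ev_prod_commute[OF x])
qed

lemma fc_tendsto:
  fixes a :: "'a::op_algebra"
  assumes a: "psd a" and f: "continuous_on {0..} f" "\<And>n. continuous_on {0..} (F n)"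
    and lim: "uniform_limit {0..norm a} F f L"
  shows "((\<lambda>n. fc (F n) a) \<longlongrightarrow> fc f a) L"
proof (rule tendstoI)
  fix e :: real assume e: "e > 0"
  have "\<forall>\<^sub>F n in L. \<forall>x\<in>{0..norm a}. dist (F n x) (f x) < e / 2"
    using uniform_limitD[OF lim, of "e / 2"] e by simp
  then show "\<forall>\<^sub>F n in L. dist (fc (F n) a) (fc f a) < e"
  proof eventually_elim
    case (elim n)
    have "norm (fc (\<lambda>t. F n t - f t) a) \<le> e / 2"
    proof (intro norm_fc_le a continuous_intros f)
      fix t assume "0 \<le> t" "t \<le> norm a"
      then have "dist (F n t) (f t) < e / 2" using elim by simp
      then show "\<bar>F n t - f t\<bar> \<le> e / 2" unfolding dist_real_def by (rule less_imp_le)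
    qed
    then show ?case using e by (simp add: dist_norm fc_diff[OF a f(2,1)])
  qed
qed

lemma continuous_on_Icc_bound:
  fixes f :: "real \<Rightarrow> real"
  assumes "continuous_on {0..} f"
  obtains K where "\<forall>t\<in>{0..M}. \<bar>f t\<bar> \<le> K"
proof -
  have "compact (f ` {0..M})"
    by (rule compact_continuous_image) (auto intro: continuous_on_subset[OF assms])
  then have "bounded (f ` {0..M})" by (rule compact_imp_bounded)
  then obtain K where "\<forall>x\<in>f ` {0..M}. norm x \<le> K" unfolding bounded_iff by blast
  then show thesis using that[of K] by simp
qed

lemma fc_compose:
  fixes a :: "'a::op_algebra"
  assumes a: "psd a" and f: "continuous_on {0..} f" "\<And>t. 0 \<le> t \<Longrightarrow> 0 \<le> f t" and g: "continuous_on {0..} g"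
  shows "fc g (fc f a) = fc (\<lambda>t. g (f t)) a"
proof -
  have pf: "psd (fc f a)" using psd_fc a f by blast
  obtain K where "\<forall>t\<in>{0..norm a}. \<bar>f t\<bar> \<le> K"
    by (rule continuous_on_Icc_bound[OF f(1)])
  then have K: "\<And>t. t \<in> {0..norm a} \<Longrightarrow> \<bar>f t\<bar> \<le> K" by blast
  \<comment> \<open>\<open>M\<close> bounds the range of \<open>f\<close> on the interval as well as
    the norm of \<open>fc f a\<close>, so the same polynomials converge on both sides.\<close>
  define M where "M = max K (norm (fc f a))"
  obtain q where q: "\<forall>c :: 'a. psd c \<longrightarrow> norm c \<le> M \<longrightarrow> (\<lambda>n. ev (q n) c) \<longlonglongrightarrow> fc g c"
      and u: "uniform_limit {0..M} (\<lambda>n. poly (q n)) g sequentially"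
    by (rule fc_approx[OF g, where M = M])
  have pc: "fc (\<lambda>t. poly p (f t)) a = ev p (fc f a)" for p
  proof (induction p)
    case 0
    then show ?case by (simp add: fc_const[OF a])
  next
    case (pCons c p)
    have c: "continuous_on {0..} (\<lambda>t. poly p (f t))" by (intro continuous_intros f)
    have "fc (\<lambda>t. c + f t * poly p (f t)) a = c *\<^sub>R 1 + fc f a * ev p (fc f a)"
      using fc_add[OF a continuous_on_const continuous_on_mult[OF f(1) c]] fc_mult[OF a f(1) c]
      by (simp add: fc_const[OF a] pCons.IH)
    then show ?case by (simp add: ev_pCons)
  qed
  have "(\<lambda>n. fc (\<lambda>t. poly (q n) (f t)) a) \<longlonglongrightarrow> fc (\<lambda>t. g (f t)) a"
  proof (rule fc_tendsto[OF a])
    show "continuous_on {0..} (\<lambda>t. g (f t))"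
      by (rule continuous_on_compose2[OF g f(1)]) (auto simp: f(2))
    show "uniform_limit {0..norm a} (\<lambda>n t. poly (q n) (f t)) (\<lambda>t. g (f t)) sequentially"
    proof (rule uniform_limit_compose'[OF u])
      show "f \<in> {0..norm a} \<rightarrow> {0..M}"
      proof
        fix t assume t: "t \<in> {0..norm a}"
        then have "\<bar>f t\<bar> \<le> M" using K[OF t] unfolding M_def by (meson max.coboundedI1)
        moreover have "0 \<le> f t" using t f(2) by simp
        ultimately show "f t \<in> {0..M}" by simp
      qed
    qed
  qed (intro continuous_intros f)
  moreover have "(\<lambda>n. ev (q n) (fc f a)) \<longlonglongrightarrow> fc g (fc f a)"
    using q pf by (simp add: M_def)
  ultimately show ?thesis using LIMSEQ_unique by (simp add: pc)
qed

lemma fc_power: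
  fixes a :: "'a::op_algebra"
  assumes a: "psd a" and f: "continuous_on {0..} f"
  shows "fc (\<lambda>t. f t ^ n) a = fc f a ^ n"
proof (induction n)
  case (Suc n)
  have "continuous_on {0..} (\<lambda>t. f t ^ n)" by (intro continuous_intros f)
  from fc_mult[OF a f this] Suc show ?case by simp
qed (simp add: fc_const[OF a])

lemma fc_sum:
  fixes a :: "'a::op_algebra"
  assumes a: "psd a" and f: "\<And>i. continuous_on {0..} (f i)"
  shows "fc (\<lambda>t. \<Sum>i<(n::nat). f i t) a = (\<Sum>i<n. fc (f i) a)"
proof (induction n)
  case (Suc n)
  have "continuous_on {0..} (\<lambda>t. \<Sum>i<n. f i t)" by (intro continuous_intros f)
  from fc_add[OF a this f[of n]] Suc show ?case by simp
qed (simp add: fc_const[OF a])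

text \<open>Links the exponential series of the Banach algebra with the calculus. It allows powers
  of a positive element to be written as exponentials and differentiated in a complex
  exponent.\<close>

lemma exp_fc:
  fixes a :: "'a::op_algebra"
  assumes a: "psd a" and f: "continuous_on {0..} f"
  shows "exp (fc f a) = fc (\<lambda>t. exp (f t)) a"
proof -
  define F where "F = (\<lambda>n t. \<Sum>i<n. (1 / fact i) * f t ^ i)"
  have c: "continuous_on {0..} (\<lambda>t. f t ^ i)" for i by (intro continuous_on_power f)
  have cF: "continuous_on {0..} (F n)" for n
    unfolding F_def by (rule continuous_on_sum) (rule continuous_on_mult[OF continuous_on_const c])
  obtain K where "\<forall>t\<in>{0..norm a}. \<bar>f t\<bar> \<le> K"
    by (rule continuous_on_Icc_bound[OF f])
  then have K: "\<And>t. t \<in> {0..norm a} \<Longrightarrow> \<bar>f t\<bar> \<le> K" by blast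
  have "uniform_limit {0..norm a} F (\<lambda>t. \<Sum>i. (1 / fact i) * f t ^ i) sequentially"
    unfolding F_def
  proof (rule Weierstrass_m_test)
    show "summable (\<lambda>i. K ^ i / fact i)" using summable_exp_generic[of K] by (simp add: field_simps)
    fix i t assume "t \<in> {0..norm a}"
    then show "norm (1 / fact i * f t ^ i) \<le> K ^ i / fact i"
      using power_mono[OF K[of t], of i] by (simp add: power_abs divide_right_mono)
  qed
  moreover have "(\<Sum>i. (1 / fact i) * x ^ i) = exp x" for x :: real
    by (simp add: exp_def field_simps)
  ultimately have "(\<lambda>n. fc (F n) a) \<longlonglongrightarrow> fc (\<lambda>t. exp (f t)) a"
    by (intro fc_tendsto[OF a] cF continuous_intros f) simp
  moreover have "fc (F n) a = (\<Sum>i<n. fc f a ^ i /\<^sub>R fact i)" for n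
    unfolding F_def
    by (subst fc_sum[OF a])
      (simp_all add: continuous_on_mult[OF continuous_on_const c] fc_scale[OF a c] fc_power[OF a f] divide_inverse)
  moreover have "(\<lambda>n. \<Sum>i<n. fc f a ^ i /\<^sub>R fact i) \<longlonglongrightarrow> exp (fc f a)"
    using summable_sums[OF summable_exp_generic[of "fc f a"]] by (simp add: exp_def sums_def)
  ultimately show ?thesis using LIMSEQ_unique by simp
qed

section \<open>The three lines theorem\<close>

lemma three_lines_max:
  assumes hol: "F holomorphic_on UNIV" and M: "M > 0"
    and bd: "\<And>z. 0 \<le> Re z \<Longrightarrow> Re z \<le> 1 \<Longrightarrow> cmod (F z) \<le> B"
    and b0: "\<And>z. Re z = 0 \<Longrightarrow> cmod (F z) \<le> M" and b1: "\<And>z. Re z = 1 \<Longrightarrow> cmod (F z) \<le> M"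
    and t: "0 < t" "t < 1"
  shows "cmod (F (of_real t)) \<le> M"
proof -
  have le: "cmod (F (of_real t)) \<le> M * exp e" if e: "e > 0" for e :: real
  proof -
    \<comment> \<open>On the strip the extra factor has modulus at most \<open>exp (- e y^2)\<close>
      with \<open>y = Im z\<close>: it never exceeds 1 and decays in the vertical
      directions.\<close>
    define G where "G z = F z * exp (of_real e * (z\<^sup>2 - 1))" for z
    have nG: "cmod (G z) = cmod (F z) * exp (e * ((Re z)\<^sup>2 - (Im z)\<^sup>2 - 1))" for z
      by (simp add: G_def norm_mult power2_eq_square algebra_simps)
    define B' where "B' = max B 1"
    have B': "0 < B'" by (simp add: B'_def)
    \<comment> \<open>Height at which the decay brings the a priori bound \<open>B'\<close> below
      \<open>M\<close> on the horizontal sides of the rectangle.\<close>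
    define R where "R = sqrt (max 0 (ln (B' / M) / e)) + 1"
    have R: "B' * exp (- (e * R\<^sup>2)) \<le> M"
    proof -
      have "ln (B' / M) / e \<le> (sqrt (max 0 (ln (B' / M) / e)))\<^sup>2" by simp
      also have "\<dots> \<le> R\<^sup>2" unfolding R_def by (intro power_mono) auto
      finally have "ln (B' / M) \<le> e * R\<^sup>2" using e by (simp add: field_simps)
      then have "B' / M \<le> exp (e * R\<^sup>2)" using M B' by (metis exp_le_cancel_iff exp_ln divide_pos_pos)
      then show ?thesis using M by (simp add: exp_minus field_simps)
    qed
    have R0: "R > 0" unfolding R_def by (rule add_nonneg_pos) auto
    let ?S = "cbox (Complex 0 (- R)) (Complex 1 R)"
    have inS: "z \<in> ?S \<longleftrightarrow> 0 \<le> Re z \<and> Re z \<le> 1 \<and> - R \<le> Im z \<and> Im z \<le> R" for z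
      by (auto simp: in_cbox_complex_iff)
    have inB: "z \<in> box (Complex 0 (- R)) (Complex 1 R) \<longleftrightarrow> 0 < Re z \<and> Re z < 1 \<and> - R < Im z \<and> Im z < R" for z
      by (auto simp: in_box_complex_iff)
    have holG: "G holomorphic_on UNIV" unfolding G_def by (intro holomorphic_intros hol)
    have "cmod (G (of_real t)) \<le> M"
    proof (rule maximum_modulus_frontier[where S = ?S and f = G])
      show "G holomorphic_on interior ?S" using holG holomorphic_on_subset by blast
      show "continuous_on (closure ?S) G"
        using holG holomorphic_on_imp_continuous_on continuous_on_subset by blast
      show "bounded ?S" by (rule bounded_cbox)
      show "complex_of_real t \<in> ?S" using t R0 by (simp add: inS)
    next
      fix z assume "z \<in> frontier ?S"
      then have z: "z \<in> ?S" "z \<notin> box (Complex 0 (- R)) (Complex 1 R)"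
        by (auto simp: frontier_def interior_cbox)
      then consider "Re z = 0" | "Re z = 1" | "Im z = R \<or> Im z = - R" "0 \<le> Re z" "Re z \<le> 1"
        unfolding inS inB by linarith
      then show "cmod (G z) \<le> M"
      proof cases
        case 3
        then have "(Im z)\<^sup>2 = R\<^sup>2" by auto
        moreover have "(Re z)\<^sup>2 \<le> 1" using 3 by (simp add: power_le_one)
        ultimately have "exp (e * ((Re z)\<^sup>2 - (Im z)\<^sup>2 - 1)) \<le> exp (- (e * R\<^sup>2))"
          using e by simp (simp add: algebra_simps)
        moreover have "cmod (F z) \<le> B'" using bd[of z] 3 by (simp add: B'_def)
        ultimately have "cmod (G z) \<le> B' * exp (- (e * R\<^sup>2))"
          unfolding nG by (intro mult_mono) (auto simp: B'_def)
        then show ?thesis using R by linarith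
      next
        case 1
        have "(Re z)\<^sup>2 - (Im z)\<^sup>2 - 1 \<le> 0" using 1 order_trans[of "- 1" 0 "(Im z)\<^sup>2"] by simp
        then have "exp (e * ((Re z)\<^sup>2 - (Im z)\<^sup>2 - 1)) \<le> 1" using e by (simp add: mult_le_0_iff)
        then show ?thesis unfolding nG using b0[OF 1] M
          by (meson exp_ge_zero mult_left_le norm_ge_zero order_trans)
      next
        case 2
        have "(Re z)\<^sup>2 - (Im z)\<^sup>2 - 1 \<le> 0" using 2 by simp
        then have "exp (e * ((Re z)\<^sup>2 - (Im z)\<^sup>2 - 1)) \<le> 1" using e by (simp add: mult_le_0_iff)
        then show ?thesis unfolding nG using b1[OF 2] M
          by (meson exp_ge_zero mult_left_le norm_ge_zero order_trans)
      qed
    qed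
    then have "cmod (F (of_real t)) * exp (e * (t\<^sup>2 - 1)) \<le> M" by (simp add: nG)
    then have "cmod (F (of_real t)) \<le> M * exp (e * (1 - t\<^sup>2))"
      by (simp add: algebra_simps exp_diff exp_minus field_simps exp_add)
    also have "\<dots> \<le> M * exp e" using M e by (intro mult_left_mono) auto
    finally show ?thesis .
  qed
  have "((\<lambda>e. M * exp e) \<longlongrightarrow> M * exp 0) (at_right (0 :: real))"
    by (intro tendsto_intros)
  moreover have "\<forall>\<^sub>F e in at_right (0 :: real). cmod (F (of_real t)) \<le> M * exp e"
    by (rule eventually_mono[OF eventually_at_right_less]) (rule le)
  ultimately have "cmod (F (of_real t)) \<le> M * exp 0"
    by (rule tendsto_lowerbound) simp
  then show ?thesis by simp
qed

lemma three_lines: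
  assumes hol: "F holomorphic_on UNIV" and M: "M0 > 0" "M1 > 0"
    and bd: "\<And>z. 0 \<le> Re z \<Longrightarrow> Re z \<le> 1 \<Longrightarrow> cmod (F z) \<le> B"
    and b0: "\<And>z. Re z = 0 \<Longrightarrow> cmod (F z) \<le> M0" and b1: "\<And>z. Re z = 1 \<Longrightarrow> cmod (F z) \<le> M1"
    and t: "0 < t" "t < 1"
  shows "cmod (F (of_real t)) \<le> M0 powr (1 - t) * M1 powr t"
proof -
  \<comment> \<open>\<open>exp (c z)\<close> is \<open>M0\<close> to the power \<open>z - 1\<close>
    times \<open>M1\<close> to the power \<open>- z\<close>; it normalises the bounds on both
    boundary lines to 1.\<close>
  define c :: "complex \<Rightarrow> complex" where "c z = (z - 1) * of_real (ln M0) - z * of_real (ln M1)" for z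
  have nc: "cmod (exp (c z)) = M0 powr (Re z - 1) * M1 powr (- Re z)" for z
    using M by (simp add: c_def powr_def exp_add[symmetric])
  have B: "0 \<le> B" using bd[of 0] order_trans[OF norm_ge_zero] by auto
  have "cmod (F (of_real t) * exp (c (of_real t))) \<le> 1"
  proof (rule three_lines_max[where B = "B * (exp \<bar>ln M0\<bar> * exp \<bar>ln M1\<bar>)" and F = "\<lambda>z. F z * exp (c z)"])
    show "(\<lambda>z. F z * exp (c z)) holomorphic_on UNIV"
      unfolding c_def by (intro holomorphic_intros hol)
    fix z
    show "cmod (F z * exp (c z)) \<le> B * (exp \<bar>ln M0\<bar> * exp \<bar>ln M1\<bar>)" if z: "0 \<le> Re z" "Re z \<le> 1"
    proof -
      have "(Re z - 1) * ln M0 \<le> \<bar>Re z - 1\<bar> * \<bar>ln M0\<bar>" "- Re z * ln M1 \<le> \<bar>Re z\<bar> * \<bar>ln M1\<bar>"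
        by (metis abs_ge_self abs_mult, metis abs_ge_self abs_minus_cancel abs_mult)
      moreover have "\<bar>Re z - 1\<bar> * \<bar>ln M0\<bar> \<le> \<bar>ln M0\<bar>" "\<bar>Re z\<bar> * \<bar>ln M1\<bar> \<le> \<bar>ln M1\<bar>"
        using z by (auto intro!: mult_left_le_one_le simp: abs_le_iff)
      ultimately have "M0 powr (Re z - 1) \<le> exp \<bar>ln M0\<bar>" "M1 powr (- Re z) \<le> exp \<bar>ln M1\<bar>"
        using M by (auto simp: powr_def)
      then have "cmod (exp (c z)) \<le> exp \<bar>ln M0\<bar> * exp \<bar>ln M1\<bar>"
        unfolding nc by (intro mult_mono) auto
      then show ?thesis unfolding norm_mult using bd[OF z] B by (intro mult_mono) auto
    qed
    show "cmod (F z * exp (c z)) \<le> 1" if z: "Re z = 0"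
    proof -
      have "cmod (F z * exp (c z)) = cmod (F z) / M0"
        unfolding norm_mult nc z using M by (simp add: powr_minus divide_inverse)
      then show ?thesis using b0[OF z] M by simp
    qed
    show "cmod (F z * exp (c z)) \<le> 1" if z: "Re z = 1"
    proof -
      have "cmod (F z * exp (c z)) = cmod (F z) / M1"
        unfolding norm_mult nc z using M by (simp add: powr_minus divide_inverse)
      then show ?thesis using b1[OF z] M by simp
    qed
  qed (use t in auto)
  then have "cmod (F (of_real t)) * (M0 powr (t - 1) * M1 powr (- t)) \<le> 1"
    unfolding norm_mult nc by simp
  moreover have "M0 powr (t - 1) * M1 powr (- t) = 1 / (M0 powr (1 - t) * M1 powr t)"
    using powr_minus_divide[of M0 "1 - t"] powr_minus_divide[of M1 t] by simp
  ultimately show ?thesis using M by (simp add: divide_le_eq)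
qed

section \<open>Imaginary powers and interpolation of bilinear forms\<close>

lemma star_exp: "star (exp x) = exp (star (x :: 'a::op_algebra))"
  unfolding exp_def
  by (subst bounded_linear.suminf[OF bounded_linear_star])
    (simp_all add: summable_exp_generic star_scaleR star_power)

text \<open>\<open>imunit * L\<close> is skew-adjoint, so its exponential is unitary.\<close>

lemma norm_exp_imunit:
  fixes L :: "'a::op_algebra"
  assumes "star L = L"
  shows "norm (exp (t *\<^sub>R (imunit * L))) = 1"
proof -
  let ?x = "t *\<^sub>R (imunit * L)"
  have "star ?x = - ?x"
    using assms imunit_comm[of L] by (simp add: star_scaleR star_mult star_imunit)
  then have "star (exp ?x) * exp ?x = exp (- ?x) * exp ?x" by (simp add: star_exp)
  also have "\<dots> = exp (- ?x + ?x)" by (rule exp_add_commuting[symmetric]) simp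
  finally have "star (exp ?x) * exp ?x = 1" by simp
  then have "norm (exp ?x) * norm (exp ?x) = 1" by (metis norm_star_mult norm_one)
  then show ?thesis by (metis norm_ge_zero real_sqrt_abs2 real_sqrt_one abs_of_nonneg)
qed

text \<open>Both orders occur in the interpolation: the unitary factor has to stand next to a
  contraction, which lies to the right of one exponential and to the left of the other.\<close>

lemma exp_ofc:
  fixes L :: "'a::op_algebra"
  shows "exp (ofc z * L) = exp (Re z *\<^sub>R L) * exp (Im z *\<^sub>R (imunit * L))"
    and "exp (ofc z * L) = exp (Im z *\<^sub>R (imunit * L)) * exp (Re z *\<^sub>R L)"
proof -
  have e: "ofc z * L = Re z *\<^sub>R L + Im z *\<^sub>R (imunit * L)"
    by (simp add: ofc_def algebra_simps)
  have c: "Re z *\<^sub>R L * (Im z *\<^sub>R (imunit * L)) = Im z *\<^sub>R (imunit * L) * (Re z *\<^sub>R L)"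
    using arg_cong[OF imunit_comm[of L], of "\<lambda>x. x * L"] by (simp add: mult.assoc mult.commute)
  show "exp (ofc z * L) = exp (Re z *\<^sub>R L) * exp (Im z *\<^sub>R (imunit * L))"
    unfolding e by (rule exp_add_commuting[OF c])
  show "exp (ofc z * L) = exp (Im z *\<^sub>R (imunit * L)) * exp (Re z *\<^sub>R L)"
    unfolding e by (subst add.commute) (rule exp_add_commuting[OF c[symmetric]])
qed

text \<open>The real derivative has the form of multiplication by \<open>ofc h\<close>. This is
  complex differentiability expressed with real scalars, and \<open>cbil\<close> turns it into an
  ordinary complex derivative.\<close>

lemma exp_ofc_has_derivative:
  fixes L :: "'a::op_algebra"
  shows "((\<lambda>z. exp (ofc (c + d * z) * L)) has_derivative
    (\<lambda>h. ofc h * (ofc d * (L * exp (ofc (c + d * z) * L))))) (at z)"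
proof -
  have R: "((\<lambda>w. exp (Re w *\<^sub>R L)) has_derivative (\<lambda>h. Re h *\<^sub>R (exp (Re w *\<^sub>R L) * L))) (at w)" for w
    using has_derivative_compose[OF has_derivative_Re[OF has_derivative_ident]
      exp_scaleR_has_vector_derivative_right[of L "Re w" UNIV, unfolded has_vector_derivative_def]]
    by simp
  have I: "((\<lambda>w. exp (Im w *\<^sub>R (imunit * L))) has_derivative
      (\<lambda>h. Im h *\<^sub>R (exp (Im w *\<^sub>R (imunit * L)) * (imunit * L)))) (at w)" for w
    using has_derivative_compose[OF has_derivative_Im[OF has_derivative_ident]
      exp_scaleR_has_vector_derivative_right[of "imunit * L" "Im w" UNIV, unfolded has_vector_derivative_def]]
    by simp
  have E: "((\<lambda>w. exp (ofc w * L)) has_derivative (\<lambda>h. ofc h * (L * exp (ofc w * L)))) (at w)" for w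
  proof -
    let ?A = "exp (Re w *\<^sub>R L)" and ?B = "exp (Im w *\<^sub>R (imunit * L))"
    have cA: "?A * L = L * ?A" and cB: "?B * (imunit * L) = (imunit * L) * ?B"
      using exp_times_scaleR_commute by auto
    have cA': "?A * imunit = imunit * ?A" by (simp add: imunit_comm)
    have "((\<lambda>w. exp (Re w *\<^sub>R L) * exp (Im w *\<^sub>R (imunit * L))) has_derivative
      (\<lambda>h. ?A * (Im h *\<^sub>R (?B * (imunit * L))) + (Re h *\<^sub>R (?A * L)) * ?B)) (at w)"
      by (rule has_derivative_mult[OF R I])
    moreover have "?A * (Im h *\<^sub>R (?B * (imunit * L))) + (Re h *\<^sub>R (?A * L)) * ?B
        = ofc h * (L * (?A * ?B))" for h
    proof -
      have "?A * (?B * (imunit * L)) = imunit * (L * (?A * ?B))"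
      proof -
        have "?A * (?B * (imunit * L)) = ?A * imunit * L * ?B" by (simp only: cB mult.assoc)
        also have "\<dots> = imunit * (?A * L) * ?B" by (simp only: cA' mult.assoc)
        finally show ?thesis by (simp only: cA mult.assoc)
      qed
      moreover have "?A * L * ?B = L * (?A * ?B)" by (simp add: cA mult.assoc)
      ultimately show ?thesis by (simp add: ofc_def algebra_simps)
    qed
    ultimately show ?thesis by (simp add: exp_ofc(1))
  qed
  have "((\<lambda>z. c + d * z) has_derivative (\<lambda>h. d * h)) (at z)"
    by (auto intro!: derivative_eq_intros)
  from has_derivative_compose[OF this E]
  show ?thesis by (simp only: ofc_mult mult.assoc mult.commute[of d])
qed

context
  fixes \<beta> :: "'a::op_algebra \<Rightarrow> 'a \<Rightarrow> real"
  assumes bilinear: "bounded_bilinear \<beta>"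
    and imunit_swap: "\<And>y x. \<beta> (imunit * y) x = \<beta> y (imunit * x)"
begin

interpretation bounded_bilinear \<beta> by (rule bilinear)

text \<open>
  \<open>\<beta>\<close> is the real part of a complex bilinear form; this recovers the form.
\<close>

definition cbil :: "'a \<Rightarrow> 'a \<Rightarrow> complex" where
  "cbil y x = Complex (\<beta> y x) (- \<beta> y (imunit * x))"

lemma cbil_ofc_right: "cbil y (ofc c * x) = c * cbil y x"
proof -
  have "imunit * (imunit * x) = - x" by (simp add: imunit_square flip: mult.assoc)
  then show ?thesis
    by (simp add: cbil_def ofc_def complex_eq_iff algebra_simps add_right scaleR_right minus_right diff_right)
qed

lemma cbil_ofc_left: "cbil (ofc c * y) x = c * cbil y x"
proof -
  have "\<beta> (ofc c * y) x = \<beta> y (ofc c * x)" for x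
    by (simp add: ofc_def algebra_simps add_right add_left scaleR_right scaleR_left imunit_swap)
  then have "cbil (ofc c * y) x = cbil y (ofc c * x)"
    by (simp add: cbil_def) (metis mult.assoc ofc_comm)
  then show ?thesis by (simp add: cbil_ofc_right)
qed

text \<open>A unimodular factor \<open>w\<close> rotates the complex value onto the positive axis,
  where it equals its real part; the bound therefore has to be assumed for all rotations of
  \<open>x\<close>.\<close>

lemma cmod_cbil_le:
  assumes "\<And>w. cmod w = 1 \<Longrightarrow> \<beta> y (ofc w * x) \<le> M"
  shows "cmod (cbil y x) \<le> M"
proof (cases "cbil y x = 0")
  case True
  have "\<beta> y x = 0" using True by (simp add: cbil_def complex_eq_iff)
  then show ?thesis using True assms[of 1] by simp
next
  case False
  define w where "w = cnj (cbil y x) / cmod (cbil y x)"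
  have w: "cmod w = 1" using False by (simp add: w_def norm_divide)
  have "w * cbil y x = of_real (cmod (cbil y x))"
    using False by (simp add: w_def mult.commute flip: complex_norm_square) (simp add: power2_eq_square)
  then have "cbil y (ofc w * x) = of_real (cmod (cbil y x))" by (simp add: cbil_ofc_right)
  then have "\<beta> y (ofc w * x) = cmod (cbil y x)" by (simp add: cbil_def complex_eq_iff)
  then show ?thesis using assms[OF w] by simp
qed

lemma cbil_holomorphic:
  assumes Y: "\<And>z. (Y has_derivative (\<lambda>h. ofc h * Y' z)) (at z)"
    and X: "\<And>z. (X has_derivative (\<lambda>h. ofc h * X' z)) (at z)"
  shows "(\<lambda>z. cbil (Y z) (X z)) holomorphic_on UNIV"
proof -
  have "((\<lambda>z. cbil (Y z) (X z)) has_field_derivative (cbil (Y z) (X' z) + cbil (Y' z) (X z))) (at z)" for z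
  proof -
    have X1: "((\<lambda>z. imunit * X z) has_derivative (\<lambda>h. imunit * (ofc h * X' z))) (at z)"
      by (rule has_derivative_mult_right[OF X])
    have "((\<lambda>z. of_real (\<beta> (Y z) (X z)) + \<i> * of_real (- \<beta> (Y z) (imunit * X z))) has_derivative
       (\<lambda>h. of_real (\<beta> (Y z) (ofc h * X' z) + \<beta> (ofc h * Y' z) (X z))
        + \<i> * of_real (- (\<beta> (Y z) (imunit * (ofc h * X' z)) + \<beta> (ofc h * Y' z) (imunit * X z))))) (at z)"
      by (intro has_derivative_add has_derivative_mult_right has_derivative_of_real has_derivative_minus
          FDERIV[OF Y X] FDERIV[OF Y X1])
    moreover have "of_real (\<beta> (Y z) (ofc h * X' z) + \<beta> (ofc h * Y' z) (X z))
        + \<i> * of_real (- (\<beta> (Y z) (imunit * (ofc h * X' z)) + \<beta> (ofc h * Y' z) (imunit * X z)))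
      = (cbil (Y z) (X' z) + cbil (Y' z) (X z)) * h" for h
    proof -
      have "of_real (\<beta> (Y z) (ofc h * X' z) + \<beta> (ofc h * Y' z) (X z))
        + \<i> * of_real (- (\<beta> (Y z) (imunit * (ofc h * X' z)) + \<beta> (ofc h * Y' z) (imunit * X z)))
        = cbil (Y z) (ofc h * X' z) + cbil (ofc h * Y' z) (X z)"
        by (simp add: cbil_def complex_eq_iff)
      then show ?thesis by (simp add: cbil_ofc_left cbil_ofc_right algebra_simps)
    qed
    ultimately show ?thesis
      by (simp add: has_field_derivative_def cbil_def Complex_eq mult_commute_abs)
  qed
  then show ?thesis by (meson holomorphic_onI field_differentiable_def has_field_derivative_at_within)
qed

text \<open>Three lines for an analytic family whose exponents of \<open>K\<close> and
  \<open>L\<close> are affine in \<open>z\<close>. The imaginary parts of the exponents produce only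
  unitaries, which merge with \<open>u\<close> and \<open>v\<close>; hence the boundary hypotheses
  concern arbitrary contractions \<open>U\<close>, \<open>V\<close> but real exponents.\<close>

lemma interpolation_exp:
  assumes L: "star L = L" and K: "star K = K" and u: "norm u \<le> 1" and v: "norm v \<le> 1"
    and t: "0 < t" "t < 1" and M: "0 < M0" "0 < M1"
    and H0: "\<And>U V. norm U \<le> 1 \<Longrightarrow> norm V \<le> 1 \<Longrightarrow> \<bar>\<beta> (exp (k0 *\<^sub>R K) * V) (U * exp (l0 *\<^sub>R L))\<bar> \<le> M0"
    and H1: "\<And>U V. norm U \<le> 1 \<Longrightarrow> norm V \<le> 1 \<Longrightarrow> \<bar>\<beta> (exp (k1 *\<^sub>R K) * V) (U * exp (l1 *\<^sub>R L))\<bar> \<le> M1"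
  shows "\<bar>\<beta> (exp (((1 - t) * k0 + t * k1) *\<^sub>R K) * v) (u * exp (((1 - t) * l0 + t * l1) *\<^sub>R L))\<bar>
    \<le> M0 powr (1 - t) * M1 powr t"
proof -
  define kz where "kz z = of_real k0 + of_real (k1 - k0) * z" for z :: complex
  define lz where "lz z = of_real l0 + of_real (l1 - l0) * z" for z :: complex
  define Y where "Y z = exp (ofc (kz z) * K) * v" for z
  define X where "X z = u * exp (ofc (lz z) * L)" for z
  define F where "F z = cbil (Y z) (X z)" for z
  have "(Y has_derivative (\<lambda>h. ofc h * (ofc (of_real (k1 - k0)) * (K * exp (ofc (kz z) * K)) * v))) (at z)" for z
    using has_derivative_mult_left[OF exp_ofc_has_derivative[of "of_real k0" "of_real (k1 - k0)" K z], of v]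
    unfolding Y_def kz_def by (simp only: mult.assoc)
  moreover have "(X has_derivative (\<lambda>h. ofc h * (u * (ofc (of_real (l1 - l0)) * (L * exp (ofc (lz z) * L)))))) (at z)" for z
  proof -
    have "u * (ofc h * (ofc (of_real (l1 - l0)) * (L * exp (ofc (lz z) * L))))
      = ofc h * (u * (ofc (of_real (l1 - l0)) * (L * exp (ofc (lz z) * L))))" for h
      using ofc_comm[of h u] by (simp only: mult.assoc[symmetric])
    then show ?thesis
      using has_derivative_mult_right[OF exp_ofc_has_derivative[of "of_real l0" "of_real (l1 - l0)" L z], of u]
      unfolding X_def lz_def by (simp only:)
  qed
  ultimately have hol: "F holomorphic_on UNIV" unfolding F_def by (rule cbil_holomorphic)
  have Rek: "Re (kz z) = k0 + (k1 - k0) * Re z" and Rel: "Re (lz z) = l0 + (l1 - l0) * Re z" for z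
    by (simp_all add: kz_def lz_def)
  have bound: "cmod (F z) \<le> M"
    if H: "\<And>U V. norm U \<le> 1 \<Longrightarrow> norm V \<le> 1 \<Longrightarrow>
        \<bar>\<beta> (exp (Re (kz z) *\<^sub>R K) * V) (U * exp (Re (lz z) *\<^sub>R L))\<bar> \<le> M" for z M
    unfolding F_def
  proof (rule cmod_cbil_le)
    fix w :: complex assume w: "cmod w = 1"
    let ?V = "exp (Im (kz z) *\<^sub>R (imunit * K)) * v" and ?U = "ofc w * u * exp (Im (lz z) *\<^sub>R (imunit * L))"
    have "norm ?V \<le> 1" using norm_mult_ineq[of "exp (Im (kz z) *\<^sub>R (imunit * K))" v] v
      by (simp add: norm_exp_imunit[OF K])
    moreover have "norm ?U \<le> 1"
      using norm_mult_ineq[of "ofc w * u" "exp (Im (lz z) *\<^sub>R (imunit * L))"] norm_mult_ineq[of "ofc w" u] u w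
      by (simp add: norm_exp_imunit[OF L] norm_ofc)
    ultimately have "\<bar>\<beta> (exp (Re (kz z) *\<^sub>R K) * ?V) (?U * exp (Re (lz z) *\<^sub>R L))\<bar> \<le> M" by (rule H[rotated])
    moreover have "Y z = exp (Re (kz z) *\<^sub>R K) * ?V"
      by (simp only: Y_def exp_ofc(1) mult.assoc)
    moreover have "ofc w * X z = ?U * exp (Re (lz z) *\<^sub>R L)"
      by (simp only: X_def exp_ofc(2) mult.assoc)
    ultimately show "\<beta> (Y z) (ofc w * X z) \<le> M" by simp
  qed
  obtain C where C: "\<And>y x. norm (\<beta> y x) \<le> norm y * norm x * C" and C0: "0 < C"
    using pos_bounded by blast
  have "cmod (F z) \<le> exp ((\<bar>k0\<bar> + \<bar>k1 - k0\<bar>) * norm K) * exp ((\<bar>l0\<bar> + \<bar>l1 - l0\<bar>) * norm L) * C"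
    if z: "0 \<le> Re z" "Re z \<le> 1" for z
  proof (rule bound)
    fix U V :: 'a assume UV: "norm U \<le> 1" "norm V \<le> 1"
    have "\<bar>k0 + (k1 - k0) * Re z\<bar> \<le> \<bar>k0\<bar> + \<bar>k1 - k0\<bar> * \<bar>Re z\<bar>"
      by (metis abs_mult abs_triangle_ineq)
    also have "\<dots> \<le> \<bar>k0\<bar> + \<bar>k1 - k0\<bar> * 1" using z by (intro add_left_mono mult_left_mono) auto
    finally have k: "norm (Re (kz z) *\<^sub>R K) \<le> (\<bar>k0\<bar> + \<bar>k1 - k0\<bar>) * norm K"
      by (simp add: Rek mult_right_mono)
    have "\<bar>l0 + (l1 - l0) * Re z\<bar> \<le> \<bar>l0\<bar> + \<bar>l1 - l0\<bar> * \<bar>Re z\<bar>"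
      by (metis abs_mult abs_triangle_ineq)
    also have "\<dots> \<le> \<bar>l0\<bar> + \<bar>l1 - l0\<bar> * 1" using z by (intro add_left_mono mult_left_mono) auto
    finally have l: "norm (Re (lz z) *\<^sub>R L) \<le> (\<bar>l0\<bar> + \<bar>l1 - l0\<bar>) * norm L"
      by (simp add: Rel mult_right_mono)
    have "norm (exp (Re (kz z) *\<^sub>R K) * V) \<le> exp ((\<bar>k0\<bar> + \<bar>k1 - k0\<bar>) * norm K) * 1"
      using UV order_trans[OF norm_exp exp_le_cancel_iff[THEN iffD2, OF k]]
      by (intro order_trans[OF norm_mult_ineq] mult_mono) auto
    moreover have "norm (U * exp (Re (lz z) *\<^sub>R L)) \<le> 1 * exp ((\<bar>l0\<bar> + \<bar>l1 - l0\<bar>) * norm L)"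
      using UV order_trans[OF norm_exp exp_le_cancel_iff[THEN iffD2, OF l]]
      by (intro order_trans[OF norm_mult_ineq] mult_mono) auto
    ultimately have "norm (exp (Re (kz z) *\<^sub>R K) * V) * norm (U * exp (Re (lz z) *\<^sub>R L)) * C
      \<le> exp ((\<bar>k0\<bar> + \<bar>k1 - k0\<bar>) * norm K) * exp ((\<bar>l0\<bar> + \<bar>l1 - l0\<bar>) * norm L) * C"
      using C0 by (intro mult_right_mono mult_mono) auto
    then show "\<bar>\<beta> (exp (Re (kz z) *\<^sub>R K) * V) (U * exp (Re (lz z) *\<^sub>R L))\<bar>
      \<le> exp ((\<bar>k0\<bar> + \<bar>k1 - k0\<bar>) * norm K) * exp ((\<bar>l0\<bar> + \<bar>l1 - l0\<bar>) * norm L) * C"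
      using C[of "exp (Re (kz z) *\<^sub>R K) * V" "U * exp (Re (lz z) *\<^sub>R L)"] by simp
  qed
  then have "cmod (F (of_real t)) \<le> M0 powr (1 - t) * M1 powr t"
    by (rule three_lines[OF hol M]) (auto intro!: bound H0 H1 simp: Rek Rel t)
  moreover have "\<bar>\<beta> (Y (of_real t)) (X (of_real t))\<bar> \<le> cmod (F (of_real t))"
    using abs_Re_le_cmod[of "F (of_real t)"] by (simp add: F_def cbil_def)
  moreover have "kz (of_real t) = of_real ((1 - t) * k0 + t * k1)" "lz (of_real t) = of_real ((1 - t) * l0 + t * l1)"
    by (simp_all add: kz_def lz_def algebra_simps)
  then have "Y (of_real t) = exp (((1 - t) * k0 + t * k1) *\<^sub>R K) * v"
    "X (of_real t) = u * exp (((1 - t) * l0 + t * l1) *\<^sub>R L)"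
    by (simp_all only: Y_def X_def ofc_of_real mult_scaleR_left mult_1_left)
  ultimately show ?thesis by simp
qed

end

section \<open>Tracial states\<close>

lemma continuous_on_powr_nonneg: "0 < r \<Longrightarrow> continuous_on {0..} (\<lambda>t :: real. t powr r)"
  by (intro continuous_on_powr' continuous_intros) auto

lemma continuous_on_shift_powr: "0 < e \<Longrightarrow> continuous_on {0..} (\<lambda>t :: real. (t + e) powr r)"
  by (intro continuous_on_powr continuous_intros) auto

text \<open>The shift by \<open>e\<close> keeps the logarithm finite at 0.\<close>

lemma exp_fc_ln:
  fixes a :: "'a::op_algebra"
  assumes a: "psd a" and e: "0 < e"
  shows "exp (s *\<^sub>R fc (\<lambda>t. c * ln (t + e)) a) = fc (\<lambda>t. (t + e) powr (s * c)) a"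
proof -
  have ln: "continuous_on {0..} (\<lambda>t. c * ln (t + e))" using e by (intro continuous_intros) auto
  have ln': "continuous_on {0..} (\<lambda>t. s * (c * ln (t + e)))" by (intro continuous_intros ln)
  have "exp (s *\<^sub>R fc (\<lambda>t. c * ln (t + e)) a) = fc (\<lambda>t. exp (s * (c * ln (t + e)))) a"
    unfolding fc_scale[OF a ln, symmetric] by (rule exp_fc[OF a ln'])
  also have "\<dots> = fc (\<lambda>t. (t + e) powr (s * c)) a"
    by (rule fc_cong) (use e in \<open>simp add: powr_def mult.assoc\<close>)
  finally show ?thesis .
qed

definition eps :: "nat \<Rightarrow> real" where "eps n = inverse (real (Suc n))"

lemma eps_pos [simp]: "0 < eps n" and eps_le_1: "eps n \<le> 1" and eps_tendsto: "eps \<longlonglongrightarrow> 0"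
  using LIMSEQ_inverse_real_of_nat by (simp_all add: eps_def[abs_def] field_simps)

lemma fc_shift_tendsto:
  fixes a :: "'a::op_algebra"
  assumes a: "psd a" and G: "continuous_on {0..} G"
  shows "(\<lambda>n. fc (\<lambda>t. G (t + eps n)) a) \<longlonglongrightarrow> fc G a"
proof (rule fc_tendsto[OF a G])
  show "continuous_on {0..} (\<lambda>t. G (t + eps n))" for n
    by (rule continuous_on_compose2[OF G]) (auto intro!: continuous_intros add_nonneg_nonneg simp: less_imp_le)
  let ?U = "{0..norm a + 1}"
  have "uniform_limit {0..norm a} (\<lambda>n t. t + eps n) (\<lambda>t. t + 0) sequentially"
  proof (rule uniform_limit_add[OF uniform_limit_const])
    show "uniform_limit {0..norm a} (\<lambda>n t. eps n) (\<lambda>t. 0) sequentially"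
      by (rule uniform_limitI) (use tendstoD[OF eps_tendsto] in \<open>auto elim: eventually_mono\<close>)
  qed
  then have "uniform_limit {0..norm a} (\<lambda>n t. G (t + eps n)) (G \<circ> (\<lambda>t. t + 0)) sequentially"
  proof (rule uniform_limit_compose)
    show "uniformly_continuous_on ?U G"
      by (rule compact_uniformly_continuous[OF continuous_on_subset[OF G]]) auto
    show "\<forall>\<^sub>F n in sequentially. (\<lambda>t. t + eps n) ` {0..norm a} \<subseteq> ?U"
      using eps_le_1 eps_pos by (auto intro!: always_eventually add_nonneg_nonneg add_mono simp: less_imp_le)
  qed auto
  then show "uniform_limit {0..norm a} (\<lambda>n t. G (t + eps n)) G sequentially" by (simp add: o_def)
qed

definition conjugate :: "real \<Rightarrow> real \<Rightarrow> bool" where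
  "conjugate p q \<longleftrightarrow> 1 < p \<and> 1 < q \<and> 1 / p + 1 / q = 1"

lemma conjugate_sym: "conjugate p q \<Longrightarrow> conjugate q p"
  by (auto simp: conjugate_def)

lemma conjugateD:
  assumes "conjugate p q"
  shows "1 < p" "1 < q" "0 < p" "0 < q" "1 / p + 1 / q = 1" "1 - 1 / p = 1 / q" "p + q = p * q"
    "(p - 1) * q = p"
proof -
  show *: "1 < p" "1 < q" "0 < p" "0 < q" "1 / p + 1 / q = 1" "1 - 1 / p = 1 / q"
    using assms by (auto simp: conjugate_def)
  have "p * q * (1 / p + 1 / q) = p + q" using * by (simp add: field_simps)
  then show "p + q = p * q" using * by simp
  then show "(p - 1) * q = p" by (simp add: algebra_simps)
qed

lemma conjugate_exists: "1 < p \<Longrightarrow> conjugate p (p / (p - 1))"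
  by (simp add: conjugate_def field_simps)

locale tracial =
  fixes tr :: "'a::op_algebra \<Rightarrow> real"
  assumes bounded_linear_tr: "bounded_linear tr"
    and tr_comm: "tr (x * y) = tr (y * x)"
    and tr_star: "tr (star x) = tr x"
    and tr_nonneg: "psd a \<Longrightarrow> 0 \<le> tr a"
    and tr_one: "tr 1 = 1"
begin

sublocale tr: bounded_linear tr by (rule bounded_linear_tr)

lemma tr_mono: "psd (b - a) \<Longrightarrow> tr a \<le> tr b"
  using tr_nonneg[of "b - a"] by (simp add: tr.diff)

lemma tr_fc_mono:
  assumes "psd a" "continuous_on {0..} f" "continuous_on {0..} g"
    and "\<And>t. 0 \<le> t \<Longrightarrow> t \<le> norm a \<Longrightarrow> f t \<le> g t"
  shows "tr (fc f a) \<le> tr (fc g a)"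
  using psd_fc[OF assms(1), of "\<lambda>t. g t - f t"] assms
  by (intro tr_mono) (simp add: fc_diff[OF assms(1,3,2)] continuous_on_diff)

lemma tr_fc_ge:
  assumes "psd a" "continuous_on {0..} f" "\<And>t. 0 \<le> t \<Longrightarrow> t \<le> norm a \<Longrightarrow> c \<le> f t"
  shows "c \<le> tr (fc f a)"
  using tr_fc_mono[OF assms(1) continuous_on_const assms(2), of c] assms(3)
  by (simp add: fc_const[OF assms(1)] tr.scaleR tr_one)

lemma tr_Cauchy_Schwarz: "\<bar>tr (x * y)\<bar> \<le> sqrt (tr (x * star x)) * sqrt (tr (star y * y))"
proof -
  let ?A = "tr (x * star x)" and ?B = "tr (x * y)" and ?C = "tr (star y * y)"
  have A: "0 \<le> ?A" using tr_nonneg[OF psd_square[of "star x"]] by (simp add: star_star)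
  have C: "0 \<le> ?C" by (intro tr_nonneg psd_square)
  have q: "0 \<le> ?A + 2 * t * ?B + t\<^sup>2 * ?C" for t
  proof -
    have "star (star x + t *\<^sub>R y) * (star x + t *\<^sub>R y)
      = x * star x + t *\<^sub>R (x * y) + t *\<^sub>R star (x * y) + t\<^sup>2 *\<^sub>R (star y * y)"
      by (simp add: star_add star_scaleR star_star star_mult algebra_simps power2_eq_square)
    then show ?thesis using tr_nonneg[OF psd_square[of "star x + t *\<^sub>R y"]]
      by (simp add: tr.add tr.scaleR tr_star)
  qed
  have "?B\<^sup>2 \<le> ?A * ?C"
  proof (cases "?C = 0")
    case True
    have "?B = 0"
    proof (rule ccontr)
      assume "?B \<noteq> 0"
      \<comment> \<open>At this \<open>t\<close> the quadratic polynomial without leading term takes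
        the value -1.\<close>
      then show False using q[of "- (?A + 1) / (2 * ?B)"] True A by (simp add: field_simps)
    qed
    then show ?thesis using True by simp
  next
    case False
    then show ?thesis using q[of "- ?B / ?C"] C
      by (simp add: power2_eq_square field_simps)
  qed
  then have "\<bar>?B\<bar> \<le> sqrt (?A * ?C)" by (intro real_le_rsqrt) simp
  then show ?thesis by (simp add: real_sqrt_mult)
qed

lemma psd_norm_square: "psd ((norm x)\<^sup>2 *\<^sub>R 1 - star x * x)"
  using psd_norm_diff[of "star x * x"] by (simp add: star_mult star_star norm_star_mult power2_eq_square)

lemma sqrt_psd:
  assumes "psd (a :: 'a)"
  obtains c where "star c = c" "c * c = a"
proof -
  have s: "continuous_on {0..} sqrt" by (intro continuous_intros)
  have "fc sqrt a * fc sqrt a = fc (\<lambda>t. sqrt t * sqrt t) a" using fc_mult[OF assms s s] by simp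
  also have "\<dots> = fc (\<lambda>t. t) a" by (rule fc_cong) simp
  finally show thesis using that star_fc[OF assms s] fc_id[OF assms] by simp
qed

lemma tr_conj_nonneg: "psd a \<Longrightarrow> 0 \<le> tr (star x * a * x)"
  by (intro tr_nonneg psd_conj)

lemma tr_psd_mult_nonneg: "psd a \<Longrightarrow> psd b \<Longrightarrow> 0 \<le> tr (a * b)"
proof -
  assume a: "psd a" and b: "psd b"
  obtain c where c: "star c = c" "c * c = b" using sqrt_psd[OF b] .
  have "tr (a * b) = tr (star c * a * c)" using tr_comm[of "a * c" c] c by (simp add: mult.assoc)
  then show ?thesis using tr_conj_nonneg[OF a] by simp
qed

text \<open>The endpoint case (exponents 1 and infinity) of Hoelder's inequality: split
  \<open>a = c * c\<close> and apply Cauchy-Schwarz to \<open>c\<close> and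
  \<open>c * x\<close>.\<close>

lemma tr_psd_mult_le:
  assumes a: "psd a"
  shows "\<bar>tr (a * x)\<bar> \<le> tr a * norm x"
proof -
  obtain c where c: "star c = c" "c * c = a" using sqrt_psd[OF a] .
  have "\<bar>tr (a * x)\<bar> \<le> sqrt (tr (c * star c)) * sqrt (tr (star (c * x) * (c * x)))"
    using tr_Cauchy_Schwarz[of c "c * x"] by (simp add: c(2)[symmetric] mult.assoc)
  also have "tr (star (c * x) * (c * x)) = tr (a * (x * star x))"
  proof -
    have "star (c * x) * (c * x) = star x * (a * x)"
      unfolding c(2)[symmetric] by (simp add: star_mult c(1) mult.assoc)
    then show ?thesis using tr_comm[of "star x" "a * x"] by (simp add: mult.assoc)
  qed
  also have "\<dots> \<le> tr (a * ((norm x)\<^sup>2 *\<^sub>R 1))"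
    using tr_psd_mult_nonneg[OF a psd_norm_square[of "star x"]]
    by (simp add: star_star algebra_simps tr.diff)
  also have "\<dots> = (norm x)\<^sup>2 * tr a" by (simp add: tr.scaleR)
  finally have "\<bar>tr (a * x)\<bar> \<le> sqrt (tr a) * sqrt ((norm x)\<^sup>2 * tr a)"
    unfolding c by (simp add: mult_left_mono tr_nonneg[OF a])
  also have "\<dots> = tr a * norm x" using tr_nonneg[OF a] by (simp add: real_sqrt_mult)
  finally show ?thesis .
qed

lemma bounded_bilinear_tr: "bounded_bilinear (\<lambda>y x. tr (y * x))"
proof -
  obtain K where K: "\<And>x. norm (tr x) \<le> norm x * K" "0 \<le> K"
    using tr.nonneg_bounded by blast
  show ?thesis
  proof
    show "\<exists>K. \<forall>a b. norm (tr (a * b)) \<le> norm a * norm b * K"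
    proof (intro exI allI)
      fix a b
      show "norm (tr (a * b)) \<le> norm a * norm b * K"
        using K(1)[of "a * b"] mult_right_mono[OF norm_mult_ineq K(2)] order_trans by blast
    qed
  qed (simp_all add: algebra_simps tr.add tr.scaleR)
qed

subsection \<open>Hoelder's inequality for positive elements\<close>

lemma tr_fc_shift_pos:
  assumes "psd a" "0 < e"
  shows "0 < tr (fc (\<lambda>t. (t + e) powr r) a)"
proof -
  have "min (e powr r) ((norm a + e) powr r) \<le> tr (fc (\<lambda>t. (t + e) powr r) a)"
  proof (rule tr_fc_ge[OF assms(1) continuous_on_shift_powr[OF assms(2)]])
    fix t assume t: "0 \<le> t" "t \<le> norm a"
    show "min (e powr r) ((norm a + e) powr r) \<le> (t + e) powr r"
    proof (cases "0 \<le> r")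
      case True
      then show ?thesis using powr_mono2[of r e "t + e"] t assms(2) by simp
    next
      case False
      then show ?thesis using powr_mono2'[of r "t + e" "norm a + e"] t assms(2) by simp
    qed
  qed
  moreover have "0 < min (e powr r) ((norm a + e) powr r)"
    using assms(2) add_nonneg_pos[OF norm_ge_zero assms(2), of a] by simp
  ultimately show ?thesis by linarith
qed

text \<open>Complex interpolation between two trivial estimates. The exponents of
  \<open>b + e\<close> and \<open>a + e\<close> run from \<open>(q, 0)\<close> to
  \<open>(0, p)\<close> and pass through \<open>(1, 1)\<close> at \<open>1 / p\<close>; at both ends
  one factor is a contraction and \<open>tr_psd_mult_le\<close> applies.\<close>

lemma Hoelder_shift:
  assumes a: "psd a" and b: "psd b" and e: "0 < e" and pq: "conjugate p q"
  shows "\<bar>tr (fc (\<lambda>t. t + e) b * fc (\<lambda>t. t + e) a)\<bar>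
    \<le> tr (fc (\<lambda>t. (t + e) powr q) b) powr (1 / q) * tr (fc (\<lambda>t. (t + e) powr p) a) powr (1 / p)"
proof -
  define L where "L = fc (\<lambda>t. 1 * ln (t + e)) a"
  define K where "K = fc (\<lambda>t. 1 * ln (t + e)) b"
  have c: "continuous_on {0..} (\<lambda>t. 1 * ln (t + e))" using e by (intro continuous_intros) auto
  have sL: "star L = L" and sK: "star K = K" unfolding L_def K_def by (intro star_fc a b c)+
  have EL: "exp (s *\<^sub>R L) = fc (\<lambda>t. (t + e) powr s) a" and EK: "exp (s *\<^sub>R K) = fc (\<lambda>t. (t + e) powr s) b" for s
    unfolding L_def K_def using exp_fc_ln[OF _ e, of _ s 1] a b by simp_all
  have E1: "exp L = fc (\<lambda>t. t + e) a" "exp K = fc (\<lambda>t. t + e) b"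
    using EL[of 1] EK[of 1] e by (auto intro: fc_cong)
  have psd: "psd (exp (s *\<^sub>R L))" "psd (exp (s *\<^sub>R K))" for s
    unfolding EL EK by (intro psd_fc a b continuous_on_shift_powr e; simp)+
  let ?M0 = "tr (exp (q *\<^sub>R K))" and ?M1 = "tr (exp (p *\<^sub>R L))"
  have M: "0 < ?M0" "0 < ?M1" unfolding EL EK by (intro tr_fc_shift_pos a b e)+
  have "\<bar>tr (exp (((1 - 1 / p) * q + 1 / p * 0) *\<^sub>R K) * 1 * (1 * exp (((1 - 1 / p) * 0 + 1 / p * p) *\<^sub>R L)))\<bar>
    \<le> ?M0 powr (1 - 1 / p) * ?M1 powr (1 / p)"
  proof (rule interpolation_exp[where \<beta> = "\<lambda>y x. tr (y * x)"])
    show "bounded_bilinear (\<lambda>y x. tr (y * x))" by (rule bounded_bilinear_tr)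
    show "tr (imunit * y * x) = tr (y * (imunit * x))" for y x
      by (simp add: imunit_comm[of y] mult.assoc)
    fix U V :: 'a assume UV: "norm U \<le> 1" "norm V \<le> 1"
    have n: "norm (V * U) \<le> 1"
      using norm_mult_ineq[of V U] mult_mono[OF UV(2,1)] by simp
    have "\<bar>tr (exp (q *\<^sub>R K) * (V * U))\<bar> \<le> ?M0 * 1"
      using tr_psd_mult_le[OF psd(2)] mult_left_mono[OF n less_imp_le[OF M(1)]] order_trans by blast
    then show "\<bar>tr (exp (q *\<^sub>R K) * V * (U * exp (0 *\<^sub>R L)))\<bar> \<le> ?M0" by (simp add: mult.assoc)
    have "\<bar>tr (exp (p *\<^sub>R L) * (V * U))\<bar> \<le> ?M1 * 1"
      using tr_psd_mult_le[OF psd(1)] mult_left_mono[OF n less_imp_le[OF M(2)]] order_trans by blast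
    then show "\<bar>tr (exp (0 *\<^sub>R K) * V * (U * exp (p *\<^sub>R L)))\<bar> \<le> ?M1"
      using tr_comm[of "exp (p *\<^sub>R L)" "V * U"] by (simp add: mult.assoc)
  qed (use conjugateD(1,3)[OF pq] sL sK M in auto)
  moreover have "1 - 1 / p = 1 / q" "(1 - 1 / p) * q = 1" "1 / p * p = 1"
    using conjugateD(3,4,6)[OF pq] by auto
  ultimately show ?thesis by (simp only: EL[symmetric] EK[symmetric] E1[symmetric]) simp
qed

lemma tr_fc_shift_tendsto:
  assumes "psd a" "0 < r"
  shows "(\<lambda>n. tr (fc (\<lambda>t. (t + eps n) powr r) a)) \<longlonglongrightarrow> tr (fc (\<lambda>t. t powr r) a)"
  by (intro tr.tendsto fc_shift_tendsto[of a "\<lambda>t. t powr r"] assms continuous_on_powr_nonneg)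

lemma fc_powr_one: "psd a \<Longrightarrow> fc (\<lambda>t. t powr 1) a = (a :: 'a)"
  using fc_cong[of a "\<lambda>t. t powr 1" "\<lambda>t. t"] fc_id[of a] by simp

lemma tr_fc_powr_nonneg: "psd a \<Longrightarrow> 0 < r \<Longrightarrow> 0 \<le> tr (fc (\<lambda>t. t powr r) a)"
  by (intro tr_nonneg psd_fc continuous_on_powr_nonneg) auto

lemma Hoelder_psd:
  assumes a: "psd a" and b: "psd b" and pq: "conjugate p q"
  shows "tr (a * b) \<le> tr (fc (\<lambda>t. t powr p) a) powr (1 / p) * tr (fc (\<lambda>t. t powr q) b) powr (1 / q)"
proof -
  note pq' = conjugateD(3,4)[OF pq]
  have l1: "(\<lambda>n. tr (fc (\<lambda>t. t + eps n) b * fc (\<lambda>t. t + eps n) a)) \<longlonglongrightarrow> tr (fc (\<lambda>t. t) b * fc (\<lambda>t. t) a)"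
    by (intro tr.tendsto tendsto_mult fc_shift_tendsto[of _ "\<lambda>t. t"] a b continuous_on_id)
  have l2: "(\<lambda>n. tr (fc (\<lambda>t. (t + eps n) powr q) b) powr (1 / q) * tr (fc (\<lambda>t. (t + eps n) powr p) a) powr (1 / p))
      \<longlonglongrightarrow> tr (fc (\<lambda>t. t powr q) b) powr (1 / q) * tr (fc (\<lambda>t. t powr p) a) powr (1 / p)"
    using pq' by (intro tendsto_mult tendsto_powr' tr_fc_shift_tendsto a b tendsto_const)
      (auto intro!: disjI2 always_eventually less_imp_le[OF tr_fc_shift_pos] a b)
  have le: "tr (fc (\<lambda>t. t + eps n) b * fc (\<lambda>t. t + eps n) a) \<le>
      tr (fc (\<lambda>t. (t + eps n) powr q) b) powr (1 / q) * tr (fc (\<lambda>t. (t + eps n) powr p) a) powr (1 / p)" for n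
    using abs_le_D1[OF Hoelder_shift[OF a b eps_pos pq]] .
  have "tr (fc (\<lambda>t. t) b * fc (\<lambda>t. t) a) \<le>
      tr (fc (\<lambda>t. t powr q) b) powr (1 / q) * tr (fc (\<lambda>t. t powr p) a) powr (1 / p)"
    by (rule LIMSEQ_le[OF l1 l2]) (intro exI allI impI le)
  then show ?thesis using tr_comm[of b a] by (simp add: fc_id a b mult.commute)
qed

end

section \<open>Noncommutative \<open>L\<^sub>p\<close>-norms\<close>

text \<open>
  \<open>reg_powr e s x\<close> is \<open>(x\<^sup>* x + e)\<^sup>s\<close>. For \<open>e > 0\<close> it is invertible, and \<open>polar e x\<close> replaces the polar part
  of \<open>x\<close>, which need not lie in the algebra.
\<close>

definition reg_powr :: "real \<Rightarrow> real \<Rightarrow> 'a::op_algebra \<Rightarrow> 'a" where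
  "reg_powr e s x = fc (\<lambda>t. (t + e) powr s) (star x * x)"

definition polar :: "real \<Rightarrow> 'a::op_algebra \<Rightarrow> 'a" where
  "polar e x = x * reg_powr e (- (1 / 2)) x"

context
  fixes e :: real
  assumes e: "0 < e"
begin

lemma reg_powr_mult: "reg_powr e s x * reg_powr e r x = reg_powr e (s + r) (x :: 'a::op_algebra)"
  unfolding reg_powr_def powr_add
  by (rule fc_mult[OF psd_square continuous_on_shift_powr[OF e] continuous_on_shift_powr[OF e], symmetric])

lemma reg_powr_0: "reg_powr e 0 x = (1 :: 'a::op_algebra)"
proof -
  have "reg_powr e 0 x = fc (\<lambda>_. 1) (star x * x)"
    unfolding reg_powr_def by (rule fc_cong) (use e in simp)
  then show ?thesis by (simp add: fc_const[OF psd_square])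
qed

lemma star_reg_powr: "star (reg_powr e s x) = reg_powr e s (x :: 'a::op_algebra)"
  unfolding reg_powr_def by (rule star_fc[OF psd_square continuous_on_shift_powr[OF e]])

lemma psd_reg_powr: "psd (reg_powr e s (x :: 'a::op_algebra))"
  unfolding reg_powr_def by (rule psd_fc[OF psd_square continuous_on_shift_powr[OF e]]) simp

lemma fc_reg_powr: "0 < r \<Longrightarrow> fc (\<lambda>t. t powr r) (reg_powr e s x) = reg_powr e (s * r) (x :: 'a::op_algebra)"
  unfolding reg_powr_def
  by (subst fc_compose[OF psd_square continuous_on_shift_powr[OF e] _ continuous_on_powr_nonneg])
    (simp_all add: powr_powr)

lemma polar_mult: "polar e x * reg_powr e (1 / 2) x = (x :: 'a::op_algebra)"
  by (simp add: polar_def mult.assoc reg_powr_mult reg_powr_0)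

text \<open>\<open>star (polar e x) * polar e x\<close> is the function \<open>t / (t + e)\<close>
  of \<open>star x * x\<close>.\<close>

lemma norm_polar_le: "norm (polar e (x :: 'a::op_algebra)) \<le> 1"
proof -
  have c: "continuous_on {0..} (\<lambda>t :: real. t * (t + e) powr (- 1))"
    by (intro continuous_on_mult continuous_on_shift_powr e continuous_on_id)
  have "star (polar e x) * polar e x = reg_powr e (- (1 / 2)) x * ((star x * x) * reg_powr e (- (1 / 2)) x)"
    by (simp add: polar_def star_mult star_reg_powr mult.assoc)
  also have "(star x * x) * reg_powr e (- (1 / 2)) x = reg_powr e (- (1 / 2)) x * (star x * x)"
    unfolding reg_powr_def
    by (rule fc_intertwine[OF psd_square psd_square continuous_on_shift_powr[OF e], symmetric]) simp
  also have "reg_powr e (- (1 / 2)) x * (reg_powr e (- (1 / 2)) x * (star x * x)) = reg_powr e (- 1) x * (star x * x)"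
    by (simp only: mult.assoc[symmetric] reg_powr_mult) simp
  also have "\<dots> = fc (\<lambda>t. t) (star x * x) * fc (\<lambda>t. (t + e) powr (- 1)) (star x * x)"
    unfolding reg_powr_def fc_id[OF psd_square]
    by (rule fc_intertwine[OF psd_square psd_square continuous_on_shift_powr[OF e]]) simp
  also have "\<dots> = fc (\<lambda>t. t * (t + e) powr (- 1)) (star x * x)"
    by (rule fc_mult[OF psd_square continuous_on_id continuous_on_shift_powr[OF e], symmetric])
  finally have "norm (star (polar e x) * polar e x) \<le> 1"
    using e by (simp only:) (rule norm_fc_le[OF psd_square c], simp add: powr_minus field_simps abs_mult)
  then have "(norm (polar e x))\<^sup>2 \<le> 1" by (simp add: norm_star_mult power2_eq_square)
  then show ?thesis by (simp add: power_le_one_iff abs_square_le_1)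
qed

text \<open>Regularised form of the fact that the polar part of \<open>x\<close> conjugates the
  absolute value of \<open>x\<close> into that of \<open>star x\<close>.\<close>

lemma polar_conj: "polar e x * reg_powr e (1 / 2) x * star (polar e x)
    = fc (\<lambda>t. t * (t + e) powr (- (1 / 2))) (x * star (x :: 'a::op_algebra))"
proof -
  have psd: "psd (x * star x)" using psd_square[of "star x"] by (simp add: star_star)
  have "polar e x * reg_powr e (1 / 2) x * star (polar e x) = x * reg_powr e (- (1 / 2)) x * star x"
    unfolding polar_mult by (simp add: polar_def star_mult star_reg_powr mult.assoc)
  also have "x * reg_powr e (- (1 / 2)) x = fc (\<lambda>t. (t + e) powr (- (1 / 2))) (x * star x) * x"
    unfolding reg_powr_def
    by (rule fc_intertwine[OF psd psd_square continuous_on_shift_powr[OF e], symmetric]) (simp add: mult.assoc)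
  also have "\<dots> * star x = fc (\<lambda>t. (t + e) powr (- (1 / 2))) (x * star x) * fc (\<lambda>t. t) (x * star x)"
    by (simp add: fc_id[OF psd] mult.assoc)
  also have "\<dots> = fc (\<lambda>t. (t + e) powr (- (1 / 2)) * t) (x * star x)"
    by (rule fc_mult[OF psd continuous_on_shift_powr[OF e] continuous_on_id, symmetric])
  finally show ?thesis by (simp add: mult.commute)
qed

end

context tracial
begin

definition pn :: "real \<Rightarrow> 'a \<Rightarrow> real" where
  "pn p x = tr (fc (\<lambda>t. t powr (p / 2)) (star x * x)) powr (1 / p)"

lemma pn_nonneg [simp]: "0 \<le> pn p x"
  by (simp add: pn_def)

lemma pn_powr: "0 < p \<Longrightarrow> pn p x powr p = tr (fc (\<lambda>t. t powr (p / 2)) (star x * x))"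
  using tr_fc_powr_nonneg[OF psd_square, of "p / 2" x] by (simp add: pn_def powr_powr)

lemma tr_ev_star: "tr (ev q (x * star x)) = tr (ev q (star x * x))"
proof -
  have "tr ((x * star x) ^ n) = tr ((star x * x) ^ n)" for n
  proof (cases n)
    case (Suc m)
    have "(x * star x) ^ Suc m = x * ((star x * x) ^ m * star x)"
      by (induction m) (simp_all add: mult.assoc power_commutes)
    then have "tr ((x * star x) ^ Suc m) = tr ((star x * x) ^ m * star x * x)"
      by (metis tr_comm)
    then show ?thesis using Suc by (simp add: mult.assoc power_commutes)
  qed simp
  then show ?thesis by (simp add: ev_def tr.sum tr.scaleR)
qed

text \<open>For powers this is the cyclicity of the trace; a common sequence of polynomials does the
  rest.\<close>

lemma tr_fc_star:
  assumes f: "continuous_on {0..} f"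
  shows "tr (fc f (x * star x)) = tr (fc f (star x * x))"
proof -
  have psd: "psd (x * star x)" using psd_square[of "star x"] by (simp add: star_star)
  define M where "M = max (norm (x * star x)) (norm (star x * x))"
  obtain q where q: "\<forall>a :: 'a. psd a \<longrightarrow> norm a \<le> M \<longrightarrow> (\<lambda>n. ev (q n) a) \<longlonglongrightarrow> fc f a"
    by (rule fc_approx[OF f, where M = M]) blast
  have "(\<lambda>n. tr (ev (q n) (x * star x))) \<longlonglongrightarrow> tr (fc f (x * star x))"
    by (rule tr.tendsto) (rule q[rule_format, OF psd], simp add: M_def)
  moreover have "(\<lambda>n. tr (ev (q n) (star x * x))) \<longlonglongrightarrow> tr (fc f (star x * x))"
    by (rule tr.tendsto) (rule q[rule_format, OF psd_square], simp add: M_def)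
  ultimately show ?thesis using LIMSEQ_unique by (simp add: tr_ev_star)
qed

lemma pn_star: "0 < p \<Longrightarrow> pn p (star x) = pn p x"
  by (simp add: pn_def star_star tr_fc_star continuous_on_powr_nonneg)

lemma tr_reg_powr_pos: "0 < e \<Longrightarrow> 0 < tr (reg_powr e s x)"
  unfolding reg_powr_def by (rule tr_fc_shift_pos[OF psd_square])

lemma tr_reg_powr_tendsto:
  assumes "0 < p"
  shows "(\<lambda>n. tr (reg_powr (eps n) (p / 2) x) powr (1 / p)) \<longlonglongrightarrow> pn p x"
  unfolding reg_powr_def pn_def using assms
  by (intro tendsto_powr' tr_fc_shift_tendsto psd_square tendsto_const)
    (auto intro!: disjI2 always_eventually less_imp_le[OF tr_fc_shift_pos] psd_square)

text \<open>The function in \<open>polar_conj\<close> lies below the square root, so the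
  regularisation can only decrease the trace. The bound thus holds for every \<open>e\<close> and
  needs no limit.\<close>

lemma tr_fc_polar_conj_le:
  assumes e: "0 < e" and p: "0 < p"
  shows "tr (fc (\<lambda>t. t powr p) (polar e x * reg_powr e (1 / 2) x * star (polar e x))) powr (1 / p) \<le> pn p x"
proof -
  have psd: "psd (x * star x)" using psd_square[of "star x"] by (simp add: star_star)
  have c: "continuous_on {0..} (\<lambda>t :: real. t * (t + e) powr (- (1 / 2)))"
    by (intro continuous_on_mult continuous_on_shift_powr e continuous_on_id)
  have c': "continuous_on {0..} (\<lambda>t :: real. (t * (t + e) powr (- (1 / 2))) powr p)"
    using p by (intro continuous_on_powr' c continuous_on_const) (auto simp: e)
  have "tr (fc (\<lambda>t. t powr p) (polar e x * reg_powr e (1 / 2) x * star (polar e x)))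
    = tr (fc (\<lambda>t. (t * (t + e) powr (- (1 / 2))) powr p) (x * star x))"
    unfolding polar_conj[OF e]
    by (subst fc_compose[OF psd c _ continuous_on_powr_nonneg[OF p]]) auto
  also have "\<dots> \<le> tr (fc (\<lambda>t. t powr (p / 2)) (x * star x))"
  proof (rule tr_fc_mono[OF psd c'])
    show "continuous_on {0..} (\<lambda>t :: real. t powr (p / 2))" using p by (simp add: continuous_on_powr_nonneg)
    fix t :: real assume t: "0 \<le> t"
    show "(t * (t + e) powr (- (1 / 2))) powr p \<le> t powr (p / 2)"
    proof (cases "t = 0")
      case False
      have "t * (t + e) powr (- (1 / 2)) \<le> t * t powr (- (1 / 2))"
        using t False e by (intro mult_left_mono powr_mono2') auto
      also have "\<dots> = t powr (1 / 2)" using t False powr_add[of t 1 "- (1 / 2)"] by simp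
      finally have "(t * (t + e) powr (- (1 / 2))) powr p \<le> (t powr (1 / 2)) powr p"
        using t p by (intro powr_mono2) auto
      then show ?thesis by (simp add: powr_powr)
    qed simp
  qed
  also have "\<dots> = tr (fc (\<lambda>t. t powr (p / 2)) (star x * x))"
    using p by (simp add: tr_fc_star continuous_on_powr_nonneg)
  finally show ?thesis unfolding pn_def using p
    by (intro powr_mono2 tr_fc_powr_nonneg) (auto simp: polar_conj[OF e] intro!: psd_fc psd c)
qed

lemma tr_polar_conj_mult_le:
  assumes e: "0 < e" and pq: "conjugate p q" and a: "psd a"
  shows "tr (a * (polar e x * reg_powr e (1 / 2) x * star (polar e x))) \<le> tr (fc (\<lambda>t. t powr q) a) powr (1 / q) * pn p x"
proof -
  have psd: "psd (polar e x * reg_powr e (1 / 2) x * star (polar e x))"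
    using psd_conj[OF psd_reg_powr[OF e], of "star (polar e x)" "1 / 2" x] by (simp add: star_star)
  have "tr (a * (polar e x * reg_powr e (1 / 2) x * star (polar e x)))
    \<le> tr (fc (\<lambda>t. t powr q) a) powr (1 / q) *
       tr (fc (\<lambda>t. t powr p) (polar e x * reg_powr e (1 / 2) x * star (polar e x))) powr (1 / p)"
    by (rule Hoelder_psd[OF a psd conjugate_sym[OF pq]])
  also have "\<dots> \<le> tr (fc (\<lambda>t. t powr q) a) powr (1 / q) * pn p x"
    by (intro mult_left_mono tr_fc_polar_conj_le e conjugateD(3)[OF pq]) simp
  finally show ?thesis .
qed

lemma reg_powr_half_split: "0 < e \<Longrightarrow> reg_powr e (1 / 4) x * reg_powr e (1 / 4) x = reg_powr e (1 / 2) x"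
  by (simp add: reg_powr_mult)

subsection \<open>Hoelder's inequality and duality\<close>

text \<open>
  Write \<open>x = u d\<^sup>2\<close> and \<open>y = v g\<^sup>2\<close> with \<open>d\<close>, \<open>g\<close> positive and invertible. The Cauchy--Schwarz
  inequality for \<open>(g u d) (d v g)\<close> reduces the general case to positive factors.
\<close>

lemma Hoelder:
  assumes pq: "conjugate p q"
  shows "\<bar>tr (x * y)\<bar> \<le> pn p x * pn q y"
proof -
  note pos = conjugateD(3,4)[OF pq]
  define P where "P n = tr (reg_powr (eps n) (p / 2) x) powr (1 / p)" for n
  define Q where "Q n = tr (reg_powr (eps n) (q / 2) y) powr (1 / q)" for n
  \<comment> \<open>Under each root the regularised norm of one factor meets the true norm of the
    other: conjugation by a polar part costs nothing by \<open>tr_fc_polar_conj_le\<close>, while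
    the outer power stays regularised until \<open>n\<close> grows.\<close>
  have le: "\<bar>tr (x * y)\<bar> \<le> sqrt (Q n * pn p x) * sqrt (P n * pn q y)" for n
  proof -
    obtain e where e_def: "e = eps n" and e: "0 < e" by simp
    have Qn: "tr (fc (\<lambda>t. t powr q) (reg_powr e (1 / 2) y)) powr (1 / q) = Q n"
      using fc_reg_powr[OF e pos(2), of "1 / 2" y] by (simp add: Q_def e_def[symmetric])
    have Pn: "tr (fc (\<lambda>t. t powr p) (reg_powr e (1 / 2) x)) powr (1 / p) = P n"
      using fc_reg_powr[OF e pos(1), of "1 / 2" x] by (simp add: P_def e_def[symmetric])
    let ?d = "reg_powr e (1 / 4) x" and ?u = "polar e x" and ?g = "reg_powr e (1 / 4) y" and ?v = "polar e y"
    have x: "?u * (?d * ?d) = x" and y: "?v * (?g * ?g) = y" by (simp_all add: reg_powr_half_split e polar_mult)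
    have "(?u * (?d * ?d)) * (?v * (?g * ?g)) = ?u * ?d * ?d * ?v * ?g * ?g" by (simp only: mult.assoc)
    then have "tr (x * y) = tr (?u * ?d * ?d * ?v * ?g * ?g)" unfolding x y by simp
    also have "\<dots> = tr ((?g * ?u * ?d) * (?d * ?v * ?g))"
      using tr_comm[of "?u * ?d * ?d * ?v * ?g" ?g] by (simp add: mult.assoc)
    finally have "\<bar>tr (x * y)\<bar> \<le> sqrt (tr ((?g * ?u * ?d) * star (?g * ?u * ?d)))
        * sqrt (tr (star (?d * ?v * ?g) * (?d * ?v * ?g)))"
      by (simp only: tr_Cauchy_Schwarz)
    also have "\<dots> \<le> sqrt (Q n * pn p x) * sqrt (P n * pn q y)"
    proof (intro mult_mono real_sqrt_le_mono)
      show "tr ((?g * ?u * ?d) * star (?g * ?u * ?d)) \<le> Q n * pn p x"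
      proof -
      have "tr ((?g * ?u * ?d) * star (?g * ?u * ?d)) = tr (?g * (?u * reg_powr e (1 / 2) x * star ?u * ?g))"
        by (simp add: star_mult star_reg_powr[OF e] mult.assoc flip: reg_powr_half_split[OF e])
      also have "\<dots> = tr (reg_powr e (1 / 2) y * (?u * reg_powr e (1 / 2) x * star ?u))"
        using tr_comm[of ?g "?u * reg_powr e (1 / 2) x * star ?u * ?g"] tr_comm[of "?u * reg_powr e (1 / 2) x * star ?u" "?g * ?g"]
        by (simp add: mult.assoc reg_powr_half_split[OF e])
      also have "\<dots> \<le> tr (fc (\<lambda>t. t powr q) (reg_powr e (1 / 2) y)) powr (1 / q) * pn p x"
        by (rule tr_polar_conj_mult_le[OF e pq psd_reg_powr[OF e]])
      finally show ?thesis unfolding Qn .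
    qed
      show "tr (star (?d * ?v * ?g) * (?d * ?v * ?g)) \<le> P n * pn q y"
    proof -
      have "tr (star (?d * ?v * ?g) * (?d * ?v * ?g)) = tr (?g * star ?v * reg_powr e (1 / 2) x * ?v * ?g)"
        by (simp add: star_mult star_reg_powr[OF e] mult.assoc flip: reg_powr_half_split[OF e])
      also have "\<dots> = tr (reg_powr e (1 / 2) x * (?v * reg_powr e (1 / 2) y * star ?v))"
        using tr_comm[of "?g * star ?v" "reg_powr e (1 / 2) x * ?v * ?g"] tr_comm[of "reg_powr e (1 / 2) x * ?v * ?g" "?g * star ?v"]
        by (simp add: mult.assoc flip: reg_powr_half_split[OF e])
      also have "\<dots> \<le> tr (fc (\<lambda>t. t powr p) (reg_powr e (1 / 2) x)) powr (1 / p) * pn q y"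
        by (rule tr_polar_conj_mult_le[OF e conjugate_sym[OF pq] psd_reg_powr[OF e]])
      finally show ?thesis unfolding Pn .
    qed
      show "0 \<le> sqrt (Q n * pn p x)" by (simp add: Q_def)
      show "0 \<le> sqrt (tr (star (?d * ?v * ?g) * (?d * ?v * ?g)))"
        by (intro real_sqrt_ge_zero tr_nonneg psd_square)
    qed
    finally show ?thesis .
  qed
  have "(\<lambda>n. sqrt (Q n * pn p x) * sqrt (P n * pn q y)) \<longlonglongrightarrow> sqrt (pn q y * pn p x) * sqrt (pn p x * pn q y)"
    unfolding P_def Q_def by (intro tendsto_intros tr_reg_powr_tendsto pos)
  then have "\<bar>tr (x * y)\<bar> \<le> sqrt (pn q y * pn p x) * sqrt (pn p x * pn q y)"
    by (rule LIMSEQ_le_const) (use le in blast)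
  also have "\<dots> = pn p x * pn q y" by (simp add: mult.commute)
  finally show ?thesis .
qed

end

section \<open>Norming elements and the norm properties of \<open>pn\<close>\<close>

context tracial
begin

text \<open>Test with \<open>g * star x\<close>, where \<open>g\<close> is the power
  \<open>p / 2 - 1\<close> of \<open>star x * x + e\<close>: the regularised norming element of
  \<open>x\<close>. The regularisation is essential for \<open>p < 2\<close>, where that power is
  negative. Its \<open>q\<close>-norm is at most \<open>T n powr (1 / q)\<close> because
  \<open>(p - 1) * q = p\<close>.\<close>

lemma pn_le_dual:
  assumes pq: "conjugate p q" and C: "0 \<le> C" and le: "\<And>y. tr (x * y) \<le> C * pn q y"
  shows "pn p x \<le> C"
proof -
  note pos = conjugateD(3,4)[OF pq] and p1 = conjugateD(1)[OF pq]
  let ?a = "star x * x"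
  \<comment> \<open>The error of replacing \<open>t + e\<close> by \<open>t\<close> is
    \<open>e\<close> times the power \<open>p / 2 - 1\<close> of \<open>t + e\<close>. One root of
    \<open>e\<close> is absorbed to raise that exponent to the positive number
    \<open>(p - 1) / 2\<close>, and \<open>K\<close> bounds the result.\<close>
  define K where "K = (norm ?a + 1) powr ((p - 1) / 2)"
  define T where "T n = tr (reg_powr (eps n) (p / 2) x)" for n
  have T0: "0 < T n" for n unfolding T_def by (rule tr_reg_powr_pos) simp
  have main: "T n - sqrt (eps n) * K \<le> C * T n powr (1 / q)" for n
  proof -
    obtain e where e_def: "e = eps n" and e: "0 < e" "e \<le> 1" by (simp add: eps_le_1)
    define g where "g = reg_powr e (p / 2 - 1) x"
    have c1: "continuous_on {0..} (\<lambda>t :: real. t * (t + e) powr r)" for r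
      by (intro continuous_on_mult continuous_on_shift_powr e continuous_on_id)
    have sg: "star g = g" unfolding g_def by (rule star_reg_powr[OF e(1)])
    have ag: "?a * g = fc (\<lambda>t. t * (t + e) powr (p / 2 - 1)) ?a"
      unfolding g_def reg_powr_def fc_mult[OF psd_square continuous_on_id continuous_on_shift_powr[OF e(1)]] fc_id[OF psd_square] ..
    have "T n - sqrt e * K \<le> tr (?a * g)"
    proof -
      have c2: "continuous_on {0..} (\<lambda>t :: real. (t + e) powr (p / 2) - sqrt e * K)"
        by (intro continuous_on_diff continuous_on_shift_powr e continuous_on_const)
      have "fc (\<lambda>t. (t + e) powr (p / 2) - sqrt e * K) ?a = reg_powr e (p / 2) x - (sqrt e * K) *\<^sub>R 1"
        unfolding reg_powr_def using fc_diff[OF psd_square continuous_on_shift_powr[OF e(1)] continuous_on_const]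
        by (simp add: fc_const[OF psd_square])
      then have "T n - sqrt e * K = tr (fc (\<lambda>t. (t + e) powr (p / 2) - sqrt e * K) ?a)"
        by (simp add: tr.diff tr.scaleR tr_one T_def e_def)
      also have "\<dots> \<le> tr (fc (\<lambda>t. t * (t + e) powr (p / 2 - 1)) ?a)"
      proof (rule tr_fc_mono[OF psd_square c2 c1])
        fix t :: real assume t: "0 \<le> t" "t \<le> norm ?a"
        define s where "s = t + e"
        have s: "0 < s" "e \<le> s" "s \<le> norm ?a + 1" using t e by (auto simp: s_def)
        have "e * s powr (p / 2 - 1) = sqrt e * (sqrt e * s powr (p / 2 - 1))"
          using e by (simp flip: mult.assoc)
        also have "\<dots> \<le> sqrt e * (s powr (1 / 2) * s powr (p / 2 - 1))"
          using s e by (intro mult_left_mono mult_right_mono) (auto simp: powr_half_sqrt)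
        also have "s powr (1 / 2) * s powr (p / 2 - 1) = s powr ((p - 1) / 2)"
          by (simp add: powr_add[symmetric] field_simps)
        also have "\<dots> \<le> K" unfolding K_def using s p1 by (intro powr_mono2) auto
        finally have "e * s powr (p / 2 - 1) \<le> sqrt e * K" using e by (simp add: mult_left_mono)
        moreover have "s powr (p / 2) = s * s powr (p / 2 - 1)"
          using s powr_add[of s 1 "p / 2 - 1"] by simp
        ultimately show "(t + e) powr (p / 2) - sqrt e * K \<le> t * (t + e) powr (p / 2 - 1)"
          unfolding s_def[symmetric] using s_def by (simp add: algebra_simps)
      qed
      finally show ?thesis by (simp add: ag)
    qed
    also have "tr (?a * g) = tr (x * (g * star x))"
      using tr_comm[of "star x" "x * g"] by (simp add: mult.assoc)
    also have "\<dots> \<le> C * pn q (g * star x)" by (rule le)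
    also have "pn q (g * star x) \<le> T n powr (1 / q)"
    proof -
      have c3: "continuous_on {0..} (\<lambda>t :: real. (t * (t + e) powr (p - 2)) powr (q / 2))"
        by (rule continuous_on_compose2[OF continuous_on_powr_nonneg c1]) (use pos in auto)
      \<comment> \<open>Passing to the adjoint makes the squared absolute value
        \<open>g * ?a * g\<close>, a function of \<open>?a\<close> alone.\<close>
      have "pn q (g * star x) = pn q (x * g)"
        using pn_star[OF pos(2), of "x * g"] by (simp add: star_mult sg)
      also have "star (x * g) * (x * g) = g * (?a * g)" by (simp add: star_mult sg mult.assoc)
      then have "pn q (x * g) = tr (fc (\<lambda>t. t powr (q / 2)) (g * (?a * g))) powr (1 / q)"
        by (simp add: pn_def)
      also have "g * (?a * g) = fc (\<lambda>t. (t + e) powr (p / 2 - 1) * (t * (t + e) powr (p / 2 - 1))) ?a"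
        unfolding ag unfolding g_def reg_powr_def
        by (rule fc_mult[OF psd_square continuous_on_shift_powr[OF e(1)] c1, symmetric])
      also have "(\<lambda>t. (t + e) powr (p / 2 - 1) * (t * (t + e) powr (p / 2 - 1))) = (\<lambda>t. t * (t + e) powr (p - 2))"
        by (simp add: fun_eq_iff mult.left_commute powr_add[symmetric])
      also have "fc (\<lambda>t. t powr (q / 2)) (fc (\<lambda>t. t * (t + e) powr (p - 2)) ?a)
          = fc (\<lambda>t. (t * (t + e) powr (p - 2)) powr (q / 2)) ?a"
        by (rule fc_compose[OF psd_square c1]) (use pos in \<open>auto intro: continuous_on_powr_nonneg\<close>)
      also have "tr \<dots> \<le> T n"
        unfolding T_def reg_powr_def e_def[symmetric]
      proof (rule tr_fc_mono[OF psd_square c3 continuous_on_shift_powr[OF e(1)]])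
        fix t :: real assume t: "0 \<le> t"
        have "(t * (t + e) powr (p - 2)) powr (q / 2) \<le> ((t + e) * (t + e) powr (p - 2)) powr (q / 2)"
          using t e pos by (intro powr_mono2 mult_right_mono) auto
        also have "(t + e) * (t + e) powr (p - 2) = (t + e) powr (p - 1)"
          using t e powr_add[of "t + e" 1 "p - 2"] by simp
        also have "((t + e) powr (p - 1)) powr (q / 2) = (t + e) powr (p / 2)"
          using conjugateD(8)[OF pq] by (simp add: powr_powr)
        finally show "(t * (t + e) powr (p - 2)) powr (q / 2) \<le> (t + e) powr (p / 2)" .
      qed
      then have "tr (fc (\<lambda>t. (t * (t + e) powr (p - 2)) powr (q / 2)) ?a) powr (1 / q) \<le> T n powr (1 / q)"
        using pos by (intro powr_mono2 tr_nonneg psd_fc psd_square c3) auto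
      finally show ?thesis .
    qed
    then have "C * pn q (g * star x) \<le> C * T n powr (1 / q)" using C by (rule mult_left_mono)
    finally show ?thesis by (simp add: e_def)
  qed
  define T' where "T' = tr (fc (\<lambda>t. t powr (p / 2)) ?a)"
  have T'0: "0 \<le> T'" unfolding T'_def using pos by (intro tr_fc_powr_nonneg psd_square) auto
  have lT: "T \<longlonglongrightarrow> T'"
    unfolding T_def T'_def reg_powr_def using pos by (intro tr_fc_shift_tendsto psd_square) auto
  have l1: "(\<lambda>n. T n - sqrt (eps n) * K) \<longlonglongrightarrow> T' - sqrt 0 * K"
    by (intro tendsto_intros lT eps_tendsto)
  have l2: "(\<lambda>n. C * T n powr (1 / q)) \<longlonglongrightarrow> C * T' powr (1 / q)"
    using pos by (intro tendsto_mult tendsto_const tendsto_powr' lT)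
      (auto intro!: disjI2 always_eventually less_imp_le[OF T0])
  have "T' - sqrt 0 * K \<le> C * T' powr (1 / q)"
    by (rule LIMSEQ_le[OF l1 l2]) (intro exI allI impI main)
  then have le': "T' \<le> C * T' powr (1 / q)" by simp
  show ?thesis
  proof (cases "T' = 0")
    case True
    then show ?thesis using C by (simp add: pn_def T'_def[symmetric])
  next
    case False
    then have T'p: "0 < T'" using T'0 by simp
    have "T' = T' powr (1 / p) * T' powr (1 / q)"
      using T'p conjugateD(5)[OF pq] by (simp flip: powr_add)
    then have "T' powr (1 / p) * T' powr (1 / q) \<le> C * T' powr (1 / q)" using le' by simp
    then show ?thesis using T'p by (simp add: pn_def T'_def[symmetric])
  qed
qed

lemma pn_triangle:
  assumes p: "1 < p"
  shows "pn p (x + y) \<le> pn p x + pn p y"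
proof (rule pn_le_dual[OF conjugate_exists[OF p]])
  fix z
  have "tr (x * z) \<le> pn p x * pn (p / (p - 1)) z" "tr (y * z) \<le> pn p y * pn (p / (p - 1)) z"
    using Hoelder[OF conjugate_exists[OF p]] abs_le_D1 by blast+
  then show "tr ((x + y) * z) \<le> (pn p x + pn p y) * pn (p / (p - 1)) z"
    by (simp add: distrib_right tr.add)
qed simp

text \<open>By duality the norm depends only on the functional
  \<open>y \<mapsto> tr (x * y)\<close>. Later this identifies the norms of operators that agree on
  the summand seen by the trace but differ elsewhere.\<close>

lemma pn_eqI:
  assumes p: "1 < p" and eq: "\<And>y. tr (x * y) = tr (x' * y)"
  shows "pn p x = pn p x'"
proof -
  note pq = conjugate_exists[OF p]
  have "pn p x \<le> pn p x'"
    by (rule pn_le_dual[OF pq]) (use abs_le_D1[OF Hoelder[OF pq]] in \<open>simp_all add: eq\<close>)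
  moreover have "pn p x' \<le> pn p x"
    by (rule pn_le_dual[OF pq]) (use abs_le_D1[OF Hoelder[OF pq]] in \<open>simp_all flip: eq\<close>)
  ultimately show ?thesis by simp
qed

lemma pn_zero: "1 < p \<Longrightarrow> pn p 0 = 0"
  using pn_le_dual[OF conjugate_exists, of p 0 0] pn_nonneg[of p 0] by (simp add: tr.zero)

lemma pn_scaleR:
  assumes p: "1 < p"
  shows "pn p (r *\<^sub>R x) = \<bar>r\<bar> * pn p x"
proof -
  note pq = conjugate_exists[OF p]
  have le: "pn p (r *\<^sub>R x) \<le> \<bar>r\<bar> * pn p x" for r x
  proof (rule pn_le_dual[OF pq])
    fix y
    have "tr (r *\<^sub>R x * y) \<le> \<bar>r\<bar> * \<bar>tr (x * y)\<bar>" by (simp add: tr.scaleR flip: abs_mult)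
    also have "\<dots> \<le> \<bar>r\<bar> * (pn p x * pn (p / (p - 1)) y)" by (intro mult_left_mono Hoelder pq) simp
    finally show "tr (r *\<^sub>R x * y) \<le> \<bar>r\<bar> * pn p x * pn (p / (p - 1)) y" by (simp add: mult.assoc)
  qed simp
  show ?thesis
  proof (cases "r = 0")
    case True
    then show ?thesis by (simp add: pn_zero[OF p])
  next
    case False
    have "pn p x = pn p (inverse r *\<^sub>R (r *\<^sub>R x))" using False by simp
    also have "\<dots> \<le> \<bar>inverse r\<bar> * pn p (r *\<^sub>R x)" by (rule le)
    finally have "\<bar>r\<bar> * pn p x \<le> pn p (r *\<^sub>R x)" using False by (simp add: field_simps)
    then show ?thesis using le[of r x] by simp
  qed
qed

lemma pn_minus: "1 < p \<Longrightarrow> pn p (- x) = pn p x"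
  using pn_scaleR[of p "-1" x] by simp

lemma pn_diff_commute: "1 < p \<Longrightarrow> pn p (x - y) = pn p (y - x)"
  using pn_minus[of p "x - y"] by simp

lemma pn_triangle_diff: "1 < p \<Longrightarrow> pn p (x - y) \<le> pn p x + pn p y"
  using pn_triangle[of p x "- y"] by (simp add: pn_minus)

lemma pn_ofc:
  assumes p: "1 < p"
  shows "pn p (ofc c * x) = cmod c * pn p x"
proof (cases "c = 0")
  case True
  then show ?thesis by (simp add: pn_zero[OF p])
next
  case False
  define w where "w = c / of_real (cmod c)"
  have "w * cnj w = 1" using False
    by (simp add: w_def complex_norm_square[symmetric] power2_eq_square flip: of_real_mult)
  then have "star (ofc w :: 'a) * ofc w = 1" by (simp add: star_ofc mult.commute flip: ofc_mult)
  moreover have "star (ofc w * x) * (ofc w * x) = star x * (star (ofc w) * ofc w) * x"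
    by (simp only: star_mult mult.assoc)
  ultimately have "star (ofc w * x) * (ofc w * x) = star x * x" by simp
  then have "pn p (ofc w * x) = pn p x" by (simp add: pn_def)
  moreover have "of_real (cmod c) * w = c" using False by (simp add: w_def)
  then have "ofc c * x = cmod c *\<^sub>R (ofc w * x)"
    using ofc_mult[of "of_real (cmod c)" w, where 'a = 'a] by simp
  ultimately show ?thesis by (simp add: pn_scaleR[OF p])
qed

subsection \<open>The ideal property\<close>

text \<open>Powers above 1 are not operator monotone, but under the trace
  \<open>a ^ r = a * a ^ (r - 1)\<close> may be replaced by \<open>b * a ^ (r - 1)\<close>;
  Hoelder's inequality then returns a power of the left-hand side, which cancels.\<close>

lemma tr_powr_mono:
  assumes a: "psd a" and b: "psd b" and ab: "psd (b - a)" and r: "1 \<le> r"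
  shows "tr (fc (\<lambda>t. t powr r) a) \<le> tr (fc (\<lambda>t. t powr r) b)"
proof (cases "r = 1")
  case True
  then show ?thesis using tr_mono[OF ab] fc_powr_one[OF a] fc_powr_one[OF b] by simp
next
  case False
  then have r1: "1 < r" using r by simp
  define q where "q = r / (r - 1)"
  have rq: "conjugate r q" unfolding q_def by (rule conjugate_exists[OF r1])
  have c: "continuous_on {0..} (\<lambda>t :: real. t powr (r - 1))" "continuous_on {0..} (\<lambda>t :: real. t powr q)"
    using r1 conjugateD(4)[OF rq] by (auto intro: continuous_on_powr_nonneg)
  let ?c = "fc (\<lambda>t. t powr (r - 1)) a"
  have psd: "psd ?c" by (intro psd_fc a c) simp
  define A where "A = tr (fc (\<lambda>t. t powr r) a)"
  define B where "B = tr (fc (\<lambda>t. t powr r) b)"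
  have A0: "0 \<le> A" and B0: "0 \<le> B" unfolding A_def B_def using r1 by (auto intro!: tr_fc_powr_nonneg a b)
  have "fc (\<lambda>t. t powr r) a = fc (\<lambda>t. t * t powr (r - 1)) a"
  proof (rule fc_cong)
    fix t :: real assume "0 \<le> t"
    then show "t powr r = t * t powr (r - 1)" using powr_add[of t 1 "r - 1"] by (cases "t = 0") auto
  qed
  then have "A = tr (a * ?c)" by (simp add: A_def fc_mult[OF a continuous_on_id c(1)] fc_id[OF a])
  also have "\<dots> \<le> tr (b * ?c)" using tr_psd_mult_nonneg[OF ab psd] by (simp add: left_diff_distrib tr.diff)
  also have "\<dots> \<le> B powr (1 / r) * tr (fc (\<lambda>t. t powr q) ?c) powr (1 / q)"
    unfolding B_def by (rule Hoelder_psd[OF b psd rq])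
  also have "fc (\<lambda>t. t powr q) ?c = fc (\<lambda>t. t powr r) a"
    by (subst fc_compose[OF a c(1) _ c(2)]) (simp_all add: powr_powr conjugateD(8)[OF rq])
  finally have le: "A \<le> B powr (1 / r) * A powr (1 / q)" by (simp add: A_def)
  show ?thesis
  proof (cases "A = 0")
    case True
    then show ?thesis using B0 by (simp add: A_def B_def)
  next
    case False
    then have A: "0 < A" using A0 by simp
    have "A = A powr (1 / r) * A powr (1 / q)" using A conjugateD(5)[OF rq] by (simp flip: powr_add)
    then have "A powr (1 / r) \<le> B powr (1 / r)" using le A
      by (metis mult_le_cancel_right powr_gt_zero less_irrefl not_less)
    then have "A \<le> B" using powr_less_mono2[of "1 / r" B A] r1 B0 by (meson divide_pos_pos less_le_not_le
          linorder_not_le order.strict_trans zero_less_one)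
    then show ?thesis by (simp only: A_def B_def)
  qed
qed

lemma pn_mult_left_ge2:
  assumes p: "2 \<le> p"
  shows "pn p (u * x) \<le> norm u * pn p x"
proof -
  have "psd (star x * ((norm u)\<^sup>2 *\<^sub>R 1 - star u * u) * x)" by (intro psd_conj psd_norm_square)
  then have d: "psd ((norm u)\<^sup>2 *\<^sub>R (star x * x) - star (u * x) * (u * x))"
    by (simp add: algebra_simps star_mult mult.assoc)
  have s: "star (norm u *\<^sub>R x) * (norm u *\<^sub>R x) = (norm u)\<^sup>2 *\<^sub>R (star x * x)"
    by (simp add: star_scaleR power2_eq_square)
  have "psd ((norm u)\<^sup>2 *\<^sub>R (star x * x))" by (intro psd_scaleR psd_square) simp
  from tr_powr_mono[OF psd_square this d, of "p / 2"]
  have "pn p (u * x) \<le> pn p (norm u *\<^sub>R x)"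
    unfolding pn_def s using p by (intro powr_mono2 tr_fc_powr_nonneg psd_square) auto
  then show ?thesis using p by (simp add: pn_scaleR)
qed

text \<open>For \<open>p \<ge> 2\<close> trace monotonicity applies with exponent
  \<open>p / 2 \<ge> 1\<close>. For smaller \<open>p\<close> the conjugate exponent is at least 2,
  and the factor is moved to the test element by cyclicity.\<close>

lemma pn_mult_left:
  assumes p: "1 < p"
  shows "pn p (u * x) \<le> norm u * pn p x"
proof (cases "2 \<le> p")
  case True
  then show ?thesis by (rule pn_mult_left_ge2)
next
  case False
  define q where "q = p / (p - 1)"
  have pq: "conjugate p q" unfolding q_def by (rule conjugate_exists[OF p])
  have q2: "2 \<le> q" using False p by (simp add: q_def field_simps)
  show ?thesis
  proof (rule pn_le_dual[OF pq])
    fix y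
    have "tr (u * x * y) = tr (x * (y * u))" using tr_comm[of u "x * y"] by (simp add: mult.assoc)
    also have "\<dots> \<le> pn p x * pn q (y * u)" using Hoelder[OF pq] abs_le_D1 by blast
    also have "pn q (y * u) = pn q (star u * star y)"
      using pn_star[of q "y * u"] q2 by (simp add: star_mult)
    also have "\<dots> \<le> norm u * pn q y"
      using pn_mult_left_ge2[OF q2, of "star u" "star y"] q2 by (simp add: pn_star)
    then have "pn p x * pn q (star u * star y) \<le> pn p x * (norm u * pn q y)" by (intro mult_left_mono) auto
    finally show "tr (u * x * y) \<le> norm u * pn p x * pn q y" by (simp add: mult_ac)
  qed simp
qed

lemma pn_mult_right:
  assumes p: "1 < p"
  shows "pn p (x * u) \<le> pn p x * norm u"
  using pn_mult_left[OF p, of "star u" "star x"] p pn_star[of p "x * u"] pn_star[of p x]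
  by (simp add: star_mult mult.commute)

text \<open>Dualise with \<open>w\<close>, split \<open>w = v * d * d\<close> by its regularised
  polar decomposition, and apply Cauchy-Schwarz to \<open>(d * x) * (y * v * d)\<close>; Hoelder's
  inequality for positive elements handles each of the two traces.\<close>

lemma pn_mult_double:
  assumes p: "1 < p"
  shows "pn p (x * y) \<le> pn (2 * p) x * pn (2 * p) y"
proof -
  define q where "q = p / (p - 1)"
  have pq: "conjugate p q" unfolding q_def by (rule conjugate_exists[OF p])
  note pos = conjugateD(3,4)[OF pq]
  have pn2: "tr (fc (\<lambda>t. t powr p) (star z * z)) powr (1 / p) = (pn (2 * p) z)\<^sup>2" for z
  proof -
    have "(pn (2 * p) z)\<^sup>2 = pn (2 * p) z powr 2" by simp
    then show ?thesis using pos by (simp add: pn_def powr_powr)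
  qed
  have pn2': "tr (fc (\<lambda>t. t powr p) (z * star z)) powr (1 / p) = (pn (2 * p) z)\<^sup>2" for z
    using pn2[of z] pos by (simp add: tr_fc_star continuous_on_powr_nonneg)
  show ?thesis
  proof (rule pn_le_dual[OF pq])
    fix w
    define Q where "Q n = tr (reg_powr (eps n) (q / 2) w) powr (1 / q)" for n
    have le: "\<bar>tr (x * y * w)\<bar> \<le> sqrt ((pn (2 * p) x)\<^sup>2 * Q n) * sqrt ((pn (2 * p) y)\<^sup>2 * pn q w)" for n
    proof -
      obtain e where e_def: "e = eps n" and e: "0 < e" by simp
      let ?d = "reg_powr e (1 / 4) w" and ?v = "polar e w"
      have Qn: "tr (fc (\<lambda>t. t powr q) (reg_powr e (1 / 2) w)) powr (1 / q) = Q n"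
        using fc_reg_powr[OF e pos(2), of "1 / 2" w] by (simp add: Q_def e_def[symmetric])
      have w: "?v * (?d * ?d) = w" by (simp add: reg_powr_half_split e polar_mult)
      have "x * y * (?v * (?d * ?d)) = (x * y * ?v * ?d) * ?d" by (simp only: mult.assoc)
      then have "tr (x * y * w) = tr ((?d * x) * (y * ?v * ?d))"
        unfolding w using tr_comm[of "x * y * ?v * ?d" ?d] by (simp add: mult.assoc)
      then have "\<bar>tr (x * y * w)\<bar> \<le> sqrt (tr ((?d * x) * star (?d * x)))
          * sqrt (tr (star (y * ?v * ?d) * (y * ?v * ?d)))"
        by (simp only: tr_Cauchy_Schwarz)
      also have "\<dots> \<le> sqrt ((pn (2 * p) x)\<^sup>2 * Q n) * sqrt ((pn (2 * p) y)\<^sup>2 * pn q w)"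
      proof (intro mult_mono real_sqrt_le_mono)
        have "tr ((?d * x) * star (?d * x)) = tr (?d * (x * star x * ?d))"
          by (simp add: star_mult star_reg_powr[OF e] mult.assoc)
        also have "\<dots> = tr ((x * star x) * reg_powr e (1 / 2) w)"
          using tr_comm[of ?d "x * star x * ?d"] by (simp add: mult.assoc reg_powr_half_split[OF e])
        also have "\<dots> \<le> tr (fc (\<lambda>t. t powr p) (x * star x)) powr (1 / p) *
            tr (fc (\<lambda>t. t powr q) (reg_powr e (1 / 2) w)) powr (1 / q)"
          using psd_square[of "star x"] by (intro Hoelder_psd pq psd_reg_powr e) (simp add: star_star)
        finally show "tr ((?d * x) * star (?d * x)) \<le> (pn (2 * p) x)\<^sup>2 * Q n" unfolding pn2' Qn .
        have "tr (star (y * ?v * ?d) * (y * ?v * ?d)) = tr ((?d * star ?v) * (star y * y * (?v * ?d)))"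
          by (simp add: star_mult star_reg_powr[OF e] mult.assoc)
        also have "\<dots> = tr ((star y * y) * (?v * reg_powr e (1 / 2) w * star ?v))"
          using tr_comm[of "?d * star ?v" "star y * y * (?v * ?d)"]
          by (simp add: mult.assoc flip: reg_powr_half_split[OF e])
        also have "\<dots> \<le> tr (fc (\<lambda>t. t powr p) (star y * y)) powr (1 / p) * pn q w"
          by (rule tr_polar_conj_mult_le[OF e conjugate_sym[OF pq] psd_square])
        finally show "tr (star (y * ?v * ?d) * (y * ?v * ?d)) \<le> (pn (2 * p) y)\<^sup>2 * pn q w" unfolding pn2 .
        show "0 \<le> sqrt ((pn (2 * p) x)\<^sup>2 * Q n)" by (simp add: Q_def)
        show "0 \<le> sqrt (tr (star (y * ?v * ?d) * (y * ?v * ?d)))"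
          by (intro real_sqrt_ge_zero tr_nonneg psd_square)
      qed
      finally show ?thesis .
    qed
    have "(\<lambda>n. sqrt ((pn (2 * p) x)\<^sup>2 * Q n) * sqrt ((pn (2 * p) y)\<^sup>2 * pn q w))
      \<longlonglongrightarrow> sqrt ((pn (2 * p) x)\<^sup>2 * pn q w) * sqrt ((pn (2 * p) y)\<^sup>2 * pn q w)"
      unfolding Q_def by (intro tendsto_intros tr_reg_powr_tendsto pos)
    then have "\<bar>tr (x * y * w)\<bar> \<le> sqrt ((pn (2 * p) x)\<^sup>2 * pn q w) * sqrt ((pn (2 * p) y)\<^sup>2 * pn q w)"
      by (rule LIMSEQ_le_const) (use le in blast)
    also have "\<dots> = pn (2 * p) x * pn (2 * p) y * pn q w"
      by (simp add: real_sqrt_mult)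
    finally show "tr (x * y * w) \<le> pn (2 * p) x * pn (2 * p) y * pn q w" by simp
  qed simp
qed

text \<open>Here the exponent doubles: a bound for \<open>x * star x\<close> at \<open>p\<close> is
  a bound for \<open>x\<close> at \<open>2 * p\<close>.\<close>

lemma pn_star_mult_self: "1 < p \<Longrightarrow> pn p (x * star x) = (pn (2 * p) x)\<^sup>2"
proof -
  assume p: "1 < p"
  have psd: "psd (x * star x)" using psd_square[of "star x"] by (simp add: star_star)
  have c: "continuous_on {0..} (\<lambda>t :: real. t powr r)" if "0 < r" for r using that by (rule continuous_on_powr_nonneg)
  have "star (x * star x) * (x * star x) = fc (\<lambda>t. t * t) (x * star x)"
    using fc_mult[OF psd continuous_on_id continuous_on_id] by (simp add: fc_id[OF psd] star_mult star_star)
  then have "fc (\<lambda>t. t powr (p / 2)) (star (x * star x) * (x * star x)) = fc (\<lambda>t. (t * t) powr (p / 2)) (x * star x)"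
    using fc_compose[OF psd, of "\<lambda>t. t * t" "\<lambda>t. t powr (p / 2)"] c p by (simp add: continuous_on_mult continuous_on_id)
  also have "\<dots> = fc (\<lambda>t. t powr p) (x * star x)"
    by (rule fc_cong) (simp add: powr_mult powr_add[symmetric])
  finally have "pn p (x * star x) = tr (fc (\<lambda>t. t powr p) (star x * x)) powr (1 / p)"
    using p by (simp add: pn_def tr_fc_star c)
  moreover have "(pn (2 * p) x)\<^sup>2 = pn (2 * p) x powr 2" by simp
  ultimately show ?thesis using p by (simp add: pn_def powr_powr)
qed

end

section \<open>Riesz-Thorin interpolation of bilinear forms\<close>

context tracial
begin

lemma pn_reg_powr:
  assumes e: "0 < e" and p: "0 < p" "0 < p0"
  shows "pn p0 (reg_powr e (p / p0 / 2) x) = tr (reg_powr e (p / 2) x) powr (1 / p0)"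
proof -
  have "star (reg_powr e (p / p0 / 2) x) * reg_powr e (p / p0 / 2) x = reg_powr e (p / p0) x"
    by (simp add: star_reg_powr[OF e] reg_powr_mult[OF e])
  then show ?thesis using p fc_reg_powr[OF e, of "p0 / 2" "p / p0" x] by (simp add: pn_def)
qed

text \<open>Regularised polar decompositions give \<open>x = u * exp L\<close> and
  \<open>y = exp K * v\<close>. Along the strip the exponent of \<open>exp L\<close> moves from
  \<open>p / p0\<close> to \<open>p / p1\<close> and that of \<open>exp K\<close> from
  \<open>q / q0\<close> to \<open>q / q1\<close>, with value 1 at \<open>t\<close>. By
  \<open>pn_reg_powr\<close> the endpoint norms are powers of the same traces \<open>S n\<close>,
  \<open>T n\<close>, and the ideal property absorbs the contractions.\<close>

lemma interpolation_pn:
  fixes \<beta> :: "'a \<Rightarrow> 'a \<Rightarrow> real"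
  assumes \<beta>: "bounded_bilinear \<beta>" "\<And>y x. \<beta> (imunit * y) x = \<beta> y (imunit * x)"
    and pq0: "conjugate p0 q0" and pq1: "conjugate p1 q1" and pq: "conjugate p q"
    and t: "0 < t" "t < 1" "1 / p = (1 - t) / p0 + t / p1" and C: "0 < C"
    and b0: "\<And>y x. \<bar>\<beta> y x\<bar> \<le> C * pn q0 y * pn p0 x"
    and b1: "\<And>y x. \<bar>\<beta> y x\<bar> \<le> C * pn q1 y * pn p1 x"
  shows "\<bar>\<beta> y x\<bar> \<le> C * pn q y * pn p x"
proof -
  note pos0 = conjugateD(3,4)[OF pq0] and pos1 = conjugateD(3,4)[OF pq1] and pos = conjugateD(3,4)[OF pq]
  define S where "S n = tr (reg_powr (eps n) (q / 2) (star y))" for n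
  define T where "T n = tr (reg_powr (eps n) (p / 2) x)" for n
  have ST: "0 < S n" "0 < T n" for n by (simp_all add: S_def T_def tr_reg_powr_pos)
  have expT: "(1 - t) * (p / p0) + t * (p / p1) = 1"
  proof -
    have "p * ((1 - t) / p0 + t / p1) = p * (1 / p)" using t(3) by simp
    then show ?thesis using pos by (simp add: algebra_simps)
  qed
  have tq: "1 / q = (1 - t) / q0 + t / q1"
  proof -
    have "1 / q = (1 - t) * (1 - 1 / p0) + t * (1 - 1 / p1)"
      using conjugateD(6)[OF pq] t(3) by (simp add: algebra_simps)
    then show ?thesis using conjugateD(6)[OF pq0] conjugateD(6)[OF pq1] by simp
  qed
  have expS: "(1 - t) * (q / q0) + t * (q / q1) = 1"
  proof -
    have "q * ((1 - t) / q0 + t / q1) = q * (1 / q)" using tq by simp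
    then show ?thesis using pos by (simp add: algebra_simps)
  qed
  have le: "\<bar>\<beta> y x\<bar> \<le> C * S n powr (1 / q) * T n powr (1 / p)" for n
  proof -
    obtain e where e_def: "eps n = e" and e: "0 < e" by simp
    define L where "L = fc (\<lambda>t. (1 / 2) * ln (t + e)) (star x * x)"
    \<comment> \<open>The decomposition of \<open>star y\<close>, read backwards, puts the positive
      factor of \<open>y\<close> on the left.\<close>
    define K where "K = fc (\<lambda>t. (1 / 2) * ln (t + e)) (star (star y) * star y)"
    have c: "continuous_on {0..} (\<lambda>t. (1 / 2) * ln (t + e))" using e by (intro continuous_intros) auto
    have sL: "star L = L" and sK: "star K = K" unfolding L_def K_def by (intro star_fc psd_square c)+
    have EL: "exp (s *\<^sub>R L) = reg_powr e (s / 2) x" and EK: "exp (s *\<^sub>R K) = reg_powr e (s / 2) (star y)" for s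
      unfolding L_def K_def reg_powr_def using exp_fc_ln[OF psd_square e, of s "1 / 2"] by simp_all
    have bd: "\<bar>\<beta> (exp ((q / r') *\<^sub>R K) * V) (U * exp ((p / r) *\<^sub>R L))\<bar>
        \<le> C * S n powr (1 / r') * T n powr (1 / r)"
      if r: "conjugate r r'" "\<And>y x. \<bar>\<beta> y x\<bar> \<le> C * pn r' y * pn r x" and UV: "norm U \<le> 1" "norm V \<le> 1"
      for r r' U V
    proof -
      note rpos = conjugateD(3,4)[OF r(1)]
      have "pn r' (exp ((q / r') *\<^sub>R K) * V) \<le> pn r' (exp ((q / r') *\<^sub>R K)) * norm V"
        by (rule pn_mult_right[OF conjugateD(2)[OF r(1)]])
      also have "\<dots> \<le> pn r' (exp ((q / r') *\<^sub>R K)) * 1" by (intro mult_left_mono UV) simp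
      also have "\<dots> = S n powr (1 / r')"
        unfolding EK S_def e_def using pn_reg_powr[OF e pos(2) rpos(2)] by simp
      finally have 1: "pn r' (exp ((q / r') *\<^sub>R K) * V) \<le> S n powr (1 / r')" .
      have "pn r (U * exp ((p / r) *\<^sub>R L)) \<le> norm U * pn r (exp ((p / r) *\<^sub>R L))"
        by (rule pn_mult_left[OF conjugateD(1)[OF r(1)]])
      also have "\<dots> \<le> 1 * pn r (exp ((p / r) *\<^sub>R L))" by (intro mult_right_mono UV) simp
      also have "\<dots> = T n powr (1 / r)"
        unfolding EL T_def e_def using pn_reg_powr[OF e pos(1) rpos(1)] by simp
      finally have 2: "pn r (U * exp ((p / r) *\<^sub>R L)) \<le> T n powr (1 / r)" .
      have "C * pn r' (exp ((q / r') *\<^sub>R K) * V) * pn r (U * exp ((p / r) *\<^sub>R L))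
        \<le> C * S n powr (1 / r') * T n powr (1 / r)"
        using 1 2 C by (intro mult_mono mult_left_mono) auto
      then show ?thesis using r(2) order_trans by blast
    qed
    let ?M0 = "C * S n powr (1 / q0) * T n powr (1 / p0)" and ?M1 = "C * S n powr (1 / q1) * T n powr (1 / p1)"
    have "\<bar>\<beta> (exp (((1 - t) * (q / q0) + t * (q / q1)) *\<^sub>R K) * star (polar e (star y)))
        (polar e x * exp (((1 - t) * (p / p0) + t * (p / p1)) *\<^sub>R L))\<bar> \<le> ?M0 powr (1 - t) * ?M1 powr t"
    proof (rule interpolation_exp[OF \<beta> sL sK])
      show "norm (polar e x) \<le> 1" "norm (star (polar e (star y))) \<le> 1"
        using norm_polar_le[OF e] by simp_all
      show "0 < ?M0" "0 < ?M1" using C ST[of n] by simp_all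
    qed (use t bd[OF pq0 b0] bd[OF pq1 b1] in auto)
    moreover have "polar e x * exp (1 *\<^sub>R L) = x" using EL[of 1] polar_mult[OF e, of x] by simp
    moreover have "exp (1 *\<^sub>R K) * star (polar e (star y)) = y"
      using EK[of 1] arg_cong[OF polar_mult[OF e, of "star y"], of star] by (simp add: star_mult star_star star_reg_powr[OF e])
    moreover have "?M0 powr (1 - t) * ?M1 powr t = C * S n powr (1 / q) * T n powr (1 / p)"
    proof -
      have "?M0 powr (1 - t) * ?M1 powr t = (C powr (1 - t) * C powr t)
          * (S n powr ((1 - t) / q0) * S n powr (t / q1)) * (T n powr ((1 - t) / p0) * T n powr (t / p1))"
        using C ST[of n] by (simp add: powr_mult powr_powr mult_ac)
      also have "\<dots> = C * S n powr (1 / q) * T n powr (1 / p)"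
        unfolding powr_add[symmetric] tq t(3) using C by simp
      finally show ?thesis .
    qed
    ultimately show ?thesis unfolding expS expT by simp
  qed
  have "(\<lambda>n. C * S n powr (1 / q) * T n powr (1 / p)) \<longlonglongrightarrow> C * pn q (star y) * pn p x"
    unfolding S_def T_def by (intro tendsto_intros tr_reg_powr_tendsto pos)
  then have "\<bar>\<beta> y x\<bar> \<le> C * pn q (star y) * pn p x"
    by (rule LIMSEQ_le_const) (use le in blast)
  then show ?thesis using pos by (simp add: pn_star)
qed

subsection \<open>Comparison with the operator norm and the \<open>L\<^sub>2\<close>-norm\<close>

lemma pn_two: "pn 2 x = sqrt (tr (star x * x))"
proof -
  have "fc (\<lambda>t. t powr (2 / 2)) (star x * x) = star x * x"
    by (rule trans[OF fc_cong fc_id[OF psd_square]]) simp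
  then show ?thesis unfolding pn_def using powr_half_sqrt[OF tr_nonneg[OF psd_square]] by simp
qed

lemma pn_le_norm: "0 < p \<Longrightarrow> pn p x \<le> norm x"
proof -
  assume p: "0 < p"
  have "tr (fc (\<lambda>t. t powr (p / 2)) (star x * x)) \<le> tr (fc (\<lambda>_. norm x powr p) (star x * x))"
  proof (rule tr_fc_mono[OF psd_square _ continuous_on_const])
    show "continuous_on {0..} (\<lambda>t :: real. t powr (p / 2))" using p by (simp add: continuous_on_powr_nonneg)
    fix t :: real assume t: "0 \<le> t" "t \<le> norm (star x * x)"
    then have "t powr (p / 2) \<le> (norm x powr 2) powr (p / 2)"
      using p by (intro powr_mono2) (auto simp: norm_star_mult power2_eq_square)
    then show "t powr (p / 2) \<le> norm x powr p" by (simp add: powr_powr del: powr_numeral)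
  qed
  then have "tr (fc (\<lambda>t. t powr (p / 2)) (star x * x)) \<le> norm x powr p"
    by (simp add: fc_const[OF psd_square] tr.scaleR tr_one)
  then have "pn p x \<le> (norm x powr p) powr (1 / p)"
    unfolding pn_def using p by (intro powr_mono2 tr_fc_powr_nonneg psd_square) auto
  then show ?thesis using p by (simp add: powr_powr)
qed

text \<open>Hoelder's inequality against the unit, whose trace is 1.\<close>

lemma pn_le_two:
  assumes p: "1 < p" "p \<le> 2"
  shows "pn p x \<le> pn 2 x"
proof (cases "p = 2")
  case False
  define r where "r = 2 / p"
  define q where "q = r / (r - 1)"
  have r: "1 < r" using p False by (simp add: r_def)
  have rq: "conjugate r q" unfolding q_def by (rule conjugate_exists[OF r])
  have c: "continuous_on {0..} (\<lambda>t :: real. t powr (p / 2))" "continuous_on {0..} (\<lambda>t :: real. t powr r)"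
    using p r by (auto intro!: continuous_on_powr_nonneg)
  let ?c = "fc (\<lambda>t. t powr (p / 2)) (star x * x)"
  have psd: "psd ?c" by (intro psd_fc psd_square c) simp
  have "tr (?c * 1) \<le> tr (fc (\<lambda>t. t powr r) ?c) powr (1 / r) * tr (fc (\<lambda>t. t powr q) 1) powr (1 / q)"
    by (rule Hoelder_psd[OF psd psd_one rq])
  also have "fc (\<lambda>t. t powr r) ?c = star x * x"
    using p fc_compose[OF psd_square c(1) _ c(2), of x] fc_powr_one[OF psd_square, of x]
    by (simp add: powr_powr r_def)
  also have "fc (\<lambda>t. t powr q) (1 :: 'a) = 1"
  proof -
    \<comment> \<open>Reading 1 as a constant function of itself reduces its power to a
      composition.\<close>
    have "fc (\<lambda>t. t powr q) (1 :: 'a) = fc (\<lambda>t. t powr q) (fc (\<lambda>_. 1) 1)" by (simp add: fc_const[OF psd_one])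
    also have "\<dots> = fc (\<lambda>t. 1 powr q) 1"
      using conjugateD(4)[OF rq] by (intro fc_compose[OF psd_one]) (auto intro: continuous_on_powr_nonneg)
    finally show ?thesis by (simp add: fc_const[OF psd_one])
  qed
  finally have "tr ?c \<le> tr (star x * x) powr (1 / r)" by (simp add: tr_one)
  then have "pn p x \<le> (tr (star x * x) powr (1 / r)) powr (1 / p)"
    unfolding pn_def using p by (intro powr_mono2 tr_fc_powr_nonneg psd_square) auto
  then show ?thesis using p tr_nonneg[OF psd_square, of x] by (simp add: powr_powr r_def pn_two powr_half_sqrt)
qed simp

lemma pn_powr_le:
  assumes p: "2 \<le> p"
  shows "pn p x powr p \<le> norm x powr (p - 2) * tr (star x * x)"
proof -
  have c: "continuous_on {0..} (\<lambda>t :: real. t powr (p / 2))" using p by (auto intro: continuous_on_powr_nonneg)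
  have "tr (fc (\<lambda>t. t powr (p / 2)) (star x * x)) \<le> tr (fc (\<lambda>t. norm x powr (p - 2) * t) (star x * x))"
  proof (rule tr_fc_mono[OF psd_square c])
    fix t :: real assume t: "0 \<le> t" "t \<le> norm (star x * x)"
    show "t powr (p / 2) \<le> norm x powr (p - 2) * t"
    proof (cases "t = 0")
      case False
      have "t powr (p / 2) = t powr ((p - 2) / 2) * t powr 1"
        using False by (simp add: powr_add[symmetric] field_simps del: powr_one powr_one')
      also have "\<dots> \<le> (norm x powr 2) powr ((p - 2) / 2) * t powr 1"
        using t p by (intro mult_right_mono powr_mono2) (auto simp: norm_star_mult power2_eq_square)
      also have "(norm x powr 2) powr ((p - 2) / 2) = norm x powr (p - 2)"
        unfolding powr_powr by (rule arg_cong[of _ _ "\<lambda>r. norm x powr r"]) simp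
      finally show ?thesis using t by simp
    qed simp
  qed (intro continuous_intros)
  then show ?thesis
    using p by (simp add: pn_powr fc_scale[OF psd_square continuous_on_id] fc_id[OF psd_square] tr.scaleR)
qed

text \<open>For \<open>p \<le> 2\<close> the 2-norm dominates; for larger \<open>p\<close> the bound
  in operator norm supplies the missing power \<open>p - 2\<close>.\<close>

lemma pn_tendsto_zero:
  assumes p: "1 < p" and K: "\<And>n. norm (X n) \<le> K" and lim: "(\<lambda>n. tr (star (X n) * X n)) \<longlonglongrightarrow> 0"
  shows "(\<lambda>n. pn p (X n)) \<longlonglongrightarrow> 0"
proof (cases "p \<le> 2")
  case True
  have "(\<lambda>n. sqrt (tr (star (X n) * X n))) \<longlonglongrightarrow> sqrt 0" by (rule tendsto_real_sqrt[OF lim])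
  then have "(\<lambda>n. pn 2 (X n)) \<longlonglongrightarrow> 0" by (simp add: pn_two)
  then show ?thesis
    by (rule tendsto_sandwich[OF _ _ tendsto_const, rotated 2]) (auto intro!: always_eventually pn_le_two p True)
next
  case False
  have "(\<lambda>n. (K powr (p - 2) * tr (star (X n) * X n)) powr (1 / p)) \<longlonglongrightarrow> (K powr (p - 2) * 0) powr (1 / p)"
    using p by (intro tendsto_powr' tendsto_mult tendsto_const lim)
      (auto intro!: disjI2 always_eventually mult_nonneg_nonneg tr_nonneg psd_square)
  then have l: "(\<lambda>n. (K powr (p - 2) * tr (star (X n) * X n)) powr (1 / p)) \<longlonglongrightarrow> 0" using p by simp
  have b: "pn p (X n) \<le> (K powr (p - 2) * tr (star (X n) * X n)) powr (1 / p)" for n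
  proof -
    have "pn p (X n) powr p \<le> norm (X n) powr (p - 2) * tr (star (X n) * X n)"
      using False by (intro pn_powr_le) simp
    also have "\<dots> \<le> K powr (p - 2) * tr (star (X n) * X n)"
      using K False by (intro mult_right_mono powr_mono2 tr_nonneg psd_square) auto
    finally have "(pn p (X n) powr p) powr (1 / p) \<le> (K powr (p - 2) * tr (star (X n) * X n)) powr (1 / p)"
      using p by (intro powr_mono2) auto
    then show ?thesis using p by (simp add: powr_powr)
  qed
  show ?thesis
    by (rule tendsto_sandwich[OF _ _ tendsto_const l]) (auto intro!: always_eventually b)
qed

end

section \<open>Group algebras in tracial algebras\<close>

definition finite_support :: "'g set \<Rightarrow> ('g \<Rightarrow> complex) \<Rightarrow> bool" where
  "finite_support H f \<longleftrightarrow> finite {g. f g \<noteq> 0} \<and> {g. f g \<noteq> 0} \<subseteq> H"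

definition fsum :: "('g \<Rightarrow> 'a::op_algebra) \<Rightarrow> ('g \<Rightarrow> complex) \<Rightarrow> 'a" where
  "fsum lam f = (\<Sum>g | f g \<noteq> 0. ofc (f g) * lam g)"

lemma fsum_superset:
  assumes "finite F" "{g. f g \<noteq> 0} \<subseteq> F"
  shows "fsum lam f = (\<Sum>g\<in>F. ofc (f g) * lam g)"
  unfolding fsum_def by (rule sum.mono_neutral_left) (use assms in auto)

lemma finite_support_mono: "finite_support H f \<Longrightarrow> H \<subseteq> H' \<Longrightarrow> finite_support H' f"
  by (auto simp: finite_support_def)

lemma finite_support_add:
  assumes "finite_support H f" "finite_support H f'"
  shows "finite_support H (\<lambda>g. f g + f' g)"
proof -
  have sub: "{g. f g + f' g \<noteq> 0} \<subseteq> {g. f g \<noteq> 0} \<union> {g. f' g \<noteq> 0}" by auto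
  then have "finite {g. f g + f' g \<noteq> 0}" using assms unfolding finite_support_def by (meson finite_UnI finite_subset)
  then show ?thesis using sub assms by (auto simp: finite_support_def)
qed

lemma finite_support_mult:
  assumes "finite_support H f"
  shows "finite_support H (\<lambda>g. c g * f g)"
proof -
  have sub: "{g. c g * f g \<noteq> 0} \<subseteq> {g. f g \<noteq> 0}" by auto
  then have "finite {g. c g * f g \<noteq> 0}" using assms unfolding finite_support_def by (meson finite_subset)
  then show ?thesis using sub assms by (auto simp: finite_support_def)
qed

lemma fsum_add:
  assumes "finite_support H f" "finite_support H f'"
  shows "fsum lam (\<lambda>g. f g + f' g) = fsum lam f + fsum lam f'"
proof -
  let ?F = "{g. f g \<noteq> 0} \<union> {g. f' g \<noteq> 0}"
  have F: "finite ?F" using assms by (auto simp: finite_support_def)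
  have "fsum lam (\<lambda>g. f g + f' g) = (\<Sum>g\<in>?F. ofc (f g + f' g) * lam g)"
    "fsum lam f = (\<Sum>g\<in>?F. ofc (f g) * lam g)" "fsum lam f' = (\<Sum>g\<in>?F. ofc (f' g) * lam g)"
    by (rule fsum_superset[OF F], auto)+
  then show ?thesis by (simp add: ofc_add distrib_right sum.distrib)
qed

lemma fsum_scale: "finite_support H f \<Longrightarrow> fsum lam (\<lambda>g. c * f g) = ofc c * fsum lam f"
  using fsum_superset[of "{g. f g \<noteq> 0}" "\<lambda>g. c * f g" lam]
  by (auto simp: finite_support_def fsum_def ofc_mult sum_distrib_left mult.assoc intro: sum.cong)

lemma fsum_single: "fsum lam (\<lambda>h. if h = g then c else 0) = ofc c * lam g"
  by (rule trans[OF fsum_superset[of "{g}"]]) auto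

text \<open>
  \<open>multiplier_form\<close> is a substitute for the action of a multiplier on all of \<open>L\<^sub>2\<close>, which interpolation
  needs: the form \<open>tr (y * T x)\<close> is defined for all \<open>x\<close>, although \<open>T x\<close> need not lie in the algebra.
\<close>

locale group_trace = tracial tr + G: group G
  for tr :: "'a::op_algebra \<Rightarrow> real" and G :: "('g, 'b) monoid_scheme" (structure) +
  fixes lam :: "'g \<Rightarrow> 'a"
  assumes lam_one: "lam \<one> = 1"
    and lam_mult: "g \<in> carrier G \<Longrightarrow> h \<in> carrier G \<Longrightarrow> lam (g \<otimes> h) = lam g * lam h"
    and star_lam: "g \<in> carrier G \<Longrightarrow> star (lam g) = lam (inv g)"
    and tr_lam: "g \<in> carrier G \<Longrightarrow> g \<noteq> \<one> \<Longrightarrow> tr (ofc c * lam g) = 0"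
    and fsum_dense: "0 < e \<Longrightarrow> \<exists>f. finite_support (carrier G) f \<and>
      tr (star (x - fsum lam f) * (x - fsum lam f)) < e"
    and multiplier_form: "(\<And>g. \<bar>m g\<bar> \<le> 1) \<Longrightarrow> \<exists>\<beta>. bounded_bilinear \<beta> \<and>
      (\<forall>y x. \<beta> (imunit * y) x = \<beta> y (imunit * x)) \<and>
      (\<forall>y f. finite_support (carrier G) f \<longrightarrow>
        \<beta> y (fsum lam f) = tr (y * fsum lam (\<lambda>g. of_real (m g) * f g))) \<and>
      (\<forall>y x. \<bar>\<beta> y x\<bar> \<le> pn 2 y * pn 2 x)"
begin

section \<open>The complex trace and Fourier coefficients\<close>

definition trc :: "'a \<Rightarrow> complex" where
  "trc x = Complex (tr x) (- tr (imunit * x))"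

lemma trc_add: "trc (x + y) = trc x + trc y"
  by (simp add: trc_def complex_eq_iff tr.add distrib_left)

lemma trc_ofc: "trc (ofc c * x) = c * trc x"
proof -
  have "imunit * (imunit * x) = - x" by (simp add: imunit_square flip: mult.assoc)
  then show ?thesis
    by (simp add: trc_def ofc_def complex_eq_iff algebra_simps tr.add tr.diff tr.scaleR tr.neg)
qed

lemma trc_sum: "trc (sum f A) = (\<Sum>i\<in>A. trc (f i))"
proof -
  have "trc 0 = 0" by (simp add: trc_def tr.zero complex_eq_iff)
  then show ?thesis by (induction A rule: infinite_finite_induct) (simp_all add: trc_add)
qed

lemma trc_comm: "trc (x * y) = trc (y * x)"
proof -
  have "tr (imunit * (x * y)) = tr (imunit * (y * x))"
    using tr_comm[of "imunit * x" y] ofc_left_commute[of y \<i> x] by (simp add: ofc_ii mult.assoc)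
  then show ?thesis using tr_comm[of x y] by (simp add: trc_def)
qed

lemma trc_star: "trc (star x) = cnj (trc x)"
proof -
  have "tr (imunit * star x) = - tr (imunit * x)"
    using tr_star[of "x * imunit"] by (simp add: star_mult star_imunit tr.neg imunit_comm)
  then show ?thesis by (simp add: trc_def complex_eq_iff tr_star)
qed

lemma tr_imunit: "tr imunit = 0"
  using tr_star[of imunit] by (simp add: star_imunit tr.neg)

lemma trc_lam: "g \<in> carrier G \<Longrightarrow> trc (lam g) = (if g = \<one> then 1 else 0)"
  using tr_lam[of g 1] tr_lam[of g \<i>]
  by (auto simp: trc_def complex_eq_iff lam_one tr_one tr_imunit ofc_ii)

text \<open>The Fourier coefficient at \<open>g\<close>. Its value 0 off the carrier makes
  \<open>co_fsum\<close> an equality of functions.\<close>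

definition co :: "'a \<Rightarrow> 'g \<Rightarrow> complex" where
  "co x g = (if g \<in> carrier G then trc (lam (inv g) * x) else 0)"

lemma co_add: "co (x + y) g = co x g + co y g"
  by (simp add: co_def distrib_left trc_add)

lemma co_ofc: "co (ofc c * x) g = c * co x g"
  by (simp add: co_def ofc_left_commute trc_ofc)

lemma co_sum: "co (sum f A) g = (\<Sum>i\<in>A. co (f i) g)"
  by (simp add: co_def sum_distrib_left trc_sum)

lemma co_lam: "h \<in> carrier G \<Longrightarrow> co (lam h) g = (if g = h then 1 else 0)"
proof (cases "g \<in> carrier G")
  case True
  assume h: "h \<in> carrier G"
  have "inv g \<otimes> h = \<one> \<longleftrightarrow> g = h"
    using True h by (metis G.inv_closed G.inv_equality G.inv_inv G.l_inv)
  then show ?thesis using True h by (simp add: co_def trc_lam flip: lam_mult)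
qed (auto simp: co_def)

lemma co_fsum:
  assumes "finite_support (carrier G) f"
  shows "co (fsum lam f) = f"
proof
  fix g
  have fin: "finite {g. f g \<noteq> 0}" "{g. f g \<noteq> 0} \<subseteq> carrier G" using assms by (auto simp: finite_support_def)
  have "co (fsum lam f) g = (\<Sum>h | f h \<noteq> 0. f h * (if g = h then 1 else 0))"
    unfolding fsum_def co_sum by (rule sum.cong) (use fin in \<open>auto simp: co_ofc co_lam\<close>)
  also have "\<dots> = (\<Sum>h | f h \<noteq> 0. if g = h then f h else 0)" by (rule sum.cong) auto
  also have "\<dots> = f g" using fin by (simp add: sum.delta')
  finally show "co (fsum lam f) g = f g" .
qed

section \<open>The algebra of finite sums\<close>

definition alg :: "'g set \<Rightarrow> 'a set" where
  "alg H = {fsum lam f |f. finite_support H f}"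

abbreviation CG :: "'a set" where "CG \<equiv> alg (carrier G)"

lemma alg_mono: "H \<subseteq> H' \<Longrightarrow> alg H \<subseteq> alg H'"
  unfolding alg_def using finite_support_mono by blast

lemma fsum_co: "x \<in> CG \<Longrightarrow> fsum lam (co x) = x"
  by (auto simp: alg_def co_fsum)

lemma finite_support_co: "x \<in> alg H \<Longrightarrow> H \<subseteq> carrier G \<Longrightarrow> finite_support H (co x)"
  using co_fsum finite_support_mono by (force simp: alg_def)

lemma algI: "finite_support H f \<Longrightarrow> fsum lam f \<in> alg H"
  by (auto simp: alg_def)

lemma CG_eqI: "x \<in> CG \<Longrightarrow> y \<in> CG \<Longrightarrow> (\<And>g. g \<in> carrier G \<Longrightarrow> co x g = co y g) \<Longrightarrow> x = y"
  by (metis (full_types) co_def ext fsum_co)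

lemma alg_add: "x \<in> alg H \<Longrightarrow> y \<in> alg H \<Longrightarrow> x + y \<in> alg H"
proof -
  assume "x \<in> alg H" "y \<in> alg H"
  then obtain f f' where "x = fsum lam f" "y = fsum lam f'" "finite_support H f" "finite_support H f'"
    by (auto simp: alg_def)
  then show ?thesis using fsum_add[of H f f' lam] algI[OF finite_support_add[of H f f']] by simp
qed

lemma alg_ofc: "x \<in> alg H \<Longrightarrow> ofc c * x \<in> alg H"
proof -
  assume "x \<in> alg H"
  then obtain f where "x = fsum lam f" "finite_support H f" by (auto simp: alg_def)
  then show ?thesis using fsum_scale[of H f lam c] algI[OF finite_support_mult[of H f "\<lambda>_. c"]] by simp
qed

lemma alg_lam: "g \<in> H \<Longrightarrow> lam g \<in> alg H"
  using fsum_single[of lam g 1] algI[of H "\<lambda>h. if h = g then 1 else 0"]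
  by (auto simp: finite_support_def)

lemma alg_zero: "0 \<in> alg H"
  using algI[of H "\<lambda>_. 0"] by (simp add: finite_support_def fsum_def)

lemma alg_sum: "(\<And>i. i \<in> A \<Longrightarrow> f i \<in> alg H) \<Longrightarrow> sum f A \<in> alg H"
  by (induction A rule: infinite_finite_induct) (auto simp: alg_zero alg_add)

lemma alg_scaleR: "x \<in> alg H \<Longrightarrow> r *\<^sub>R x \<in> alg H"
  using alg_ofc[of x H "of_real r"] by simp

lemma alg_diff: "x \<in> alg H \<Longrightarrow> y \<in> alg H \<Longrightarrow> x - y \<in> alg H"
  using alg_add[of x H "(-1) *\<^sub>R y"] alg_scaleR[of y H "-1"] by simp

lemma fsum_induct [consumes 1, case_names add scale]:
  assumes "x \<in> alg H"
  obtains F c where "finite F" "F \<subseteq> H" "x = (\<Sum>g\<in>F. ofc (c g) * lam g)"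
  using assms unfolding alg_def finite_support_def fsum_def by blast

lemma alg_mult:
  assumes H: "subgroup H G" and x: "x \<in> alg H" and y: "y \<in> alg H"
  shows "x * y \<in> alg H"
proof -
  have sub: "H \<subseteq> carrier G" using H by (rule subgroup.subset)
  obtain F c where F: "F \<subseteq> H" "x = (\<Sum>g\<in>F. ofc (c g) * lam g)" using x by (rule fsum_induct)
  obtain F' d where F': "F' \<subseteq> H" "y = (\<Sum>g\<in>F'. ofc (d g) * lam g)" using y by (rule fsum_induct)
  have "ofc (c g) * lam g * (ofc (d h) * lam h) \<in> alg H" if "g \<in> F" "h \<in> F'" for g h
  proof -
    have gh: "g \<in> H" "h \<in> H" using that F F' by auto
    then have gc: "g \<in> carrier G" "h \<in> carrier G" using sub by auto
    have "ofc (c g) * lam g * (ofc (d h) * lam h) = ofc (c g) * (ofc (d h) * lam (g \<otimes> h))"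
      using ofc_left_commute[of "lam g" "d h" "lam h"] by (simp add: mult.assoc lam_mult[OF gc])
    also have "\<dots> \<in> alg H"
      using gh H by (intro alg_ofc alg_lam subgroup.m_closed)
    finally show ?thesis .
  qed
  then show ?thesis unfolding F F' sum_product by (intro alg_sum)
qed

lemma alg_star:
  assumes H: "subgroup H G" and x: "x \<in> alg H"
  shows "star x \<in> alg H"
proof -
  have sub: "H \<subseteq> carrier G" using H by (rule subgroup.subset)
  obtain F c where F: "F \<subseteq> H" "x = (\<Sum>g\<in>F. ofc (c g) * lam g)" using x by (rule fsum_induct)
  have "star (ofc (c g) * lam g) \<in> alg H" if "g \<in> F" for g
  proof -
    have g: "g \<in> H" using that F by auto
    have "star (ofc (c g) * lam g) = ofc (cnj (c g)) * lam (inv g)"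
      using g sub by (auto simp: star_mult star_ofc star_lam ofc_comm)
    also have "\<dots> \<in> alg H" using g H by (intro alg_ofc alg_lam subgroup.m_inv_closed)
    finally show ?thesis .
  qed
  then show ?thesis unfolding F star_sum by (intro alg_sum)
qed

lemma alg_power:
  assumes "subgroup H G" "x \<in> alg H"
  shows "x ^ n \<in> alg H"
  using alg_lam[OF subgroup.one_closed[OF assms(1)]] by (induction n) (auto simp: lam_one intro: alg_mult assms)

lemmas CG_intros = alg_add alg_diff alg_mult[OF G.subgroup_self] alg_star[OF G.subgroup_self]
  alg_power[OF G.subgroup_self] alg_scaleR

lemma co_mult:
  assumes "x \<in> CG" "g \<in> carrier G"
  shows "co (x * y) g = (\<Sum>h | co x h \<noteq> 0. co x h * co y (inv h \<otimes> g))"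
proof -
  have fin: "{h. co x h \<noteq> 0} \<subseteq> carrier G" by (auto simp: co_def)
  have "x * y = fsum lam (co x) * y" by (simp add: fsum_co[OF assms(1)])
  also have "\<dots> = (\<Sum>h | co x h \<noteq> 0. ofc (co x h) * (lam h * y))"
    by (simp add: fsum_def sum_distrib_right mult.assoc)
  finally have "co (x * y) g = (\<Sum>h | co x h \<noteq> 0. co x h * co (lam h * y) g)"
    by (simp add: co_sum co_ofc)
  also have "\<dots> = (\<Sum>h | co x h \<noteq> 0. co x h * co y (inv h \<otimes> g))"
  proof (rule sum.cong[OF refl])
    fix h assume "h \<in> {h. co x h \<noteq> 0}"
    then have h: "h \<in> carrier G" using fin by auto
    have "lam (inv g) * (lam h * y) = lam (inv (inv h \<otimes> g)) * y"
      using h assms(2) by (simp add: G.inv_mult_group lam_mult mult.assoc)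
    then show "co x h * co (lam h * y) g = co x h * co y (inv h \<otimes> g)"
      using h assms(2) by (simp add: co_def)
  qed
  finally show ?thesis .
qed

lemma co_star: "g \<in> carrier G \<Longrightarrow> co (star x) g = cnj (co x (inv g))"
  using trc_comm[of x "lam g"] trc_star[of "x * lam g"]
  by (simp add: co_def star_mult star_lam)

lemma co_mult_star:
  assumes "x \<in> CG" "g \<in> carrier G"
  shows "co (x * star y) g = (\<Sum>h | co x h \<noteq> 0. co x h * cnj (co y (inv g \<otimes> h)))"
  unfolding co_mult[OF assms]
proof (rule sum.cong[OF refl])
  fix h assume "h \<in> {h. co x h \<noteq> 0}"
  then have h: "h \<in> carrier G" by (auto simp: co_def split: if_splits)
  then show "co x h * co (star y) (inv h \<otimes> g) = co x h * cnj (co y (inv g \<otimes> h))"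
    using assms(2) by (simp add: co_star G.inv_mult_group)
qed

lemma tr_eq_co: "tr x = Re (co x \<one>)"
  by (simp add: co_def lam_one trc_def)

section \<open>Multipliers on finite sums\<close>

text \<open>Meaningful on finite sums; if the new coefficients have infinite support, the sum in
  \<open>fsum\<close> takes its default value 0.\<close>

definition mul :: "('g \<Rightarrow> real) \<Rightarrow> 'a \<Rightarrow> 'a" where
  "mul m x = fsum lam (\<lambda>g. of_real (m g) * co x g)"

lemma mul_CG: "x \<in> CG \<Longrightarrow> mul m x \<in> CG"
  unfolding mul_def by (intro algI finite_support_mult finite_support_co order_refl)

lemma co_mul: "x \<in> CG \<Longrightarrow> co (mul m x) g = of_real (m g) * co x g"
  by (simp add: mul_def co_fsum finite_support_mult finite_support_co)

text \<open>In the coefficient at the unit, \<open>h\<close> is paired with \<open>inv h\<close>, so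
  transposition under the trace reflects the symbol. This is how bounds reach the dual
  exponents.\<close>

lemma tr_mult_mul:
  assumes "x \<in> CG" "y \<in> CG"
  shows "tr (y * mul m x) = tr (mul (\<lambda>g. m (inv g)) y * x)"
proof -
  have supp: "{h. co y h \<noteq> 0} \<subseteq> carrier G" by (auto simp: co_def)
  have fin: "finite {h. co y h \<noteq> 0}"
    using finite_support_co[OF assms(2)] by (simp add: finite_support_def)
  have "co (y * mul m x) \<one> = (\<Sum>h | co y h \<noteq> 0. co y h * (of_real (m (inv h)) * co x (inv h)))"
    using supp by (subst co_mult[OF assms(2)]) (auto simp: co_mul[OF assms(1)] intro!: sum.cong)
  also have "\<dots> = co (mul (\<lambda>g. m (inv g)) y * x) \<one>"
    using supp fin
    by (subst co_mult[OF mul_CG[OF assms(2)]])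
      (auto simp: co_mul[OF assms(2)] intro!: sum.mono_neutral_cong_right)
  finally show ?thesis by (simp add: tr_eq_co)
qed

text \<open>The symbol is real, so conjugating by \<open>star\<close> only reflects it; the
  reflected multiplier therefore inherits every norm bound of the original one.\<close>

lemma mul_inv_eq_star: "x \<in> CG \<Longrightarrow> mul (\<lambda>g. m (inv g)) x = star (mul m (star x))"
  by (rule CG_eqI) (simp_all add: CG_intros mul_CG co_mul co_star)

lemma pn_mul_inv: "0 < p \<Longrightarrow> x \<in> CG \<Longrightarrow> pn p (mul (\<lambda>g. m (inv g)) x) = pn p (mul m (star x))"
  by (simp add: mul_inv_eq_star pn_star)

lemma tr_star_mult_self:
  assumes "x \<in> CG"
  shows "tr (star x * x) = (\<Sum>h | co x h \<noteq> 0. (cmod (co x h))\<^sup>2)"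
proof -
  have supp: "h \<in> carrier G" if "co x h \<noteq> 0" for h using that by (auto simp: co_def split: if_splits)
  have "tr (star x * x) = Re (co (x * star x) \<one>)" using tr_comm[of "star x" x] by (simp add: tr_eq_co)
  also have "co (x * star x) \<one> = (\<Sum>h | co x h \<noteq> 0. of_real ((cmod (co x h))\<^sup>2))"
    using supp by (subst co_mult_star[OF assms]) (auto simp del: of_real_power simp flip: complex_norm_square intro!: sum.cong)
  finally show ?thesis by simp
qed

end

context group_trace
begin

section \<open>Density of finite sums\<close>

lemma alg_ev:
  assumes "subgroup H G" "x \<in> alg H"
  shows "ev q x \<in> alg H"
  unfolding ev_def by (intro alg_sum alg_scaleR alg_power assms)

text \<open>The inverse of \<open>1 + s *\<^sub>R a\<close>, obtained from the calculus.\<close>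

definition resolvent :: "real \<Rightarrow> 'a \<Rightarrow> 'a" where
  "resolvent s a = fc (\<lambda>t. 1 / (1 + s * t)) a"

context
  fixes s :: real
  assumes s: "0 < s"
begin

lemma resolvent_cont: "continuous_on {0..} (\<lambda>t. 1 / (1 + s * t))"
  using s by (intro continuous_intros) (auto simp: add_nonneg_eq_0_iff)

lemma resolvent_right: "psd a \<Longrightarrow> (1 + s *\<^sub>R a) * resolvent s a = 1"
proof -
  assume a: "psd a"
  have c: "continuous_on {0..} (\<lambda>t. 1 + s * t)" by (intro continuous_intros)
  have "1 + s *\<^sub>R a = fc (\<lambda>t. 1 + s * t) a"
    using fc_add[OF a continuous_on_const continuous_on_mult[OF continuous_on_const continuous_on_id], of 1 s]
    by (simp add: fc_const[OF a] fc_id[OF a] fc_scale[OF a continuous_on_id])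
  then have "(1 + s *\<^sub>R a) * resolvent s a = fc (\<lambda>t. (1 + s * t) * (1 / (1 + s * t))) a"
    unfolding resolvent_def by (simp only: fc_mult[OF a c resolvent_cont])
  also have "\<dots> = fc (\<lambda>_. 1) a"
    by (rule fc_cong) (use s in \<open>auto simp: add_nonneg_eq_0_iff\<close>)
  finally show ?thesis by (simp add: fc_const[OF a])
qed

lemma resolvent_left: "psd a \<Longrightarrow> resolvent s a * (1 + s *\<^sub>R a) = 1"
proof -
  assume a: "psd a"
  have "resolvent s a * (1 + s *\<^sub>R a) = (1 + s *\<^sub>R a) * resolvent s a"
    unfolding resolvent_def by (rule fc_intertwine[OF a a resolvent_cont]) (simp add: algebra_simps)
  then show ?thesis by (simp add: resolvent_right[OF a])
qed

lemma norm_resolvent: "psd a \<Longrightarrow> norm (resolvent s a) \<le> 1"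
  unfolding resolvent_def by (rule norm_fc_le[OF _ resolvent_cont]) (use s in \<open>auto simp: divide_le_eq\<close>)

lemma resolvent_intertwine: "x * resolvent s (star x * x) = resolvent s (x * star x) * x"
  unfolding resolvent_def
  using psd_square[of "star x"] by (intro fc_intertwine[symmetric] psd_square resolvent_cont) (simp_all add: star_star mult.assoc)

text \<open>The squared absolute value is the function \<open>t / (1 + s t)^2\<close> of
  \<open>star x * x\<close>, which is at most \<open>1 / s\<close> everywhere. The bound does not
  depend on \<open>x\<close>.\<close>

lemma norm_mult_resolvent: "norm (x * resolvent s (star x * x)) \<le> sqrt (1 / s)"
proof -
  let ?a = "star x * x" and ?f = "\<lambda>t. 1 / (1 + s * t)"
  have c: "continuous_on {0..} (\<lambda>t. t * ?f t)" by (intro continuous_on_mult continuous_on_id resolvent_cont)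
  have "star (x * resolvent s ?a) * (x * resolvent s ?a) = resolvent s ?a * (?a * resolvent s ?a)"
    unfolding resolvent_def by (simp add: star_mult star_fc[OF psd_square resolvent_cont] mult.assoc)
  also have "\<dots> = fc (\<lambda>t. ?f t * (t * ?f t)) ?a"
    unfolding fc_mult[OF psd_square resolvent_cont c] fc_mult[OF psd_square continuous_on_id resolvent_cont]
      fc_id[OF psd_square] resolvent_def ..
  also have "norm \<dots> \<le> 1 / s"
  proof (rule norm_fc_le[OF psd_square continuous_on_mult[OF resolvent_cont c]])
    fix t :: real assume t: "0 \<le> t"
    define D where "D = (1 + s * t) * (1 + s * t)"
    have "s * t \<le> D" using s t by (simp add: D_def algebra_simps)
    moreover have "0 < D" using s t by (simp add: D_def add_pos_nonneg)
    ultimately have "t / D \<le> 1 / s" using s by (simp add: pos_divide_le_eq pos_le_divide_eq mult.commute)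
    then show "\<bar>?f t * (t * ?f t)\<bar> \<le> 1 / s" using s t by (simp add: D_def)
  qed
  finally have "(norm (x * resolvent s ?a))\<^sup>2 \<le> 1 / s" by (simp add: norm_star_mult power2_eq_square)
  then show ?thesis by (rule real_le_rsqrt)
qed

text \<open>A resolvent identity in which \<open>y - x\<close> or its adjoint occurs once in each
  term, between factors bounded in terms of \<open>s\<close> alone. With the ideal property it gives
  a Lipschitz estimate.\<close>

lemma resolvent_diff:
  "y * resolvent s (star y * y) - x * resolvent s (star x * x) =
    resolvent s (y * star y) * (y - x) * resolvent s (star x * x)
    - s *\<^sub>R ((y * resolvent s (star y * y)) * star (y - x) * (x * resolvent s (star x * x)))"
proof -
  let ?r = "resolvent s (star x * x)" and ?l = "resolvent s (y * star y)"
  have psd: "psd (y * star y)" using psd_square[of "star y"] by (simp add: star_star)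
  \<comment> \<open>Insert \<open>1 = (1 + s *\<^sub>R (star x * x)) * ?r\<close> after the first
    term and \<open>1 = ?l * (1 + s *\<^sub>R (y * star y))\<close> before the second.\<close>
  have "?l * y - x * ?r = ?l * y * ((1 + s *\<^sub>R (star x * x)) * ?r) - ?l * (1 + s *\<^sub>R (y * star y)) * x * ?r"
    by (simp only: resolvent_right[OF psd_square] resolvent_left[OF psd] mult_1_left mult_1_right)
  also have "\<dots> = ?l * (y - x) * ?r - s *\<^sub>R (?l * y * star (y - x) * (x * ?r))"
    by (simp add: algebra_simps star_diff)
  finally show ?thesis by (simp only: resolvent_intertwine[of y])
qed

end

text \<open>Both terms of \<open>resolvent_diff\<close> contribute at most
  \<open>pn 2 (y - x)\<close>; in the second one \<open>s\<close> cancels two factors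
  \<open>sqrt (1 / s)\<close>, so the constant is independent of \<open>s\<close>.\<close>

lemma pn_two_resolvent_diff:
  assumes s: "0 < s"
  shows "pn 2 (y * resolvent s (star y * y) - x * resolvent s (star x * x)) \<le> 2 * pn 2 (y - x)"
proof -
  let ?r = "resolvent s (star x * x)" and ?l = "resolvent s (y * star y)"
  let ?u = "y * resolvent s (star y * y)" and ?v = "x * ?r"
  have psd: "psd (y * star y)" using psd_square[of "star y"] by (simp add: star_star)
  have "pn 2 (?l * (y - x) * ?r) \<le> norm ?l * pn 2 (y - x) * norm ?r"
    by (rule order_trans[OF pn_mult_right mult_right_mono[OF pn_mult_left]]) simp_all
  also have "\<dots> \<le> 1 * pn 2 (y - x) * 1"
    by (intro mult_mono norm_resolvent s psd psd_square) auto
  finally have 1: "pn 2 (?l * (y - x) * ?r) \<le> pn 2 (y - x)" by simp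
  have "pn 2 (?u * star (y - x) * ?v) \<le> norm ?u * pn 2 (star (y - x)) * norm ?v"
    by (rule order_trans[OF pn_mult_right mult_right_mono[OF pn_mult_left]]) simp_all
  also have "\<dots> \<le> sqrt (1 / s) * pn 2 (y - x) * sqrt (1 / s)"
    using s by (intro mult_mono norm_mult_resolvent) (auto simp: pn_star)
  also have "\<dots> = (sqrt (1 / s) * sqrt (1 / s)) * pn 2 (y - x)" by (simp only: mult_ac)
  also have "sqrt (1 / s) * sqrt (1 / s) = 1 / s" using s by simp
  finally have "s * pn 2 (?u * star (y - x) * ?v) \<le> pn 2 (y - x)" using s by (simp add: field_simps)
  then have 2: "pn 2 (s *\<^sub>R (?u * star (y - x) * ?v)) \<le> pn 2 (y - x)" using s by (simp add: pn_scaleR)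
  show ?thesis unfolding resolvent_diff[OF s]
    using pn_triangle_diff[of 2 "?l * (y - x) * ?r" "s *\<^sub>R (?u * star (y - x) * ?v)"] 1 2 by simp
qed

text \<open>
  A Kaplansky-type argument: \<open>x (1 + s x\<^sup>* x)\<^sup>-\<^sup>1\<close> is close to \<open>x\<close> in norm, and it depends continuously
  on \<open>x\<close> for the \<open>L\<^sub>2\<close>-norm while staying bounded in operator norm, so that it may be approximated
  by replacing \<open>x\<close> with a finite sum.
\<close>

lemma CG_dense:
  assumes p: "1 < p" and e: "0 < e"
  obtains y where "y \<in> CG" "pn p (x - y) < e" "pn 2 (x - y) < e"
proof -
  \<comment> \<open>\<open>x - Z x\<close> is \<open>s\<close> times a product of norm at most the
    cube of \<open>norm x\<close>; the summand 1 avoids a zero denominator.\<close>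
  define s where "s = e / (3 * ((norm x) ^ 3 + 1))"
  have s: "0 < s" using e by (simp add: s_def add_nonneg_pos)
  define Z where "Z y = y * resolvent s (star y * y)" for y
  have 1: "norm (x - Z x) < e / 3"
  proof -
    let ?a = "star x * x"
    have "x - Z x = x * ((1 + s *\<^sub>R ?a) * resolvent s ?a) - x * resolvent s ?a"
      by (simp add: resolvent_right[OF s psd_square] Z_def)
    also have "\<dots> = s *\<^sub>R (x * (?a * resolvent s ?a))" by (simp add: algebra_simps)
    finally have "norm (x - Z x) = s * norm (x * (?a * resolvent s ?a))" using s by simp
    also have "norm (x * (?a * resolvent s ?a)) \<le> norm x * (norm ?a * norm (resolvent s ?a))"
      by (intro order_trans[OF norm_mult_ineq] mult_left_mono norm_mult_ineq) simp
    also have "\<dots> \<le> norm x * (norm ?a * 1)"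
      by (intro mult_left_mono norm_resolvent s psd_square) auto
    finally have "norm (x - Z x) \<le> s * (norm x) ^ 3"
      using s by (simp add: norm_star_mult power3_eq_cube)
    also have "\<dots> < e / 3"
    proof -
      have "e * (norm x) ^ 3 < e * ((norm x) ^ 3 + 1)" using e by (simp add: distrib_left)
      moreover have "0 < (norm x) ^ 3 + 1" by (simp add: add_nonneg_pos)
      ultimately show ?thesis using e by (simp add: s_def divide_less_eq algebra_simps)
    qed
    finally show ?thesis .
  qed
  have "\<exists>f. finite_support (carrier G) f \<and> tr (star (x - fsum lam f) * (x - fsum lam f)) < eps n" for n
    by (rule fsum_dense) simp
  then obtain f where f: "\<And>n. finite_support (carrier G) (f n)"
      "\<And>n. tr (star (x - fsum lam (f n)) * (x - fsum lam (f n))) < eps n" by metis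
  define Y where "Y n = fsum lam (f n)" for n
  have Y: "Y n \<in> CG" for n unfolding Y_def by (rule algI[OF f(1)])
  have l2: "(\<lambda>n. pn 2 (x - Y n)) \<longlonglongrightarrow> 0"
  proof -
    have "(\<lambda>n. sqrt (eps n)) \<longlonglongrightarrow> sqrt 0" by (rule tendsto_real_sqrt[OF eps_tendsto])
    then have l: "(\<lambda>n. sqrt (eps n)) \<longlonglongrightarrow> 0" by simp
    have b: "pn 2 (x - Y n) \<le> sqrt (eps n)" for n
      unfolding pn_two Y_def by (intro real_sqrt_le_mono less_imp_le f)
    show ?thesis by (rule tendsto_sandwich[OF _ _ tendsto_const l]) (auto intro!: always_eventually b)
  qed
  have l2': "(\<lambda>n. pn 2 (Z (Y n) - Z x)) \<longlonglongrightarrow> 0"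
  proof -
    have l: "(\<lambda>n. 2 * pn 2 (x - Y n)) \<longlonglongrightarrow> 0" using tendsto_mult_right_zero[OF l2] by simp
    have b: "pn 2 (Z (Y n) - Z x) \<le> 2 * pn 2 (x - Y n)" for n
      using pn_two_resolvent_diff[OF s, of "Y n" x] pn_diff_commute[of 2 "Y n" x] by (simp add: Z_def)
    show ?thesis by (rule tendsto_sandwich[OF _ _ tendsto_const l]) (auto intro!: always_eventually b)
  qed
  have bd: "norm (Z (Y n) - Z x) \<le> 2 * sqrt (1 / s)" for n
    using norm_triangle_ineq4[of "Z (Y n)" "Z x"] norm_mult_resolvent[OF s, of "Y n"] norm_mult_resolvent[OF s, of x]
    by (simp add: Z_def)
  have "(\<lambda>n. tr (star (Z (Y n) - Z x) * (Z (Y n) - Z x))) \<longlonglongrightarrow> 0"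
  proof -
    have "(\<lambda>n. (pn 2 (Z (Y n) - Z x))\<^sup>2) \<longlonglongrightarrow> 0\<^sup>2" by (intro tendsto_power l2')
    then show ?thesis by (simp add: pn_two tr_nonneg psd_square)
  qed
  from pn_tendsto_zero[OF p bd this] have "(\<lambda>n. pn p (Z (Y n) - Z x)) \<longlonglongrightarrow> 0" .
  then have "\<forall>\<^sub>F n in sequentially. pn p (Z (Y n) - Z x) < e / 3" "\<forall>\<^sub>F n in sequentially. pn 2 (Z (Y n) - Z x) < e / 3"
    using order_tendstoD(2)[of _ 0 sequentially "e / 3"] l2' e by auto
  then have "\<forall>\<^sub>F n in sequentially. pn p (Z (Y n) - Z x) < e / 3 \<and> pn 2 (Z (Y n) - Z x) < e / 3"
    by (rule eventually_conj)
  then obtain n where n: "pn p (Z (Y n) - Z x) < e / 3" "pn 2 (Z (Y n) - Z x) < e / 3"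
    unfolding eventually_sequentially by blast
  let ?y = "Y n"
  \<comment> \<open>The resolvent of a finite sum need not be a finite sum; a polynomial in its
    place leads back into \<open>CG\<close> at a small cost in operator norm.\<close>
  obtain q where "(\<lambda>k. ev (q k) (star ?y * ?y)) \<longlonglongrightarrow> resolvent s (star ?y * ?y)"
    using fc_approx_ex[OF psd_square resolvent_cont[OF s]] unfolding resolvent_def by (rule exE)
  then have "(\<lambda>k. norm (?y * ev (q k) (star ?y * ?y) - Z ?y)) \<longlonglongrightarrow> norm (?y * resolvent s (star ?y * ?y) - Z ?y)"
    by (intro tendsto_intros)
  then have "(\<lambda>k. norm (?y * ev (q k) (star ?y * ?y) - Z ?y)) \<longlonglongrightarrow> 0" by (simp add: Z_def)
  then have "\<forall>\<^sub>F k in sequentially. norm (?y * ev (q k) (star ?y * ?y) - Z ?y) < e / 3"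
    using order_tendstoD(2)[of _ 0 sequentially "e / 3"] e by auto
  then obtain k where k: "norm (?y * ev (q k) (star ?y * ?y) - Z ?y) < e / 3"
    unfolding eventually_sequentially by blast
  define w where "w = ?y * ev (q k) (star ?y * ?y)"
  have "w \<in> CG" unfolding w_def
    by (intro alg_mult alg_ev alg_star Y G.subgroup_self)
  moreover have "pn r (x - w) < e" if r: "1 < r" "pn r (Z ?y - Z x) < e / 3" for r
  proof -
    have "x - w = (x - Z x) - (Z ?y - Z x) - (w - Z ?y)" by simp
    then have "pn r (x - w) \<le> pn r (x - Z x) + pn r (Z ?y - Z x) + pn r (w - Z ?y)"
      using pn_triangle_diff[OF r(1), of "(x - Z x) - (Z ?y - Z x)" "w - Z ?y"]
        pn_triangle_diff[OF r(1), of "x - Z x" "Z ?y - Z x"] by simp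
    moreover have "pn r (x - Z x) < e / 3" "pn r (w - Z ?y) < e / 3"
      using pn_le_norm[of r "x - Z x"] pn_le_norm[of r "w - Z ?y"] 1 k r(1) by (auto simp: w_def)
    ultimately show ?thesis using r(2) by linarith
  qed
  ultimately show thesis using that p n by (metis one_less_numeral_iff semiring_norm(76))
qed

section \<open>Conditional expectations\<close>

lemma fc_powr_nat:
  assumes a: "psd (a :: 'a)" and n: "0 < n"
  shows "fc (\<lambda>t. t powr real n) a = a ^ n"
proof -
  have "fc (\<lambda>t. t powr real n) a = fc (\<lambda>t. t ^ n) a"
  proof (rule fc_cong)
    fix t :: real assume "0 \<le> t"
    then show "t powr real n = t ^ n" using n by (cases "t = 0") (simp_all add: powr_realpow)
  qed
  then show ?thesis using fc_power[OF a continuous_on_id, of n] by (simp add: fc_id[OF a])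
qed

lemma pn_even_powr:
  assumes n: "0 < n"
  shows "pn (2 * real n) x powr (2 * real n) = tr ((star x * x) ^ n)"
  using pn_powr[of "2 * real n" x] n fc_powr_nat[OF psd_square n, of x] by simp

lemma power_intertwine:
  fixes a b x :: 'a
  assumes "a * x = x * b"
  shows "a ^ k * x = x * b ^ k"
proof (induction k)
  case (Suc k)
  have "a ^ Suc k * x = a * (a ^ k * x)" by (simp add: mult.assoc)
  also have "\<dots> = a * x * b ^ k" by (simp add: Suc mult.assoc)
  also have "\<dots> = x * b ^ Suc k" by (simp add: assms mult.assoc)
  finally show ?case .
qed simp

text \<open>The product of this element with its adjoint is the power \<open>2 n - 1\<close> of
  \<open>star z * z\<close>, and \<open>(2 n - 1) * q = 2 n\<close>. So for even exponents the
  norming element is a polynomial in \<open>z\<close> and \<open>star z\<close>.\<close>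

lemma pn_even_dual:
  assumes n: "0 < n" and q: "conjugate (2 * real n) q"
  shows "pn q (star z * (z * star z) ^ (n - 1)) = pn (2 * real n) z powr (2 * real n - 1)"
proof -
  let ?p = "2 * real n"
  have pos: "0 < q" using conjugateD(4)[OF q] .
  have sw: "(star z * z) ^ k * star z = star z * (z * star z) ^ k" for k
    by (rule power_intertwine) (simp add: mult.assoc)
  define y where "y = star z * (z * star z) ^ (n - 1)"
  have "star y = (z * star z) ^ (n - 1) * z" by (simp add: y_def star_mult star_power star_star)
  then have "y * star y = star z * (z * star z) ^ (n - 1 + (n - 1)) * z"
    by (simp add: y_def power_add mult.assoc)
  also have "\<dots> = (star z * z) ^ Suc (n - 1 + (n - 1))"
    by (simp only: sw[symmetric] power_Suc2 mult.assoc)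
  also have "Suc (n - 1 + (n - 1)) = 2 * n - 1" using n by simp
  finally have "star (star y) * star y = (star z * z) ^ (2 * n - 1)" by (simp add: star_star)
  then have "pn q y = tr (fc (\<lambda>t. t powr (q / 2)) ((star z * z) ^ (2 * n - 1))) powr (1 / q)"
    using pn_star[OF pos, of y] by (simp add: pn_def)
  also have "(star z * z) ^ (2 * n - 1) = fc (\<lambda>t. t ^ (2 * n - 1)) (star z * z)"
    unfolding fc_power[OF psd_square continuous_on_id] fc_id[OF psd_square] ..
  also have "fc (\<lambda>t. t powr (q / 2)) \<dots> = fc (\<lambda>t. (t ^ (2 * n - 1)) powr (q / 2)) (star z * z)"
    using pos by (intro fc_compose psd_square continuous_intros continuous_on_powr_nonneg) auto
  also have "\<dots> = fc (\<lambda>t. t powr (?p / 2)) (star z * z)"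
  proof (rule fc_cong)
    fix t :: real assume t: "0 \<le> t"
    have "real (2 * n - 1) * (q / 2) = ?p / 2" using conjugateD(8)[OF q] n by (simp add: of_nat_diff)
    then show "(t ^ (2 * n - 1)) powr (q / 2) = t powr (?p / 2)"
      using t n by (cases "t = 0") (simp_all add: powr_powr flip: powr_realpow)
  qed
  finally have "pn q y = (pn ?p z powr ?p) powr (1 / q)" using pn_powr[of ?p z] n by simp
  also have "\<dots> = pn ?p z powr (?p - 1)"
  proof -
    have "?p / q = (?p - 1) * q / q" by (simp only: conjugateD(8)[OF q])
    also have "\<dots> = ?p - 1" using pos by simp
    finally have "?p * (1 / q) = ?p - 1" by simp
    then show ?thesis unfolding powr_powr by (simp only:)
  qed
  finally show ?thesis by (simp add: y_def)
qed

text \<open>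
  With \<open>z = E x\<close> and the dual element \<open>y = z\<^sup>* (z z\<^sup>*)\<^sup>n\<^sup>-\<^sup>1\<close>, which lies in the algebra of \<open>K\<close>, one has
  \<open>\<parallel>z\<parallel>\<^sub>2\<^sub>n\<^sup>2\<^sup>n = tr (z y) = tr (x y)\<close>, and Hoelder's inequality applies.
\<close>

lemma pn_conditional_expectation:
  assumes K: "subgroup K G" and x: "x \<in> CG" and n: "0 < n"
  shows "pn (2 * real n) (mul (indicator K) x) \<le> pn (2 * real n) x"
proof -
  let ?p = "2 * real n" and ?z = "mul (indicator K) x"
  have p1: "1 < ?p" using n by simp
  obtain q where q: "conjugate ?p q" using conjugate_exists[OF p1] by blast
  define y where "y = star ?z * (?z * star ?z) ^ (n - 1)"
  have sub: "K \<subseteq> carrier G" using K by (rule subgroup.subset)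
  have zK: "?z \<in> alg K"
  proof -
    have "finite_support (carrier G) (co x)" using finite_support_co[OF x] by simp
    then have "finite_support K (\<lambda>g. of_real (indicator K g) * co x g)"
      using finite_support_mult[of "carrier G" "co x"] by (auto simp: finite_support_def indicator_def split: if_splits)
    then show ?thesis unfolding mul_def by (rule algI)
  qed
  have yK: "y \<in> alg K" unfolding y_def by (intro alg_mult alg_star alg_power K zK)
  then have yCG: "y \<in> CG" using alg_mono[OF sub] by blast
  have supp: "h \<in> K" if "co y h \<noteq> 0" for h
    using finite_support_co[OF yK sub] that by (auto simp: finite_support_def)
  have "co (y * ?z) \<one> = co (y * x) \<one>"
    unfolding co_mult[OF yCG G.one_closed]
  proof (rule sum.cong[OF refl])
    fix h assume "h \<in> {h. co y h \<noteq> 0}"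
    then have "inv h \<in> K" "h \<in> carrier G" using supp sub K by (auto simp: subgroup.m_inv_closed)
    then show "co y h * co ?z (inv h \<otimes> \<one>) = co y h * co x (inv h \<otimes> \<one>)"
      using x by (simp add: co_mul)
  qed
  then have "tr (y * ?z) = tr (y * x)" by (simp only: tr_eq_co)
  then have zx: "tr (?z * y) = tr (x * y)" by (simp only: tr_comm[of _ y])
  have "tr (?z * y) = tr ((?z * star ?z) ^ n)"
  proof -
    have "?z * y = (?z * star ?z) ^ Suc (n - 1)" by (simp only: y_def mult.assoc power_Suc)
    then show ?thesis using n by simp
  qed
  also have "\<dots> = pn ?p ?z powr ?p"
    using pn_even_powr[OF n, of "star ?z"] n by (simp add: star_star pn_star)
  finally have "pn ?p ?z powr ?p = tr (x * y)" using zx by simp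
  also have "\<dots> \<le> pn ?p x * pn q y" by (rule abs_le_D1[OF Hoelder[OF q]])
  finally have le: "pn ?p ?z powr ?p \<le> pn ?p x * pn ?p ?z powr (?p - 1)"
    unfolding y_def pn_even_dual[OF n q] .
  show ?thesis
  proof (cases "pn ?p ?z = 0")
    case False
    then have z: "0 < pn ?p ?z" using pn_nonneg[of ?p ?z] by linarith
    have "pn ?p ?z powr ?p = pn ?p ?z * pn ?p ?z powr (?p - 1)"
      using z powr_add[of "pn ?p ?z" 1 "?p - 1"] by simp
    then show ?thesis using le z by simp
  qed simp
qed

end

section \<open>The Cotlar identity\<close>

lemma convex_combination_between:
  fixes a b x :: real
  assumes "a < x" "x < b"
  obtains t where "0 < t" "t < 1" "x = (1 - t) * a + t * b"
proof -
  define t where "t = (x - a) / (b - a)"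
  have "t * (b - a) = x - a" "0 < t" "t < 1" using assms by (simp_all add: t_def)
  then show thesis using that[of t] by (simp add: algebra_simps)
qed

locale cotlar_symbol = group_trace tr G lam
  for tr :: "'a::op_algebra \<Rightarrow> real" and G :: "('g, 'b) monoid_scheme" (structure) and lam +
  fixes m :: "'g \<Rightarrow> real" and K :: "'g set"
  assumes m_values: "m g = 1 \<or> m g = - 1"
    and subgroup_K: "subgroup K G"
    and cotlar: "g \<in> carrier G \<Longrightarrow> g \<notin> K \<Longrightarrow> h \<in> carrier G \<Longrightarrow>
      (m g - m h) * (m (inv g \<otimes> h) - m (inv g)) = 0"
    and left_invariant: "k \<in> K \<Longrightarrow> h \<in> carrier G \<Longrightarrow> m (k \<otimes> h) = m h"
begin

text \<open>Modelled on Cotlar's formula \<open>(H f)^2 = 2 H (f H f) - H (H (f^2))\<close> for the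
  Hilbert transform; the two mixed terms differ here because the product is not commutative.\<close>

definition cross :: "'a \<Rightarrow> 'a" where
  "cross x = mul m (x * star (mul m x)) + mul (\<lambda>g. m (inv g)) (mul m x * star x)
    - mul m (mul (\<lambda>g. m (inv g)) (x * star x))"

lemma cross_CG: "x \<in> CG \<Longrightarrow> cross x \<in> CG"
  unfolding cross_def by (intro alg_add alg_diff mul_CG alg_mult[OF G.subgroup_self] alg_star[OF G.subgroup_self])

lemma m_square: "m g * m g = 1"
  using m_values[of g] by auto

lemma m_nonzero: "m g \<noteq> 0"
  using m_values[of g] by auto

lemma co_diff: "co (x - y) g = co x g - co y g"
  using co_add[of "x - y" y g] by simp

lemma supp_mul: "x \<in> CG \<Longrightarrow> {h. co (mul m x) h \<noteq> 0} = {h. co x h \<noteq> 0}"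
  by (simp add: co_mul m_nonzero)

text \<open>All coefficients at \<open>g\<close> are sums of the same terms \<open>a h\<close> with
  different weights. The weight of \<open>cross x\<close> minus that of the left-hand side is
  exactly \<open>(m g - m h) * (m (inv g \<otimes> h) - m (inv g))\<close>. For \<open>g\<close> in
  \<open>K\<close> left invariance makes the weight on the left
  \<open>m h * m h = 1\<close>.\<close>

lemma cotlar_identity:
  assumes x: "x \<in> CG"
  shows "mul m x * star (mul m x) = cross x - mul (indicator K) (cross x) + mul (indicator K) (x * star x)"
proof (rule CG_eqI)
  show "mul m x * star (mul m x) \<in> CG" using x by (simp add: CG_intros mul_CG)
  show "cross x - mul (indicator K) (cross x) + mul (indicator K) (x * star x) \<in> CG"
    using x by (simp add: CG_intros mul_CG cross_CG)
  fix g assume g: "g \<in> carrier G"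
  define a where "a h = co x h * cnj (co x (inv g \<otimes> h))" for h
  let ?S = "{h. co x h \<noteq> 0}"
  have S: "h \<in> carrier G" if "h \<in> ?S" for h using that by (auto simp: co_def split: if_splits)
  note CGs = x mul_CG[OF x] alg_star[OF G.subgroup_self] alg_mult[OF G.subgroup_self] mul_CG
  have L: "co (mul m x * star (mul m x)) g = (\<Sum>h\<in>?S. of_real (m h * m (inv g \<otimes> h)) * a h)"
    unfolding co_mult_star[OF mul_CG[OF x] g] supp_mul[OF x] by (simp add: co_mul[OF x] a_def mult_ac)
  have X: "co (x * star x) g = (\<Sum>h\<in>?S. a h)"
    unfolding co_mult_star[OF x g] a_def ..
  have 1: "co (x * star (mul m x)) g = (\<Sum>h\<in>?S. of_real (m (inv g \<otimes> h)) * a h)"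
    unfolding co_mult_star[OF x g] by (simp add: co_mul[OF x] a_def mult_ac)
  have 2: "co (mul m x * star x) g = (\<Sum>h\<in>?S. of_real (m h) * a h)"
    unfolding co_mult_star[OF mul_CG[OF x] g] supp_mul[OF x] by (simp add: co_mul[OF x] a_def mult_ac)
  have C: "co (cross x) g = (\<Sum>h\<in>?S. of_real (m g * m (inv g \<otimes> h) + m (inv g) * m h - m g * m (inv g)) * a h)"
    unfolding cross_def co_diff co_add
    using x by (simp add: CGs co_mul 1 2 X sum_distrib_left distrib_right left_diff_distrib
        sum.distrib sum_subtractf mult.assoc)
  show "co (mul m x * star (mul m x)) g =
      co (cross x - mul (indicator K) (cross x) + mul (indicator K) (x * star x)) g"
  proof (cases "g \<in> K")
    case False
    have "co (mul m x * star (mul m x)) g = co (cross x) g"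
      unfolding L C
    proof (rule sum.cong[OF refl])
      fix h assume "h \<in> ?S"
      then have "(m g - m h) * (m (inv g \<otimes> h) - m (inv g)) = 0" using cotlar g False S by blast
      then have "m h * m (inv g \<otimes> h) = m g * m (inv g \<otimes> h) + m (inv g) * m h - m g * m (inv g)"
        by (simp add: algebra_simps)
      then show "of_real (m h * m (inv g \<otimes> h)) * a h
        = of_real (m g * m (inv g \<otimes> h) + m (inv g) * m h - m g * m (inv g)) * a h" by simp
    qed
    then show ?thesis using False x by (simp add: co_add co_diff co_mul cross_CG CGs)
  next
    case True
    have "co (mul m x * star (mul m x)) g = co (x * star x) g"
      unfolding L X
    proof (rule sum.cong[OF refl])
      fix h assume "h \<in> ?S"
      then have "m (inv g \<otimes> h) = m h"
        using left_invariant[of "inv g" h] True S subgroup.m_inv_closed[OF subgroup_K] by blast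
      then show "of_real (m h * m (inv g \<otimes> h)) * a h = a h" by (simp add: m_square)
    qed
    then show ?thesis using True x by (simp add: co_add co_diff co_mul cross_CG CGs)
  qed
qed

subsection \<open>Boundedness for \<open>p = 2\<^sup>k\<close>\<close>

lemma pn_mul_two:
  assumes x: "x \<in> CG"
  shows "pn 2 (mul m x) = pn 2 x"
proof -
  have "(cmod (of_real (m h) * co x h))\<^sup>2 = (cmod (co x h))\<^sup>2" for h
    using m_values[of h] by (auto simp: norm_mult)
  then show ?thesis
    unfolding pn_two tr_star_mult_self[OF mul_CG[OF x]] tr_star_mult_self[OF x] supp_mul[OF x]
    by (simp add: co_mul[OF x])
qed

text \<open>With \<open>y\<close> and \<open>N\<close> the norms of \<open>mul m x\<close> and
  \<open>x\<close> at the doubled exponent, the identity gives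
  \<open>y^2 \<le> 4 c N y + (2 c^2 + 1) N^2\<close>. Subtracting the expectation of
  \<open>cross x\<close> doubles its contribution, and the reflected multiplier shares the constant
  \<open>c\<close>.\<close>

lemma pn_mul_double:
  assumes n: "0 < n" and c: "0 \<le> c"
    and bound: "\<And>x. x \<in> CG \<Longrightarrow> pn (2 * real n) (mul m x) \<le> c * pn (2 * real n) x"
    and x: "x \<in> CG"
  shows "pn (4 * real n) (mul m x) \<le> (4 * c + 2 * c\<^sup>2 + 1) * pn (4 * real n) x"
proof -
  let ?p = "2 * real n"
  have p: "1 < ?p" "0 < ?p" using n by simp_all
  define N where "N = pn (2 * ?p) x"
  define y where "y = pn (2 * ?p) (mul m x)"
  have pos: "0 \<le> N" "0 \<le> y" by (simp_all add: N_def y_def)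
  note CGs = x mul_CG[OF x] alg_star[OF G.subgroup_self] alg_mult[OF G.subgroup_self] mul_CG
  have bound': "pn ?p (mul (\<lambda>g. m (inv g)) z) \<le> c * pn ?p z" if "z \<in> CG" for z
    using bound[of "star z"] that by (simp add: pn_mul_inv pn_star p(2) alg_star[OF G.subgroup_self])
  have star: "pn (2 * ?p) (star z) = pn (2 * ?p) z" for z using p by (intro pn_star) simp
  have "pn ?p (mul m (x * star (mul m x))) \<le> c * pn ?p (x * star (mul m x))"
    by (intro bound CGs)
  also have "\<dots> \<le> c * (N * y)"
    unfolding N_def y_def using pn_mult_double[OF p(1), of x "star (mul m x)"] c unfolding star by (intro mult_left_mono)
  finally have 1: "pn ?p (mul m (x * star (mul m x))) \<le> c * (N * y)" .
  have "pn ?p (mul (\<lambda>g. m (inv g)) (mul m x * star x)) \<le> c * pn ?p (mul m x * star x)"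
    by (intro bound' CGs)
  also have "\<dots> \<le> c * (y * N)"
    unfolding N_def y_def using pn_mult_double[OF p(1), of "mul m x" "star x"] c unfolding star by (intro mult_left_mono)
  finally have 2: "pn ?p (mul (\<lambda>g. m (inv g)) (mul m x * star x)) \<le> c * (y * N)" .
  have "pn ?p (mul m (mul (\<lambda>g. m (inv g)) (x * star x))) \<le> c * pn ?p (mul (\<lambda>g. m (inv g)) (x * star x))"
    by (intro bound CGs)
  also have "\<dots> \<le> c * (c * pn ?p (x * star x))" by (intro mult_left_mono c bound' CGs)
  also have "pn ?p (x * star x) = N\<^sup>2" unfolding N_def by (rule pn_star_mult_self[OF p(1)])
  finally have 3: "pn ?p (mul m (mul (\<lambda>g. m (inv g)) (x * star x))) \<le> c * (c * N\<^sup>2)" .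
  have 4: "pn ?p (cross x) \<le> 2 * c * N * y + c\<^sup>2 * N\<^sup>2"
  proof -
    have "pn ?p (cross x) \<le> pn ?p (mul m (x * star (mul m x))) + pn ?p (mul (\<lambda>g. m (inv g)) (mul m x * star x))
        + pn ?p (mul m (mul (\<lambda>g. m (inv g)) (x * star x)))"
      unfolding cross_def by (rule order_trans[OF pn_triangle_diff[OF p(1)] add_right_mono[OF pn_triangle[OF p(1)]]])
    also have "\<dots> \<le> c * (N * y) + c * (y * N) + c * (c * N\<^sup>2)" by (intro add_mono 1 2 3)
    finally show ?thesis by (simp add: power2_eq_square algebra_simps)
  qed
  have E: "pn ?p (mul (indicator K) z) \<le> pn ?p z" if "z \<in> CG" for z
    by (rule pn_conditional_expectation[OF subgroup_K that n])
  have "y\<^sup>2 = pn ?p (mul m x * star (mul m x))"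
    unfolding y_def by (rule pn_star_mult_self[OF p(1), symmetric])
  also have "\<dots> \<le> pn ?p (cross x) + pn ?p (mul (indicator K) (cross x)) + pn ?p (mul (indicator K) (x * star x))"
    unfolding cotlar_identity[OF x]
    by (rule order_trans[OF pn_triangle[OF p(1)] add_right_mono[OF pn_triangle_diff[OF p(1)]]])
  also have "\<dots> \<le> pn ?p (cross x) + pn ?p (cross x) + pn ?p (x * star x)"
    by (intro add_mono order_refl E cross_CG CGs)
  also have "pn ?p (x * star x) = N\<^sup>2" unfolding N_def by (rule pn_star_mult_self[OF p(1)])
  finally have main: "y\<^sup>2 \<le> 4 * c * N * y + (2 * c\<^sup>2 + 1) * N\<^sup>2" using 4 by (simp add: algebra_simps)
  \<comment> \<open>The constant is the sum of the coefficients of the quadratic inequality. It is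
    at least 1, so a violation forces \<open>N < y\<close>, and replacing one \<open>N\<close> by
    \<open>y\<close> in the last term contradicts that inequality.\<close>
  have "y \<le> (4 * c + 2 * c\<^sup>2 + 1) * N"
  proof (rule ccontr)
    let ?C = "4 * c + 2 * c\<^sup>2 + 1"
    assume "\<not> y \<le> ?C * N"
    then have gt: "?C * N < y" by simp
    have "1 * N \<le> ?C * N" using c pos by (intro mult_right_mono) auto
    then have Ny: "N < y" using gt by simp
    then have y0: "0 < y" using pos by simp
    have "4 * c * N * y + (2 * c\<^sup>2 + 1) * N\<^sup>2 \<le> 4 * c * N * y + (2 * c\<^sup>2 + 1) * (N * y)"
      using Ny pos by (intro add_left_mono mult_left_mono) (auto simp: power2_eq_square mult_left_mono)
    also have "\<dots> = ?C * N * y" by (simp add: algebra_simps)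
    also have "\<dots> < y * y" using gt y0 by (rule mult_strict_right_mono)
    finally show False using main by (simp add: power2_eq_square)
  qed
  then show ?thesis by (simp add: y_def N_def)
qed

lemma pn_mul_power_of_two: "\<exists>c\<ge>0. \<forall>x\<in>CG. pn (2 ^ Suc k) (mul m x) \<le> c * pn (2 ^ Suc k) x"
proof (induction k)
  case 0
  then show ?case using pn_mul_two by (intro exI[of _ 1]) simp
next
  case (Suc k)
  then obtain c where c: "0 \<le> c" "\<And>x. x \<in> CG \<Longrightarrow> pn (2 ^ Suc k) (mul m x) \<le> c * pn (2 ^ Suc k) x" by blast
  have e: "(2 :: real) ^ Suc k = 2 * real (2 ^ k)" "(2 :: real) ^ Suc (Suc k) = 4 * real (2 ^ k)" by simp_all
  have "pn (2 ^ Suc (Suc k)) (mul m x) \<le> (4 * c + 2 * c\<^sup>2 + 1) * pn (2 ^ Suc (Suc k)) x" if "x \<in> CG" for x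
    unfolding e(2) by (rule pn_mul_double[OF _ c(1) c(2)[unfolded e(1)] that]) simp_all
  then show ?case using c(1) by (intro exI[of _ "4 * c + 2 * c\<^sup>2 + 1"]) simp
qed

section \<open>Boundedness for all exponents\<close>

theorem pn_mul_bounded:
  assumes p: "1 < p"
  obtains C where "0 < C" "\<And>x. x \<in> CG \<Longrightarrow> pn p (mul m x) \<le> C * pn p x"
proof -
  define q where "q = p / (p - 1)"
  have pq: "conjugate p q" unfolding q_def by (rule conjugate_exists[OF p])
  \<comment> \<open>Both exponents have to lie below \<open>r\<close>: \<open>q < r\<close> amounts
    to \<open>r' < p\<close>, which puts \<open>p\<close> strictly between the endpoints of the
    interpolation.\<close>
  obtain k where k: "max p q < 2 ^ k" using real_arch_pow[of 2 "max p q"] by auto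
  define r where "r = (2 :: real) ^ Suc k"
  have r: "p < r" "q < r" using k p conjugateD(2)[OF pq] unfolding r_def power_Suc max_less_iff_conj by linarith+
  have r1: "1 < r" using r p by simp
  define r' where "r' = r / (r - 1)"
  have rr: "conjugate r r'" unfolding r'_def by (rule conjugate_exists[OF r1])
  obtain c0 where c0: "0 \<le> c0" "\<And>x. x \<in> CG \<Longrightarrow> pn r (mul m x) \<le> c0 * pn r x"
    using pn_mul_power_of_two[of k] unfolding r_def by blast
  define c where "c = c0 + 1"
  have c: "0 < c" using c0(1) by (simp add: c_def)
  have bound: "pn r (mul m x) \<le> c * pn r x" if "x \<in> CG" for x
    using c0(2)[OF that] pn_nonneg[of r x] unfolding c_def distrib_right by linarith
  have bound': "pn r (mul (\<lambda>g. m (inv g)) x) \<le> c * pn r x" if "x \<in> CG" for x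
    using bound[of "star x"] that conjugateD(3)[OF rr] by (simp add: pn_mul_inv pn_star alg_star[OF G.subgroup_self])
  have "\<bar>m g\<bar> \<le> 1" for g using m_values[of g] by auto
  from multiplier_form[of m, OF this] obtain \<beta> where \<beta>: "bounded_bilinear \<beta>" "\<And>y x. \<beta> (imunit * y) x = \<beta> y (imunit * x)"
      "\<And>y f. finite_support (carrier G) f \<Longrightarrow> \<beta> y (fsum lam f) = tr (y * fsum lam (\<lambda>g. of_real (m g) * f g))"
      "\<And>y x. \<bar>\<beta> y x\<bar> \<le> pn 2 y * pn 2 x"
    by blast
  have one_less_numeral: "1 < (2 :: real)" by simp
  interpret \<beta>: bounded_bilinear \<beta> by (rule \<beta>(1))
  have \<beta>_right: "\<beta> y x = tr (y * mul m x)" if "x \<in> CG" for x y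
    using \<beta>(3)[OF finite_support_co[OF that order_refl], of y] by (simp add: fsum_co[OF that] mul_def)
  \<comment> \<open>For a finite sum \<open>y\<close> the symbol can be moved to the left even when
    \<open>x\<close> is arbitrary: both sides are continuous in \<open>x\<close> for the 2-norm and
    agree on finite sums.\<close>
  have \<beta>_left: "\<beta> y x = tr (mul (\<lambda>g. m (inv g)) y * x)" if y: "y \<in> CG" for x y
  proof -
    let ?T = "mul (\<lambda>g. m (inv g)) y"
    have "\<bar>\<beta> y x - tr (?T * x)\<bar> \<le> 0 + e" if e: "0 < e" for e
    proof -
      define d where "d = e / (pn 2 y + pn 2 ?T + 1)"
      have d: "0 < d" using e by (simp add: d_def add_nonneg_pos)
      obtain z where z: "z \<in> CG" "pn 2 (x - z) < d" "pn 2 (x - z) < d"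
        by (rule CG_dense[OF one_less_numeral d, of x])
      have "\<beta> y x - tr (?T * x) = \<beta> y (x - z) - tr (?T * (x - z))"
        using \<beta>_right[OF z(1), of y] tr_mult_mul[OF z(1) y, of m]
        by (simp add: \<beta>.diff_right right_diff_distrib tr.diff)
      also have "\<bar>\<dots>\<bar> \<le> \<bar>\<beta> y (x - z)\<bar> + \<bar>tr (?T * (x - z))\<bar>" by (rule abs_triangle_ineq4)
      also have "\<dots> \<le> pn 2 y * pn 2 (x - z) + pn 2 ?T * pn 2 (x - z)"
        by (intro add_mono \<beta>(4) Hoelder) (simp add: conjugate_def)
      also have "\<dots> = (pn 2 y + pn 2 ?T) * pn 2 (x - z)" by (simp add: distrib_right)
      also have "\<dots> \<le> (pn 2 y + pn 2 ?T + 1) * d" using z d by (intro mult_mono) auto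
      also have "\<dots> = e"
      proof -
        have "0 < pn 2 y + pn 2 ?T + 1" by (simp add: add_nonneg_pos)
        then show ?thesis by (simp add: d_def)
      qed
      finally show ?thesis by simp
    qed
    then have "\<bar>\<beta> y x - tr (?T * x)\<bar> \<le> 0" by (rule field_le_epsilon)
    then show ?thesis by simp
  qed
  \<comment> \<open>\<open>x\<close> is approximated by a finite sum in two norms at once: the
    \<open>r\<close>-norm enters the estimate for the multiplier, the 2-norm controls the error of
    \<open>\<beta>\<close>.\<close>
  have b0: "\<bar>\<beta> y x\<bar> \<le> c * pn r' y * pn r x" for y x
  proof (rule field_le_epsilon)
    fix e :: real assume e: "0 < e"
    define d where "d = e / (c * pn r' y + pn 2 y + 1)"
    have D: "0 < c * pn r' y + pn 2 y + 1" using c by (simp add: add_nonneg_pos)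
    have d: "0 < d" using e D by (simp add: d_def)
    obtain z where z: "z \<in> CG" "pn r (x - z) < d" "pn 2 (x - z) < d" by (rule CG_dense[OF r1 d, of x])
    have zx: "pn r z \<le> pn r x + d"
      using pn_triangle_diff[OF r1, of x "x - z"] z by simp
    have "\<bar>\<beta> y z\<bar> \<le> pn r' y * pn r (mul m z)"
      unfolding \<beta>_right[OF z(1)] by (rule Hoelder[OF conjugate_sym[OF rr]])
    also have "\<dots> \<le> pn r' y * (c * (pn r x + d))"
      using bound[OF z(1)] zx c by (intro mult_left_mono) (auto intro: order_trans)
    finally have 1: "\<bar>\<beta> y z\<bar> \<le> pn r' y * (c * (pn r x + d))" .
    have "\<bar>\<beta> y (x - z)\<bar> \<le> pn 2 y * d"
      using \<beta>(4)[of y "x - z"] z(3) by (meson less_imp_le mult_left_mono order_trans pn_nonneg)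
    then have "\<bar>\<beta> y x\<bar> \<le> pn r' y * (c * (pn r x + d)) + pn 2 y * d"
      using 1 \<beta>.diff_right[of y x z] by linarith
    also have "\<dots> \<le> c * pn r' y * pn r x + (c * pn r' y + pn 2 y + 1) * d"
      using d by (simp add: algebra_simps)
    also have "\<dots> = c * pn r' y * pn r x + e" using D by (simp add: d_def)
    finally show "\<bar>\<beta> y x\<bar> \<le> c * pn r' y * pn r x + e" .
  qed
  \<comment> \<open>The mirror image with \<open>y\<close> approximated and the reflected multiplier
    acting on it; this is the bound at the dual exponent.\<close>
  have b1: "\<bar>\<beta> y x\<bar> \<le> c * pn r y * pn r' x" for y x
  proof (rule field_le_epsilon)
    fix e :: real assume e: "0 < e"
    define d where "d = e / (c * pn r' x + pn 2 x + 1)"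
    have D: "0 < c * pn r' x + pn 2 x + 1" using c by (simp add: add_nonneg_pos)
    have d: "0 < d" using e D by (simp add: d_def)
    obtain z where z: "z \<in> CG" "pn r (y - z) < d" "pn 2 (y - z) < d" by (rule CG_dense[OF r1 d, of y])
    have zy: "pn r z \<le> pn r y + d"
      using pn_triangle_diff[OF r1, of y "y - z"] z by simp
    have "\<bar>\<beta> z x\<bar> \<le> pn r (mul (\<lambda>g. m (inv g)) z) * pn r' x"
      unfolding \<beta>_left[OF z(1)] by (rule Hoelder[OF rr])
    also have "\<dots> \<le> (c * (pn r y + d)) * pn r' x"
      using bound'[OF z(1)] zy c by (intro mult_right_mono) (auto intro: order_trans)
    finally have 1: "\<bar>\<beta> z x\<bar> \<le> (c * (pn r y + d)) * pn r' x" .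
    have "\<bar>\<beta> (y - z) x\<bar> \<le> d * pn 2 x"
      using \<beta>(4)[of "y - z" x] z(3) by (meson less_imp_le mult_right_mono order_trans pn_nonneg)
    then have "\<bar>\<beta> y x\<bar> \<le> (c * (pn r y + d)) * pn r' x + d * pn 2 x"
      using 1 \<beta>.diff_left[of y z x] by linarith
    also have "\<dots> \<le> c * pn r y * pn r' x + (c * pn r' x + pn 2 x + 1) * d"
      using d by (simp add: algebra_simps)
    also have "\<dots> = c * pn r y * pn r' x + e" using D by (simp add: d_def)
    finally show "\<bar>\<beta> y x\<bar> \<le> c * pn r y * pn r' x + e" .
  qed
  have ip: "1 / r < 1 / p" "1 / r < 1 / q"
    using r conjugateD(3,4)[OF pq] by (auto intro!: divide_strict_left_mono mult_pos_pos)
  then have ip': "1 / p < 1 / r'" using conjugateD(6)[OF pq] conjugateD(5)[OF rr] by linarith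
  obtain t where t: "0 < t" "t < 1" "1 / p = (1 - t) * (1 / r) + t * (1 / r')"
    by (rule convex_combination_between[OF ip(1) ip'])
  have te: "1 / p = (1 - t) / r + t / r'" using t(3) by simp
  have b: "\<bar>\<beta> y x\<bar> \<le> c * pn q y * pn p x" for y x
    by (rule interpolation_pn[OF \<beta>(1,2) rr conjugate_sym[OF rr] pq t(1,2) te c b0 b1])
  have "pn p (mul m x) \<le> c * pn p x" if x: "x \<in> CG" for x
  proof (rule pn_le_dual[OF pq])
    show "0 \<le> c * pn p x" using c by simp
    fix y
    have "tr (mul m x * y) = \<beta> y x" unfolding \<beta>_right[OF x] by (rule tr_comm)
    also have "\<dots> \<le> c * pn q y * pn p x" by (rule abs_le_D1[OF b])
    finally show "tr (mul m x * y) \<le> c * pn p x * pn q y" by (simp add: mult_ac)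
  qed
  then show thesis by (rule that[OF c])
qed

end

section \<open>The Hilbert space of square-summable families\<close>

definition square_summable :: "('i \<Rightarrow> complex) \<Rightarrow> bool" where
  "square_summable f \<longleftrightarrow> (\<lambda>i. (cmod (f i))\<^sup>2) summable_on UNIV"

lemma square_summableI:
  assumes "\<And>F. finite F \<Longrightarrow> (\<Sum>i\<in>F. (cmod (f i))\<^sup>2) \<le> C"
  shows "square_summable f"
  unfolding square_summable_def
proof (rule nonneg_bdd_above_summable_on)
  show "bdd_above (sum (\<lambda>i. (cmod (f i))\<^sup>2) ` {F. F \<subseteq> UNIV \<and> finite F})"
    by (rule bdd_aboveI[of _ C]) (use assms in auto)
qed simp

lemma square_summable_dot:
  assumes "square_summable f" "square_summable g"
  shows "(\<lambda>i. inner (f i) (g i)) summable_on UNIV"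
proof -
  have "(\<lambda>i. (cmod (f i))\<^sup>2 + (cmod (g i))\<^sup>2) summable_on UNIV"
    using assms unfolding square_summable_def by (rule summable_on_add)
  then have "(\<lambda>i. norm (inner (f i) (g i))) summable_on UNIV"
  proof (rule Infinite_Sum.abs_summable_on_comparison_test')
    fix i
    have "norm (inner (f i) (g i)) \<le> cmod (f i) * cmod (g i)"
      unfolding real_norm_def by (rule Cauchy_Schwarz_ineq2)
    also have "\<dots> \<le> (cmod (f i))\<^sup>2 + (cmod (g i))\<^sup>2"
      using sum_squares_bound[of "cmod (f i)" "cmod (g i)"] mult_nonneg_nonneg[OF norm_ge_zero norm_ge_zero, of "f i" "g i"]
      unfolding mult.assoc by linarith
    finally show "norm (inner (f i) (g i)) \<le> (cmod (f i))\<^sup>2 + (cmod (g i))\<^sup>2" .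
  qed
  then show ?thesis by (rule abs_summable_summable)
qed

lemma square_summable_add:
  assumes "square_summable f" "square_summable g"
  shows "square_summable (\<lambda>i. f i + g i)"
proof -
  have "(\<lambda>i. 2 * (cmod (f i))\<^sup>2 + 2 * (cmod (g i))\<^sup>2) summable_on UNIV"
    using assms unfolding square_summable_def by (intro summable_on_add summable_on_cmult_right)
  then show ?thesis unfolding square_summable_def
  proof (rule summable_on_comparison_test)
    fix i
    have "(cmod (f i + g i))\<^sup>2 \<le> (cmod (f i) + cmod (g i))\<^sup>2" by (intro power_mono norm_triangle_ineq) simp
    also have "\<dots> \<le> 2 * (cmod (f i))\<^sup>2 + 2 * (cmod (g i))\<^sup>2"
      using sum_squares_bound[of "cmod (f i)" "cmod (g i)"] by (simp add: power2_sum)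
    finally show "(cmod (f i + g i))\<^sup>2 \<le> 2 * (cmod (f i))\<^sup>2 + 2 * (cmod (g i))\<^sup>2" .
  qed simp
qed

lemma square_summable_mult:
  assumes f: "square_summable f" and c: "\<And>i. cmod (c i) \<le> B"
  shows "square_summable (\<lambda>i. c i * f i)"
proof -
  have "(\<lambda>i. B\<^sup>2 * (cmod (f i))\<^sup>2) summable_on UNIV"
    using f unfolding square_summable_def by (rule summable_on_cmult_right)
  then show ?thesis unfolding square_summable_def
    by (rule summable_on_comparison_test) (auto simp: norm_mult power_mult_distrib intro!: mult_right_mono power_mono c)
qed

text \<open>A type in place of the set \<open>l2 A\<close>, so that the classes of inner product and
  Banach spaces and the type of bounded operators apply.\<close>

typedef 'i ell2 = "{f :: 'i \<Rightarrow> complex. square_summable f}"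
  morphisms coord Abs_ell2
  by (rule exI[of _ "\<lambda>_. 0"]) (simp add: square_summable_def)

setup_lifting type_definition_ell2

lemma square_summable_coord: "square_summable (coord f)"
  using coord by auto

lemma ell2_eqI: "(\<And>i. coord f i = coord g i) \<Longrightarrow> f = g"
  by (metis coord_inject ext)

instantiation ell2 :: (type) real_vector
begin

lift_definition zero_ell2 :: "'a ell2" is "\<lambda>_. 0" by (simp add: square_summable_def)
lift_definition plus_ell2 :: "'a ell2 \<Rightarrow> 'a ell2 \<Rightarrow> 'a ell2" is "\<lambda>f g i. f i + g i"
  by (rule square_summable_add)
lift_definition uminus_ell2 :: "'a ell2 \<Rightarrow> 'a ell2" is "\<lambda>f i. - f i"
  by (simp add: square_summable_def)
lift_definition minus_ell2 :: "'a ell2 \<Rightarrow> 'a ell2 \<Rightarrow> 'a ell2" is "\<lambda>f g i. f i - g i"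
proof -
  fix f g :: "'a \<Rightarrow> complex" assume "square_summable f" "square_summable g"
  then show "square_summable (\<lambda>i. f i - g i)"
    using square_summable_add[of f "\<lambda>i. - g i"] by (simp add: square_summable_def)
qed
lift_definition scaleR_ell2 :: "real \<Rightarrow> 'a ell2 \<Rightarrow> 'a ell2" is "\<lambda>r f i. r *\<^sub>R f i"
proof -
  fix r and f :: "'a \<Rightarrow> complex" assume "square_summable f"
  then show "square_summable (\<lambda>i. r *\<^sub>R f i)"
    using square_summable_mult[of f "\<lambda>_. of_real r" "\<bar>r\<bar>"] by (simp add: scaleR_conv_of_real)
qed

instance
proof
  fix x y z :: "'a ell2" and r s :: real
  show "x + y + z = x + (y + z)" "x + y = y + x" "0 + x = x" "- x + x = 0" "x - y = x + - y"
    by (transfer; simp add: algebra_simps)+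
  show "r *\<^sub>R (x + y) = r *\<^sub>R x + r *\<^sub>R y" "(r + s) *\<^sub>R x = r *\<^sub>R x + s *\<^sub>R x" "r *\<^sub>R s *\<^sub>R x = (r * s) *\<^sub>R x" "1 *\<^sub>R x = x"
    by (transfer; simp add: algebra_simps)+
qed

end

instantiation ell2 :: (type) real_inner
begin

text \<open>The real part of the complex inner product, as \<open>inner\<close> on complex numbers
  is real-valued.\<close>

lift_definition inner_ell2 :: "'a ell2 \<Rightarrow> 'a ell2 \<Rightarrow> real" is "\<lambda>f g. \<Sum>\<^sub>\<infinity>i. inner (f i) (g i)" .

definition norm_ell2 :: "'a ell2 \<Rightarrow> real" where "norm_ell2 f = sqrt (inner f f)"
definition sgn_ell2 :: "'a ell2 \<Rightarrow> 'a ell2" where "sgn_ell2 f = f /\<^sub>R norm f"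
definition dist_ell2 :: "'a ell2 \<Rightarrow> 'a ell2 \<Rightarrow> real" where "dist_ell2 f g = norm (f - g)"
definition uniformity_ell2 :: "('a ell2 \<times> 'a ell2) filter" where
  "uniformity_ell2 = (INF e\<in>{0 <..}. principal {(x, y). dist x y < e})"
definition open_ell2 :: "'a ell2 set \<Rightarrow> bool" where
  "open_ell2 U = (\<forall>x\<in>U. eventually (\<lambda>(x', y). x' = x \<longrightarrow> y \<in> U) uniformity)"

instance
proof
  fix x y z :: "'a ell2" and r :: real
  show "inner x y = inner y x" by transfer (simp add: inner_commute)
  show "inner (x + y) z = inner x z + inner y z"
    by transfer (simp add: inner_add_left infsum_add square_summable_dot)
  show "inner (r *\<^sub>R x) y = r * inner x y"
    by transfer (simp add: infsum_cmult_right square_summable_dot)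
  show "0 \<le> inner x x" by transfer (intro infsum_nonneg inner_ge_zero)
  show "inner x x = 0 \<longleftrightarrow> x = 0"
  proof transfer
    fix f :: "'a \<Rightarrow> complex" assume f: "square_summable f"
    show "(\<Sum>\<^sub>\<infinity>i. inner (f i) (f i)) = 0 \<longleftrightarrow> f = (\<lambda>_. 0)"
    proof
      assume 0: "(\<Sum>\<^sub>\<infinity>i. inner (f i) (f i)) = 0"
      have "inner (f i) (f i) \<le> 0" for i
        using finite_sum_le_infsum[OF square_summable_dot[OF f f], of "{i}"] 0 by simp
      then have "f i = 0" for i using inner_ge_zero[of "f i"] by (metis antisym inner_eq_zero_iff)
      then show "f = (\<lambda>_. 0)" by blast
    qed simp
  qed
qed (simp_all add: norm_ell2_def sgn_ell2_def dist_ell2_def uniformity_ell2_def open_ell2_def)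

end

lemma coord_simps [simp]:
  "coord 0 i = 0" "coord (f + g) i = coord f i + coord g i" "coord (- f) i = - coord f i"
  "coord (f - g) i = coord f i - coord g i" "coord (r *\<^sub>R f) i = r *\<^sub>R coord f i"
  by (simp_all add: zero_ell2.rep_eq plus_ell2.rep_eq uminus_ell2.rep_eq minus_ell2.rep_eq scaleR_ell2.rep_eq)

lemma coord_sum: "coord (sum f A) i = (\<Sum>j\<in>A. coord (f j) i)"
  by (induction A rule: infinite_finite_induct) simp_all

lemma inner_coord: "inner f g = (\<Sum>\<^sub>\<infinity>i. inner (coord f i) (coord g i))"
  by (simp add: inner_ell2.rep_eq)

lemma norm_coord: "(norm f)\<^sup>2 = (\<Sum>\<^sub>\<infinity>i. (cmod (coord f i))\<^sup>2)"
  by (simp add: power2_norm_eq_inner inner_coord)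

lemma sum_coord_le: "finite F \<Longrightarrow> (\<Sum>i\<in>F. (cmod (coord f i))\<^sup>2) \<le> (norm f)\<^sup>2"
  unfolding norm_coord
  using square_summable_coord[of f] by (intro finite_sum_le_infsum) (auto simp: square_summable_def)

lemma norm_ell2_le:
  assumes "\<And>F. finite F \<Longrightarrow> (\<Sum>i\<in>F. (cmod (coord f i))\<^sup>2) \<le> C\<^sup>2" "0 \<le> C"
  shows "norm f \<le> C"
proof -
  have "(norm f)\<^sup>2 \<le> C\<^sup>2" unfolding norm_coord
    using square_summable_coord[of f] assms(1) by (intro infsum_le_finite_sums) (auto simp: square_summable_def)
  then show ?thesis using assms(2) power2_le_imp_le by blast
qed

lemma norm_coord_le: "cmod (coord f i) \<le> norm f"
  using sum_coord_le[of "{i}" f] by simp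

text \<open>Coordinates converge, and the Cauchy estimate passes to the limit on each finite set of
  coordinates with a bound that does not depend on the set.\<close>

instance ell2 :: (type) banach
proof
  fix X :: "nat \<Rightarrow> 'a ell2" assume X: "Cauchy X"
  have "Cauchy (\<lambda>n. coord (X n) i)" for i
  proof (rule metric_CauchyI)
    fix e :: real assume "0 < e"
    then obtain N where N: "\<And>m n. m \<ge> N \<Longrightarrow> n \<ge> N \<Longrightarrow> dist (X m) (X n) < e" using metric_CauchyD[OF X] by blast
    have "dist (coord (X m) i) (coord (X n) i) < e" if "m \<ge> N" "n \<ge> N" for m n
      using norm_coord_le[of "X m - X n" i] N[OF that] by (simp add: dist_norm)
    then show "\<exists>N. \<forall>m\<ge>N. \<forall>n\<ge>N. dist (coord (X m) i) (coord (X n) i) < e" by blast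
  qed
  then have "\<exists>l. (\<lambda>n. coord (X n) i) \<longlonglongrightarrow> l" for i
    by (simp add: Cauchy_convergent_iff convergent_def)
  then obtain l where l: "\<And>i. (\<lambda>n. coord (X n) i) \<longlonglongrightarrow> l i" by metis
  have tail: "(\<Sum>i\<in>F. (cmod (coord (X n) i - l i))\<^sup>2) \<le> e\<^sup>2"
    if N: "\<And>m. m \<ge> N \<Longrightarrow> norm (X n - X m) \<le> e" and F: "finite F" for F n N e
  proof (rule LIMSEQ_le_const2)
    show "(\<lambda>m. \<Sum>i\<in>F. (cmod (coord (X n) i - coord (X m) i))\<^sup>2) \<longlonglongrightarrow> (\<Sum>i\<in>F. (cmod (coord (X n) i - l i))\<^sup>2)"
      by (intro tendsto_intros l)
    have "(\<Sum>i\<in>F. (cmod (coord (X n) i - coord (X m) i))\<^sup>2) \<le> e\<^sup>2" if "m \<ge> N" for m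
      using sum_coord_le[OF F, of "X n - X m"] power_mono[OF N[OF that], of 2] by simp
    then show "\<exists>N. \<forall>m\<ge>N. (\<Sum>i\<in>F. (cmod (coord (X n) i - coord (X m) i))\<^sup>2) \<le> e\<^sup>2" by blast
  qed
  obtain N where N: "\<And>m n. m \<ge> N \<Longrightarrow> n \<ge> N \<Longrightarrow> dist (X m) (X n) < 1" using metric_CauchyD[OF X, of 1] by auto
  \<comment> \<open>The limit is \<open>X N\<close> minus this difference, hence square-summable
    itself.\<close>
  have "square_summable (\<lambda>i. coord (X N) i - l i)"
    by (rule square_summableI[of _ "1\<^sup>2"], rule tail[of N]) (use N in \<open>auto simp: dist_norm less_imp_le\<close>)
  then have "square_summable (\<lambda>i. coord (X N) i + (-1) * (coord (X N) i - l i))"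
    by (intro square_summable_add square_summable_coord square_summable_mult[of _ "\<lambda>_. -1" 1]) auto
  then have sl: "square_summable l" by simp
  define L where "L = Abs_ell2 l"
  have L: "coord L = l" unfolding L_def using sl by (simp add: Abs_ell2_inverse)
  have "X \<longlonglongrightarrow> L"
  proof (rule metric_LIMSEQ_I)
    fix e :: real assume e: "0 < e"
    then obtain N where N: "\<And>m n. m \<ge> N \<Longrightarrow> n \<ge> N \<Longrightarrow> dist (X m) (X n) < e / 2" using metric_CauchyD[OF X, of "e / 2"] by auto
    have "norm (X n - L) \<le> e / 2" if n: "n \<ge> N" for n
    proof (rule norm_ell2_le)
      fix F :: "'a set" assume F: "finite F"
      have "(\<Sum>i\<in>F. (cmod (coord (X n) i - l i))\<^sup>2) \<le> (e / 2)\<^sup>2"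
        by (rule tail[OF _ F, of N]) (use N n in \<open>auto simp: dist_norm less_imp_le\<close>)
      then show "(\<Sum>i\<in>F. (cmod (coord (X n - L) i))\<^sup>2) \<le> (e / 2)\<^sup>2" by (simp add: L)
    qed (use e in simp)
    then show "\<exists>no. \<forall>n\<ge>no. dist (X n) L < e" using e by (intro exI[of _ N]) (force simp: dist_norm)
  qed
  then show "convergent X" by (rule convergentI)
qed

section \<open>Basis vectors, representation of functionals and adjoints\<close>

lift_definition ket :: "complex \<Rightarrow> 'i \<Rightarrow> 'i ell2" is "\<lambda>c i j. if j = i then c else 0"
proof -
  fix c :: complex and i :: 'i
  show "square_summable (\<lambda>j. if j = i then c else 0)"
    by (rule square_summableI[of _ "(cmod c)\<^sup>2"]) (simp add: if_distrib[of cmod] if_distrib[of "\<lambda>x. x\<^sup>2"] sum.delta' cong: if_cong)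
qed

lemma coord_ket: "coord (ket c i) j = (if j = i then c else 0)"
  by (simp add: ket.rep_eq)

lemma inner_ket: "inner (ket c i) f = inner c (coord f i)"
proof -
  have "inner (ket c i) f = (\<Sum>\<^sub>\<infinity>j\<in>{i}. inner c (coord f j))"
    unfolding inner_coord by (rule infsum_cong_neutral) (auto simp: coord_ket)
  then show ?thesis by simp
qed

lemma norm_ket: "norm (ket c i) = cmod c"
  by (simp add: norm_eq_sqrt_inner inner_ket coord_ket)

lemma sum_ket_approx:
  assumes "0 < e"
  obtains F where "finite F" "norm (f - (\<Sum>i\<in>F. ket (coord f i) i)) < e"
proof -
  have s: "(\<lambda>i. (cmod (coord f i))\<^sup>2) summable_on UNIV"
    using square_summable_coord[of f] by (simp add: square_summable_def)
  have "(sum (\<lambda>i. (cmod (coord f i))\<^sup>2) \<longlongrightarrow> (norm f)\<^sup>2) (finite_subsets_at_top UNIV)"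
    using has_sum_infsum[OF s] unfolding norm_coord has_sum_def .
  then have "\<forall>\<^sub>F F in finite_subsets_at_top UNIV. dist (\<Sum>i\<in>F. (cmod (coord f i))\<^sup>2) ((norm f)\<^sup>2) < e\<^sup>2"
    using assms by (intro tendstoD) auto
  then obtain F where F: "finite F" "dist (\<Sum>i\<in>F. (cmod (coord f i))\<^sup>2) ((norm f)\<^sup>2) < e\<^sup>2"
    by (metis (no_types, lifting) eventually_finite_subsets_at_top subset_UNIV order_refl)
  let ?g = "\<Sum>i\<in>F. ket (coord f i) i"
  have cg: "coord ?g i = (if i \<in> F then coord f i else 0)" for i
    using F(1) by (simp add: coord_sum coord_ket sum.delta cong: if_cong)
  have ig: "inner ?g h = (\<Sum>i\<in>F. inner (coord f i) (coord h i))" for h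
    by (simp add: inner_sum_left inner_ket)
  have "(norm (f - ?g))\<^sup>2 = (norm f)\<^sup>2 - (\<Sum>i\<in>F. (cmod (coord f i))\<^sup>2)"
  proof -
    have "inner ?g ?g = inner ?g f" unfolding ig by (rule sum.cong) (auto simp: cg)
    then have "(norm (f - ?g))\<^sup>2 = (norm f)\<^sup>2 - inner ?g f"
      by (simp add: power2_norm_eq_inner inner_diff_left inner_diff_right inner_commute[of f ?g])
    then show ?thesis by (simp add: ig power2_norm_eq_inner)
  qed
  then have "(norm (f - ?g))\<^sup>2 < e\<^sup>2" using F(2) by (simp add: dist_real_def)
  then have "norm (f - ?g) < e" using assms power2_less_imp_less by force
  then show thesis using that F(1) by blast
qed

text \<open>Only real linearity is available, so agreement is required for kets with arbitrary
  complex \<open>c\<close>.\<close>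

lemma bounded_linear_eq_on_kets:
  fixes A B :: "'i ell2 \<Rightarrow> 'b::real_normed_vector"
  assumes A: "bounded_linear A" and B: "bounded_linear B" and eq: "\<And>c i. A (ket c i) = B (ket c i)"
  shows "A f = B f"
proof -
  interpret bounded_linear "\<lambda>f. A f - B f" by (rule bounded_linear_sub[OF A B])
  obtain K where K: "\<And>f. norm (A f - B f) \<le> norm f * K" "0 < K" using pos_bounded by blast
  have "norm (A f - B f) \<le> 0 + e" if e: "0 < e" for e
  proof -
    obtain F where F: "norm (f - (\<Sum>i\<in>F. ket (coord f i) i)) < e / K" using sum_ket_approx[of "e / K"] e K(2) by auto
    let ?g = "\<Sum>i\<in>F. ket (coord f i) i"
    have "A ?g - B ?g = 0" by (simp only: sum eq diff_self sum.neutral_const)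
    then have "norm (A f - B f) = norm (A (f - ?g) - B (f - ?g))" using diff[of f ?g] by simp
    also have "\<dots> \<le> norm (f - ?g) * K" by (rule K)
    also have "\<dots> \<le> e" using F K(2) by (simp add: field_simps)
    finally show ?thesis by simp
  qed
  then have "norm (A f - B f) \<le> 0" by (rule field_le_epsilon)
  then show ?thesis by simp
qed

lemma Riesz_representation:
  fixes \<phi> :: "'i ell2 \<Rightarrow> real"
  assumes "bounded_linear \<phi>"
  obtains r where "\<And>f. \<phi> f = inner r f"
proof -
  interpret \<phi>: bounded_linear \<phi> by (rule assms)
  obtain K where K: "\<And>f. norm (\<phi> f) \<le> norm f * K" "0 \<le> K" using \<phi>.nonneg_bounded by blast
  \<comment> \<open>The only possible coordinates of the representing vector, because the real inner
    product of \<open>c i\<close> with \<open>z\<close> has to be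
    \<open>\<phi> (ket z i)\<close>.\<close>
  define c where "c i = Complex (\<phi> (ket 1 i)) (\<phi> (ket \<i> i))" for i
  have \<phi>_ket: "\<phi> (ket z i) = inner (c i) z" for z i
  proof -
    have "ket z i = Re z *\<^sub>R ket 1 i + Im z *\<^sub>R ket \<i> i"
      by (rule ell2_eqI) (simp add: coord_ket complex_eq_iff)
    then show ?thesis by (simp add: \<phi>.add \<phi>.scaleR inner_complex_def c_def mult.commute)
  qed
  \<comment> \<open>Testing \<open>\<phi>\<close> on the truncation of \<open>c\<close> to
    \<open>F\<close> gives \<open>S \<le> sqrt S * K\<close> for the squared norm \<open>S\<close>
    of the truncation.\<close>
  have le: "(\<Sum>i\<in>F. (cmod (c i))\<^sup>2) \<le> K\<^sup>2" if F: "finite F" for F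
  proof -
    define S where "S = (\<Sum>i\<in>F. (cmod (c i))\<^sup>2)"
    have S0: "0 \<le> S" unfolding S_def by (simp add: sum_nonneg)
    let ?g = "\<Sum>i\<in>F. ket (c i) i"
    have cg: "coord ?g i = (if i \<in> F then c i else 0)" for i
      using F by (simp add: coord_sum coord_ket sum.delta cong: if_cong)
    have "\<phi> ?g = S" by (simp add: \<phi>.sum \<phi>_ket S_def power2_norm_eq_inner)
    moreover have "(norm ?g)\<^sup>2 = S"
      by (simp add: power2_norm_eq_inner inner_sum_left inner_ket S_def) (simp add: cg)
    then have "norm ?g = sqrt S" by (metis norm_ge_zero real_sqrt_abs abs_of_nonneg)
    ultimately have "S \<le> sqrt S * K" using K(1)[of ?g] by simp
    then have "sqrt S * sqrt S \<le> sqrt S * K" using S0 by simp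
    then have "sqrt S \<le> K" if "S \<noteq> 0" using mult_left_le_imp_le[of "sqrt S" "sqrt S" K] S0 that by simp
    then have "sqrt S \<le> K" using K(2) by (cases "S = 0") simp_all
    then have "(sqrt S)\<^sup>2 \<le> K\<^sup>2" using S0 by (intro power_mono) auto
    then show ?thesis using S0 by (simp add: S_def)
  qed
  have c: "square_summable c" by (rule square_summableI[OF le])
  have "\<phi> f = inner (Abs_ell2 c) f" for f
  proof (rule bounded_linear_eq_on_kets[OF assms bounded_linear_inner_right])
    show "\<phi> (ket z i) = inner (Abs_ell2 c) (ket z i)" for z i
      using c by (simp add: \<phi>_ket inner_commute[of _ "ket z i"] inner_ket Abs_ell2_inverse) (simp add: inner_commute)
  qed
  then show thesis by (rule that)
qed

lemma adjoint_exists: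
  fixes T :: "'i ell2 \<Rightarrow>\<^sub>L 'i ell2"
  shows "\<exists>S :: 'i ell2 \<Rightarrow>\<^sub>L 'i ell2. \<forall>f g. inner (S f) g = inner f (T g)"
proof -
  have "\<exists>r. \<forall>g. inner f (T g) = inner r g" for f
  proof -
    have "bounded_linear (\<lambda>g. inner f (T g))"
      by (intro bounded_linear_compose[OF bounded_linear_inner_right] blinfun.bounded_linear_right)
    from Riesz_representation[OF this] show ?thesis by metis
  qed
  then obtain s where s: "\<And>f g. inner f (T g) = inner (s f) g" by metis
  have eqI: "a = b" if "\<And>g. inner a g = inner b g" for a b :: "'i ell2"
  proof -
    have "inner (a - b) (a - b) = 0" using that[of "a - b"] by (simp add: inner_diff_left)
    then show ?thesis by simp
  qed
  have "bounded_linear s"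
  proof (rule bounded_linear_intro[where K = "norm T"])
    show "s (f + g) = s f + s g" for f g
      by (rule eqI) (simp add: inner_add_left flip: s)
    show "s (r *\<^sub>R f) = r *\<^sub>R s f" for r f
      by (rule eqI) (simp flip: s)
    show "norm (s f) \<le> norm f * norm T" for f
    proof (cases "s f = 0")
      case False
      have "norm (s f) * norm (s f) = inner f (T (s f))" by (simp add: s dot_square_norm power2_eq_square)
      also have "\<dots> \<le> norm f * norm (T (s f))" by (rule norm_cauchy_schwarz)
      also have "\<dots> \<le> norm f * (norm T * norm (s f))" by (intro mult_left_mono norm_blinfun) simp
      finally show ?thesis using False by simp
    qed simp
  qed
  then show ?thesis by (intro exI[of _ "Blinfun s"]) (simp add: bounded_linear_Blinfun_apply s)
qed

section \<open>Diagonal operators and pull-backs along injections\<close>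

text \<open>Lifting requires square-summable values for every argument, so unsuitable symbols are
  replaced by 0.\<close>

lift_definition diag :: "('i \<Rightarrow> complex) \<Rightarrow> 'i ell2 \<Rightarrow> 'i ell2" is
  "\<lambda>c f i. (if \<forall>j. cmod (c j) \<le> 1 then c i else 0) * f i"
  by (rule square_summable_mult[of _ _ 1]) auto

lemma coord_diag: "(\<And>j. cmod (c j) \<le> 1) \<Longrightarrow> coord (diag c f) i = c i * coord f i"
  by (simp add: diag.rep_eq)

lemma bounded_linear_diag:
  assumes c: "\<And>j. cmod (c j) \<le> 1"
  shows "bounded_linear (diag c)" and "norm (diag c f) \<le> norm f"
proof -
  show le: "norm (diag c f) \<le> norm f" for f
  proof (rule norm_ell2_le)
    fix F :: "'a set" assume F: "finite F"
    have "(\<Sum>i\<in>F. (cmod (coord (diag c f) i))\<^sup>2) \<le> (\<Sum>i\<in>F. (cmod (coord f i))\<^sup>2)"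
      by (intro sum_mono power_mono) (auto simp: coord_diag c norm_mult mult_left_le_one_le)
    then show "(\<Sum>i\<in>F. (cmod (coord (diag c f) i))\<^sup>2) \<le> (norm f)\<^sup>2" using sum_coord_le[OF F, of f] by linarith
  qed simp
  show "bounded_linear (diag c)"
    by (rule bounded_linear_intro[where K = 1]) (auto intro!: ell2_eqI simp: coord_diag c algebra_simps le)
qed

text \<open>Composition with \<open>\<sigma>\<close> on \<open>D\<close> and 0 elsewhere; maps that
  are not injective on \<open>D\<close> default to 0. Left and right translations and the inversion
  of a group are all of this form.\<close>

lift_definition pull :: "('i \<Rightarrow> 'i) \<Rightarrow> 'i set \<Rightarrow> 'i ell2 \<Rightarrow> 'i ell2" is
  "\<lambda>\<sigma> D f i. if inj_on \<sigma> D \<and> i \<in> D then f (\<sigma> i) else 0"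
proof -
  fix \<sigma> :: "'i \<Rightarrow> 'i" and D and f :: "'i \<Rightarrow> complex" assume f: "square_summable f"
  show "square_summable (\<lambda>i. if inj_on \<sigma> D \<and> i \<in> D then f (\<sigma> i) else 0)"
  proof (rule square_summableI[of _ "\<Sum>\<^sub>\<infinity>i. (cmod (f i))\<^sup>2"])
    fix F :: "'i set" assume F: "finite F"
    show "(\<Sum>i\<in>F. (cmod (if inj_on \<sigma> D \<and> i \<in> D then f (\<sigma> i) else 0))\<^sup>2) \<le> (\<Sum>\<^sub>\<infinity>i. (cmod (f i))\<^sup>2)"
    proof (cases "inj_on \<sigma> D")
      case True
      have "(\<Sum>i\<in>F. (cmod (if inj_on \<sigma> D \<and> i \<in> D then f (\<sigma> i) else 0))\<^sup>2) = (\<Sum>i\<in>F \<inter> D. (cmod (f (\<sigma> i)))\<^sup>2)"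
        using F True by (auto intro!: sum.mono_neutral_cong_right split: if_splits)
      also have "\<dots> = (\<Sum>j\<in>\<sigma> ` (F \<inter> D). (cmod (f j))\<^sup>2)"
        using True by (subst sum.reindex) (auto intro: inj_on_subset)
      also have "\<dots> \<le> (\<Sum>\<^sub>\<infinity>i. (cmod (f i))\<^sup>2)"
        using f F by (intro finite_sum_le_infsum) (auto simp: square_summable_def)
      finally show ?thesis .
    qed (simp add: infsum_nonneg)
  qed
qed

lemma coord_pull: "inj_on \<sigma> D \<Longrightarrow> coord (pull \<sigma> D f) i = (if i \<in> D then coord f (\<sigma> i) else 0)"
  by (simp add: pull.rep_eq)

lemma bounded_linear_pull:
  assumes inj: "inj_on \<sigma> D"
  shows "bounded_linear (pull \<sigma> D)" and "norm (pull \<sigma> D f) \<le> norm f"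
proof -
  show le: "norm (pull \<sigma> D f) \<le> norm f" for f
  proof (rule norm_ell2_le)
    fix F :: "'a set" assume F: "finite F"
    have "(\<Sum>i\<in>F. (cmod (coord (pull \<sigma> D f) i))\<^sup>2) = (\<Sum>i\<in>F \<inter> D. (cmod (coord f (\<sigma> i)))\<^sup>2)"
      using F inj by (auto intro!: sum.mono_neutral_cong_right simp: coord_pull split: if_splits)
    also have "\<dots> = (\<Sum>j\<in>\<sigma> ` (F \<inter> D). (cmod (coord f j))\<^sup>2)"
      using inj by (subst sum.reindex) (auto intro: inj_on_subset)
    also have "\<dots> \<le> (norm f)\<^sup>2" using F by (intro sum_coord_le) auto
    finally show "(\<Sum>i\<in>F. (cmod (coord (pull \<sigma> D f) i))\<^sup>2) \<le> (norm f)\<^sup>2" .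
  qed simp
  show "bounded_linear (pull \<sigma> D)"
    by (rule bounded_linear_intro[where K = 1]) (auto intro!: ell2_eqI simp: coord_pull inj le)
qed

lemma pull_ket:
  assumes "inj_on \<sigma> D"
  shows "i \<in> D \<Longrightarrow> pull \<sigma> D (ket c (\<sigma> i)) = ket c i" and "j \<notin> \<sigma> ` D \<Longrightarrow> pull \<sigma> D (ket c j) = 0"
  using assms by (auto intro!: ell2_eqI simp: coord_pull coord_ket inj_on_def)

lemma inner_pull:
  assumes \<sigma>: "inj_on \<sigma> D" and \<tau>: "\<And>i. i \<in> D \<Longrightarrow> \<tau> (\<sigma> i) = i"
  shows "inner (pull \<sigma> D f) g = inner f (pull \<tau> (\<sigma> ` D) g)"
proof -
  have inj: "inj_on \<tau> (\<sigma> ` D)" using \<tau> by (auto simp: inj_on_def)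
  have "inner f (pull \<tau> (\<sigma> ` D) g) = inner (pull \<sigma> D f) g"
  proof (rule bounded_linear_eq_on_kets[of "\<lambda>g. inner f (pull \<tau> (\<sigma> ` D) g)" "inner (pull \<sigma> D f)"])
    show "bounded_linear (\<lambda>g. inner f (pull \<tau> (\<sigma> ` D) g))"
      by (intro bounded_linear_compose[OF bounded_linear_inner_right] bounded_linear_pull inj)
    fix c i
    show "inner f (pull \<tau> (\<sigma> ` D) (ket c i)) = inner (pull \<sigma> D f) (ket c i)"
    proof (cases "i \<in> D")
      case True
      then have "pull \<tau> (\<sigma> ` D) (ket c i) = ket c (\<sigma> i)"
        using pull_ket(1)[OF inj, of "\<sigma> i" c] \<tau> by simp
      then show ?thesis using True by (simp add: inner_commute[of _ "ket _ _"] inner_ket coord_pull \<sigma>)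
    next
      case False
      then have "i \<notin> \<tau> ` \<sigma> ` D" using \<tau> by auto
      then have "pull \<tau> (\<sigma> ` D) (ket c i) = 0" by (rule pull_ket(2)[OF inj])
      then show ?thesis using False by (simp add: inner_commute[of _ "ket _ _"] inner_ket coord_pull \<sigma>)
    qed
  qed (rule bounded_linear_inner_right)
  then show ?thesis by simp
qed

section \<open>Simultaneous group von Neumann algebras\<close>

text \<open>
  A type cannot depend on the given group. The operators below act on the direct sum of the spaces
  \<open>\<ell>\<^sub>2(G)\<close> over all groups \<open>G\<close> with carrier in the type \<open>'a\<close> (and of an irrelevant complement) and
  commute with the right translations of every \<open>G\<close>; every \<open>G\<close> provides a trace on this algebra.
\<close>

type_synonym 'a index = "'a monoid \<times> 'a"

definition imul :: "'i ell2 \<Rightarrow> 'i ell2" where "imul = diag (\<lambda>_. \<i>)"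

text \<open>Zero off the summand of \<open>G\<close>, and not the identity there:
  \<open>rt G \<one>\<close> is the projection onto that summand, so an operator commuting with all
  translations preserves each summand.\<close>

definition rt :: "'a monoid \<Rightarrow> 'a \<Rightarrow> 'a index ell2 \<Rightarrow> 'a index ell2" where
  "rt G h = pull (\<lambda>(G', x). (G', x \<otimes>\<^bsub>G\<^esub> h)) ({G} \<times> carrier G)"

lemma coord_imul: "coord (imul f) i = \<i> * coord f i"
  by (simp add: imul_def coord_diag)

lemma imul_imul: "imul (imul f) = - f"
  by (rule ell2_eqI) (simp add: coord_imul)

lemma bounded_linear_imul: "bounded_linear imul"
  unfolding imul_def by (rule bounded_linear_diag) simp

lemma inner_imul: "inner (imul f) g = - inner f (imul g)"
proof -
  have "inner (imul f) g + inner f (imul g) = (\<Sum>\<^sub>\<infinity>i. inner (coord (imul f) i) (coord g i) + inner (coord f i) (coord (imul g) i))"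
    unfolding inner_coord by (rule infsum_add[symmetric]) (rule square_summable_dot[OF square_summable_coord square_summable_coord])+
  also have "\<dots> = 0" by (rule infsum_0) (simp add: coord_imul inner_complex_def)
  finally show ?thesis by simp
qed

lemma inj_on_rt:
  assumes "group G" "h \<in> carrier G"
  shows "inj_on (\<lambda>(G', x). (G', x \<otimes>\<^bsub>G\<^esub> h)) ({G} \<times> carrier G)"
  using assms by (auto simp: inj_on_def group.right_cancel)

lemma coord_rt:
  assumes "group G" "h \<in> carrier G"
  shows "coord (rt G h f) (G', x) = (if G' = G \<and> x \<in> carrier G then coord f (G, x \<otimes>\<^bsub>G\<^esub> h) else 0)"
  unfolding rt_def by (simp add: coord_pull[OF inj_on_rt[OF assms]])

lemma bounded_linear_rt: "group G \<Longrightarrow> h \<in> carrier G \<Longrightarrow> bounded_linear (rt G h)"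
  unfolding rt_def by (intro bounded_linear_pull inj_on_rt)

lemma inner_rt:
  assumes G: "group G" and h: "h \<in> carrier G"
  shows "inner (rt G h f) g = inner f (rt G (inv\<^bsub>G\<^esub> h) g)"
proof -
  interpret group G by (rule G)
  have img: "(\<lambda>(G', x). (G', x \<otimes>\<^bsub>G\<^esub> h)) ` ({G} \<times> carrier G) = {G} \<times> carrier G"
  proof
    show "{G} \<times> carrier G \<subseteq> (\<lambda>(G', x). (G', x \<otimes>\<^bsub>G\<^esub> h)) ` ({G} \<times> carrier G)"
    proof
      fix i assume "i \<in> {G} \<times> carrier G"
      then obtain x where "i = (G, x)" "x \<in> carrier G" by auto
      then show "i \<in> (\<lambda>(G', x). (G', x \<otimes>\<^bsub>G\<^esub> h)) ` ({G} \<times> carrier G)"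
        using h by (intro image_eqI[of _ _ "(G, x \<otimes>\<^bsub>G\<^esub> inv\<^bsub>G\<^esub> h)"]) (auto simp: m_assoc)
    qed
  qed (use h in auto)
  show ?thesis
    unfolding rt_def using inner_pull[OF inj_on_rt[OF G h], of "\<lambda>(G', x). (G', x \<otimes>\<^bsub>G\<^esub> inv\<^bsub>G\<^esub> h)"] h
    by (auto simp: img m_assoc)
qed

definition translation_invariant :: "('a index ell2 \<Rightarrow> 'a index ell2) \<Rightarrow> bool" where
  "translation_invariant T \<longleftrightarrow> (\<forall>f. T (imul f) = imul (T f)) \<and>
     (\<forall>G h f. group G \<longrightarrow> h \<in> carrier G \<longrightarrow> T (rt G h f) = rt G h (T f))"

typedef 'a gvn = "{T :: 'a index ell2 \<Rightarrow>\<^sub>L 'a index ell2. translation_invariant (blinfun_apply T)}"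
  morphisms blin Abs_gvn
  by (rule exI[of _ id_blinfun]) (simp add: translation_invariant_def)

setup_lifting type_definition_gvn

abbreviation app :: "'a gvn \<Rightarrow> 'a index ell2 \<Rightarrow> 'a index ell2" where
  "app x \<equiv> blinfun_apply (blin x)"

lemma app_imul: "app x (imul f) = imul (app x f)"
  and app_rt: "group G \<Longrightarrow> h \<in> carrier G \<Longrightarrow> app x (rt G h f) = rt G h (app x f)"
  using blin[of x] by (auto simp: translation_invariant_def)

lemma gvn_eqI: "(\<And>f. app x f = app y f) \<Longrightarrow> x = y"
  by (metis blin_inject blinfun_eqI)

lemma translation_invariantI:
  assumes "\<And>f. T (imul f) = imul (T f)"
    "\<And>G h f. group G \<Longrightarrow> h \<in> carrier G \<Longrightarrow> T (rt G h f) = rt G h (T f)"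
  shows "translation_invariant T"
  using assms by (auto simp: translation_invariant_def)

lemmas linear_imul = bounded_linear.linear[OF bounded_linear_imul]
lemmas linear_rt = bounded_linear.linear[OF bounded_linear_rt]

instantiation gvn :: (type) real_vector
begin

lift_definition zero_gvn :: "'a gvn" is 0
  by (auto intro!: translation_invariantI simp: linear_0[OF linear_imul] linear_0[OF linear_rt])
lift_definition plus_gvn :: "'a gvn \<Rightarrow> 'a gvn \<Rightarrow> 'a gvn" is "(+)"
  by (auto intro!: translation_invariantI
      simp: translation_invariant_def blinfun.add_left linear_add[OF linear_imul] linear_add[OF linear_rt])
lift_definition minus_gvn :: "'a gvn \<Rightarrow> 'a gvn \<Rightarrow> 'a gvn" is "(-)"
  by (auto intro!: translation_invariantI
      simp: translation_invariant_def blinfun.diff_left linear_diff[OF linear_imul] linear_diff[OF linear_rt])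
lift_definition uminus_gvn :: "'a gvn \<Rightarrow> 'a gvn" is uminus
  by (auto intro!: translation_invariantI
      simp: translation_invariant_def blinfun.minus_left linear_neg[OF linear_imul] linear_neg[OF linear_rt])
lift_definition scaleR_gvn :: "real \<Rightarrow> 'a gvn \<Rightarrow> 'a gvn" is scaleR
  by (auto intro!: translation_invariantI
      simp: translation_invariant_def blinfun.scaleR_left linear_scale[OF linear_imul] linear_scale[OF linear_rt])

instance
  by standard (transfer; simp add: algebra_simps)+

end

instantiation gvn :: (type) real_normed_vector
begin

lift_definition norm_gvn :: "'a gvn \<Rightarrow> real" is norm .
definition sgn_gvn :: "'a gvn \<Rightarrow> 'a gvn" where "sgn_gvn x = x /\<^sub>R norm x"
definition dist_gvn :: "'a gvn \<Rightarrow> 'a gvn \<Rightarrow> real" where "dist_gvn x y = norm (x - y)"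
definition uniformity_gvn :: "('a gvn \<times> 'a gvn) filter" where
  "uniformity_gvn = (INF e\<in>{0 <..}. principal {(x, y). dist x y < e})"
definition open_gvn :: "'a gvn set \<Rightarrow> bool" where
  "open_gvn U = (\<forall>x\<in>U. eventually (\<lambda>(x', y). x' = x \<longrightarrow> y \<in> U) uniformity)"

instance
proof
  fix x y :: "'a gvn" and r :: real
  show "norm x = 0 \<longleftrightarrow> x = 0" by transfer simp
  show "norm (x + y) \<le> norm x + norm y" by transfer (rule norm_triangle_ineq)
  show "norm (r *\<^sub>R x) = \<bar>r\<bar> * norm x" by transfer simp
qed (simp_all add: sgn_gvn_def dist_gvn_def uniformity_gvn_def open_gvn_def)

end

lemma app_simps [simp]:
  "app 0 f = 0" "app (x + y) f = app x f + app y f" "app (x - y) f = app x f - app y f"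
  "app (- x) f = - app x f" "app (r *\<^sub>R x) f = r *\<^sub>R app x f"
  by (simp_all add: zero_gvn.rep_eq plus_gvn.rep_eq minus_gvn.rep_eq uminus_gvn.rep_eq scaleR_gvn.rep_eq
      blinfun.add_left blinfun.diff_left blinfun.minus_left blinfun.scaleR_left)

lemma app_sum: "app (sum x A) f = (\<Sum>i\<in>A. app (x i) f)"
  by (induction A rule: infinite_finite_induct) simp_all

lemma norm_app_le: "norm (app x f) \<le> norm x * norm f"
  unfolding norm_gvn.rep_eq by (rule norm_blinfun)

lemma norm_gvn_le: "0 \<le> c \<Longrightarrow> (\<And>f. norm (app x f) \<le> c * norm f) \<Longrightarrow> norm x \<le> c"
  unfolding norm_gvn.rep_eq by (rule norm_blinfun_bound)

instance gvn :: (type) banach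
proof
  fix X :: "nat \<Rightarrow> 'a gvn" assume X: "Cauchy X"
  have "Cauchy (\<lambda>n. blin (X n))"
  proof (rule metric_CauchyI)
    fix e :: real assume "0 < e"
    then obtain N where N: "\<And>m n. m \<ge> N \<Longrightarrow> n \<ge> N \<Longrightarrow> dist (X m) (X n) < e" using metric_CauchyD[OF X] by blast
    then show "\<exists>N. \<forall>m\<ge>N. \<forall>n\<ge>N. dist (blin (X m)) (blin (X n)) < e"
      by (auto simp: dist_norm norm_gvn.rep_eq minus_gvn.rep_eq)
  qed
  then obtain L where L: "(\<lambda>n. blin (X n)) \<longlonglongrightarrow> L" using Cauchy_convergent convergent_def by blast
  have lim: "(\<lambda>n. app (X n) f) \<longlonglongrightarrow> blinfun_apply L f" for f
    by (intro tendsto_intros L)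
  have "translation_invariant (blinfun_apply L)"
  proof (rule translation_invariantI)
    fix f
    have "(\<lambda>n. imul (app (X n) f)) \<longlonglongrightarrow> imul (blinfun_apply L f)"
      by (rule bounded_linear.tendsto[OF bounded_linear_imul lim])
    then show "blinfun_apply L (imul f) = imul (blinfun_apply L f)"
      using lim[of "imul f"] LIMSEQ_unique by (simp add: app_imul)
  next
    fix G :: "'a monoid" and h f assume G: "group G" "h \<in> carrier G"
    have "(\<lambda>n. rt G h (app (X n) f)) \<longlonglongrightarrow> rt G h (blinfun_apply L f)"
      by (rule bounded_linear.tendsto[OF bounded_linear_rt[OF G] lim])
    then show "blinfun_apply L (rt G h f) = rt G h (blinfun_apply L f)"
      using lim[of "rt G h f"] LIMSEQ_unique by (simp add: app_rt[OF G])
  qed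
  then have "blin (Abs_gvn L) = L" by (simp add: Abs_gvn_inverse)
  then have "(\<lambda>n. norm (X n - Abs_gvn L)) \<longlonglongrightarrow> 0"
    using L by (simp add: norm_gvn.rep_eq minus_gvn.rep_eq tendsto_norm_zero_iff flip: LIM_zero_iff[of _ L])
  then have "X \<longlonglongrightarrow> Abs_gvn L" by (simp add: tendsto_norm_zero_iff LIM_zero_iff)
  then show "convergent X" by (rule convergentI)
qed

instantiation gvn :: (type) real_normed_algebra_1
begin

lift_definition one_gvn :: "'a gvn" is id_blinfun
  by (simp add: translation_invariant_def)
lift_definition times_gvn :: "'a gvn \<Rightarrow> 'a gvn \<Rightarrow> 'a gvn" is blinfun_compose
  by (simp add: translation_invariant_def)

instance
proof
  fix x y z :: "'a gvn" and r :: real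
  show "x * y * z = x * (y * z)" "1 * x = x" "x * 1 = x" "(x + y) * z = x * z + y * z" "x * (y + z) = x * y + x * z"
    "r *\<^sub>R x * y = r *\<^sub>R (x * y)" "x * r *\<^sub>R y = r *\<^sub>R (x * y)"
    by (rule gvn_eqI, simp add: times_gvn.rep_eq one_gvn.rep_eq blinfun.add_right blinfun.scaleR_right)+
  have "(1 :: 'a gvn) \<noteq> 0"
  proof
    assume "(1 :: 'a gvn) = 0"
    then have "app (1 :: 'a gvn) (ket 1 undefined) = 0" by simp
    then have "norm (ket 1 undefined :: 'a index ell2) = 0" by (simp add: one_gvn.rep_eq)
    then show False unfolding norm_ket by simp
  qed
  then show "(0 :: 'a gvn) \<noteq> 1" by simp
  show "norm (x * y) \<le> norm x * norm y"
    by transfer (rule norm_blinfun_compose)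
  have "norm (1 :: 'a gvn) \<le> 1" by (rule norm_gvn_le) (simp_all add: one_gvn.rep_eq)
  moreover have "1 \<le> norm (1 :: 'a gvn)"
    using norm_app_le[of "1 :: 'a gvn" "ket 1 undefined"] by (simp add: one_gvn.rep_eq norm_ket)
  ultimately show "norm (1 :: 'a gvn) = 1" by simp
qed

end

lemma app_mult [simp]: "app (x * y) f = app x (app y f)" and app_one [simp]: "app 1 f = f"
  by (simp_all add: times_gvn.rep_eq one_gvn.rep_eq)

lemma ell2_inner_eqI: "(\<And>g. inner f g = inner f' g) \<Longrightarrow> f = (f' :: 'i ell2)"
  by (metis inner_diff_left inner_eq_zero_iff right_minus_eq)

text \<open>The commutation relations pass to the adjoint because the adjoint of \<open>imul\<close>
  is its negative and that of a right translation is the inverse translation.\<close>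

lemma gvn_adjoint_exists: "\<exists>y :: 'a gvn. \<forall>f g. inner (app y f) g = inner f (app x g)"
proof -
  obtain S where S: "\<And>f g. inner (blinfun_apply S f) g = inner f (app x g)"
    using adjoint_exists[of "blin x"] by blast
  have "translation_invariant (blinfun_apply S)"
  proof (rule translation_invariantI; rule ell2_inner_eqI)
    show "inner (blinfun_apply S (imul f)) g = inner (imul (blinfun_apply S f)) g" for f g
      by (simp add: S inner_imul app_imul)
    show "inner (blinfun_apply S (rt G h f)) g = inner (rt G h (blinfun_apply S f)) g"
      if G: "group G" "h \<in> carrier G" for G h f g
      using G group.inv_closed[OF G] by (simp add: S inner_rt app_rt)
  qed
  then have "blin (Abs_gvn S) = S" by (simp add: Abs_gvn_inverse)
  then show ?thesis using S by (intro exI[of _ "Abs_gvn S"]) simp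
qed

instantiation gvn :: (type) op_algebra
begin

definition star_gvn :: "'a gvn \<Rightarrow> 'a gvn" where
  "star_gvn x = (SOME y. \<forall>f g. inner (app y f) g = inner f (app x g))"

lift_definition imunit_gvn :: "'a gvn" is "Blinfun imul"
proof -
  have "imul (rt G h f) = rt G h (imul f)" if "group G" "h \<in> carrier G" for G :: "'a monoid" and h f
    by (rule ell2_eqI) (auto simp: coord_imul coord_rt[OF that])
  then show "translation_invariant (blinfun_apply (Blinfun imul) :: 'a index ell2 \<Rightarrow> _)"
    by (simp add: bounded_linear_Blinfun_apply[OF bounded_linear_imul] translation_invariant_def)
qed

text \<open>Symmetry is a separate condition: the inner product is only the real part of the complex
  one, and \<open>imunit\<close> has the form 0 without being symmetric.\<close>

definition psd_gvn :: "'a gvn \<Rightarrow> bool" where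
  "psd_gvn x \<longleftrightarrow> (\<forall>f g. inner (app x f) g = inner f (app x g)) \<and> (\<forall>f. 0 \<le> inner f (app x f))"

lemma inner_app_star: "inner (app (star x) f) g = inner f (app x (g :: 'a index ell2))"
proof -
  have "\<forall>f g. inner (app (star x) f) g = inner f (app x g)"
    unfolding star_gvn_def by (rule someI_ex[OF gvn_adjoint_exists])
  then show ?thesis by blast
qed

lemma star_gvn_eqI:
  assumes "\<And>f g. inner (app y f) g = inner f (app x g)"
  shows "star x = (y :: 'a gvn)"
  by (intro gvn_eqI ell2_inner_eqI) (simp add: inner_app_star assms)

lemma app_imunit: "app (imunit :: 'a gvn) f = imul f"
  by (simp add: imunit_gvn.rep_eq bounded_linear_Blinfun_apply[OF bounded_linear_imul])

instance
proof
  fix x y a b :: "'a gvn" and r c :: real and X :: "nat \<Rightarrow> 'a gvn"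
  show "star (x + y) = star x + star y"
    by (rule star_gvn_eqI) (simp add: inner_add_left inner_add_right inner_app_star)
  show "star (r *\<^sub>R x) = r *\<^sub>R star x" by (rule star_gvn_eqI) (simp add: inner_app_star)
  show "star (x * y) = star y * star x" by (rule star_gvn_eqI) (simp add: inner_app_star)
  have inner_star: "inner f (app (star x) g) = inner (app x f) g" for f g and x :: "'a gvn"
    by (metis inner_app_star inner_commute)
  show ss: "star (star x) = x" by (rule star_gvn_eqI) (simp add: inner_star)
  have nst: "norm (star x) \<le> norm x" for x :: "'a gvn"
  proof (rule norm_gvn_le)
    fix f
    show "norm (app (star x) f) \<le> norm x * norm f"
    proof (cases "app (star x) f = 0")
      case False
      have "norm (app (star x) f) * norm (app (star x) f) = inner f (app x (app (star x) f))"
        by (simp add: inner_app_star[symmetric] dot_square_norm power2_eq_square)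
      also have "\<dots> \<le> norm f * norm (app x (app (star x) f))" by (rule norm_cauchy_schwarz)
      also have "\<dots> \<le> norm f * (norm x * norm (app (star x) f))" by (intro mult_left_mono norm_app_le) simp
      finally show ?thesis using False by (simp add: mult_ac)
    qed simp
  qed simp
  show "norm (star x * x) = norm x * norm x"
  proof (rule antisym)
    have "norm (star x * x) \<le> norm (star x) * norm x" by (rule norm_mult_ineq)
    also have "\<dots> \<le> norm x * norm x" by (intro mult_right_mono nst) simp
    finally show "norm (star x * x) \<le> norm x * norm x" .
    have "norm x \<le> sqrt (norm (star x * x))"
    proof (rule norm_gvn_le)
      fix f
      have "(norm (app x f))\<^sup>2 = inner f (app (star x * x) f)"
        by (simp add: power2_norm_eq_inner inner_star)
      also have "\<dots> \<le> norm f * norm (app (star x * x) f)" by (rule norm_cauchy_schwarz)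
      also have "\<dots> \<le> norm f * (norm (star x * x) * norm f)" by (intro mult_left_mono norm_app_le) simp
      finally have "norm (app x f) \<le> sqrt (norm (star x * x) * (norm f)\<^sup>2)"
        by (intro real_le_rsqrt) (simp add: power2_eq_square mult_ac)
      then show "norm (app x f) \<le> sqrt (norm (star x * x)) * norm f" by (simp add: real_sqrt_mult)
    qed simp
    then have "(norm x)\<^sup>2 \<le> (sqrt (norm (star x * x)))\<^sup>2" by (intro power_mono) auto
    then show "norm x * norm x \<le> norm (star x * x)" by (simp add: power2_eq_square)
  qed
  show "imunit * imunit = (- 1 :: 'a gvn)" by (rule gvn_eqI) (simp add: app_imunit imul_imul)
  show "imunit * x = x * imunit" by (rule gvn_eqI) (simp add: app_imunit app_imul)
  show "star imunit = (- imunit :: 'a gvn)" by (rule star_gvn_eqI) (simp add: app_imunit inner_imul)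
  show "psd a \<Longrightarrow> star a = a" by (rule star_gvn_eqI) (simp add: psd_gvn_def)
  show "psd a \<Longrightarrow> psd b \<Longrightarrow> psd (a + b)" by (simp add: psd_gvn_def inner_add_left inner_add_right)
  show "0 \<le> r \<Longrightarrow> psd a \<Longrightarrow> psd (r *\<^sub>R a)" by (simp add: psd_gvn_def)
  show "psd (1 :: 'a gvn)" by (simp add: psd_gvn_def)
  show "psd a \<Longrightarrow> psd (star x * a * x)" by (simp add: psd_gvn_def inner_star inner_app_star)
  show "psd a" if X: "\<And>n. psd (X n)" "X \<longlonglongrightarrow> a"
  proof -
    have lim: "(\<lambda>n. app (X n) f) \<longlonglongrightarrow> app a f" for f
    proof -
      have "(\<lambda>n. norm (X n - a) * norm f) \<longlonglongrightarrow> 0 * norm f"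
        using X(2) by (intro tendsto_mult tendsto_const) (simp add: tendsto_norm_zero_iff LIM_zero_iff)
      then have lim: "(\<lambda>n. norm (X n - a) * norm f) \<longlonglongrightarrow> 0" by simp
      have "(\<lambda>n. app (X n - a) f) \<longlonglongrightarrow> 0"
        by (rule Lim_null_comparison[OF _ lim]) (intro always_eventually allI norm_app_le)
      then show ?thesis by (simp add: LIM_zero_iff)
    qed
    have "inner (app a f) g = inner f (app a g)" for f g
    proof (rule LIMSEQ_unique)
      show "(\<lambda>n. inner (app (X n) f) g) \<longlonglongrightarrow> inner (app a f) g" by (intro tendsto_intros lim)
      show "(\<lambda>n. inner (app (X n) f) g) \<longlonglongrightarrow> inner f (app a g)"
        using tendsto_inner[OF tendsto_const lim, of f g] X(1) by (simp add: psd_gvn_def)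
    qed
    moreover have "0 \<le> inner f (app a f)" for f
      by (rule LIMSEQ_le_const[OF tendsto_inner[OF tendsto_const lim]]) (use X(1) in \<open>auto simp: psd_gvn_def\<close>)
    ultimately show ?thesis by (simp add: psd_gvn_def)
  qed
  show "norm a \<le> c" if a: "star a = a" "psd (c *\<^sub>R 1 - a)" "psd (c *\<^sub>R 1 + a)"
  proof -
    have sym: "inner (app a f) g = inner f (app a g)" for f g using inner_app_star[of a f g] a(1) by simp
    have q: "\<bar>inner f (app a f)\<bar> \<le> c * (norm f)\<^sup>2" for f
      using a(2,3) unfolding psd_gvn_def by (simp add: inner_diff_right inner_add_right power2_norm_eq_inner abs_le_iff) (smt (verit))
    have c: "0 \<le> c" using q[of "ket 1 undefined"] by (simp add: norm_ket)
    show ?thesis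
    proof (rule norm_gvn_le[OF c])
      fix f
      show "norm (app a f) \<le> c * norm f"
      proof (cases "app a f = 0 \<or> f = 0")
        case True
        then show ?thesis using c by auto
      next
        case False
        then have pos: "0 < norm f" "0 < norm (app a f)" by auto
        \<comment> \<open>The direction of \<open>app a f\<close>, scaled to the norm of
          \<open>f\<close>. Polarisation turns the quadratic bound into one for
          \<open>inner (app a f) g\<close>, and equal norms make the parallelogram law give the
          sharp constant.\<close>
        define g where "g = (norm f / norm (app a f)) *\<^sub>R app a f"
        have ng: "norm g = norm f" using pos by (simp add: g_def)
        have "4 * inner (app a f) g = inner (f + g) (app a (f + g)) - inner (f - g) (app a (f - g))"
          using sym[of f g] by (simp add: blinfun.add_right blinfun.diff_right inner_add_left inner_add_right
              inner_diff_left inner_diff_right inner_commute)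
        also have "\<dots> \<le> c * (norm (f + g))\<^sup>2 + c * (norm (f - g))\<^sup>2"
          using q[of "f + g"] q[of "f - g"] by linarith
        also have "\<dots> = c * (2 * (norm f)\<^sup>2 + 2 * (norm g)\<^sup>2)"
          by (simp add: power2_norm_eq_inner inner_add_left inner_add_right inner_diff_left inner_diff_right
              inner_commute algebra_simps)
        finally have "inner (app a f) g \<le> c * (norm f)\<^sup>2" by (simp add: ng)
        moreover have "inner (app a f) g = norm f * norm (app a f)"
          using pos by (simp add: g_def dot_square_norm power2_eq_square)
        ultimately have "norm f * norm (app a f) \<le> norm f * (c * norm f)" by (simp add: power2_eq_square mult_ac)
        then show ?thesis using pos by simp
      qed
    qed
  qed
  show "psd (norm a *\<^sub>R 1 - a)" if a: "star a = a"
  proof -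
    have sym: "inner (app a f) g = inner f (app a g)" for f g using inner_app_star[of a f g] a by simp
    have "inner f (app a f) \<le> norm a * inner f f" for f
    proof -
      have "inner f (app a f) \<le> norm f * norm (app a f)" by (rule norm_cauchy_schwarz)
      also have "\<dots> \<le> norm f * (norm a * norm f)" by (intro mult_left_mono norm_app_le) simp
      finally show ?thesis by (simp add: dot_square_norm power2_eq_square mult_ac)
    qed
    then show ?thesis by (simp add: psd_gvn_def inner_diff_left inner_diff_right sym)
  qed
qed

end

section \<open>The canonical trace of a group\<close>

definition vac :: "'a monoid \<Rightarrow> 'a index ell2" where
  "vac G = ket 1 (G, \<one>\<^bsub>G\<^esub>)"

definition vtr :: "'a monoid \<Rightarrow> 'a gvn \<Rightarrow> real" where
  "vtr G x = inner (vac G) (app x (vac G))"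

text \<open>The identity on the other summands, so that \<open>lam g\<close> is unitary and
  \<open>lam \<one>\<close> is the unit on the whole direct sum.\<close>

definition shift :: "'a monoid \<Rightarrow> 'a \<Rightarrow> 'a index \<Rightarrow> 'a index" where
  "shift G g = (\<lambda>(G', x). if G' = G \<and> x \<in> carrier G then (G, inv\<^bsub>G\<^esub> g \<otimes>\<^bsub>G\<^esub> x) else (G', x))"

lift_definition cconj :: "'i ell2 \<Rightarrow> 'i ell2" is "\<lambda>f i. cnj (f i)"
  by (simp add: square_summable_def)

lemma coord_cconj: "coord (cconj f) i = cnj (coord f i)"
  by (simp add: cconj.rep_eq)

lemma inner_cconj: "inner (cconj f) g = inner f (cconj g)"
  unfolding inner_coord by (rule infsum_cong) (simp add: coord_cconj inner_complex_def)

lemma coord_app_ofc: "coord (app (ofc z) f) i = z * coord f i"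
  by (simp add: ofc_def app_imunit coord_imul complex_eq_iff)

lemma app_ofc_ket: "app (ofc z) (ket c i) = ket (z * c) i"
  by (rule ell2_eqI) (simp add: coord_app_ofc coord_ket)

lemma app_ket: "app x (ket c i) = app (ofc c) (app x (ket 1 i))"
proof -
  have "app x (ket c i) = app x (app (ofc c) (ket 1 i))" by (simp add: app_ofc_ket)
  also have "\<dots> = app (x * ofc c) (ket 1 i)" by simp
  also have "\<dots> = app (ofc c * x) (ket 1 i)" by (simp only: ofc_comm)
  finally show ?thesis by simp
qed

lemma translation_invariant_Blinfun:
  "bounded_linear T \<Longrightarrow> translation_invariant T \<Longrightarrow> app (Abs_gvn (Blinfun T)) = T"
  by (simp add: Abs_gvn_inverse bounded_linear_Blinfun_apply)

context
  fixes G :: "'a monoid" (structure)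
  assumes G: "group G"
begin

interpretation group G by (rule G)

lemma inj_shift: "g \<in> carrier G \<Longrightarrow> inj (shift G g)"
  by (auto simp: inj_on_def shift_def split: if_splits prod.splits)

definition lam :: "'a \<Rightarrow> 'a gvn" where
  "lam g = Abs_gvn (Blinfun (pull (shift G g) UNIV))"

text \<open>By associativity left translations commute with right translations of the same group; on
  the summands of other groups the shift is the identity.\<close>

lemma app_lam:
  assumes g: "g \<in> carrier G"
  shows "app (lam g) = pull (shift G g) UNIV"
  unfolding lam_def
proof (rule translation_invariant_Blinfun)
  have cp: "coord (pull (shift G g) UNIV f) i = coord f (shift G g i)" for f i
    by (simp add: coord_pull[OF inj_shift[OF g]])
  show "bounded_linear (pull (shift G g) UNIV)" by (rule bounded_linear_pull[OF inj_shift[OF g]])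
  show "translation_invariant (pull (shift G g) UNIV)"
  proof (rule translation_invariantI; rule ell2_eqI)
    show "coord (pull (shift G g) UNIV (imul f)) i = coord (imul (pull (shift G g) UNIV f)) i" for f i
      by (simp add: cp coord_imul)
    show "coord (pull (shift G g) UNIV (rt G' h f)) i = coord (rt G' h (pull (shift G g) UNIV f)) i"
      if G': "group G'" "h \<in> carrier G'" for G' h f i
    proof (cases i)
      case (Pair H x)
      have 1: "coord (pull (shift G g) UNIV (rt G' h f)) i = coord (rt G' h f) (shift G g (H, x))" by (simp only: cp Pair)
      have 2: "coord (rt G' h (pull (shift G g) UNIV f)) i = (if H = G' \<and> x \<in> carrier G' then coord f (shift G g (G', x \<otimes>\<^bsub>G'\<^esub> h)) else 0)"
        by (simp only: cp Pair coord_rt[OF G'])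
      show ?thesis unfolding 1 2 using g G' by (auto simp: coord_rt[OF G'] shift_def m_assoc)
    qed
  qed
qed

lemma coord_app_lam:
  "g \<in> carrier G \<Longrightarrow> coord (app (lam g) f) i = coord f (shift G g i)"
  by (simp add: app_lam coord_pull[OF inj_shift])

lemma lam_one: "lam \<one> = 1"
  by (intro gvn_eqI ell2_eqI) (auto simp: coord_app_lam shift_def split: prod.splits)

lemma lam_mult: "g \<in> carrier G \<Longrightarrow> h \<in> carrier G \<Longrightarrow> lam (g \<otimes> h) = lam g * lam h"
  by (intro gvn_eqI ell2_eqI) (auto simp: coord_app_lam shift_def inv_mult_group m_assoc split: prod.splits)

lemma star_lam:
  assumes g: "g \<in> carrier G"
  shows "star (lam g) = lam (inv g)"
proof (rule star_gvn_eqI)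
  fix f f'
  have inverse: "shift G (inv g) (shift G g i) = i" "shift G g (shift G (inv g) i) = i" for i
    using g by (auto simp: shift_def m_assoc[symmetric] split: prod.splits)
  have "range (shift G (inv g)) = UNIV" using inverse(1) by (metis surjI)
  then show "inner (app (lam (inv g)) f) f' = inner f (app (lam g) f')"
    using g inner_pull[OF inj_shift[of "inv g"], of "shift G g" f f'] inverse by (simp add: app_lam)
qed

lemma app_lam_vac: "g \<in> carrier G \<Longrightarrow> app (lam g) (vac G) = ket 1 (G, g)"
proof (rule ell2_eqI)
  fix i assume g: "g \<in> carrier G"
  have "inv g \<otimes> x = \<one> \<longleftrightarrow> x = g" if "x \<in> carrier G" for x
    using g that by (metis inv_closed inv_equality inv_inv l_inv)
  then show "coord (app (lam g) (vac G)) i = coord (ket 1 (G, g)) i"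
    using g by (cases i) (auto simp: coord_app_lam vac_def coord_ket shift_def)
qed

text \<open>Right translations carry the vacuum to every basis point of the summand, so the vector
  \<open>app x (vac G)\<close> determines \<open>x\<close> there.\<close>

lemma app_vac_rt: "h \<in> carrier G \<Longrightarrow> rt G (inv h) (app x (vac G)) = app x (ket 1 (G, h))"
proof -
  assume h: "h \<in> carrier G"
  have *: "y \<otimes> inv h = \<one> \<longleftrightarrow> y = h" if "y \<in> carrier G" for y
  proof
    assume "y \<otimes> inv h = \<one>"
    then have "y \<otimes> inv h \<otimes> h = h" using h by simp
    then show "y = h" using h that by (simp add: m_assoc)
  qed (use h in simp)
  have ih: "inv h \<in> carrier G" using h by simp
  have "rt G (inv h) (vac G) = ket 1 (G, h)"
  proof (rule ell2_eqI)
    fix i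
    show "coord (rt G (inv h) (vac G)) i = coord (ket 1 (G, h)) i"
      using h * by (cases i) (simp add: coord_rt[OF G ih] vac_def coord_ket)
  qed
  then show ?thesis using app_rt[OF G, of "inv h" x "vac G"] h by simp
qed

text \<open>The projection \<open>rt G \<one>\<close> fixes the vacuum and commutes with
  \<open>x\<close>.\<close>

lemma coord_app_vac_outside: "\<not> (G' = G \<and> g \<in> carrier G) \<Longrightarrow> coord (app x (vac G)) (G', g) = 0"
proof -
  assume *: "\<not> (G' = G \<and> g \<in> carrier G)"
  have "app x (vac G) = rt G \<one> (app x (vac G))" 
    using app_vac_rt[OF one_closed, of x] unfolding inv_one by (metis vac_def)
  then have "coord (app x (vac G)) (G', g) = coord (rt G \<one> (app x (vac G))) (G', g)" by (rule arg_cong)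
  also have "\<dots> = 0" by (subst coord_rt[OF G one_closed]) (simp only: * if_False)
  finally show "coord (app x (vac G)) (G', g) = 0" .
qed

lemma coord_app_star_vac:
  assumes g: "g \<in> carrier G"
  shows "coord (app (star x) (vac G)) (G, g) = cnj (coord (app x (vac G)) (G, inv g))"
proof -
  have "inner c (coord (app (star x) (vac G)) (G, g)) = inner c (cnj (coord (app x (vac G)) (G, inv g)))" for c
  proof -
    have "inner c (coord (app (star x) (vac G)) (G, g)) = inner (app x (ket c (G, g))) (vac G)"
      using inner_ket[of c "(G, g)" "app (star x) (vac G)"] inner_app_star[of x "vac G" "ket c (G, g)"]
      by (simp add: inner_commute[of "ket c (G, g)"] inner_commute[of "vac G"] del: inner_ket)
    also have "\<dots> = inner (ket 1 (G, \<one>)) (app (ofc c) (app x (ket 1 (G, g))))"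
      by (subst inner_commute) (simp only: vac_def app_ket[of x c "(G, g)"])
    also have "\<dots> = inner 1 (c * coord (rt G (inv g) (app x (vac G))) (G, \<one>))"
      by (simp only: inner_ket coord_app_ofc app_vac_rt[OF g])
    also have "\<dots> = inner 1 (c * coord (app x (vac G)) (G, inv g))"
      using g by (simp add: coord_rt[OF G inv_closed[OF g]])
    also have "\<dots> = inner c (cnj (coord (app x (vac G)) (G, inv g)))"
      by (simp add: inner_complex_def)
    finally show ?thesis .
  qed
  then have "inner c (coord (app (star x) (vac G)) (G, g) - cnj (coord (app x (vac G)) (G, inv g))) = 0" for c
    by (simp only: inner_diff_right diff_self)
  from this[of "coord (app (star x) (vac G)) (G, g) - cnj (coord (app x (vac G)) (G, inv g))"]
  show ?thesis by (simp only: inner_eq_zero_iff right_minus_eq)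
qed

abbreviation flip :: "'a index ell2 \<Rightarrow> 'a index ell2" where
  "flip \<equiv> pull (\<lambda>(G', x). (G', inv x)) ({G} \<times> carrier G)"

lemma inj_flip: "inj_on (\<lambda>(G', x). (G', inv x)) ({G} \<times> carrier G)"
  by (auto simp: inj_on_def) (metis inv_inv)

lemma inner_flip: "inner (flip f) f' = inner f (flip f')"
proof -
  have "(\<lambda>(G', x). (G', inv x)) ` ({G} \<times> carrier G) = {G} \<times> carrier G"
  proof
    show "{G} \<times> carrier G \<subseteq> (\<lambda>(G', x). (G', inv x)) ` ({G} \<times> carrier G)"
    proof
      fix i assume "i \<in> {G} \<times> carrier G"
      then obtain x where "i = (G, x)" "x \<in> carrier G" by auto
      then show "i \<in> (\<lambda>(G', x). (G', inv x)) ` ({G} \<times> carrier G)"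
        by (intro image_eqI[of _ _ "(G, inv x)"]) auto
    qed
  qed auto
  then show ?thesis using inner_pull[OF inj_flip, of "\<lambda>(G', x). (G', inv x)" f f'] by auto
qed

text \<open>On vacuum vectors \<open>star\<close> acts as a conjugate-linear isometric involution
  that does not depend on \<open>x\<close>. The trace property follows by applying it to both
  factors.\<close>

lemma app_star_vac: "app (star x) (vac G) = cconj (flip (app x (vac G)))"
proof (rule ell2_eqI)
  fix i
  show "coord (app (star x) (vac G)) i = coord (cconj (flip (app x (vac G)))) i"
    by (cases i) (auto simp: coord_cconj coord_pull[OF inj_flip] coord_app_vac_outside coord_app_star_vac)
qed

lemma flip_cconj: "flip (cconj f) = cconj (flip f)"
  by (rule ell2_eqI) (auto simp: coord_cconj coord_pull[OF inj_flip] split: prod.splits)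

lemma vtr_comm: "vtr G (x * y) = vtr G (y * x)"
proof -
  have "vtr G (x * y) = inner (app (star x) (vac G)) (app y (vac G))"
    by (simp add: vtr_def inner_app_star)
  also have "\<dots> = inner (flip (app x (vac G))) (cconj (app y (vac G)))"
    by (simp only: app_star_vac inner_cconj)
  also have "\<dots> = inner (app x (vac G)) (cconj (flip (app y (vac G))))"
    by (simp only: inner_flip flip_cconj)
  also have "\<dots> = inner (app (star y) (vac G)) (app x (vac G))"
    by (simp only: app_star_vac inner_commute)
  also have "\<dots> = vtr G (y * x)" by (simp add: vtr_def inner_app_star)
  finally show ?thesis .
qed

lemma norm_vac: "norm (vac G) = 1"
  by (simp add: vac_def norm_ket)

lemma vtr_tracial: "tracial (vtr G)"
proof (rule tracial.intro)
  show "bounded_linear (vtr G)"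
  proof (rule bounded_linear_intro[where K = 1])
    fix x :: "'a gvn"
    have "\<bar>vtr G x\<bar> \<le> norm (vac G) * norm (app x (vac G))"
      unfolding vtr_def by (rule Cauchy_Schwarz_ineq2)
    then show "norm (vtr G x) \<le> norm x * 1" using norm_app_le[of x "vac G"] by (simp add: norm_vac)
  qed (simp_all add: vtr_def inner_add_right)
  show "vtr G (x * y) = vtr G (y * x)" for x y by (rule vtr_comm)
  show "vtr G (star x) = vtr G x" for x
    unfolding vtr_def by (subst inner_commute) (rule inner_app_star)
  show "psd a \<Longrightarrow> 0 \<le> vtr G a" for a by (simp add: vtr_def psd_gvn_def)
  show "vtr G 1 = 1" by (simp add: vtr_def norm_vac dot_square_norm)
qed

lemma vtr_star_mult: "vtr G (star x * x) = (norm (app x (vac G)))\<^sup>2"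
proof -
  have "vtr G (star x * x) = inner (app (star x) (app x (vac G))) (vac G)"
    by (simp add: vtr_def inner_commute)
  then show ?thesis by (simp add: inner_app_star power2_norm_eq_inner)
qed

lemma pn_two_vac: "tracial.pn (vtr G) 2 x = norm (app x (vac G))"
  using tracial.pn_two[OF vtr_tracial, of x] by (simp add: vtr_star_mult)

lemma app_fsum_vac:
  assumes "finite_support (carrier G) f"
  shows "app (fsum lam f) (vac G) = (\<Sum>g | f g \<noteq> 0. ket (f g) (G, g))"
  unfolding fsum_def app_sum
proof (rule sum.cong[OF refl])
  fix g assume "g \<in> {g. f g \<noteq> 0}"
  then have "g \<in> carrier G" using assms by (auto simp: finite_support_def)
  then show "app (ofc (f g) * lam g) (vac G) = ket (f g) (G, g)"
    by (simp add: app_lam_vac app_ofc_ket)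
qed

lemma vtr_group_trace: "group_trace (vtr G) G lam"
proof -
  interpret tracial "vtr G" by (rule vtr_tracial)
  show ?thesis
  proof
    show "lam \<one> = 1" by (rule lam_one)
    show "g \<in> carrier G \<Longrightarrow> h \<in> carrier G \<Longrightarrow> lam (g \<otimes> h) = lam g * lam h" for g h by (rule lam_mult)
    show "g \<in> carrier G \<Longrightarrow> star (lam g) = lam (inv g)" for g by (rule star_lam)
    show "vtr G (ofc c * lam g) = 0" if "g \<in> carrier G" "g \<noteq> \<one>" for g c
      using that by (simp add: vtr_def app_lam_vac app_ofc_ket) (simp add: vac_def inner_ket coord_ket)
  next
    fix e :: real and x :: "'a gvn" assume e: "0 < e"
    \<comment> \<open>By \<open>vtr_star_mult\<close> the 2-norm of \<open>x\<close> is the norm of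
      its vacuum vector, and finite combinations of basis vectors in the summand are vacuum vectors
      of finite sums.\<close>
    obtain F where F: "finite F" "norm (app x (vac G) - (\<Sum>i\<in>F. ket (coord (app x (vac G)) i) i)) < sqrt e"
      using sum_ket_approx[of "sqrt e"] e by auto
    define f where "f g = (if (G, g) \<in> F then coord (app x (vac G)) (G, g) else 0)" for g
    have "{g. f g \<noteq> 0} \<subseteq> snd ` F" by (force simp: f_def split: if_splits)
    then have "finite {g. f g \<noteq> 0}" using F(1) finite_subset by blast
    moreover have "g \<in> carrier G" if "f g \<noteq> 0" for g
      using that coord_app_vac_outside[of G g x] by (auto simp: f_def split: if_splits)
    ultimately have fs: "finite_support (carrier G) f" by (auto simp: finite_support_def)
    have "app (fsum lam f) (vac G) = (\<Sum>g | f g \<noteq> 0. ket (f g) (G, g))" by (rule app_fsum_vac[OF fs])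
    also have "\<dots> = (\<Sum>i\<in>Pair G ` {g. f g \<noteq> 0}. ket (coord (app x (vac G)) i) i)"
      by (subst sum.reindex) (auto simp: inj_on_def f_def intro!: sum.cong split: if_splits)
    also have "\<dots> = (\<Sum>i\<in>F. ket (coord (app x (vac G)) i) i)"
    proof (rule sum.mono_neutral_left[OF F(1)])
      show "Pair G ` {g. f g \<noteq> 0} \<subseteq> F" by (auto simp: f_def split: if_splits)
      have "coord (app x (vac G)) i = 0" if "i \<in> F - Pair G ` {g. f g \<noteq> 0}" for i
        using that coord_app_vac_outside[of "fst i" "snd i" x] by (cases i) (auto simp: f_def split: if_splits)
      then show "\<forall>i\<in>F - Pair G ` {g. f g \<noteq> 0}. ket (coord (app x (vac G)) i) i = 0"
        by (auto intro!: ell2_eqI simp: coord_ket)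
    qed
    finally have "norm (app (x - fsum lam f) (vac G)) < sqrt e" using F(2) by simp
    then have "(norm (app (x - fsum lam f) (vac G)))\<^sup>2 < (sqrt e)\<^sup>2" by (intro power_strict_mono) auto
    then show "\<exists>f. finite_support (carrier G) f \<and> vtr G (star (x - fsum lam f) * (x - fsum lam f)) < e"
      using fs e by (intro exI[of _ f]) (simp add: vtr_star_mult del: app_simps)
  next
    fix m :: "'a \<Rightarrow> real" assume m: "\<And>g. \<bar>m g\<bar> \<le> 1"
    define c where "c = (\<lambda>i :: 'a index. complex_of_real (m (snd i)))"
    have c: "cmod (c i) \<le> 1" for i by (simp add: c_def m)
    interpret D: bounded_linear "diag c" by (rule bounded_linear_diag[OF c])
    \<comment> \<open>The multiplier acts diagonally on the vacuum vector of \<open>x\<close>, which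
      exists for every \<open>x\<close>; no operator having the new vector as its vacuum vector is
      required. The adjoint of \<open>y\<close> moves the left factor to the other side of the inner
      product.\<close>
    define \<beta> where "\<beta> y x = inner (app (star y) (vac G)) (diag c (app x (vac G)))" for y x
    have nv: "norm (app x (vac G)) \<le> norm x" for x
      using norm_app_le[of x "vac G"] by (simp add: norm_vac)
    have \<beta>_le: "\<bar>\<beta> y x\<bar> \<le> pn 2 y * pn 2 x" for y x
    proof -
      have "\<bar>\<beta> y x\<bar> \<le> norm (app (star y) (vac G)) * norm (diag c (app x (vac G)))"
        unfolding \<beta>_def by (rule Cauchy_Schwarz_ineq2)
      also have "\<dots> \<le> norm (app (star y) (vac G)) * norm (app x (vac G))"
        by (intro mult_left_mono bounded_linear_diag c) simp
      also have "norm (app (star y) (vac G)) = pn 2 y" using pn_star[of 2 y] by (simp add: pn_two_vac)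
      finally show ?thesis by (simp add: pn_two_vac)
    qed
    have "bounded_bilinear \<beta>"
    proof
      show "\<exists>K. \<forall>a b. norm (\<beta> a b) \<le> norm a * norm b * K"
      proof (intro exI[of _ 1] allI)
        fix a b
        have "pn 2 a * pn 2 b \<le> norm a * norm b" unfolding pn_two_vac by (intro mult_mono nv) auto
        then show "norm (\<beta> a b) \<le> norm a * norm b * 1" using \<beta>_le[of a b] by simp
      qed
    qed (simp_all add: \<beta>_def star_add star_scaleR inner_add_left inner_add_right D.add D.scaleR)
    moreover have "\<beta> (imunit * y) x = \<beta> y (imunit * x)" for y x
    proof -
      have "diag c (imul f) = imul (diag c f)" for f by (rule ell2_eqI) (simp add: coord_diag[OF c] coord_imul)
      then show ?thesis by (simp add: \<beta>_def star_mult star_imunit app_imunit app_imul inner_imul)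
    qed
    moreover have "\<beta> y (fsum lam f) = vtr G (y * fsum lam (\<lambda>g. of_real (m g) * f g))"
      if f: "finite_support (carrier G) f" for y f
    proof -
      have fin: "finite {g. f g \<noteq> 0}" using f by (simp add: finite_support_def)
      have "diag c (app (fsum lam f) (vac G)) = (\<Sum>g | f g \<noteq> 0. ket (of_real (m g) * f g) (G, g))"
      proof -
        have "diag c (ket z i) = ket (c i * z) i" for z i by (rule ell2_eqI) (simp add: coord_diag[OF c] coord_ket)
        then have "diag c (ket z (G, g)) = ket (of_real (m g) * z) (G, g)" for z g by (simp only: c_def snd_conv)
        then show ?thesis by (simp only: app_fsum_vac[OF f] D.sum)
      qed
      also have "\<dots> = (\<Sum>g | of_real (m g) * f g \<noteq> 0. ket (of_real (m g) * f g) (G, g))"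
        using fin by (intro sum.mono_neutral_right) (auto intro!: ell2_eqI simp: coord_ket)
      also have "\<dots> = app (fsum lam (\<lambda>g. of_real (m g) * f g)) (vac G)"
        by (rule app_fsum_vac[OF finite_support_mult[OF f], symmetric])
      finally show ?thesis by (simp add: \<beta>_def vtr_def inner_app_star)
    qed
    ultimately show "\<exists>\<beta>. bounded_bilinear \<beta> \<and> (\<forall>y x. \<beta> (imunit * y) x = \<beta> y (imunit * x)) \<and>
      (\<forall>y f. finite_support (carrier G) f \<longrightarrow> \<beta> y (fsum lam f) = vtr G (y * fsum lam (\<lambda>g. of_real (m g) * f g))) \<and>
      (\<forall>y x. \<bar>\<beta> y x\<bar> \<le> pn 2 y * pn 2 x)"
      using \<beta>_le by blast
  qed
qed

end

section \<open>Operators on \<open>\<ell>\<^sub>2\<close> of a group\<close>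

text \<open>Indices are plain monoid records. Truncation drops the extension fields of
  \<open>W\<close> and keeps the group.\<close>

lemma truncate_simps [simp]:
  "carrier (monoid.truncate W) = carrier W" "mult (monoid.truncate W) = mult W" "one (monoid.truncate W) = one W"
  by (simp_all add: monoid.truncate_def)

lemma inv_truncate [simp]: "inv\<^bsub>monoid.truncate W\<^esub> x = inv\<^bsub>W\<^esub> x"
  by (simp add: m_inv_def)

lemma group_truncate: "group W \<Longrightarrow> group (monoid.truncate W)"
  unfolding group_def group_axioms_def monoid_def Units_def by simp

lemma l2_add: "f \<in> l2 A \<Longrightarrow> g \<in> l2 A \<Longrightarrow> f + g \<in> l2 A"
proof -
  assume f: "f \<in> l2 A" and g: "g \<in> l2 A"
  have "(\<lambda>i. 2 * (cmod (f i))\<^sup>2 + 2 * (cmod (g i))\<^sup>2) summable_on A"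
    using f g unfolding l2_def by (intro summable_on_add summable_on_cmult_right) auto
  then have "(\<lambda>i. (cmod ((f + g) i))\<^sup>2) summable_on A"
  proof (rule summable_on_comparison_test)
    fix i
    have "(cmod (f i + g i))\<^sup>2 \<le> (cmod (f i) + cmod (g i))\<^sup>2" by (intro power_mono norm_triangle_ineq) simp
    also have "\<dots> \<le> 2 * (cmod (f i))\<^sup>2 + 2 * (cmod (g i))\<^sup>2"
      using sum_squares_bound[of "cmod (f i)" "cmod (g i)"] by (simp add: power2_sum)
    finally show "(cmod ((f + g) i))\<^sup>2 \<le> 2 * (cmod (f i))\<^sup>2 + 2 * (cmod (g i))\<^sup>2" by simp
  qed simp
  then show ?thesis using f g by (simp add: l2_def)
qed

lemma l2_scale: "f \<in> l2 A \<Longrightarrow> (\<lambda>x. c * f x) \<in> l2 A"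
  by (auto simp: l2_def norm_mult power_mult_distrib intro: summable_on_cmult_right)

lemma l2_zero: "(\<lambda>_. 0) \<in> l2 A"
  by (simp add: l2_def)

lemma l2_uminus: "f \<in> l2 A \<Longrightarrow> - f \<in> l2 A"
  by (simp add: l2_def)

lemma bounded_opsD:
  assumes "T \<in> bounded_ops A"
  shows "f \<in> l2 A \<Longrightarrow> T f \<in> l2 A"
    and "f \<in> l2 A \<Longrightarrow> g \<in> l2 A \<Longrightarrow> T (f + g) = T f + T g"
    and "f \<in> l2 A \<Longrightarrow> T (\<lambda>x. c * f x) = (\<lambda>x. c * T f x)"
    and "\<exists>C. \<forall>f\<in>l2 A. l2_norm A (T f) \<le> C * l2_norm A f"
    and "f \<notin> l2 A \<Longrightarrow> T f = (\<lambda>_. 0)"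
  using assms by (auto simp: bounded_ops_def)

lemma bounded_ops_zero: "T \<in> bounded_ops A \<Longrightarrow> T (\<lambda>_. 0) = (\<lambda>_. 0)"
  using bounded_opsD(3)[OF _ l2_zero, of T A 0] by simp

lemma bounded_ops_diff:
  assumes "T \<in> bounded_ops A" "f \<in> l2 A" "g \<in> l2 A"
  shows "T (f - g) = T f - T g"
proof -
  have "T (f + (\<lambda>x. (-1) * g x)) = T f + (\<lambda>x. (-1) * T g x)"
    using assms bounded_opsD(2)[OF assms(1,2) l2_scale] bounded_opsD(3)[OF assms(1,3), of "-1"] by metis
  then show ?thesis by (simp add: fun_eq_iff plus_fun_def fun_diff_def)
qed

lemma bounded_ops_eqI:
  assumes "T \<in> bounded_ops A" "T' \<in> bounded_ops A" "\<And>f. f \<in> l2 A \<Longrightarrow> T f = T' f"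
  shows "T = T'"
  using assms bounded_opsD(5)[of _ A] by (metis ext)

locale group_l2 = group W for W :: "('a, 'b) monoid_scheme" (structure)
begin

abbreviation G :: "'a monoid" where "G \<equiv> monoid.truncate W"
abbreviation A :: "'a set" where "A \<equiv> carrier W"

lemma G: "group G"
  by (rule group_truncate[OF group_axioms])

text \<open>\<open>lft\<close> and \<open>prj\<close> identify \<open>l2 A\<close> with the vectors
  supported on the summand of \<open>G\<close>.\<close>

definition lft :: "('a \<Rightarrow> complex) \<Rightarrow> 'a index ell2" where
  "lft f = Abs_ell2 (\<lambda>(G', x). if G' = G \<and> x \<in> A then f x else 0)"

definition prj :: "'a index ell2 \<Rightarrow> 'a \<Rightarrow> complex" where
  "prj F = (\<lambda>x. if x \<in> A then coord F (G, x) else 0)"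

lemma infsum_block:
  fixes h :: "'a index \<Rightarrow> real"
  assumes "\<And>G' x. \<not> (G' = G \<and> x \<in> A) \<Longrightarrow> h (G', x) = 0"
  shows "(\<Sum>\<^sub>\<infinity>i. h i) = (\<Sum>\<^sub>\<infinity>x\<in>A. h (G, x))" and "h summable_on UNIV \<longleftrightarrow> (\<lambda>x. h (G, x)) summable_on A"
proof -
  have inj: "inj_on (Pair G) A" by (simp add: inj_on_def)
  have out: "h i = 0" if "i \<notin> Pair G ` A" for i
  proof (cases i)
    case (Pair G' x)
    then show ?thesis using that assms[of G' x] by auto
  qed
  have "(\<Sum>\<^sub>\<infinity>i. h i) = (\<Sum>\<^sub>\<infinity>i\<in>Pair G ` A. h i)" by (rule infsum_cong_neutral) (use out in auto)
  then show "(\<Sum>\<^sub>\<infinity>i. h i) = (\<Sum>\<^sub>\<infinity>x\<in>A. h (G, x))" by (simp add: infsum_reindex[OF inj] o_def)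
  have "h summable_on UNIV \<longleftrightarrow> h summable_on Pair G ` A" by (rule summable_on_cong_neutral) (use out in auto)
  then show "h summable_on UNIV \<longleftrightarrow> (\<lambda>x. h (G, x)) summable_on A" by (simp add: summable_on_reindex[OF inj] o_def)
qed

lemma coord_lft:
  assumes "f \<in> l2 A"
  shows "coord (lft f) (G', x) = (if G' = G \<and> x \<in> A then f x else 0)"
proof -
  let ?h = "\<lambda>(G', x). (if G' = G \<and> x \<in> A then f x else 0)"
  have "(\<lambda>i. (cmod (?h i))\<^sup>2) summable_on UNIV"
    by (subst infsum_block(2)) (use assms in \<open>auto simp: l2_def cong: summable_on_cong\<close>)
  then have "square_summable ?h" by (simp add: square_summable_def)
  then show ?thesis by (simp add: lft_def Abs_ell2_inverse)
qed

lemma prj_l2: "prj F \<in> l2 A"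
proof -
  let ?P = "rt G \<one> F"
  have "(\<lambda>i. (cmod (coord ?P i))\<^sup>2) summable_on UNIV" using square_summable_coord[of ?P] by (simp add: square_summable_def)
  then have "(\<lambda>x. (cmod (coord ?P (G, x)))\<^sup>2) summable_on A"
    by (subst (asm) infsum_block(2)) (auto simp: coord_rt[OF G])
  then have "(\<lambda>x. (cmod (prj F x))\<^sup>2) summable_on A"
    by (rule summable_on_cong[THEN iffD1, rotated]) (simp add: coord_rt[OF G] prj_def)
  then show ?thesis by (simp add: l2_def prj_def)
qed

lemma prj_lft: "f \<in> l2 A \<Longrightarrow> prj (lft f) = f"
  by (rule ext) (auto simp: prj_def coord_lft l2_def)

lemma lft_prj: "lft (prj F) = rt G \<one> F"
proof (rule ell2_eqI)
  fix i
  show "coord (lft (prj F)) i = coord (rt G \<one> F) i"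
    by (cases i) (simp add: coord_lft[OF prj_l2] coord_rt[OF G], simp add: prj_def)
qed

lemma rt_lft: "f \<in> l2 A \<Longrightarrow> rt G \<one> (lft f) = lft f"
  using lft_prj[of "lft f"] by (simp add: prj_lft)

lemma lft_linear:
  assumes "f \<in> l2 A" "g \<in> l2 A"
  shows "lft (f + g) = lft f + lft g" "lft (f - g) = lft f - lft g"
    "lft (\<lambda>x. c * f x) = app (ofc c) (lft f)" "lft (\<lambda>x. \<i> * f x) = imul (lft f)"
    "lft (\<lambda>x. of_real r * f x) = r *\<^sub>R lft f"
proof -
  have m: "f - g \<in> l2 A" using l2_add[OF assms(1) l2_uminus[OF assms(2)]] by simp
  show "lft (f + g) = lft f + lft g" "lft (f - g) = lft f - lft g"
    "lft (\<lambda>x. c * f x) = app (ofc c) (lft f)" "lft (\<lambda>x. \<i> * f x) = imul (lft f)"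
    "lft (\<lambda>x. of_real r * f x) = r *\<^sub>R lft f"
    by (auto intro!: ell2_eqI simp: coord_app_ofc coord_imul scaleR_conv_of_real coord_lft[OF l2_add[OF assms]]
        coord_lft[OF m] coord_lft[OF l2_scale[OF assms(1)]] coord_lft[OF assms(1)] coord_lft[OF assms(2)])
qed

lemma prj_linear:
  "prj (F + F') = prj F + prj F'" "prj (F - F') = prj F - prj F'" "prj (r *\<^sub>R F) = (\<lambda>x. of_real r * prj F x)"
  "prj (imul F) = (\<lambda>x. \<i> * prj F x)" "prj (app (ofc c) F) = (\<lambda>x. c * prj F x)" "prj 0 = (\<lambda>_. 0)"
  by (auto simp: prj_def coord_imul coord_app_ofc scaleR_conv_of_real)

lemma norm_lft:
  assumes "f \<in> l2 A"
  shows "norm (lft f) = l2_norm A f"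
proof -
  have "(norm (lft f))\<^sup>2 = (\<Sum>\<^sub>\<infinity>x\<in>A. (cmod (f x))\<^sup>2)"
    unfolding norm_coord by (subst infsum_block(1)) (auto simp: coord_lft[OF assms] intro!: infsum_cong)
  then show ?thesis unfolding l2_norm_def by (simp flip: \<open>(norm (lft f))\<^sup>2 = _\<close>)
qed

lemma norm_rt_one: "norm (rt G \<one> F) \<le> norm F"
  unfolding rt_def by (rule bounded_linear_pull, rule inj_on_rt[OF G]) simp

lemma l2_norm_prj: "l2_norm A (prj F) \<le> norm F"
  using norm_lft[OF prj_l2, of F] norm_rt_one[of F] by (simp add: lft_prj)

lemma l2_norm_nonneg: "0 \<le> l2_norm A f"
  by (simp add: l2_norm_def infsum_nonneg)

lemma Re_l2_inner:
  assumes "f \<in> l2 A" "g \<in> l2 A"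
  shows "Re (l2_inner A f g) = inner (lft f) (lft g)"
proof -
  have "(\<lambda>x. (cmod (f x))\<^sup>2 + (cmod (g x))\<^sup>2) summable_on A"
    using assms by (intro summable_on_add) (auto simp: l2_def)
  then have "(\<lambda>x. norm (cnj (f x) * g x)) summable_on A"
  proof (rule Infinite_Sum.abs_summable_on_comparison_test')
    fix i
    show "norm (cnj (f i) * g i) \<le> (cmod (f i))\<^sup>2 + (cmod (g i))\<^sup>2"
      using sum_squares_bound[of "cmod (f i)" "cmod (g i)"] mult_nonneg_nonneg[OF norm_ge_zero norm_ge_zero, of "f i" "g i"]
      unfolding mult.assoc norm_mult complex_mod_cnj by linarith
  qed
  then have s: "(\<lambda>x. cnj (f x) * g x) summable_on A" by (rule abs_summable_summable)
  have "Re (l2_inner A f g) = (\<Sum>\<^sub>\<infinity>x\<in>A. inner (f x) (g x))"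
    unfolding l2_inner_def infsum_Re[OF s, symmetric] by (rule infsum_cong) (simp add: inner_complex_def)
  also have "\<dots> = inner (lft f) (lft g)"
    unfolding inner_coord by (subst infsum_block(1)) (auto simp: coord_lft assms intro!: infsum_cong)
  finally show ?thesis .
qed

lemma l2_inner_eqI:
  assumes fg: "f \<in> l2 A" "g \<in> l2 A" "f' \<in> l2 A" "g' \<in> l2 A"
    and eq: "\<And>c. inner (lft f) (app (ofc c) (lft g)) = inner (lft f') (app (ofc c) (lft g'))"
  shows "l2_inner A f g = l2_inner A f' g'"
proof -
  have c: "l2_inner A f (\<lambda>x. c * g x) = c * l2_inner A f g" for c f g
    unfolding l2_inner_def by (subst infsum_cmult_right'[symmetric]) (simp add: mult.left_commute)
  have "Re (c * l2_inner A f g) = Re (c * l2_inner A f' g')" for c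
    unfolding c[symmetric] by (simp add: Re_l2_inner fg l2_scale lft_linear(3)[OF _ l2_zero] eq)
  from this[of 1] this[of "- \<i>"] show ?thesis by (simp add: complex_eq_iff)
qed

section \<open>Compression of operators to one group\<close>

text \<open>The zero branch follows the convention of \<open>bounded_ops\<close> that operators
  vanish outside \<open>l2 A\<close>.\<close>

definition cut :: "('a index ell2 \<Rightarrow> 'a index ell2) \<Rightarrow> 'a l2_op" where
  "cut S f = (if f \<in> l2 A then prj (S (lft f)) else (\<lambda>_. 0))"

lemma cut_bounded_ops:
  assumes S: "bounded_linear S" and i: "\<And>F. S (imul F) = imul (S F)"
  shows "cut S \<in> bounded_ops A"
proof -
  interpret bounded_linear S by (rule S)
  have ofc: "S (app (ofc c) F) = app (ofc c) (S F)" for c F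
    by (simp add: ofc_def app_imunit add scaleR i)
  obtain K where K: "\<And>F. norm (S F) \<le> norm F * K" "0 \<le> K" using nonneg_bounded by blast
  have "l2_norm A (prj (S (lft f))) \<le> K * l2_norm A f" if "f \<in> l2 A" for f
    using order_trans[OF l2_norm_prj K(1)[of "lft f"]] that by (simp add: norm_lft mult.commute)
  then show ?thesis
    by (auto simp: bounded_ops_def cut_def prj_l2 l2_add l2_scale lft_linear lft_linear(3)[OF _ l2_zero] add ofc prj_linear)
qed

abbreviation res :: "'a gvn \<Rightarrow> 'a l2_op" where "res X \<equiv> cut (app X)"

lemma res_bounded_ops: "res X \<in> bounded_ops A"
  by (rule cut_bounded_ops) (simp_all add: app_imul blinfun.bounded_linear_right)

lemma app_rt_one: "app X (rt G \<one> F) = rt G \<one> (app X F)"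
  by (rule app_rt[OF G]) simp

text \<open>Compression is multiplicative because elements of the algebra commute with the
  projection \<open>rt G \<one>\<close>.\<close>

lemma res_mult: "res (X * Y) = res X \<circ> res Y"
proof (rule bounded_ops_eqI[of _ A])
  have "res X \<circ> res Y = cut (app X \<circ> app Y)"
  proof
    fix f :: "'a \<Rightarrow> complex"
    show "(res X \<circ> res Y) f = cut (app X \<circ> app Y) f"
    proof (cases "f \<in> l2 A")
      case True
      then show ?thesis by (simp add: cut_def prj_l2 lft_prj app_rt_one[symmetric] rt_lft)
    next
      case False
      have "prj (app X (lft (\<lambda>_. 0))) = (\<lambda>_. 0)" using bounded_ops_zero[OF res_bounded_ops, of X] by (simp add: cut_def l2_zero)
      then show ?thesis using False by (simp add: cut_def l2_zero)
    qed
  qed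
  then show "res X \<circ> res Y \<in> bounded_ops A"
    by (simp only:) (rule cut_bounded_ops, auto simp: o_def app_imul intro!: bounded_linear_compose[of "app X"] blinfun.bounded_linear_right)
  show "res (X * Y) \<in> bounded_ops A" by (rule res_bounded_ops)
  show "res (X * Y) f = (res X \<circ> res Y) f" if "f \<in> l2 A" for f
    using that by (simp add: cut_def prj_l2 lft_prj app_rt_one[symmetric] rt_lft)
qed

text \<open>Extension by 0 to the other summands. It places operators in a Banach space where
  \<open>op_norm\<close> is the norm and limits are unique.\<close>

definition ext_op :: "'a l2_op \<Rightarrow> 'a index ell2 \<Rightarrow>\<^sub>L 'a index ell2" where
  "ext_op T = Blinfun (\<lambda>F. lft (T (prj F)))"

lemma ext_op_apply:
  assumes T: "T \<in> bounded_ops A"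
  shows "blinfun_apply (ext_op T) F = lft (T (prj F))"
proof -
  note [simp] = bounded_opsD[OF T] prj_l2 l2_norm_nonneg
  obtain C where C: "\<And>f. f \<in> l2 A \<Longrightarrow> l2_norm A (T f) \<le> C * l2_norm A f" using bounded_opsD(4)[OF T] by blast
  have "bounded_linear (\<lambda>F. lft (T (prj F)))"
  proof (rule bounded_linear_intro[where K = "\<bar>C\<bar>"])
    fix F
    have "norm (lft (T (prj F))) = l2_norm A (T (prj F))" by (rule norm_lft) simp
    also have "\<dots> \<le> C * l2_norm A (prj F)" by (rule C) simp
    also have "\<dots> \<le> \<bar>C\<bar> * l2_norm A (prj F)" by (rule mult_right_mono) simp_all
    also have "\<dots> \<le> \<bar>C\<bar> * norm F" by (rule mult_left_mono[OF l2_norm_prj]) simp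
    finally show "norm (lft (T (prj F))) \<le> norm F * \<bar>C\<bar>" by (simp add: mult.commute)
  qed (simp_all add: prj_linear lft_linear lft_linear(5)[OF _ l2_zero])
  then show ?thesis by (simp add: ext_op_def bounded_linear_Blinfun_apply)
qed

lemma op_norm_bdd:
  assumes T: "T \<in> bounded_ops A"
  shows "bdd_above ((\<lambda>f. l2_norm A (T f) / l2_norm A f) ` l2 A)" and "op_norm A T = norm (ext_op T)"
proof -
  have le: "l2_norm A (T f) / l2_norm A f \<le> norm (ext_op T)" if f: "f \<in> l2 A" for f
  proof -
    have "l2_norm A (T f) \<le> norm (ext_op T) * l2_norm A f"
      using norm_blinfun[of "ext_op T" "lft f"] f by (simp add: ext_op_apply[OF T] prj_lft norm_lft bounded_opsD[OF T])
    then show ?thesis by (cases "l2_norm A f = 0") (use l2_norm_nonneg[of f] in \<open>auto simp: field_simps\<close>)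
  qed
  then show bdd: "bdd_above ((\<lambda>f. l2_norm A (T f) / l2_norm A f) ` l2 A)"
    by (intro bdd_aboveI[of _ "norm (ext_op T)"]) auto
  have up: "l2_norm A (T f) / l2_norm A f \<le> op_norm A T" if "f \<in> l2 A" for f
    unfolding op_norm_def by (rule cSUP_upper[OF that bdd])
  show "op_norm A T = norm (ext_op T)"
  proof (rule antisym)
    show "op_norm A T \<le> norm (ext_op T)" unfolding op_norm_def by (rule cSUP_least) (use le l2_zero in auto)
    have 0: "0 \<le> op_norm A T" using up[OF l2_zero] by (simp add: l2_norm_def)
    show "norm (ext_op T) \<le> op_norm A T"
    proof (rule norm_blinfun_bound[OF 0])
      fix F
      have "l2_norm A (T (prj F)) \<le> op_norm A T * l2_norm A (prj F)"
      proof (cases "l2_norm A (prj F) = 0")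
        case True
        \<comment> \<open>For vectors of norm 0 the quotient in \<open>op_norm\<close> is 0 by
          convention and carries no information; the boundedness of \<open>T\<close> forces the
          image to have norm 0.\<close>
        obtain C where C: "\<And>f. f \<in> l2 A \<Longrightarrow> l2_norm A (T f) \<le> C * l2_norm A f" using bounded_opsD(4)[OF T] by blast
        show ?thesis using C[OF prj_l2, of F] True by simp
      next
        case False
        then show ?thesis using up[OF prj_l2, of F] l2_norm_nonneg[of "prj F"] by (simp add: field_simps)
      qed
      also have "\<dots> \<le> op_norm A T * norm F" by (rule mult_left_mono[OF l2_norm_prj 0])
      finally show "norm (blinfun_apply (ext_op T) F) \<le> op_norm A T * norm F"
        by (simp add: ext_op_apply[OF T] norm_lft bounded_opsD[OF T] prj_l2)
    qed
  qed
qed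

lemma ext_op_inject:
  assumes "T \<in> bounded_ops A" "T' \<in> bounded_ops A" "ext_op T = ext_op T'"
  shows "T = T'"
proof (rule bounded_ops_eqI[OF assms(1,2)])
  fix f assume f: "f \<in> l2 A"
  have "lft (T f) = lft (T' f)"
    using assms ext_op_apply[of T "lft f"] ext_op_apply[of T' "lft f"] f by (simp add: prj_lft)
  then show "T f = T' f" using f assms by (metis prj_lft bounded_opsD(1))
qed

lemma bounded_ops_minus:
  assumes T: "T \<in> bounded_ops A" and T': "T' \<in> bounded_ops A"
  shows "T - T' \<in> bounded_ops A" and "ext_op (T - T') = ext_op T - ext_op T'"
proof -
  have "T - T' = cut (\<lambda>F. blinfun_apply (ext_op T - ext_op T') F)"
  proof
    fix f
    show "(T - T') f = cut (\<lambda>F. blinfun_apply (ext_op T - ext_op T') F) f"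
      using bounded_opsD[OF T] bounded_opsD[OF T']
      by (simp add: cut_def blinfun.diff_left ext_op_apply[OF T] ext_op_apply[OF T'] prj_lft prj_linear zero_fun_def)
  qed
  also have "\<dots> \<in> bounded_ops A"
    using bounded_opsD(3)[OF T, of _ \<i>] bounded_opsD(3)[OF T', of _ \<i>]
    by (intro cut_bounded_ops blinfun.bounded_linear_right)
      (simp add: blinfun.diff_left ext_op_apply[OF T] ext_op_apply[OF T'] prj_linear prj_l2
        lft_linear(4)[OF _ l2_zero] bounded_opsD(1)[OF T] bounded_opsD(1)[OF T'] linear_diff[OF linear_imul])
  finally show D: "T - T' \<in> bounded_ops A" .
  show "ext_op (T - T') = ext_op T - ext_op T'"
    by (rule blinfun_eqI) (simp add: ext_op_apply D T T' blinfun.diff_left lft_linear prj_l2 bounded_opsD(1)[OF T] bounded_opsD(1)[OF T'])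
qed

lemma ext_op_res:
  assumes "\<And>F. app X (rt G \<one> F) = app X F"
  shows "ext_op (res X) = blin X"
  by (rule blinfun_eqI) (simp add: ext_op_apply[OF res_bounded_ops] cut_def prj_l2 lft_prj app_rt_one[symmetric] assms)

lemma op_norm_res_le: "op_norm A (res X) \<le> norm X"
proof -
  have "norm (ext_op (res X)) \<le> norm X"
  proof (rule norm_blinfun_bound)
    fix F
    have "norm (blinfun_apply (ext_op (res X)) F) = norm (rt G \<one> (app X (rt G \<one> F)))"
      by (simp add: ext_op_apply[OF res_bounded_ops] cut_def prj_l2 lft_prj)
    also have "\<dots> \<le> norm X * norm (rt G \<one> F)" using norm_rt_one norm_app_le order_trans by blast
    also have "\<dots> \<le> norm X * norm F" by (rule mult_left_mono[OF norm_rt_one]) simp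
    finally show "norm (blinfun_apply (ext_op (res X)) F) \<le> norm X * norm F" .
  qed simp
  then show ?thesis by (simp add: op_norm_bdd[OF res_bounded_ops])
qed

text \<open>Restricted to \<open>l2 A\<close>: the zeroth iterate in \<open>op_poly\<close> is the
  identity function, which does not vanish outside \<open>l2 A\<close>. Since \<open>op_norm\<close>
  looks only at \<open>l2 A\<close>, this suffices.\<close>

lemma op_poly_res:
  assumes f: "f \<in> l2 A"
  shows "op_poly q (res X) f = res (ev q X) f"
proof -
  have pow: "(res X ^^ i) f = res (X ^ i) f" for i
  proof (induction i)
    case 0
    then show ?case using f by (simp add: cut_def prj_lft)
  next
    case (Suc i)
    have "(res X ^^ Suc i) f = res X (res (X ^ i) f)" by (simp add: Suc)
    also have "\<dots> = res (X ^ Suc i) f" unfolding power_Suc res_mult by simp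
    finally show ?case .
  qed
  have sum: "(\<Sum>i\<in>I. op_scale (of_real (c i)) (T i)) f = (\<lambda>x. \<Sum>i\<in>I. of_real (c i) * T i f x)" for I :: "nat set" and c T
    by (induction I rule: infinite_finite_induct) (auto simp: op_scale_def)
  have "op_poly q (res X) f = (\<lambda>x. \<Sum>i\<le>degree q. of_real (coeff q i) * res (X ^ i) f x)"
    unfolding op_poly_def sum pow ..
  also have "\<dots> = res (ev q X) f"
    using f by (auto simp: cut_def ev_def prj_def app_sum coord_sum scaleR_conv_of_real[where 'a = complex])
  finally show ?thesis .
qed

lemma op_norm_cong: "(\<And>f. f \<in> l2 A \<Longrightarrow> T f = T' f) \<Longrightarrow> op_norm A T = op_norm A T'"
  unfolding op_norm_def by (rule SUP_cong) auto

text \<open>The hypothesis \<open>supp\<close> says that \<open>X\<close> kills the other summands;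
  then compression preserves its norm and both calculi use the same interval. Uniqueness of the
  described operator follows from uniqueness of limits after \<open>ext_op\<close>.\<close>

lemma op_calculus_res:
  assumes X: "psd X" and supp: "\<And>F. app X (rt G \<one> F) = app X F"
    and h: "continuous_on {0..} h"
  shows "op_calculus A h (res X) = res (fc h X)"
proof -
  have nX: "op_norm A (res X) = norm X"
    by (simp add: op_norm_bdd[OF res_bounded_ops] ext_op_res[OF supp] norm_gvn.rep_eq)
  have hX: "continuous_on {0..norm X} h" by (rule continuous_on_subset[OF h]) auto
  have lim: "(\<lambda>n. op_norm A (op_poly (q n) (res X) - res (fc h X))) \<longlonglongrightarrow> 0"
    if q: "uniform_limit {0..norm X} (\<lambda>n. poly (q n)) h sequentially" for q
  proof (rule tendsto_sandwich[OF always_eventually always_eventually tendsto_const])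
    have D: "(op_poly (q n) (res X) - res (fc h X)) f = res (ev (q n) X - fc h X) f" if "f \<in> l2 A" for n f
      using that by (simp add: op_poly_res) (simp add: cut_def prj_linear)
    have eq: "op_norm A (op_poly (q n) (res X) - res (fc h X)) = op_norm A (res (ev (q n) X - fc h X))" for n
      by (rule op_norm_cong[OF D])
    show "\<forall>n. op_norm A (op_poly (q n) (res X) - res (fc h X)) \<le> norm (ev (q n) X - fc h X)"
      unfolding eq using op_norm_res_le by blast
    show "\<forall>n. 0 \<le> op_norm A (op_poly (q n) (res X) - res (fc h X))"
      unfolding eq by (simp add: op_norm_bdd[OF res_bounded_ops])
    show "(\<lambda>n. norm (ev (q n) X - fc h X)) \<longlonglongrightarrow> 0"
      using fc_limit_norm[OF X hX q] by (simp add: tendsto_norm_zero_iff LIM_zero_iff)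
  qed
  show ?thesis
    unfolding op_calculus_def nX
  proof (rule the_equality)
    fix b assume b: "b \<in> bounded_ops A \<and> (\<forall>q. uniform_limit {0..norm X} (\<lambda>n. poly (q n)) h sequentially \<longrightarrow>
      (\<lambda>n. op_norm A (op_poly (q n) (res X) - b)) \<longlonglongrightarrow> 0)"
    obtain q where q: "uniform_limit {0..norm X} (\<lambda>n. poly (q n)) h sequentially"
      by (rule polynomials_uniform_limit[OF hX])
    have "(\<lambda>n. ext_op (res (ev (q n) X))) \<longlonglongrightarrow> ext_op c"
      if c: "c \<in> bounded_ops A" "(\<lambda>n. op_norm A (op_poly (q n) (res X) - c)) \<longlonglongrightarrow> 0" for c
    proof -
      have "op_norm A (op_poly (q n) (res X) - c) = op_norm A (res (ev (q n) X) - c)" for n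
        by (rule op_norm_cong) (simp add: op_poly_res)
      then have "(\<lambda>n. norm (ext_op (res (ev (q n) X)) - ext_op c)) \<longlonglongrightarrow> 0"
        using c(2) by (simp add: op_norm_bdd(2)[OF bounded_ops_minus(1)[OF res_bounded_ops c(1)]] bounded_ops_minus(2)[OF res_bounded_ops c(1)])
      then show ?thesis by (simp add: tendsto_norm_zero_iff LIM_zero_iff)
    qed
    then have "ext_op b = ext_op (res (fc h X))"
      using b q by (intro LIMSEQ_unique[of "\<lambda>n. ext_op (res (ev (q n) X))"]) (auto intro: lim res_bounded_ops)
    then show "b = res (fc h X)" using b by (intro ext_op_inject res_bounded_ops) auto
  qed (auto intro: lim res_bounded_ops)
qed

lemma op_adjoint_res: "op_adjoint A (res X) = res (star X)"
  unfolding op_adjoint_def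
proof (rule the_equality)
  have inner_l: "inner (lft (prj F)) (app (ofc c) (lft g)) = inner F (app (ofc c) (lft g))" if "g \<in> l2 A" for F c g
    using that inner_rt[OF G, of \<one> F "app (ofc c) (lft g)"] by (simp add: lft_prj rt_lft app_rt_one[symmetric])
  have "l2_inner A f (res X g) = l2_inner A (res (star X) f) g" if fg: "f \<in> l2 A" "g \<in> l2 A" for f g
  proof (rule l2_inner_eqI)
    fix c
    have "inner (lft f) (app (ofc c) (lft (res X g))) = inner (lft f) (app (ofc c) (app X (lft g)))"
      using fg by (simp add: cut_def lft_prj app_rt_one[symmetric] rt_lft)
    also have "\<dots> = inner (lft f) (app X (app (ofc c) (lft g)))" by (metis app_mult ofc_comm)
    also have "\<dots> = inner (app (star X) (lft f)) (app (ofc c) (lft g))" by (simp only: inner_app_star)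
    also have "\<dots> = inner (lft (res (star X) f)) (app (ofc c) (lft g))" using fg by (simp add: inner_l cut_def)
    finally show "inner (lft f) (app (ofc c) (lft (res X g))) = inner (lft (res (star X) f)) (app (ofc c) (lft g))" .
  qed (use fg bounded_opsD(1)[OF res_bounded_ops] in auto)
  then show *: "res (star X) \<in> bounded_ops A \<and> (\<forall>f\<in>l2 A. \<forall>g\<in>l2 A. l2_inner A f (res X g) = l2_inner A (res (star X) f) g)"
    using res_bounded_ops by blast
  fix R assume R: "R \<in> bounded_ops A \<and> (\<forall>f\<in>l2 A. \<forall>g\<in>l2 A. l2_inner A f (res X g) = l2_inner A (R f) g)"
  show "R = res (star X)"
  proof (rule bounded_ops_eqI)
    fix f assume f: "f \<in> l2 A"
    have Rf: "R f \<in> l2 A" "res (star X) f \<in> l2 A" using R f bounded_opsD(1) res_bounded_ops by blast+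
    have "inner (lft (R f)) (lft g) = inner (lft (res (star X) f)) (lft g)" if g: "g \<in> l2 A" for g
      using R * f g Rf by (simp flip: Re_l2_inner)
    then have "inner (lft (R f)) F = inner (lft (res (star X) f)) F" for F
      using inner_rt[OF G, of \<one> _ F] prj_l2[of F] Rf by (metis lft_prj rt_lft inv_one inv_truncate one_closed truncate_simps(1))
    then have "lft (R f) = lft (res (star X) f)" by (rule ell2_inner_eqI)
    then show "R f = res (star X) f" using Rf by (metis prj_lft)
  qed (use R res_bounded_ops in auto)
qed

lemma prj_vac: "prj (vac G) = indicator {\<one>}"
  by (auto simp: prj_def vac_def coord_ket indicator_def)

lemma rt_vac: "rt G \<one> (vac G) = vac G"
proof (rule ell2_eqI)
  fix i
  show "coord (rt G \<one> (vac G)) i = coord (vac G) i"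
    by (cases i) (auto simp: coord_rt[OF G] vac_def coord_ket)
qed

lemma vN_trace_res: "Re (vN_trace W (res X)) = vtr G X"
proof -
  have v: "(indicator {\<one>} :: 'a \<Rightarrow> complex) \<in> l2 A" using prj_l2[of "vac G"] by (simp only: prj_vac)
  have l: "lft (indicator {\<one>}) = vac G" using lft_prj[of "vac G"] by (simp only: prj_vac rt_vac)
  have "Re (vN_trace W (res X)) = inner (vac G) (lft (res X (indicator {\<one>})))"
    unfolding vN_trace_def Re_l2_inner[OF v bounded_opsD(1)[OF res_bounded_ops v]] l ..
  also have "\<dots> = inner (vac G) (app X (rt G \<one> (vac G)))"
    using v by (simp add: cut_def l lft_prj app_rt_one)
  finally show ?thesis by (simp only: rt_vac vtr_def)
qed

lemma Lp_norm_res: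
  assumes p: "1 < p" and supp: "\<And>F. app X (rt G \<one> F) = app X F"
  shows "Lp_norm W p (res X) = tracial.pn (vtr G) p X"
proof -
  have "abs_powr A p (res X) = res (fc (\<lambda>t. t powr (p / 2)) (star X * X))"
    unfolding abs_powr_def op_adjoint_res res_mult[symmetric]
    by (rule op_calculus_res[OF psd_square]) (use p in \<open>auto simp: supp intro: continuous_on_powr_nonneg\<close>)
  then show ?thesis by (simp add: Lp_norm_def tracial.pn_def[OF vtr_tracial[OF G]] vN_trace_res)
qed

end

section \<open>The group von Neumann algebra inside the large algebra\<close>

lemma commutant_bounded: "T \<in> commutant A X \<Longrightarrow> T \<in> bounded_ops A"
  by (simp add: commutant_def)

lemma commutantD: "T \<in> commutant A X \<Longrightarrow> R \<in> X \<Longrightarrow> T (R f) = R (T f)"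
  by (auto simp: commutant_def fun_eq_iff)

lemma commutantI:
  assumes T: "T \<in> bounded_ops A" and X: "X \<subseteq> bounded_ops A"
    and c: "\<And>R f. R \<in> X \<Longrightarrow> f \<in> l2 A \<Longrightarrow> T (R f) = R (T f)"
  shows "T \<in> commutant A X"
proof -
  have "T (R f) = R (T f)" if R: "R \<in> X" for R f
  proof (cases "f \<in> l2 A")
    case False
    have "R \<in> bounded_ops A" using R X by blast
    then show ?thesis using False T by (simp add: bounded_opsD(5)[OF _ False] bounded_ops_zero)
  qed (rule c[OF R])
  then show ?thesis using T by (simp add: commutant_def fun_eq_iff)
qed

context group_l2
begin

lemma res_add: "res (X + Y) = res X + res Y" and res_diff: "res (X - Y) = res X - res Y"
  and res_scale: "res (ofc c * X) = op_scale c (res X)" and res_zero: "res 0 = 0"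
  by (auto simp: fun_eq_iff cut_def prj_linear op_scale_def)

lemma res_sum: "res (sum X I) = (\<Sum>i\<in>I. res (X i))"
  by (induction I rule: infinite_finite_induct) (simp_all only: sum.infinite sum.empty sum.insert res_zero res_add not_False_eq_True)

lemma left_regular_res:
  assumes g: "g \<in> A"
  shows "left_regular W g = res (lam G g)"
proof
  fix f
  show "left_regular W g f = res (lam G g) f"
    using g by (auto simp: left_regular_def cut_def prj_def coord_app_lam[OF G] coord_lft shift_def)
qed

definition op_sum :: "('a \<Rightarrow> complex) \<Rightarrow> 'a l2_op" where
  "op_sum f = (\<Sum>g | f g \<noteq> 0. op_scale (f g) (left_regular W g))"

lemma op_sum_res:
  assumes "finite_support A f"
  shows "op_sum f = res (fsum (lam G) f)"
  unfolding op_sum_def fsum_def res_sum res_scale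
  using assms by (intro sum.cong) (auto simp: finite_support_def left_regular_res)

abbreviation vN :: "'a l2_op set" where "vN \<equiv> group_vN W"

lemma vN_bounded: "T \<in> vN \<Longrightarrow> T \<in> bounded_ops A"
  unfolding group_vN_def by (rule commutant_bounded)

lemma rt_rt_one:
  assumes h: "h \<in> A"
  shows "rt G h (rt G \<one> F) = rt G h F" "rt G \<one> (rt G h F) = rt G h F"
proof -
  have hG: "h \<in> carrier G" "\<one> \<in> carrier G" using h by simp_all
  show "rt G h (rt G \<one> F) = rt G h F" "rt G \<one> (rt G h F) = rt G h F"
    using h by (auto intro!: ell2_eqI simp: coord_rt[OF G hG(1)] coord_rt[OF G hG(2)] split_paired_all)
qed

text \<open>Right translations commute with left ones, so every element of the bicommutant commutes
  with them. This is the invariance that \<open>lift\<close> needs.\<close>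

lemma rt_commutant:
  assumes h: "h \<in> A"
  shows "cut (rt G h) \<in> commutant A (left_regular W ` A)"
proof (rule commutantI)
  have hG: "h \<in> carrier G" using h by simp
  have ri: "rt G h (imul F) = imul (rt G h F)" for F
    by (rule ell2_eqI) (auto simp: coord_imul coord_rt[OF G hG] split: prod.splits)
  then show "cut (rt G h) \<in> bounded_ops A" by (intro cut_bounded_ops bounded_linear_rt[OF G hG])
  show "left_regular W ` A \<subseteq> bounded_ops A" using res_bounded_ops by (auto simp: left_regular_res)
  fix R f assume R: "R \<in> left_regular W ` A" and f: "f \<in> l2 A"
  then obtain g where g: "g \<in> A" "R = res (lam G g)" using left_regular_res by blast
  show "cut (rt G h) (R f) = R (cut (rt G h) f)"
    using f by (simp add: g cut_def prj_l2 lft_prj rt_rt_one[OF h] app_rt[OF G hG])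
qed

definition lift :: "'a l2_op \<Rightarrow> 'a gvn" where
  "lift T = Abs_gvn (ext_op T)"

lemma app_lift:
  assumes T: "T \<in> vN"
  shows "app (lift T) F = lft (T (prj F))"
proof -
  note Tb = vN_bounded[OF T]
  have "translation_invariant (blinfun_apply (ext_op T))"
  proof (rule translation_invariantI)
    show "blinfun_apply (ext_op T) (imul F) = imul (blinfun_apply (ext_op T) F)" for F
      by (simp add: ext_op_apply[OF Tb] prj_linear bounded_opsD[OF Tb] prj_l2 lft_linear(4)[OF _ l2_zero])
  next
    fix G' :: "'a monoid" and h F assume G': "group G'" "h \<in> carrier G'"
    show "blinfun_apply (ext_op T) (rt G' h F) = rt G' h (blinfun_apply (ext_op T) F)"
    proof (cases "G' = G")
      case True
      then have h: "h \<in> A" "h \<in> carrier G" using G' by auto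
      have c: "cut (rt G h) (prj F) = prj (rt G h F)" for F
        by (simp add: cut_def prj_l2 lft_prj rt_rt_one[OF h(1)])
      have s: "lft (prj (rt G h F)) = rt G h F" for F
        by (simp add: lft_prj rt_rt_one[OF h(1)])
      have "T (cut (rt G h) (prj F)) = cut (rt G h) (T (prj F))"
        using T rt_commutant[OF h(1)] unfolding group_vN_def by (rule commutantD)
      then have "lft (T (prj (rt G h F))) = lft (prj (rt G h (lft (T (prj F)))))"
        using bounded_opsD(1)[OF Tb prj_l2] by (simp add: c) (simp add: cut_def)
      then show ?thesis by (simp only: True ext_op_apply[OF Tb] s)
    next
      case False
      have "prj (rt G' h F) = (\<lambda>_. 0)" using False by (auto simp: prj_def coord_rt[OF G'])
      moreover have "rt G' h (lft (T (prj F))) = 0"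
      proof (rule ell2_eqI)
        fix i
        show "coord (rt G' h (lft (T (prj F)))) i = coord 0 i"
          using False by (cases i) (simp add: coord_rt[OF G'] coord_lft[OF bounded_opsD(1)[OF Tb prj_l2]])
      qed
      moreover have "lft (\<lambda>_. 0) = 0" by (rule ell2_eqI) (simp add: coord_lft[OF l2_zero] split_paired_all)
      ultimately show ?thesis by (simp add: ext_op_apply[OF Tb] bounded_ops_zero[OF Tb])
    qed
  qed
  then show ?thesis by (simp add: lift_def Abs_gvn_inverse ext_op_apply[OF Tb])
qed

lemma res_lift:
  assumes T: "T \<in> vN"
  shows "res (lift T) = T"
  using bounded_opsD[OF vN_bounded[OF T]]
  by (intro bounded_ops_eqI[OF res_bounded_ops vN_bounded[OF T]]) (simp add: cut_def app_lift[OF T] prj_lft)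

lemma res_vN: "res X \<in> vN" if "\<And>R F. R \<in> commutant A (left_regular W ` A) \<Longrightarrow> F \<in> l2 A \<Longrightarrow> res X (R F) = R (res X F)"
  unfolding group_vN_def using that by (intro commutantI res_bounded_ops) (auto simp: commutant_def)

lemma vN_closed:
  assumes T: "T \<in> vN" and T': "T' \<in> vN"
  shows "T + T' \<in> vN" "T - T' \<in> vN" "op_scale c T \<in> vN"
proof -
  note Tb = vN_bounded[OF T] vN_bounded[OF T']
  have comm: "T (R F) = R (T F)" "T' (R F) = R (T' F)" "R \<in> bounded_ops A"
    if "R \<in> commutant A (left_regular W ` A)" for R F
    using that T T' unfolding group_vN_def by (auto intro: commutantD commutant_bounded)
  have lin: "R (T F + T' F) = R (T F) + R (T' F)" "R (T F - T' F) = R (T F) - R (T' F)" "R (\<lambda>x. c * T F x) = (\<lambda>x. c * R (T F) x)"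
    if R: "R \<in> commutant A (left_regular W ` A)" and F: "F \<in> l2 A" for R F c
    using bounded_opsD(1)[OF Tb(1) F] bounded_opsD(1)[OF Tb(2) F] comm(3)[OF R]
    by (auto intro: bounded_opsD(2,3) bounded_ops_diff)
  have "res (lift T + lift T') \<in> vN"
    by (rule res_vN) (simp only: res_add res_lift[OF T] res_lift[OF T'] plus_fun_apply[of T T'] comm lin)
  then show "T + T' \<in> vN" by (simp only: res_add res_lift[OF T] res_lift[OF T'])
  have "res (lift T - lift T') \<in> vN"
    by (rule res_vN) (simp only: res_diff res_lift[OF T] res_lift[OF T'] minus_apply[of T T'] comm lin)
  then show "T - T' \<in> vN" by (simp only: res_diff res_lift[OF T] res_lift[OF T'])
  have "res (ofc c * lift T) \<in> vN"
    by (rule res_vN) (simp only: res_scale res_lift[OF T] op_scale_def comm lin)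
  then show "op_scale c T \<in> vN" by (simp only: res_scale res_lift[OF T])
qed

lemma vN_left_regular: "g \<in> A \<Longrightarrow> left_regular W g \<in> vN"
  using res_vN[of "lam G g"] by (auto simp: left_regular_res commutant_def fun_eq_iff)

lemma vN_zero: "0 \<in> vN"
  using vN_closed(2)[OF vN_left_regular[OF one_closed] vN_left_regular[OF one_closed]] by simp

lemma vN_sum: "(\<And>i. i \<in> I \<Longrightarrow> T i \<in> vN) \<Longrightarrow> sum T I \<in> vN"
  by (induction I rule: infinite_finite_induct) (auto simp: vN_zero vN_closed)

lemma vN_op_sum: "finite_support A f \<Longrightarrow> op_sum f \<in> vN"
  unfolding op_sum_def by (intro vN_sum) (auto simp: finite_support_def intro!: vN_closed(3)[OF vN_left_regular vN_zero])

lemma lift_linear: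
  assumes T: "T \<in> vN" and T': "T' \<in> vN"
  shows "lift (T + T') = lift T + lift T'" "lift (T - T') = lift T - lift T'" "lift (op_scale c T) = ofc c * lift T"
proof -
  have l2: "T (prj F) \<in> l2 A" "T' (prj F) \<in> l2 A" for F
    using bounded_opsD(1)[OF vN_bounded prj_l2] T T' by blast+
  show "lift (T + T') = lift T + lift T'" "lift (T - T') = lift T - lift T'"
    by (rule gvn_eqI; simp add: app_lift T T' vN_closed lft_linear l2)+
  have "op_scale c T F = (\<lambda>x. c * T F x)" for F by (simp add: op_scale_def)
  then show "lift (op_scale c T) = ofc c * lift T"
    by (intro gvn_eqI) (simp add: app_lift T vN_closed(3)[OF T T] l2 lft_linear(3)[OF _ l2_zero])
qed

text \<open>The two elements differ on the other summands, where the lift is 0 but each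
  \<open>lam G g\<close> is the identity. The vacuum of \<open>G\<close> sees only the summand on
  which they agree.\<close>

lemma vtr_lift_op_sum:
  assumes f: "finite_support A f"
  shows "vtr G (lift (op_sum f) * y) = vtr G (fsum (lam G) f * y)"
proof -
  have rr: "rt G \<one> (rt G \<one> F) = rt G \<one> F" for F by (rule rt_rt_one) simp
  have "app (lift (op_sum f)) F = app (fsum (lam G) f) (rt G \<one> F)" for F
    by (simp only: app_lift[OF vN_op_sum[OF f]]) (simp add: op_sum_res[OF f] cut_def prj_l2 lft_prj app_rt_one rr)
  then have "app (lift (op_sum f) * y) (vac G) = app (fsum (lam G) f) (app y (rt G \<one> (vac G)))"
    by (simp add: app_rt_one)
  then show ?thesis by (simp add: vtr_def rt_vac)
qed

context
  fixes p :: real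
  assumes p: "1 < p"
begin

interpretation group_trace "vtr G" G "lam G" by (rule vtr_group_trace[OF G])

lemma Lp_norm_lift:
  assumes "T \<in> vN"
  shows "Lp_norm W p T = pn p (lift T)"
proof -
  have "app (lift T) (rt G \<one> F) = app (lift T) F" for F
    by (simp add: app_lift[OF assms] flip: lft_prj) (simp add: prj_lft prj_l2)
  from Lp_norm_res[OF p this] show ?thesis by (simp add: res_lift[OF assms])
qed

lemma Lp_norm_nonneg: "0 \<le> Lp_norm W p T"
  by (simp add: Lp_norm_def)

lemma Lp_norm_scale: "T \<in> vN \<Longrightarrow> Lp_norm W p (op_scale c T) = cmod c * Lp_norm W p T"
  by (simp add: Lp_norm_lift vN_closed lift_linear pn_ofc p)

lemma Lp_norm_triangle: "T \<in> vN \<Longrightarrow> T' \<in> vN \<Longrightarrow> Lp_norm W p (T + T') \<le> Lp_norm W p T + Lp_norm W p T'"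
  by (simp add: Lp_norm_lift vN_closed lift_linear pn_triangle p)

lemma Lp_norm_commute: "T \<in> vN \<Longrightarrow> T' \<in> vN \<Longrightarrow> Lp_norm W p (T - T') = Lp_norm W p (T' - T)"
  by (simp add: Lp_norm_lift vN_closed lift_linear pn_diff_commute p)

lemma Lp_norm_zero: "Lp_norm W p 0 = 0"
proof -
  have "op_scale 0 0 = (0 :: 'a l2_op)" by (simp add: op_scale_def fun_eq_iff)
  then show ?thesis using Lp_norm_scale[OF vN_zero, of 0] by simp
qed

lemma Lp_norm_op_sum:
  assumes f: "finite_support A f"
  shows "Lp_norm W p (op_sum f) = pn p (fsum (lam G) f)"
  unfolding Lp_norm_lift[OF vN_op_sum[OF f]] by (rule pn_eqI[OF p vtr_lift_op_sum[OF f]])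

lemma op_sum_dense:
  assumes T: "T \<in> vN" and e: "0 < e"
  obtains f where "finite_support A f" "Lp_norm W p (T - op_sum f) < e"
proof -
  obtain y where y: "y \<in> CG" "pn p (lift T - y) < e" using CG_dense[OF p e, of "lift T"] by blast
  then obtain f where f: "finite_support A f" "y = fsum (lam G) f" unfolding alg_def by auto
  have "vtr G ((lift T - lift (op_sum f)) * z) = vtr G ((lift T - y) * z)" for z
    by (simp only: left_diff_distrib linear_diff[OF bounded_linear.linear[OF bounded_linear_tr]] vtr_lift_op_sum[OF f(1)] f(2))
  then have "Lp_norm W p (T - op_sum f) = pn p (lift T - y)"
    unfolding Lp_norm_lift[OF vN_closed(2)[OF T vN_op_sum[OF f(1)]]] lift_linear(2)[OF T vN_op_sum[OF f(1)]]
    by (rule pn_eqI[OF p])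
  then show thesis using that f(1) y(2) by simp
qed

end

end

section \<open>Multipliers on the completion\<close>

context group_l2
begin

lemma op_sum_add:
  "finite_support A f \<Longrightarrow> finite_support A f' \<Longrightarrow> op_sum (\<lambda>g. f g + f' g) = op_sum f + op_sum f'"
  by (simp add: op_sum_res finite_support_add fsum_add res_add)

lemma op_sum_scale:
  "finite_support A f \<Longrightarrow> op_sum (\<lambda>g. c * f g) = op_scale c (op_sum f)"
  using finite_support_mult[of A f "\<lambda>_. c"] by (simp add: op_sum_res fsum_scale res_scale)

lemma op_sum_diff:
  assumes f: "finite_support A f" and f': "finite_support A f'"
  shows "finite_support A (\<lambda>g. f g - f' g)" "op_sum (\<lambda>g. f g - f' g) = op_sum f - op_sum f'"
proof -
  have fs: "finite_support A (\<lambda>g. (-1) * f' g)" by (rule finite_support_mult[OF f'])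
  show "finite_support A (\<lambda>g. f g - f' g)" using finite_support_add[OF f fs] by simp
  have "op_sum (\<lambda>g. f g + (-1) * f' g) = op_sum f + op_scale (-1) (op_sum f')"
    by (simp only: op_sum_add[OF f fs] op_sum_scale[OF f'])
  also have "op_scale (-1) (op_sum f') = - op_sum f'" by (simp add: op_scale_def fun_eq_iff)
  finally show "op_sum (\<lambda>g. f g - f' g) = op_sum f - op_sum f'"
    by (simp only: mult_minus1 add_uminus_conv_diff)
qed

context
  fixes p :: real
  assumes p: "1 < p"
begin

abbreviation N :: "'a l2_op \<Rightarrow> real" where "N \<equiv> Lp_norm W p"

lemmas N_nonneg = Lp_norm_nonneg[OF p] and N_zero = Lp_norm_zero[OF p] and N_commute = Lp_norm_commute[OF p]

lemma N_diff_triangle: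
  assumes "T \<in> vN" "T' \<in> vN" "T'' \<in> vN"
  shows "N (T - T'') \<le> N (T - T') + N (T' - T'')"
  using Lp_norm_triangle[OF p vN_closed(2)[OF assms(1,2)] vN_closed(2)[OF assms(2,3)]] by simp

lemma N_diff_abs:
  assumes "T \<in> vN" "T' \<in> vN"
  shows "\<bar>N T - N T'\<bar> \<le> N (T - T')"
  using Lp_norm_triangle[OF p vN_closed(2)[OF assms] assms(2)] Lp_norm_triangle[OF p vN_closed(2)[OF assms(2,1)] assms(1)]
    N_commute[OF assms] by simp

lemma CauchyD: "X \<in> Lp_Cauchy W p \<Longrightarrow> X n \<in> vN"
  by (simp add: Lp_Cauchy_def)

lemma Cauchy_eventually:
  "X \<in> Lp_Cauchy W p \<Longrightarrow> 0 < e \<Longrightarrow> \<exists>n0. \<forall>i\<ge>n0. \<forall>j\<ge>n0. N (X i - X j) < e"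
  by (simp add: Lp_Cauchy_def)

lemma N_tendsto_zero_le:
  assumes "\<And>n. N (Z n) \<le> b n" "b \<longlonglongrightarrow> 0"
  shows "(\<lambda>n. N (Z n)) \<longlonglongrightarrow> 0"
  by (rule tendsto_sandwich[OF _ _ tendsto_const assms(2)]) (auto simp: assms(1) N_nonneg)

lemma null_trans:
  assumes "\<And>n. X n \<in> vN" "\<And>n. Y n \<in> vN" "\<And>n. Z n \<in> vN"
    and "(\<lambda>n. N (X n - Y n)) \<longlonglongrightarrow> 0" "(\<lambda>n. N (Y n - Z n)) \<longlonglongrightarrow> 0"
  shows "(\<lambda>n. N (X n - Z n)) \<longlonglongrightarrow> 0"
  by (rule N_tendsto_zero_le[OF N_diff_triangle[OF assms(1,2,3)]]) (use tendsto_add[OF assms(4,5)] in simp)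

lemma null_add:
  assumes "\<And>n. X n \<in> vN" "\<And>n. Y n \<in> vN" "\<And>n. X' n \<in> vN" "\<And>n. Y' n \<in> vN"
    and "(\<lambda>n. N (X n - X' n)) \<longlonglongrightarrow> 0" "(\<lambda>n. N (Y n - Y' n)) \<longlonglongrightarrow> 0"
  shows "(\<lambda>n. N (X n + Y n - (X' n + Y' n))) \<longlonglongrightarrow> 0"
proof (rule N_tendsto_zero_le)
  show "N (X n + Y n - (X' n + Y' n)) \<le> N (X n - X' n) + N (Y n - Y' n)" for n
    using Lp_norm_triangle[OF p vN_closed(2)[OF assms(1,3)] vN_closed(2)[OF assms(2,4)], of n n] by (simp add: add_diff_add)
  show "(\<lambda>n. N (X n - X' n) + N (Y n - Y' n)) \<longlonglongrightarrow> 0" using tendsto_add[OF assms(5,6)] by simp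
qed

lemma op_scale_diff: "op_scale c (T - T') = op_scale c T - op_scale c T'"
  by (simp add: op_scale_def fun_eq_iff algebra_simps)

lemma null_scale:
  assumes "\<And>n. X n \<in> vN" "\<And>n. X' n \<in> vN" "(\<lambda>n. N (X n - X' n)) \<longlonglongrightarrow> 0"
  shows "(\<lambda>n. N (op_scale c (X n) - op_scale c (X' n))) \<longlonglongrightarrow> 0"
  using tendsto_mult_right_zero[OF assms(3), of "cmod c"]
  by (simp add: op_scale_diff[symmetric] Lp_norm_scale[OF p] vN_closed assms(1,2))

lemma Cauchy_null:
  assumes X: "X \<in> Lp_Cauchy W p" and Y: "\<And>n. Y n \<in> vN" and XY: "(\<lambda>n. N (X n - Y n)) \<longlonglongrightarrow> 0"
  shows "Y \<in> Lp_Cauchy W p"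
  unfolding Lp_Cauchy_def
proof (intro CollectI conjI allI impI Y)
  fix e :: real assume e: "0 < e"
  have e3: "0 < e / 3" using e by simp
  obtain n1 where n1: "\<forall>i\<ge>n1. \<forall>j\<ge>n1. N (X i - X j) < e / 3" using Cauchy_eventually[OF X e3] by blast
  obtain n2 where "\<forall>n\<ge>n2. norm (N (X n - Y n) - 0) < e / 3" using LIMSEQ_D[OF XY e3] by blast
  then have n2: "N (X n - Y n) < e / 3" if "n \<ge> n2" for n using that by (auto simp: abs_of_nonneg[OF N_nonneg])
  have "N (Y i - Y j) < e" if "i \<ge> max n1 n2" "j \<ge> max n1 n2" for i j
    using N_diff_triangle[OF Y[of i] CauchyD[OF X, of i] Y[of j]] N_diff_triangle[OF CauchyD[OF X, of i] CauchyD[OF X, of j] Y[of j]]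
      n1[rule_format, of i j] n2[of i] n2[of j] N_commute[OF CauchyD[OF X, of i] Y[of i]] that by simp
  then show "\<exists>n0. \<forall>i\<ge>n0. \<forall>j\<ge>n0. N (Y i - Y j) < e" by (intro exI[of _ "max n1 n2"]) simp
qed

lemma Cauchy_dominated:
  assumes X: "X \<in> Lp_Cauchy W p" and Y: "\<And>n. Y n \<in> vN"
    and le: "\<And>i j. N (Y i - Y j) \<le> C * N (X i - X j)"
  shows "Y \<in> Lp_Cauchy W p"
  unfolding Lp_Cauchy_def
proof (intro CollectI conjI allI impI Y)
  fix e :: real assume e: "0 < e"
  \<comment> \<open>No sign of \<open>C\<close> is assumed; the denominator is positive in any
    case.\<close>
  then have "0 < e / (\<bar>C\<bar> + 1)" by simp
  from Cauchy_eventually[OF X this] obtain n0 where n0: "\<forall>i\<ge>n0. \<forall>j\<ge>n0. N (X i - X j) < e / (\<bar>C\<bar> + 1)" ..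
  have "N (Y i - Y j) < e" if "i \<ge> n0" "j \<ge> n0" for i j
  proof -
    have "N (Y i - Y j) \<le> (\<bar>C\<bar> + 1) * N (X i - X j)"
      using le[of i j] mult_right_mono[OF _ N_nonneg, of C "\<bar>C\<bar> + 1" "X i - X j"] by linarith
    also have "\<dots> < (\<bar>C\<bar> + 1) * (e / (\<bar>C\<bar> + 1))" by (rule mult_strict_left_mono[OF n0[rule_format, OF that]]) simp
    finally show ?thesis by simp
  qed
  then show "\<exists>n0. \<forall>i\<ge>n0. \<forall>j\<ge>n0. N (Y i - Y j) < e" by blast
qed

lemma Cauchy_add:
  assumes X: "X \<in> Lp_Cauchy W p" and Y: "Y \<in> Lp_Cauchy W p"
  shows "X + Y \<in> Lp_Cauchy W p"
  unfolding Lp_Cauchy_def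
proof (intro CollectI conjI allI impI)
  show "(X + Y) n \<in> vN" for n using CauchyD[OF X] CauchyD[OF Y] by (simp add: vN_closed plus_fun_def[of X])
  fix e :: real assume e: "0 < e"
  then have e2: "0 < e / 2" by simp
  obtain n1 where n1: "\<forall>i\<ge>n1. \<forall>j\<ge>n1. N (X i - X j) < e / 2" using Cauchy_eventually[OF X e2] ..
  obtain n2 where n2: "\<forall>i\<ge>n2. \<forall>j\<ge>n2. N (Y i - Y j) < e / 2" using Cauchy_eventually[OF Y e2] ..
  have "N ((X + Y) i - (X + Y) j) < e" if "i \<ge> max n1 n2" "j \<ge> max n1 n2" for i j
  proof -
    have eq: "(X + Y) i - (X + Y) j = (X i - X j) + (Y i - Y j)" by (simp add: plus_fun_def[of X] add_diff_add)
    show ?thesis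
      unfolding eq using Lp_norm_triangle[OF p vN_closed(2)[OF CauchyD[OF X, of i] CauchyD[OF X, of j]] vN_closed(2)[OF CauchyD[OF Y, of i] CauchyD[OF Y, of j]]]
        n1[rule_format, of i j] n2[rule_format, of i j] that by simp
  qed
  then show "\<exists>n0. \<forall>i\<ge>n0. \<forall>j\<ge>n0. N ((X + Y) i - (X + Y) j) < e" by (intro exI[of _ "max n1 n2"]) simp
qed

lemma Cauchy_scale:
  assumes X: "X \<in> Lp_Cauchy W p"
  shows "(\<lambda>n. op_scale c (X n)) \<in> Lp_Cauchy W p"
  by (rule Cauchy_dominated[OF X, of _ "cmod c"])
    (simp_all add: op_scale_diff[symmetric] Lp_norm_scale[OF p] vN_closed CauchyD[OF X] vN_closed(3)[OF CauchyD[OF X] vN_zero])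

lemma Cauchy_const: "T \<in> vN \<Longrightarrow> (\<lambda>_. T) \<in> Lp_Cauchy W p"
  by (simp add: Lp_Cauchy_def N_zero)

abbreviation cls :: "(nat \<Rightarrow> 'a l2_op) \<Rightarrow> (nat \<Rightarrow> 'a l2_op) set" where "cls X \<equiv> Lp_rel W p `` {X}"

lemma equiv_Lp_rel: "equiv (Lp_Cauchy W p) (Lp_rel W p)"
proof (rule equivI)
  show "Lp_rel W p \<subseteq> Lp_Cauchy W p \<times> Lp_Cauchy W p" by (auto simp: Lp_rel_def)
  show "refl_on (Lp_Cauchy W p) (Lp_rel W p)" by (auto simp: refl_on_def Lp_rel_def N_zero)
  show "sym (Lp_rel W p)"
  proof (rule symI)
    fix X Y assume "(X, Y) \<in> Lp_rel W p"
    then have XY: "X \<in> Lp_Cauchy W p" "Y \<in> Lp_Cauchy W p" "(\<lambda>n. N (X n - Y n)) \<longlonglongrightarrow> 0" by (auto simp: Lp_rel_def)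
    then have "(\<lambda>n. N (Y n - X n)) \<longlonglongrightarrow> 0" by (simp add: N_commute[OF CauchyD[OF XY(2)] CauchyD[OF XY(1)]])
    then show "(Y, X) \<in> Lp_rel W p" using XY by (simp add: Lp_rel_def)
  qed
  show "trans (Lp_rel W p)"
  proof (rule transI)
    fix X Y Z assume "(X, Y) \<in> Lp_rel W p" "(Y, Z) \<in> Lp_rel W p"
    then show "(X, Z) \<in> Lp_rel W p" using null_trans[of X Y Z] by (auto simp: Lp_rel_def CauchyD)
  qed
qed

lemma cls_eqI:
  assumes "X \<in> Lp_Cauchy W p" "\<And>n. Y n \<in> vN" "(\<lambda>n. N (X n - Y n)) \<longlonglongrightarrow> 0"
  shows "cls X = cls Y"
  using Cauchy_null[OF assms] assms by (intro equiv_class_eq[OF equiv_Lp_rel]) (simp add: Lp_rel_def)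

lemma in_cls: "X \<in> Lp_Cauchy W p \<Longrightarrow> X \<in> cls X"
  by (rule equiv_class_self[OF equiv_Lp_rel])

text \<open>\<open>Lp_add\<close> and \<open>Lp_scale\<close> saturate a set of combined
  representatives; once all of these are equivalent to one of them, the result is a single
  class.\<close>

lemma Image_cls:
  assumes "X \<in> Q" "\<And>Y. Y \<in> Q \<Longrightarrow> (X, Y) \<in> Lp_rel W p"
  shows "Lp_rel W p `` Q = cls X"
proof -
  have eq: "cls Y = cls X" if "Y \<in> Q" for Y by (rule equiv_class_eq[OF equiv_Lp_rel assms(2)[OF that], symmetric])
  have "Lp_rel W p `` Q = (\<Union>Y\<in>Q. cls Y)" by (rule Image_eq_UN)
  also have "\<dots> = (\<Union>Y\<in>Q. cls X)" by (rule SUP_cong[OF refl eq])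
  also have "\<dots> = cls X" using assms(1) by auto
  finally show ?thesis .
qed

lemma Lp_spaceE:
  assumes "U \<in> Lp_space W p"
  obtains X where "X \<in> Lp_Cauchy W p" "U = cls X"
  using assms unfolding Lp_space_def by (rule quotientE)

lemma cls_Lp_space: "X \<in> Lp_Cauchy W p \<Longrightarrow> cls X \<in> Lp_space W p"
  unfolding Lp_space_def by (rule quotientI)

lemma Lp_add_cls:
  assumes X: "X \<in> Lp_Cauchy W p" and Y: "Y \<in> Lp_Cauchy W p"
  shows "Lp_add W p (cls X) (cls Y) = cls (X + Y)"
  unfolding Lp_add_def
proof (rule Image_cls)
  show "X + Y \<in> {X' + Y' |X' Y'. X' \<in> cls X \<and> Y' \<in> cls Y}" 
    unfolding mem_Collect_eq by (rule exI[of _ X], rule exI[of _ Y]) (simp only: in_cls X Y simp_thms)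
  fix Z assume "Z \<in> {X' + Y' |X' Y'. X' \<in> cls X \<and> Y' \<in> cls Y}"
  then obtain X' Y' where Z: "Z = X' + Y'" "(X, X') \<in> Lp_rel W p" "(Y, Y') \<in> Lp_rel W p"
    unfolding mem_Collect_eq Image_singleton_iff by (elim exE conjE)
  then have *: "X' \<in> Lp_Cauchy W p" "Y' \<in> Lp_Cauchy W p" "(\<lambda>n. N (X n - X' n)) \<longlonglongrightarrow> 0" "(\<lambda>n. N (Y n - Y' n)) \<longlonglongrightarrow> 0"
    by (auto simp: Lp_rel_def)
  have "(\<lambda>n. N ((X + Y) n - (X' + Y') n)) \<longlonglongrightarrow> 0"
    unfolding plus_fun_apply[of X] plus_fun_apply[of X']
    by (rule null_add[OF CauchyD[OF X] CauchyD[OF Y] CauchyD[OF *(1)] CauchyD[OF *(2)] *(3,4)])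
  then show "(X + Y, Z) \<in> Lp_rel W p"
    unfolding Lp_rel_def Z(1) using Cauchy_add[OF X Y] Cauchy_add[OF *(1,2)] by blast
qed

lemma Lp_scale_cls:
  assumes X: "X \<in> Lp_Cauchy W p"
  shows "Lp_scale W p c (cls X) = cls (\<lambda>n. op_scale c (X n))"
  unfolding Lp_scale_def
proof (rule Image_cls)
  show "(\<lambda>n. op_scale c (X n)) \<in> {\<lambda>n. op_scale c (Y n) |Y. Y \<in> cls X}"
    unfolding mem_Collect_eq by (rule exI[of _ X]) (simp only: in_cls X simp_thms)
  fix Z assume "Z \<in> {\<lambda>n. op_scale c (Y n) |Y. Y \<in> cls X}"
  then obtain X' where Z: "Z = (\<lambda>n. op_scale c (X' n))" "(X, X') \<in> Lp_rel W p"
    unfolding mem_Collect_eq Image_singleton_iff by (elim exE conjE)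
  then have *: "X' \<in> Lp_Cauchy W p" "(\<lambda>n. N (X n - X' n)) \<longlonglongrightarrow> 0" by (auto simp: Lp_rel_def)
  show "(\<lambda>n. op_scale c (X n), Z) \<in> Lp_rel W p"
    using null_scale[OF CauchyD[OF X] CauchyD[OF *(1)] *(2)] by (simp add: Lp_rel_def Z(1) Cauchy_scale X *(1))
qed

lemma Lp_norm_convergent:
  assumes X: "X \<in> Lp_Cauchy W p"
  obtains r where "(\<lambda>n. N (X n)) \<longlonglongrightarrow> r"
proof -
  have "Cauchy (\<lambda>n. N (X n))"
  proof (rule metric_CauchyI)
    fix e :: real assume "0 < e"
    from Cauchy_eventually[OF X this] obtain n0 where n0: "\<forall>i\<ge>n0. \<forall>j\<ge>n0. N (X i - X j) < e" ..
    have "dist (N (X i)) (N (X j)) < e" if "i \<ge> n0" "j \<ge> n0" for i j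
      using le_less_trans[OF N_diff_abs[OF CauchyD[OF X, of i] CauchyD[OF X, of j]] n0[rule_format, OF that]] by (simp add: dist_real_def)
    then show "\<exists>n0. \<forall>i\<ge>n0. \<forall>j\<ge>n0. dist (N (X i)) (N (X j)) < e" by blast
  qed
  then show thesis using that Cauchy_convergent convergent_def by blast
qed

lemma Lp_space_norm_cls:
  assumes X: "X \<in> Lp_Cauchy W p" and r: "(\<lambda>n. N (X n)) \<longlonglongrightarrow> r"
  shows "Lp_space_norm W p (cls X) = r"
  unfolding Lp_space_norm_def
proof (rule the_equality)
  show "\<forall>Y\<in>cls X. (\<lambda>n. N (Y n)) \<longlonglongrightarrow> r"
  proof
    fix Y assume "Y \<in> cls X"
    then have Y: "Y \<in> Lp_Cauchy W p" "(\<lambda>n. N (X n - Y n)) \<longlonglongrightarrow> 0" by (auto simp: Lp_rel_def)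
    have "(\<lambda>n. N (X n) - N (Y n)) \<longlonglongrightarrow> 0"
      by (rule Lim_null_comparison[OF _ Y(2)]) (simp add: N_diff_abs CauchyD X Y(1))
    from tendsto_diff[OF r this] show "(\<lambda>n. N (Y n)) \<longlonglongrightarrow> r" by simp
  qed
  then show "r' = r" if "\<forall>Y\<in>cls X. (\<lambda>n. N (Y n)) \<longlonglongrightarrow> r'" for r'
    using that in_cls[OF X] LIMSEQ_unique by blast
qed

definition approx :: "(nat \<Rightarrow> 'a l2_op) \<Rightarrow> (nat \<Rightarrow> 'a \<Rightarrow> complex) \<Rightarrow> bool" where
  "approx X f \<longleftrightarrow> (\<forall>n. finite_support A (f n)) \<and> (\<lambda>n. N (X n - op_sum (f n))) \<longlonglongrightarrow> 0"

lemma approx_exists: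
  assumes X: "X \<in> Lp_Cauchy W p"
  obtains f where "approx X f"
proof -
  have "\<exists>f. finite_support A f \<and> N (X n - op_sum f) < 1 / real (Suc n)" for n
    by (rule op_sum_dense[OF p CauchyD[OF X, of n], of "1 / real (Suc n)"]) auto
  then obtain f where f: "\<And>n. finite_support A (f n)" "\<And>n. N (X n - op_sum (f n)) < 1 / real (Suc n)" by metis
  have lim: "(\<lambda>n. N (X n - op_sum (f n))) \<longlonglongrightarrow> 0"
    by (rule N_tendsto_zero_le[OF less_imp_le[OF f(2)]]) (use LIMSEQ_inverse_real_of_nat in \<open>simp add: inverse_eq_divide\<close>)
  show thesis by (rule that[of f]) (simp only: approx_def f(1) lim simp_thms)
qed

text \<open>Extension by continuity: each class contains a sequence of finite sums, and the bound on
  finite sums carries Cauchy sequences to Cauchy sequences and null sequences to null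
  sequences.\<close>

lemma multiplier_boundedI:
  assumes bound: "\<And>f. finite_support A f \<Longrightarrow> N (op_sum (\<lambda>g. m g * f g)) \<le> C * N (op_sum f)"
  shows "multiplier_bounded W p m"
proof -
  define M where "M f = op_sum (\<lambda>g. m g * f g)" for f
  have M_vN: "M f \<in> vN" if "finite_support A f" for f
    unfolding M_def by (rule vN_op_sum[OF finite_support_mult[OF that]])
  have M_diff: "N (M f - M f') \<le> C * N (op_sum f - op_sum f')" if "finite_support A f" "finite_support A f'" for f f'
    using bound[OF op_sum_diff(1)[OF that]] op_sum_diff(2)[OF that]
      op_sum_diff(2)[OF finite_support_mult[OF that(1), of m] finite_support_mult[OF that(2), of m]]
    by (simp add: M_def right_diff_distrib)
  \<comment> \<open>Choice-free: all sequences equivalent to the image of some approximating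
    sequence of some representative. \<open>\<Phi>_cls\<close> shows that these form one
    class.\<close>
  define \<Phi> where "\<Phi> U = {Z \<in> Lp_Cauchy W p. \<exists>X\<in>U. \<exists>f. approx X f \<and> (\<lambda>n. N (M (f n) - Z n)) \<longlonglongrightarrow> 0}" for U
  have \<Phi>_cls: "(\<lambda>n. M (f n)) \<in> Lp_Cauchy W p" "\<Phi> (cls X) = cls (\<lambda>n. M (f n))"
    if X: "X \<in> Lp_Cauchy W p" and f: "approx X f" for X f
  proof -
    have fs: "\<And>n. finite_support A (f n)" and lim: "(\<lambda>n. N (X n - op_sum (f n))) \<longlonglongrightarrow> 0" using f by (auto simp: approx_def)
    have "(\<lambda>n. op_sum (f n)) \<in> Lp_Cauchy W p" by (rule Cauchy_null[OF X vN_op_sum[OF fs] lim])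
    then show Mf: "(\<lambda>n. M (f n)) \<in> Lp_Cauchy W p"
      by (rule Cauchy_dominated[OF _ M_vN[OF fs] M_diff[OF fs fs]])
    show "\<Phi> (cls X) = cls (\<lambda>n. M (f n))"
    proof (intro Set.set_eqI iffI)
      fix Z assume "Z \<in> cls (\<lambda>n. M (f n))"
      then have "Z \<in> Lp_Cauchy W p" "(\<lambda>n. N (M (f n) - Z n)) \<longlonglongrightarrow> 0" by (auto simp: Lp_rel_def)
      then show "Z \<in> \<Phi> (cls X)" using in_cls[OF X] f by (auto simp: \<Phi>_def)
    next
      fix Z assume "Z \<in> \<Phi> (cls X)"
      then obtain X' f' where Z: "Z \<in> Lp_Cauchy W p" "X' \<in> cls X" "approx X' f'" "(\<lambda>n. N (M (f' n) - Z n)) \<longlonglongrightarrow> 0"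
        by (auto simp: \<Phi>_def)
      have fs': "\<And>n. finite_support A (f' n)" and lim': "(\<lambda>n. N (X' n - op_sum (f' n))) \<longlonglongrightarrow> 0" using Z(3) by (auto simp: approx_def)
      have X': "X' \<in> Lp_Cauchy W p" "(\<lambda>n. N (X n - X' n)) \<longlonglongrightarrow> 0" using Z(2) by (auto simp: Lp_rel_def)
      note v = CauchyD[OF X] CauchyD[OF X'(1)] vN_op_sum[OF fs] vN_op_sum[OF fs']
      have "(\<lambda>n. N (op_sum (f n) - X n)) \<longlonglongrightarrow> 0" using lim by (simp add: N_commute[OF v(1,3)])
      from null_trans[OF v(3,1,2) this X'(2)] have "(\<lambda>n. N (op_sum (f n) - op_sum (f' n))) \<longlonglongrightarrow> 0"
        by (rule null_trans[OF v(3,2,4) _ lim'])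
      from tendsto_mult_right_zero[OF this, of C] have "(\<lambda>n. N (M (f n) - M (f' n))) \<longlonglongrightarrow> 0"
        by (rule N_tendsto_zero_le[OF M_diff[OF fs fs'], rotated])
      then have "(\<lambda>n. N (M (f n) - Z n)) \<longlonglongrightarrow> 0"
        by (rule null_trans[OF M_vN[OF fs] M_vN[OF fs'] CauchyD[OF Z(1)] _ Z(4)])
      then show "Z \<in> cls (\<lambda>n. M (f n))" using Mf Z(1) by (simp add: Lp_rel_def)
    qed
  qed
  have "bounded_linear_Lp W p \<Phi>"
    unfolding bounded_linear_Lp_def
  proof (intro conjI ballI allI)
    fix U assume "U \<in> Lp_space W p"
    then obtain X where X: "X \<in> Lp_Cauchy W p" "U = cls X" by (rule Lp_spaceE)
    obtain f where f: "approx X f" by (rule approx_exists[OF X(1)])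
    have fs: "\<And>n. finite_support A (f n)" and lim: "(\<lambda>n. N (X n - op_sum (f n))) \<longlonglongrightarrow> 0" using f by (auto simp: approx_def)
    show "\<Phi> U \<in> Lp_space W p" using \<Phi>_cls[OF X(1) f] cls_Lp_space X(2) by simp
    show "\<Phi> (Lp_scale W p c U) = Lp_scale W p c (\<Phi> U)" for c
    proof -
      have Mc: "M (\<lambda>g. c * f n g) = op_scale c (M (f n))" for n
        using op_sum_scale[OF finite_support_mult[OF fs, of m n], of c] by (simp add: M_def mult.left_commute)
      have "approx (\<lambda>n. op_scale c (X n)) (\<lambda>n g. c * f n g)"
        using null_scale[OF CauchyD[OF X(1)] vN_op_sum[OF fs] lim] by (simp add: approx_def finite_support_mult fs op_sum_scale)
      from \<Phi>_cls(2)[OF Cauchy_scale[OF X(1)] this] show ?thesis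
        by (simp add: X(2) Lp_scale_cls[OF X(1)] \<Phi>_cls(2)[OF X(1) f] Lp_scale_cls[OF \<Phi>_cls(1)[OF X(1) f]] Mc)
    qed
    fix V assume "V \<in> Lp_space W p"
    then obtain Y where Y: "Y \<in> Lp_Cauchy W p" "V = cls Y" by (rule Lp_spaceE)
    obtain f' where f': "approx Y f'" by (rule approx_exists[OF Y(1)])
    have fs': "\<And>n. finite_support A (f' n)" and lim': "(\<lambda>n. N (Y n - op_sum (f' n))) \<longlonglongrightarrow> 0" using f' by (auto simp: approx_def)
    have Ma: "(\<lambda>n. M (\<lambda>g. f n g + f' n g)) = (\<lambda>n. M (f n)) + (\<lambda>n. M (f' n))"
      using op_sum_add[OF finite_support_mult[OF fs, of m] finite_support_mult[OF fs', of m]]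
      by (intro ext[of "\<lambda>n. M (\<lambda>g. f n g + f' n g)"]) (simp add: M_def distrib_left)
    have "approx (X + Y) (\<lambda>n g. f n g + f' n g)"
      using null_add[OF CauchyD[OF X(1)] CauchyD[OF Y(1)] vN_op_sum[OF fs] vN_op_sum[OF fs'] lim lim']
      by (simp add: approx_def finite_support_add fs fs' op_sum_add plus_fun_def[of X])
    from \<Phi>_cls(2)[OF Cauchy_add[OF X(1) Y(1)] this]
    show "\<Phi> (Lp_add W p U V) = Lp_add W p (\<Phi> U) (\<Phi> V)"
      by (simp only: X(2) Y(2) Lp_add_cls[OF X(1) Y(1)] \<Phi>_cls(2)[OF X(1) f] \<Phi>_cls(2)[OF Y(1) f']
          Lp_add_cls[OF \<Phi>_cls(1)[OF X(1) f] \<Phi>_cls(1)[OF Y(1) f']] Ma)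
  next
    have "Lp_space_norm W p (\<Phi> U) \<le> C * Lp_space_norm W p U" if "U \<in> Lp_space W p" for U
    proof -
      obtain X where X: "X \<in> Lp_Cauchy W p" "U = cls X" using \<open>U \<in> Lp_space W p\<close> by (rule Lp_spaceE)
      obtain f where f: "approx X f" by (rule approx_exists[OF X(1)])
      have fs: "\<And>n. finite_support A (f n)" and lim: "(\<lambda>n. N (X n - op_sum (f n))) \<longlonglongrightarrow> 0" using f by (auto simp: approx_def)
      have Y: "(\<lambda>n. op_sum (f n)) \<in> Lp_Cauchy W p" by (rule Cauchy_null[OF X(1) vN_op_sum[OF fs] lim])
      obtain r where r: "(\<lambda>n. N (op_sum (f n))) \<longlonglongrightarrow> r" by (rule Lp_norm_convergent[OF Y])
      obtain r' where r': "(\<lambda>n. N (M (f n))) \<longlonglongrightarrow> r'" by (rule Lp_norm_convergent[OF \<Phi>_cls(1)[OF X(1) f]])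
      have "r' \<le> C * r"
        by (rule LIMSEQ_le[OF r' tendsto_mult_left[OF r]]) (use bound[OF fs] in \<open>auto simp: M_def\<close>)
      moreover have "Lp_space_norm W p U = r"
        unfolding X(2) cls_eqI[OF X(1) vN_op_sum[OF fs] lim] by (rule Lp_space_norm_cls[OF Y r])
      moreover have "Lp_space_norm W p (\<Phi> U) = r'"
        unfolding X(2) \<Phi>_cls(2)[OF X(1) f] by (rule Lp_space_norm_cls[OF \<Phi>_cls(1)[OF X(1) f] r'])
      ultimately show ?thesis by simp
    qed
    then show "\<exists>C. \<forall>U\<in>Lp_space W p. Lp_space_norm W p (\<Phi> U) \<le> C * Lp_space_norm W p U" by blast
  qed
  moreover have "\<Phi> (Lp_embed W p (\<Sum>g\<in>F. op_scale (c g) (left_regular W g))) =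
      Lp_embed W p (\<Sum>g\<in>F. op_scale (m g * c g) (left_regular W g))"
    if F: "finite F" "F \<subseteq> A" for F and c :: "'a \<Rightarrow> complex"
  proof -
    define f where "f g = (if g \<in> F then c g else 0)" for g
    have fs: "finite_support A f" using F by (auto simp: finite_support_def f_def intro: finite_subset[of _ F] split: if_splits)
    have s0: "op_scale 0 T = 0" for T :: "'a l2_op" by (simp add: op_scale_def fun_eq_iff)
    have sum: "(\<Sum>g\<in>F. op_scale (k g * c g) (left_regular W g)) = op_sum (\<lambda>g. k g * f g)" for k
      unfolding op_sum_def using F(1)
      by (intro sum.mono_neutral_cong_right) (auto simp: f_def s0)
    have "approx (\<lambda>_. op_sum f) (\<lambda>_. f)" by (simp add: approx_def fs N_zero)
    from \<Phi>_cls(2)[OF Cauchy_const[OF vN_op_sum[OF fs]] this] show ?thesis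
      using sum[of "\<lambda>_. 1"] sum[of m] by (simp add: Lp_embed_def M_def)
  qed
  ultimately show ?thesis
    unfolding multiplier_bounded_def by (intro exI[of _ \<Phi>]) simp
qed

end

end

section \<open>Roots of a Coxeter system\<close>

locale coxeter = group W for W :: "('a, 'b) monoid_scheme" (structure) +
  fixes S :: "'a set" and M :: "'a \<Rightarrow> 'a \<Rightarrow> enat"
  assumes coxeter_system: "coxeter_system W S M"
begin

abbreviation val :: "'a list \<Rightarrow> 'a" where "val \<equiv> word_value W"

lemma S_carrier: "a \<in> S \<Longrightarrow> a \<in> carrier W"
  using coxeter_system by (auto simp: coxeter_system_def)

lemma val_simps [simp]: "val [] = \<one>" "val (a # u) = a \<otimes> val u"
  by (simp_all add: word_value_def)

lemma val_closed [simp]: "u \<in> lists S \<Longrightarrow> val u \<in> carrier W"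
  by (induction u) (auto simp: S_carrier)

lemma val_append: "u \<in> lists S \<Longrightarrow> v \<in> lists S \<Longrightarrow> val (u @ v) = val u \<otimes> val v"
  by (induction u) (auto simp: S_carrier m_assoc)

lemma val_eq_iff: "u \<in> lists S \<Longrightarrow> v \<in> lists S \<Longrightarrow> val u = val v \<longleftrightarrow> equivclp (coxeter_step S M) u v"
  using coxeter_system by (auto simp: coxeter_system_def)

lemma alternating_word: "a \<in> S \<Longrightarrow> b \<in> S \<Longrightarrow> concat (replicate k [a, b]) \<in> lists S"
  by (induction k) auto

lemma val_relator:
  assumes "a \<in> S" "b \<in> S" "M a b = enat k"
  shows "val (concat (replicate k [a, b])) = \<one>"
proof -
  note r = alternating_word[OF assms(1,2), of k]
  have "coxeter_step S M ([] @ concat (replicate k [a, b]) @ []) ([] @ [])"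
    by (rule coxeter_step.intros) (use assms in auto)
  then have "equivclp (coxeter_step S M) (concat (replicate k [a, b])) []" unfolding append_Nil append_Nil2 by (rule r_into_equivclp)
  then show ?thesis using val_eq_iff[OF r, of "[]"] by simp
qed

lemma relator:
  assumes "a \<in> S" "b \<in> S" "M a b = enat k"
  shows "(a \<otimes> b) [^] k = \<one>"
proof -
  have "val (concat (replicate j [a, b])) = (a \<otimes> b) [^] j" for j :: nat
  proof (induction j)
    case (Suc j)
    then show ?case using assms nat_pow_Suc2[of "a \<otimes> b" j] by (simp add: S_carrier m_assoc)
  qed simp
  then show ?thesis using val_relator[OF assms] by simp
qed

lemma involution: "a \<in> S \<Longrightarrow> a \<otimes> a = \<one>"
  using relator[of a a 1] coxeter_system by (simp add: coxeter_system_def coxeter_matrix_def one_enat_def S_carrier)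

lemma inv_S: "a \<in> S \<Longrightarrow> inv a = a"
  by (rule inv_equality) (simp_all add: involution S_carrier)

lemma cancel_S [simp]: "a \<in> S \<Longrightarrow> x \<in> carrier W \<Longrightarrow> a \<otimes> (a \<otimes> x) = x"
  by (simp add: m_assoc[symmetric] involution S_carrier)

lemma word_exists:
  assumes "g \<in> carrier W"
  obtains u where "u \<in> lists S" "val u = g"
proof -
  have "g \<in> generate W S" using assms coxeter_system by (simp add: coxeter_system_def)
  then have "\<exists>u\<in>lists S. val u = g"
  proof induction
    case one
    then show ?case by (intro bexI[of _ "[]"]) auto
  next
    case (incl h)
    then show ?case by (intro bexI[of _ "[h]"]) (auto simp: S_carrier)
  next
    case (inv h)
    then show ?case by (intro bexI[of _ "[h]"]) (auto simp: S_carrier inv_S)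
  next
    case (eng h1 h2)
    then obtain u v where "u \<in> lists S" "v \<in> lists S" "val u = h1" "val v = h2" by blast
    then show ?case by (intro bexI[of _ "u @ v"]) (auto simp: val_append)
  qed
  then show thesis using that by blast
qed

section \<open>Parity of wall crossings\<close>

text \<open>
  The number of \<open>i\<close> for which the \<open>i\<close>-th reflection \<open>a\<^sub>1 \<cdots> a\<^sub>i\<^sub>-\<^sub>1 a\<^sub>i a\<^sub>i\<^sub>-\<^sub>1 \<cdots> a\<^sub>1\<close> of the word equals \<open>x\<close>, that is, how
  often the gallery described by the word crosses the wall of \<open>x\<close>. Its parity depends on the group
  element only.
\<close>

fun crossings :: "'a list \<Rightarrow> 'a \<Rightarrow> nat" where
  "crossings [] x = 0"
| "crossings (a # u) x = (if x = a then 1 else 0) + crossings u (a \<otimes> x \<otimes> a)"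

lemma crossings_append:
  assumes "u \<in> lists S" "x \<in> carrier W"
  shows "crossings (u @ v) x = crossings u x + crossings v (inv (val u) \<otimes> x \<otimes> val u)"
  using assms
proof (induction u arbitrary: x)
  case (Cons a u)
  then have "inv (val u) \<otimes> (a \<otimes> x \<otimes> a) \<otimes> val u = inv (val (a # u)) \<otimes> x \<otimes> val (a # u)"
    by (simp add: S_carrier inv_mult_group inv_S m_assoc)
  then show ?case using Cons by (simp add: S_carrier)
qed simp

text \<open>The reflections along an alternating word are
  \<open>(a \<otimes> b) [^] i \<otimes> a\<close>; stripping the first two letters conjugates
  \<open>x\<close> and thereby shifts \<open>i\<close> by two.\<close>

lemma crossings_alternating:
  assumes a: "a \<in> S" and b: "b \<in> S" and x: "x \<in> carrier W"
  shows "crossings (concat (replicate k [a, b])) x = (\<Sum>i<2 * k. if x = (a \<otimes> b) [^] i \<otimes> a then 1 else 0)"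
  using x
proof (induction k arbitrary: x)
  case (Suc k)
  note [simp] = S_carrier[OF a] S_carrier[OF b] a b
  let ?f = "\<lambda>y (i :: nat). if y = (a \<otimes> b) [^] i \<otimes> a then 1 else 0 :: nat"
  have conj: "b \<otimes> (a \<otimes> x \<otimes> a) \<otimes> b = y \<longleftrightarrow> x = a \<otimes> b \<otimes> y \<otimes> b \<otimes> a" if "y \<in> carrier W" for y
    using that Suc.prems by (auto simp: m_assoc involution)
  have "(a \<otimes> b) [^] Suc (Suc i) \<otimes> a = a \<otimes> b \<otimes> ((a \<otimes> b) [^] i \<otimes> a) \<otimes> b \<otimes> a" for i :: nat
  proof -
    have ab: "a \<otimes> b \<in> carrier W" by simp
    have "(a \<otimes> b) [^] Suc (Suc i) = a \<otimes> b \<otimes> (a \<otimes> b) [^] i \<otimes> (a \<otimes> b)"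
      by (simp only: nat_pow_Suc[of _ "Suc i"] nat_pow_Suc2[OF ab])
    then show ?thesis by (simp only:) (simp add: m_assoc)
  qed
  then have f2: "?f (b \<otimes> (a \<otimes> x \<otimes> a) \<otimes> b) i = ?f x (Suc (Suc i))" for i
    using conj[of "(a \<otimes> b) [^] i \<otimes> a"] by simp
  have f0: "x = a \<longleftrightarrow> x = (a \<otimes> b) [^] (0 :: nat) \<otimes> a" by simp
  have f1: "a \<otimes> x \<otimes> a = b \<longleftrightarrow> x = (a \<otimes> b) [^] Suc 0 \<otimes> a"
    using Suc.prems by (auto simp: m_assoc involution)
  have y: "b \<otimes> (a \<otimes> x \<otimes> a) \<otimes> b \<in> carrier W" using Suc.prems by simp
  have "crossings (concat (replicate (Suc k) [a, b])) x = ?f x 0 + (?f x (Suc 0) + (\<Sum>i<2 * k. ?f x (Suc (Suc i))))"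
    by (simp only: replicate_Suc concat.simps append.simps crossings.simps f0 f1 Suc.IH[OF y] f2)
  also have "\<dots> = (\<Sum>i<Suc (Suc (2 * k)). ?f x i)"
    by (simp only: sum.lessThan_Suc_shift)
  also have "Suc (Suc (2 * k)) = 2 * Suc k" by simp
  finally show ?case .
qed simp

text \<open>The relator has \<open>2 * k\<close> letters, but the sequence of its reflections has
  period \<open>k\<close>, so each value is counted twice.\<close>

lemma even_crossings_relator:
  assumes a: "a \<in> S" and b: "b \<in> S" and x: "x \<in> carrier W" and k: "M a b = enat k"
  shows "even (crossings (concat (replicate k [a, b])) x)"
proof -
  let ?f = "\<lambda>i :: nat. if x = (a \<otimes> b) [^] i \<otimes> a then 1 else 0 :: nat"
  have "(a \<otimes> b) [^] (i + k) = (a \<otimes> b) [^] i" for i :: nat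
    using relator[OF a b k] a b by (simp add: nat_pow_mult[symmetric] S_carrier)
  then have "(\<Sum>i<k. ?f (i + k)) = (\<Sum>i<k. ?f i)" by simp
  moreover have "(\<Sum>i<2 * k. ?f i) = (\<Sum>i<k. ?f i) + (\<Sum>i<k. ?f (i + k))"
  proof -
    have "(\<Sum>i<2 * k. ?f i) = (\<Sum>i<k. ?f i) + (\<Sum>i=k..<k + k. ?f i)"
      unfolding mult_2 lessThan_atLeast0 by (rule sum.atLeastLessThan_concat[symmetric]) simp_all
    also have "(\<Sum>i=k..<k + k. ?f i) = (\<Sum>i<k. ?f (i + k))"
      using sum.shift_bounds_nat_ivl[of ?f 0 k k] by (simp only: lessThan_atLeast0 add_0)
    finally show ?thesis .
  qed
  ultimately have "crossings (concat (replicate k [a, b])) x = 2 * (\<Sum>i<k. ?f i)"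
    by (simp only: crossings_alternating[OF a b x] mult_2)
  then show ?thesis by simp
qed

text \<open>A relator contributes an even number of crossings and has value \<open>\<one>\<close>,
  so deleting it does not change how the later letters are conjugated.\<close>

lemma even_crossings_cong:
  assumes "u \<in> lists S" "v \<in> lists S" "val u = val v" "x \<in> carrier W"
  shows "even (crossings u x) = even (crossings v x)"
proof -
  have step: "even (crossings u x) = even (crossings v x)" if "coxeter_step S M u v" for u v
    using that
  proof cases
    case (1 u' v' a b k)
    let ?r = "concat (replicate k [a, b])"
    have r: "?r \<in> lists S" using 1 by (intro alternating_word)
    have vr: "val ?r = \<one>" using 1 by (intro val_relator)
    let ?y = "inv (val u') \<otimes> x \<otimes> val u'"
    have y: "?y \<in> carrier W" using 1 assms(4) by simp
    have "crossings u x = crossings u' x + (crossings ?r ?y + crossings v' ?y)"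
      using 1 assms(4) y by (simp add: crossings_append[OF r y] crossings_append[OF \<open>u' \<in> lists S\<close>] vr)
    moreover have "crossings v x = crossings u' x + crossings v' ?y"
      using 1 assms(4) by (simp add: crossings_append)
    moreover have "even (crossings ?r ?y)" using 1 y by (intro even_crossings_relator)
    ultimately show ?thesis by simp
  qed
  have "equivclp (coxeter_step S M) u v" using assms(3) val_eq_iff[OF assms(1,2)] by simp
  then show ?thesis by (induction rule: equivclp_induct) (use step in metis)+
qed

text \<open>The exchange argument: where the word meets the reflection \<open>x\<close>,
  multiplication by \<open>x\<close> from the left deletes that letter. The recursion carries
  \<open>x\<close> past the earlier letters by conjugation.\<close>

lemma deletion:
  assumes "u \<in> lists S" "x \<in> carrier W" "crossings u x \<noteq> 0"
  shows "\<exists>v\<in>lists S. length v < length u \<and> val v = x \<otimes> val u"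
  using assms
proof (induction u arbitrary: x)
  case (Cons a u)
  show ?case
  proof (cases "x = a")
    case True
    then show ?thesis using Cons by (intro bexI[of _ u]) auto
  next
    case False
    then have "\<exists>v\<in>lists S. length v < length u \<and> val v = (a \<otimes> x \<otimes> a) \<otimes> val u"
      using Cons by (intro Cons.IH) (auto simp: S_carrier)
    then obtain v where v: "v \<in> lists S" "length v < length u" "val v = (a \<otimes> x \<otimes> a) \<otimes> val u" by blast
    then show ?thesis using Cons by (intro bexI[of _ "a # v"]) (auto simp: S_carrier m_assoc)
  qed
qed simp

lemma word_length_le: "u \<in> lists S \<Longrightarrow> word_length W S (val u) \<le> length u"
  unfolding word_length_def by (rule Least_le) blast

lemma reduced_word:
  assumes "g \<in> carrier W"
  obtains u where "u \<in> lists S" "val u = g" "length u = word_length W S g"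
proof -
  obtain v where "v \<in> lists S" "val v = g" using word_exists[OF assms] .
  then have "\<exists>n. \<exists>ws\<in>lists S. length ws = n \<and> val ws = g" by blast
  then have "\<exists>ws\<in>lists S. length ws = word_length W S g \<and> val ws = g"
    unfolding word_length_def by (rule LeastI_ex)
  then show thesis using that by blast
qed

section \<open>The half-space of a generator\<close>

context
  fixes s assumes s: "s \<in> S"
begin

definition half_space :: "'a set" where
  "half_space = {g \<in> carrier W. word_length W S g < word_length W S (s \<otimes> g)}"

text \<open>Parity depends only on the group element, so a reduced word also has an odd and hence
  nonzero number of crossings, and \<open>deletion\<close> shortens it.\<close>

lemma odd_imp_shorter:
  assumes u: "u \<in> lists S" and odd: "odd (crossings u s)"
  shows "word_length W S (s \<otimes> val u) < word_length W S (val u)"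
proof -
  obtain v where v: "v \<in> lists S" "val v = val u" "length v = word_length W S (val u)"
    using reduced_word[OF val_closed[OF u]] .
  then have "odd (crossings v s)" using even_crossings_cong[OF v(1) u v(2) S_carrier[OF s]] odd by simp
  then have "crossings v s \<noteq> 0" by (metis even_zero)
  from deletion[OF v(1) S_carrier[OF s] this] obtain w where
    w: "w \<in> lists S" "length w < length v" "val w = s \<otimes> val v" by blast
  then show ?thesis using word_length_le[OF w(1)] v by simp
qed

lemma half_space_iff_even:
  assumes u: "u \<in> lists S"
  shows "val u \<in> half_space \<longleftrightarrow> even (crossings u s)"
proof (cases "even (crossings u s)")
  case True
  \<comment> \<open>Conjugation by \<open>s\<close> fixes \<open>s\<close>, so a prefixed
    \<open>s\<close> adds one crossing and flips the parity.\<close>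
  have "crossings (s # u) s = 1 + crossings u s" using s by (simp add: m_assoc S_carrier involution)
  then have "word_length W S (s \<otimes> val (s # u)) < word_length W S (val (s # u))"
    using True s u by (intro odd_imp_shorter) auto
  then show ?thesis using True u s by (simp add: half_space_def)
next
  case False
  then show ?thesis using odd_imp_shorter[OF u] by (simp add: half_space_def)
qed

lemma half_space_s:
  assumes g: "g \<in> carrier W"
  shows "s \<otimes> g \<in> half_space \<longleftrightarrow> g \<notin> half_space"
proof -
  obtain u where u: "u \<in> lists S" "val u = g" using word_exists[OF g] .
  have "crossings (s # u) s = 1 + crossings u s" using s by (simp add: m_assoc S_carrier involution)
  then show ?thesis using half_space_iff_even[of "s # u"] half_space_iff_even[OF u(1)] u s by simp
qed

lemma complement_half_space:
  assumes g: "g \<in> carrier W"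
  shows "g \<notin> half_space \<longleftrightarrow> word_length W S g > word_length W S (s \<otimes> g)"
  using half_space_s[OF g] g s by (simp add: half_space_def S_carrier)

lemma one_half_space: "\<one> \<in> half_space"
  using half_space_iff_even[of "[]"] by simp

text \<open>Appending \<open>t\<close> to a word for \<open>g\<close> crosses exactly the wall of
  the reflection \<open>g \<otimes> t \<otimes> inv g\<close>; a change of side means that this
  reflection is \<open>s\<close>.\<close>

lemma commute_if_crossing:
  assumes g: "g \<in> carrier W" and t: "t \<in> S" and cross: "g \<in> half_space \<longleftrightarrow> g \<otimes> t \<notin> half_space"
  shows "g \<otimes> t = s \<otimes> g"
proof -
  obtain u where u: "u \<in> lists S" "val u = g" using word_exists[OF g] .
  have "crossings (u @ [t]) s = crossings u s + (if inv g \<otimes> s \<otimes> g = t then 1 else 0)"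
    using u S_carrier[OF s] by (simp add: crossings_append)
  moreover have "val (u @ [t]) = g \<otimes> t" using u t by (simp add: val_append S_carrier)
  ultimately have "inv g \<otimes> s \<otimes> g = t"
    using half_space_iff_even[OF u(1)] half_space_iff_even[of "u @ [t]"] cross u t by (auto split: if_splits)
  then have "g \<otimes> t = g \<otimes> (inv g \<otimes> s \<otimes> g)" by simp
  then show ?thesis using g S_carrier[OF s] by (simp add: m_assoc[symmetric])
qed

lemma chamber_eq: "g \<in> carrier W \<Longrightarrow> chamber W g = {g}"
  by (simp add: chamber_def generate_empty l_coset_def)

lemma pos_root_eq: "pos_root W S s = (\<lambda>g. {g}) ` half_space"
  and neg_root_eq: "neg_root W S s = (\<lambda>g. {g}) ` (carrier W - half_space)"
proof -
  show "pos_root W S s = (\<lambda>g. {g}) ` half_space"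
    unfolding pos_root_def half_space_def by (force simp: chamber_eq)
  have "carrier W - half_space = {g \<in> carrier W. word_length W S g > word_length W S (s \<otimes> g)}"
    using complement_half_space by blast
  then show "neg_root W S s = (\<lambda>g. {g}) ` (carrier W - half_space)"
    unfolding neg_root_def by (force simp: chamber_eq)
qed

lemma translate_eq:
  "translate W g ((\<lambda>x. {x}) ` X) = (\<lambda>x. {x}) ` ((\<lambda>x. g \<otimes> x) ` X)"
  by (simp add: translate_def image_image l_coset_def)

lemma root_symbol_eq:
  "g \<in> carrier W \<Longrightarrow> root_symbol W S s g = (if g \<in> half_space then 1 else -1)"
  by (auto simp: root_symbol_def pos_root_eq neg_root_eq chamber_eq)

lemma singleton_image_iff:
  "(\<lambda>x. {x}) ` X = (\<lambda>x. {x}) ` Y \<longleftrightarrow> X = Y" "(\<lambda>x. {x}) ` X \<subseteq> (\<lambda>x. {x}) ` Y \<longleftrightarrow> X \<subseteq> Y"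
  by (auto simp: inj_image_eq_iff inj_image_subset_iff)

lemma mem_translate:
  assumes "g \<in> carrier W" "X \<subseteq> carrier W" "x \<in> carrier W"
  shows "x \<in> (\<lambda>y. g \<otimes> y) ` X \<longleftrightarrow> inv g \<otimes> x \<in> X"
proof
  assume "inv g \<otimes> x \<in> X"
  then show "x \<in> (\<lambda>y. g \<otimes> y) ` X" using assms by (intro image_eqI[of _ _ "inv g \<otimes> x"]) (simp_all add: m_assoc[symmetric])
qed (use assms in \<open>auto simp: m_assoc[symmetric]\<close>)

lemma half_space_carrier: "half_space \<subseteq> carrier W"
  by (auto simp: half_space_def)

lemma root_stabilizer_iff:
  "g \<in> root_stabilizer W S s \<longleftrightarrow> g \<in> carrier W \<and> (\<forall>x\<in>carrier W. inv g \<otimes> x \<in> half_space \<longleftrightarrow> x \<in> half_space)"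
proof (cases "g \<in> carrier W")
  case g: True
  have "(\<lambda>x. g \<otimes> x) ` half_space = half_space \<longleftrightarrow> (\<forall>x\<in>carrier W. inv g \<otimes> x \<in> half_space \<longleftrightarrow> x \<in> half_space)"
    using mem_translate[OF g half_space_carrier] half_space_carrier g by auto
  then show ?thesis using g by (simp add: root_stabilizer_def pos_root_eq translate_eq singleton_image_iff)
qed (simp add: root_stabilizer_def)

lemma left_invariant_half_space:
  assumes "h \<in> root_stabilizer W S s" "x \<in> carrier W"
  shows "h \<otimes> x \<in> half_space \<longleftrightarrow> x \<in> half_space"
proof -
  have h: "h \<in> carrier W" using assms(1) root_stabilizer_iff by blast
  then have "inv h \<otimes> (h \<otimes> x) \<in> half_space \<longleftrightarrow> h \<otimes> x \<in> half_space" using assms root_stabilizer_iff[of h] by simp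
  then show ?thesis using h assms(2) by (simp add: m_assoc[symmetric])
qed

lemma subgroup_root_stabilizer: "subgroup (root_stabilizer W S s) W"
proof (rule subgroupI)
  show "root_stabilizer W S s \<subseteq> carrier W" by (auto simp: root_stabilizer_def)
  have "\<one> \<in> root_stabilizer W S s" by (simp add: root_stabilizer_iff)
  then show "root_stabilizer W S s \<noteq> {}" by blast
  show "inv a \<in> root_stabilizer W S s" if a: "a \<in> root_stabilizer W S s" for a
    using a left_invariant_half_space[OF a] by (auto simp: root_stabilizer_iff)
  show "a \<otimes> b \<in> root_stabilizer W S s" if "a \<in> root_stabilizer W S s" "b \<in> root_stabilizer W S s" for a b
    using that by (auto simp: root_stabilizer_iff inv_mult_group m_assoc)
qed

text \<open>
  If \<open>g\<close> commutes with \<open>s\<close> then \<open>g\<close> maps opposite roots to opposite roots and no inclusion can be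
  strict; by \<open>commute_if_crossing\<close> this excludes that the walls of \<open>s\<close> and its translate separate the
  relevant adjacent chambers.
\<close>

lemma half_space_cotlar:
  assumes nested: "nested_condition W S s (carrier W)"
    and g: "g \<in> carrier W" "g \<notin> root_stabilizer W S s" and h: "h \<in> carrier W"
  shows "(g \<in> half_space \<longleftrightarrow> h \<in> half_space) \<or> (inv g \<otimes> h \<in> half_space \<longleftrightarrow> inv g \<in> half_space)"
proof -
  \<comment> \<open>\<open>Q\<close> and \<open>R\<close> record the sides of the wall of
    \<open>s\<close> and of its translate by \<open>g\<close>. The goal compares \<open>h\<close>
    with \<open>g\<close> for the first and with \<open>\<one>\<close> for the second.\<close>
  define Q where "Q x \<longleftrightarrow> x \<in> half_space" for x
  define R where "R x \<longleftrightarrow> inv g \<otimes> x \<in> half_space" for x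
  have sW: "s \<in> carrier W" by (rule S_carrier[OF s])
  let ?P = "half_space" let ?N = "carrier W - half_space"
  have mP: "x \<in> (\<lambda>x. g \<otimes> x) ` ?P \<longleftrightarrow> R x" if "x \<in> carrier W" for x
    using mem_translate[OF g(1) half_space_carrier that] by (simp add: R_def)
  have mN: "x \<in> (\<lambda>x. g \<otimes> x) ` ?N \<longleftrightarrow> \<not> R x" if "x \<in> carrier W" for x
    using mem_translate[OF g(1) Diff_subset that] g(1) that by (simp add: R_def)
  have sub: "(\<lambda>x. g \<otimes> x) ` ?P \<subseteq> carrier W" "(\<lambda>x. g \<otimes> x) ` ?N \<subseteq> carrier W" "?P \<subseteq> carrier W" "?N \<subseteq> carrier W"
    using g(1) half_space_carrier by auto
  have eqI: "X = Y \<longleftrightarrow> (\<forall>x\<in>carrier W. x \<in> X \<longleftrightarrow> x \<in> Y)" "X \<subseteq> Y \<longleftrightarrow> (\<forall>x\<in>carrier W. x \<in> X \<longrightarrow> x \<in> Y)"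
    if "X \<subseteq> carrier W" "Y \<subseteq> carrier W" for X Y
    using that by blast+
  have mQ: "x \<in> ?P \<longleftrightarrow> Q x" and mQ': "x \<in> carrier W \<Longrightarrow> x \<in> ?N \<longleftrightarrow> \<not> Q x" for x
    by (simp_all add: Q_def)
  note n = bspec[OF nested[unfolded nested_condition_def] g(1), unfolded pos_root_eq neg_root_eq translate_eq
      singleton_image_iff psubset_eq eqI[OF sub(1,3)] eqI[OF sub(1,4)] eqI[OF sub(2,3)] eqI[OF sub(2,4)]]
  have cases: "(\<forall>x\<in>carrier W. R x \<longleftrightarrow> Q x) \<or> (\<forall>x\<in>carrier W. R x \<longleftrightarrow> \<not> Q x) \<or>
      (\<forall>x\<in>carrier W. R x \<longrightarrow> Q x) \<and> \<not> (\<forall>x\<in>carrier W. R x \<longleftrightarrow> Q x) \<or>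
      (\<forall>x\<in>carrier W. R x \<longrightarrow> \<not> Q x) \<and> \<not> (\<forall>x\<in>carrier W. R x \<longleftrightarrow> \<not> Q x) \<or>
      (\<forall>x\<in>carrier W. \<not> R x \<longrightarrow> Q x) \<and> \<not> (\<forall>x\<in>carrier W. \<not> R x \<longleftrightarrow> Q x) \<or>
      (\<forall>x\<in>carrier W. \<not> R x \<longrightarrow> \<not> Q x) \<and> \<not> (\<forall>x\<in>carrier W. \<not> R x \<longleftrightarrow> \<not> Q x)"
    using n by (simp only: mP mN mQ mQ' cong: ball_cong)
  have Qs: "Q (s \<otimes> x) \<longleftrightarrow> \<not> Q x" if "x \<in> carrier W" for x using half_space_s[OF that] by (simp add: Q_def)
  have Q: "Q \<one>" "\<not> Q s" using one_half_space Qs[of \<one>] sW by (simp_all add: Q_def)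
  \<comment> \<open>Translate of the fact that \<open>\<one>\<close> and \<open>s\<close> lie on
    opposite sides of the wall of \<open>s\<close>.\<close>
  have R: "R g" "\<not> R (g \<otimes> s)"
    using g(1) sW one_half_space Q(2) by (simp_all add: R_def Q_def m_assoc[symmetric])
  have inv_comm: "inv y \<otimes> s = s \<otimes> inv y" if "y \<otimes> s = s \<otimes> y" "y \<in> carrier W" for y
  proof -
    have "inv y \<otimes> s = inv y \<otimes> (s \<otimes> y) \<otimes> inv y" using that(2) sW by (simp add: m_assoc)
    also have "\<dots> = inv y \<otimes> (y \<otimes> s) \<otimes> inv y" by (simp only: that(1))
    also have "\<dots> = s \<otimes> inv y" using that(2) sW by (simp add: m_assoc[symmetric])
    finally show ?thesis .
  qed
  have comm: "R (s \<otimes> x) \<longleftrightarrow> \<not> R x" if "g \<otimes> s = s \<otimes> g" "x \<in> carrier W" for x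
  proof -
    have "inv g \<otimes> (s \<otimes> x) = s \<otimes> (inv g \<otimes> x)"
      using inv_comm[OF that(1) g(1)] that(2) g(1) sW by (simp add: m_assoc[symmetric])
    then show ?thesis using half_space_s[of "inv g \<otimes> x"] g(1) that(2) by (simp add: R_def)
  qed
  have cross: "g \<otimes> s = s \<otimes> g" if "Q g \<longleftrightarrow> \<not> Q (g \<otimes> s)"
    using commute_if_crossing[OF g(1) s] that by (simp add: Q_def)
  have cross': "g \<otimes> s = s \<otimes> g" if "R \<one> \<longleftrightarrow> \<not> R s"
  proof -
    have "inv g \<otimes> s = s \<otimes> inv g" using commute_if_crossing[OF inv_closed[OF g(1)] s] that g(1) by (simp add: R_def)
    then show ?thesis using inv_comm[of "inv g"] g(1) by simp
  qed
  have sx: "s \<otimes> x \<in> carrier W" if "x \<in> carrier W" for x using that sW by simp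
  \<comment> \<open>Outside the stabilizer case each alternative fixes the values \<open>Q g\<close>
    and \<open>R \<one>\<close> so that an \<open>h\<close> differing in both would violate the
    inclusion between the two half-spaces.\<close>
  have goal: "(Q g \<longleftrightarrow> Q h) \<or> (R h \<longleftrightarrow> R \<one>)"
    using cases
  proof (elim disjE)
    assume "\<forall>x\<in>carrier W. R x \<longleftrightarrow> Q x"
    then show ?thesis using g root_stabilizer_iff by (auto simp: Q_def R_def)
  next
    assume *: "\<forall>x\<in>carrier W. R x \<longleftrightarrow> \<not> Q x"
    then show ?thesis using R(1) Q(1) g(1) h by blast
  next
    assume *: "(\<forall>x\<in>carrier W. R x \<longrightarrow> Q x) \<and> \<not> (\<forall>x\<in>carrier W. R x \<longleftrightarrow> Q x)"
    \<comment> \<open>If \<open>g\<close> commuted with \<open>s\<close>, then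
      \<open>x \<mapsto> s \<otimes> x\<close> would negate both \<open>Q\<close> and
      \<open>R\<close> and turn the inclusion into its reverse, contrary to strictness.\<close>
    then have "g \<otimes> s \<noteq> s \<otimes> g" using comm Qs sx by blast
    then show ?thesis using * cross' Q(2) R(1) g(1) h sW by blast
  next
    assume "(\<forall>x\<in>carrier W. R x \<longrightarrow> \<not> Q x) \<and> \<not> (\<forall>x\<in>carrier W. R x \<longleftrightarrow> \<not> Q x)"
    then show ?thesis using R(1) Q(1) g(1) h by blast
  next
    assume *: "(\<forall>x\<in>carrier W. \<not> R x \<longrightarrow> Q x) \<and> \<not> (\<forall>x\<in>carrier W. \<not> R x \<longleftrightarrow> Q x)"
    then have nc: "g \<otimes> s \<noteq> s \<otimes> g" using comm Qs sx by blast
    \<comment> \<open>The inclusion gives information at \<open>g \<otimes> s\<close> and at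
      \<open>s\<close>; without commutation no wall is crossed towards \<open>g\<close> and
      \<open>\<one>\<close>, so the values there are the same.\<close>
    have "Q (g \<otimes> s)" using * R(2) g(1) sW by blast
    then have "Q g" using cross nc by blast
    moreover have "R \<one>" using * Q(2) cross' nc sW by blast
    ultimately show ?thesis using * h by blast
  next
    assume *: "(\<forall>x\<in>carrier W. \<not> R x \<longrightarrow> \<not> Q x) \<and> \<not> (\<forall>x\<in>carrier W. \<not> R x \<longleftrightarrow> \<not> Q x)"
    then have nc: "g \<otimes> s \<noteq> s \<otimes> g" using comm Qs sx by blast
    have "\<not> Q (g \<otimes> s)" using * R(2) g(1) sW by blast
    then have "\<not> Q g" using cross nc by blast
    moreover have "R \<one>" using * Q(1) by blast
    ultimately show ?thesis using * h by blast
  qed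
  then show ?thesis using g(1) by (simp add: Q_def R_def)
qed

end

end

context coxeter
begin

lemma root_multiplier_bounded:
  assumes s: "s \<in> S" and nested: "nested_condition W S s (carrier W)" and p: "1 < p"
  shows "multiplier_bounded W p (root_symbol W S s)"
proof -
  interpret group_l2 W by unfold_locales
  interpret group_trace "vtr G" G "lam G" by (rule vtr_group_trace[OF G])
  \<comment> \<open>Off the carrier the value is 1, whereas \<open>root_symbol\<close> is 0 there:
    \<open>cotlar_symbol\<close> asks for a sign everywhere, and finitely supported coefficients
    never see the difference.\<close>
  define m :: "'a \<Rightarrow> real" where "m g = (if g \<in> carrier W \<and> g \<notin> half_space s then -1 else 1)" for g
  have symbol: "root_symbol W S s g = of_real (m g)" if "g \<in> carrier W" for g
    using that by (simp add: root_symbol_eq[OF s] m_def)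
  interpret cotlar_symbol "vtr G" G "lam G" m "root_stabilizer W S s"
  proof (rule cotlar_symbol.intro[OF group_trace_axioms], rule cotlar_symbol_axioms.intro)
    show "m g = 1 \<or> m g = -1" for g by (simp add: m_def)
    show "subgroup (root_stabilizer W S s) G"
      using subgroup_root_stabilizer[OF s] by (simp add: subgroup_def)
    show "(m g - m h) * (m (inv\<^bsub>G\<^esub> g \<otimes>\<^bsub>G\<^esub> h) - m (inv\<^bsub>G\<^esub> g)) = 0"
      if "g \<in> carrier G" "g \<notin> root_stabilizer W S s" "h \<in> carrier G" for g h
      using half_space_cotlar[OF s nested, of g h] that by (auto simp: m_def)
    show "m (k \<otimes>\<^bsub>G\<^esub> h) = m h" if "k \<in> root_stabilizer W S s" "h \<in> carrier G" for k h
    proof -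
      have "k \<in> carrier W" using that(1) by (simp add: root_stabilizer_def)
      then show ?thesis using left_invariant_half_space[OF s that(1), of h] that(2) by (simp add: m_def)
    qed
  qed
  obtain C where "0 < C" and C: "\<And>x. x \<in> CG \<Longrightarrow> pn p (mul m x) \<le> C * pn p x"
    by (rule pn_mul_bounded[OF p]) (rule that)
  show ?thesis
  proof (rule multiplier_boundedI[OF p])
    fix f assume f: "finite_support (carrier W) f"
    have fG: "finite_support (carrier G) f" using f by simp
    have eq: "(\<lambda>g. root_symbol W S s g * f g) = (\<lambda>g. of_real (m g) * f g)"
    proof
      fix g
      show "root_symbol W S s g * f g = of_real (m g) * f g"
        using f symbol[of g] by (cases "f g = 0") (auto simp: finite_support_def)
    qed
    have "mul m (fsum (lam G) f) = fsum (lam G) (\<lambda>g. of_real (m g) * f g)"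
      unfolding mul_def by (simp add: co_fsum[OF fG])
    then show "Lp_norm W p (op_sum (\<lambda>g. root_symbol W S s g * f g)) \<le> C * Lp_norm W p (op_sum f)"
      using C[OF algI[OF fG]] by (simp add: eq Lp_norm_op_sum[OF p] f finite_support_mult)
  qed
qed

end

theorem theoremA:
  fixes W :: "('a, 'b) monoid_scheme"
    and S :: "'a set"
    and M :: "'a \<Rightarrow> 'a \<Rightarrow> enat"
    and s :: 'a
  assumes "coxeter_system W S M"
    and "s \<in> S"
    and "nested_condition W S s (carrier W)"
  shows "(\<forall>g \<in> carrier W - root_stabilizer W S s. \<forall>h \<in> carrier W.
            (root_symbol W S s g - root_symbol W S s h) *
            (root_symbol W S s (inv\<^bsub>W\<^esub> g \<otimes>\<^bsub>W\<^esub> h) - root_symbol W S s (inv\<^bsub>W\<^esub> g)) = 0) \<and>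
         (\<forall>h' \<in> root_stabilizer W S s. \<forall>h \<in> carrier W.
            root_symbol W S s (h' \<otimes>\<^bsub>W\<^esub> h) = root_symbol W S s h) \<and>
         (\<forall>p::real. 1 < p \<longrightarrow> multiplier_bounded W p (root_symbol W S s))"
proof -
  interpret group W using assms(1) by (simp add: coxeter_system_def)
  interpret coxeter W S M by unfold_locales (rule assms(1))
  show ?thesis
  proof (intro conjI ballI allI impI)
    fix g h assume "g \<in> carrier W - root_stabilizer W S s" "h \<in> carrier W"
    then show "(root_symbol W S s g - root_symbol W S s h) *
        (root_symbol W S s (inv\<^bsub>W\<^esub> g \<otimes>\<^bsub>W\<^esub> h) - root_symbol W S s (inv\<^bsub>W\<^esub> g)) = 0"
      using half_space_cotlar[OF assms(2,3), of g h] by (auto simp: root_symbol_eq[OF assms(2)])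
  next
    fix h' h assume h: "h' \<in> root_stabilizer W S s" "h \<in> carrier W"
    then have "h' \<in> carrier W" by (simp add: root_stabilizer_def)
    then show "root_symbol W S s (h' \<otimes>\<^bsub>W\<^esub> h) = root_symbol W S s h"
      using h left_invariant_half_space[OF assms(2) h] by (simp add: root_symbol_eq[OF assms(2)])
  qed (rule root_multiplier_bounded[OF assms(2,3)])
qed

end
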